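(* Let $p\neq p'$ be primes, $K$ a finite field of characteristic $p$, $V$ a nonzero finite-dimensional vector space over $K$, $\eta$ an automorphism of $K$ with $\eta^2=1$, and $f$ an $\eta$-sesquilinear form on $V$ such that one of the following holds: (1) $\eta=1$, $p\ne 2$ and $f$ is alternating and nondegenerate; (2) $\eta=1$, $V=U^*\oplus U$ for a $K$-space $U$, and $f((\alpha,x),(\beta,y))=x\beta$; (3) $\eta\neq 1$ and $f$ is $\eta$-Hermitian and nondegenerate. Define $\hat f\colon V\times V\to\mathbf F_p$ by $\hat f(x,y)=T(\lambda f(x,y))$, where $T\colon K\to\mathbf F_p$ is the trace map, $\lambda=1$ in cases (1) and (2), and $\lambda\in K$ satisfies $\lambda^\eta\ne\lambda$ in case (3). Then $\hat f-\hat f^{\mathrm t}$ is nondegenerate, so that $E(\hat f)$ is an extraspecial $p$-group; let $|E(\hat f)|=p^{2n+1}$. Let $K'$ be a finite field of characteristic $p'$ and $\tilde\rho\colon E(\hat f)\to \mathrm{GL}(W)$ a faithful absolutely irreducible representation on a $K'$-space $W$; let $\epsilon\in K'$ be the primitive $p$-th root of unity such that $\tilde\rho(0,1)=\epsilon\cdot 1$. (A) If $E(\hat f)\cong D^n$, or if $p$ is odd and the multiplicative order of $p'$ modulo $p$ is odd, let $V'=W^*\oplus W$, let $\rho=\tilde\rho^*\oplus\tilde\rho$ be the sum of $\tilde\rho$ and its contragredient, and let $f'$ be the bilinear form $f'((\alpha,x),(\beta,y))=x\beta$ on $V'$. Then $\rho$ extends to an embedding $G(\hat f)\ltimes E(\hat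 f)\hookrightarrow G(f')$. (B) Otherwise, let $V'=W$, $\rho=\tilde\rho$, and assume that $K'$ has an automorphism $\eta'$ with $(\eta')^2=1$ and $\epsilon^{\eta'}=\epsilon^{-1}$ (with $\eta'=1$ if $p=2$). Then $\rho$ preserves a nondegenerate $\eta'$-sesquilinear form $f'$ on $V'$, alternating bilinear if $p=2$ and $\eta'$-Hermitian if $p$ is odd, and $\rho$ extends to an embedding $G(\hat f)\ltimes E(\hat f)\hookrightarrow G(f')$.
   Context: Linear maps act on the right. For a bilinear form $h\colon V\times V\to\mathbf F_p$ put $h^{\mathrm t}(x,y)=h(y,x)$; when $h-h^{\mathrm t}$ is nondegenerate, $E(h)$ is the set $V\times\mathbf F_p$ with multiplication $(x_1,z_1)(x_2,z_2)=(x_1+x_2,z_1+z_2+h(x_1,x_2))$, an extraspecial $p$-group. For $\beta\in U^*$ and $x\in U$, $x\beta$ is the value of $\beta$ at $x$. An $\eta$-sesquilinear form is linear in the first variable and $\eta$-semilinear in the second; it is $\eta$-Hermitian if $f(y,x)=f(x,y)^\eta$. For any form $h$ on a vector space $V$ over $K$ (taking values in $K$ or in the prime field), $G(h)$ is the group of all $K$-linear $g\in\mathrm{GL}(V)$ with $h(xg,yg)=h(x,y)$ for all $x,y$ (for forms on $V'$, $K$ is replaced by $K'$). The group $G(\hat f)$ acts on $E(\hat f)$ by $(x,z)\mapsto(xg,z)$, and $G(\hat f)\ltimes E(\hat f)$ is the corresponding semidirect product with $E(\hat f)$ normal. $D$ is the dihedral group of order $8$ and $D^n$ is the central product of $n$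 copies of $D$. The contragredient of $\tilde\rho$ is the dual representation on $W^*$. *)

theory Defs
  imports
    "HOL-Algebra.Algebra"
    "HOL-Number_Theory.Pocklington"
    "Jordan_Normal_Form.Missing_VectorSpace"
begin

text \<open>Maps between carriers are kept extensional, so that equality of such functions is
  equality of maps. The image \<open>x g\<close> of the right action is written \<open>g x\<close>.\<close>

section \<open>Linear groups and forms\<close>

text \<open>Since maps act on the right, the product \<open>g h\<close> applies \<open>g\<close> first. (The library's
  \<^const>\<open>BijGroup\<close> uses the opposite order.)\<close>

definition GL :: "('k, 'm) ring_scheme \<Rightarrow> ('k, 'v, 'n) module_scheme \<Rightarrow> ('v \<Rightarrow> 'v) monoid" where
  "GL K V = \<lparr>carrier = {g \<in> module_hom K V V. g \<in> extensional (carrier V)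
                            \<and> bij_betw g (carrier V) (carrier V)},
             monoid.mult = (\<lambda>g h. compose (carrier V) h g),
             one = (\<lambda>x\<in>carrier V. x)\<rparr>"

text \<open>The group \<open>G(h)\<close>. The values of \<open>h\<close> may lie in \<open>K\<close> or in its prime field.\<close>

definition isometry_group ::
    "('k, 'm) ring_scheme \<Rightarrow> ('k, 'v, 'n) module_scheme \<Rightarrow> ('v \<Rightarrow> 'v \<Rightarrow> 'k) \<Rightarrow> ('v \<Rightarrow> 'v) monoid" where
  "isometry_group K V h =
     (GL K V)\<lparr>carrier := {g \<in> carrier (GL K V).
                 \<forall>x\<in>carrier V. \<forall>y\<in>carrier V. h (g x) (g y) = h x y}\<rparr>"

definition sesquilinear ::
    "('k, 'm) ring_scheme \<Rightarrow> ('k, 'v, 'n) module_scheme \<Rightarrow> ('k \<Rightarrow> 'k) \<Rightarrow> ('v \<Rightarrow> 'v \<Rightarrow> 'k) \<Rightarrow> bool" where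
  "sesquilinear K V \<eta> f \<longleftrightarrow>
     (\<forall>x\<in>carrier V. \<forall>y\<in>carrier V. f x y \<in> carrier K) \<and>
     (\<forall>x\<in>carrier V. \<forall>x'\<in>carrier V. \<forall>y\<in>carrier V. f (x \<oplus>\<^bsub>V\<^esub> x') y = f x y \<oplus>\<^bsub>K\<^esub> f x' y) \<and>
     (\<forall>x\<in>carrier V. \<forall>y\<in>carrier V. \<forall>y'\<in>carrier V. f x (y \<oplus>\<^bsub>V\<^esub> y') = f x y \<oplus>\<^bsub>K\<^esub> f x y') \<and>
     (\<forall>a\<in>carrier K. \<forall>x\<in>carrier V. \<forall>y\<in>carrier V. f (a \<odot>\<^bsub>V\<^esub> x) y = a \<otimes>\<^bsub>K\<^esub> f x y) \<and>
     (\<forall>a\<in>carrier K. \<forall>x\<in>carrier V. \<forall>y\<in>carrier V. f x (a \<odot>\<^bsub>V\<^esub> y) = \<eta> a \<otimes>\<^bsub>K\<^esub> f x y)"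

definition hermitian :: "('k, 'v, 'n) module_scheme \<Rightarrow> ('k \<Rightarrow> 'k) \<Rightarrow> ('v \<Rightarrow> 'v \<Rightarrow> 'k) \<Rightarrow> bool" where
  "hermitian V \<eta> f \<longleftrightarrow> (\<forall>x\<in>carrier V. \<forall>y\<in>carrier V. f y x = \<eta> (f x y))"

definition alternating ::
    "('k, 'm) ring_scheme \<Rightarrow> ('k, 'v, 'n) module_scheme \<Rightarrow> ('v \<Rightarrow> 'v \<Rightarrow> 'k) \<Rightarrow> bool" where
  "alternating K V f \<longleftrightarrow> (\<forall>x\<in>carrier V. f x x = \<zero>\<^bsub>K\<^esub>)"

definition nondegenerate ::
    "('k, 'm) ring_scheme \<Rightarrow> ('k, 'v, 'n) module_scheme \<Rightarrow> ('v \<Rightarrow> 'v \<Rightarrow> 'k) \<Rightarrow> bool" where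
  "nondegenerate K V f \<longleftrightarrow>
     (\<forall>x\<in>carrier V. (\<forall>y\<in>carrier V. f x y = \<zero>\<^bsub>K\<^esub>) \<longrightarrow> x = \<zero>\<^bsub>V\<^esub>) \<and>
     (\<forall>y\<in>carrier V. (\<forall>x\<in>carrier V. f x y = \<zero>\<^bsub>K\<^esub>) \<longrightarrow> y = \<zero>\<^bsub>V\<^esub>)"

definition dual_space ::
    "('k, 'm) ring_scheme \<Rightarrow> ('k, 'v, 'n) module_scheme \<Rightarrow> ('k, 'v \<Rightarrow> 'k) module" where
  "dual_space K V = (ring.func_space K (carrier V))
     \<lparr>carrier := {\<alpha> \<in> carrier V \<rightarrow>\<^sub>E carrier K.
        (\<forall>x\<in>carrier V. \<forall>y\<in>carrier V. \<alpha> (x \<oplus>\<^bsub>V\<^esub> y) = \<alpha> x \<oplus>\<^bsub>K\<^esub> \<alpha> y) \<and>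
        (\<forall>c\<in>carrier K. \<forall>x\<in>carrier V. \<alpha> (c \<odot>\<^bsub>V\<^esub> x) = c \<otimes>\<^bsub>K\<^esub> \<alpha> x)}\<rparr>"

text \<open>The form \<open>((\<alpha>, x), (\<beta>, y)) \<mapsto> x \<beta>\<close> on the sum of the dual of a space and the space.\<close>

definition pairing_form :: "('u \<Rightarrow> 'k) \<times> 'u \<Rightarrow> ('u \<Rightarrow> 'k) \<times> 'u \<Rightarrow> 'k" where
  "pairing_form = (\<lambda>(\<alpha>, x) (\<beta>, y). \<beta> x)"


section \<open>The trace and the extraspecial group of a form\<close>

text \<open>\<open>F\<^sub>p\<close> is taken to be the prime field of \<open>K\<close>.\<close>

definition prime_field :: "('k, 'm) ring_scheme \<Rightarrow> 'k set" where
  "prime_field K = generate_field K {}"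

text \<open>The absolute trace of a finite field, as the sum \<open>x + x\<^sup>p + x\<^bsup>p^2\<^esup> + \<dots>\<close> of the
  \<open>[K : F\<^sub>p]\<close> Galois conjugates.\<close>

definition trace_map :: "nat \<Rightarrow> ('k, 'm) ring_scheme \<Rightarrow> 'k \<Rightarrow> 'k" where
  "trace_map p K x =
     finsum K (\<lambda>i. x [^]\<^bsub>K\<^esub> (p ^ i)) {..<ring.dim K (prime_field K) (carrier K)}"

definition trace_form ::
    "nat \<Rightarrow> ('k, 'm) ring_scheme \<Rightarrow> 'k \<Rightarrow> ('v \<Rightarrow> 'v \<Rightarrow> 'k) \<Rightarrow> 'v \<Rightarrow> 'v \<Rightarrow> 'k" where
  "trace_form p K lam f x y = trace_map p K (lam \<otimes>\<^bsub>K\<^esub> f x y)"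

definition form_group ::
    "('k, 'm) ring_scheme \<Rightarrow> ('k, 'v, 'n) module_scheme \<Rightarrow> ('v \<Rightarrow> 'v \<Rightarrow> 'k) \<Rightarrow> ('v \<times> 'k) monoid" where
  "form_group K V h =
     \<lparr>carrier = carrier V \<times> prime_field K,
      monoid.mult = (\<lambda>(x1, z1) (x2, z2). (x1 \<oplus>\<^bsub>V\<^esub> x2, z1 \<oplus>\<^bsub>K\<^esub> z2 \<oplus>\<^bsub>K\<^esub> h x1 x2)),
      one = (\<zero>\<^bsub>V\<^esub>, \<zero>\<^bsub>K\<^esub>)\<rparr>"


section \<open>Group constructions\<close>

definition group_center :: "('a, 'b) monoid_scheme \<Rightarrow> 'a set" where
  "group_center G = {z \<in> carrier G. \<forall>g\<in>carrier G. z \<otimes>\<^bsub>G\<^esub> g = g \<otimes>\<^bsub>G\<^esub> z}"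

text \<open>A \<open>p\<close>-group whose centre has order \<open>p\<close> and coincides with the derived subgroup and with
  the Frattini subgroup. The Frattini subgroup of a \<open>p\<close>-group is generated by commutators and
  \<open>p\<close>-th powers, so the last condition puts the \<open>p\<close>-th powers in the centre.\<close>

definition extraspecial :: "nat \<Rightarrow> ('a, 'b) monoid_scheme \<Rightarrow> bool" where
  "extraspecial p G \<longleftrightarrow>
     group G \<and> finite (carrier G) \<and> (\<exists>k. order G = p ^ k) \<and>
     card (group_center G) = p \<and>
     derived G (carrier G) = group_center G \<and>
     (\<forall>g\<in>carrier G. g [^]\<^bsub>G\<^esub> p \<in> group_center G)"

text \<open>The dihedral group of order \<open>2 m\<close>; \<open>(a, s)\<close> stands for \<open>r\<^sup>a t\<^sup>s\<close> with \<open>r\<close> the rotation of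
  order \<open>m\<close> and \<open>t\<close> a reflection.\<close>

definition dihedral_group :: "int \<Rightarrow> (int \<times> bool) monoid" where
  "dihedral_group m =
     \<lparr>carrier = {0..<m} \<times> UNIV,
      monoid.mult = (\<lambda>(a, s) (b, t). ((if s then a - b else a + b) mod m, s \<noteq> t)),
      one = (0, False)\<rparr>"

text \<open>The central product of \<open>n\<close> copies of \<open>G\<close>: all the centres of the factors of \<open>G\<^sup>n\<close> are
  identified by factoring out the central tuples with product 1.\<close>

definition central_power :: "('a, 'b) monoid_scheme \<Rightarrow> nat \<Rightarrow> (nat \<Rightarrow> 'a) set monoid" where
  "central_power G n =
     product_group {..<n} (\<lambda>_. G) Mod
       {z \<in> {..<n} \<rightarrow>\<^sub>E group_center G.
          finprod (G\<lparr>carrier := group_center G\<rparr>) z {..<n} = \<one>\<^bsub>G\<^esub>}"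

text \<open>\<open>(g, e)\<close> stands for the product \<open>g e\<close>, and \<open>act g e\<close> for the image of \<open>e\<close> under the right
  action of \<open>g\<close>, which becomes \<open>g\<^sup>-\<^sup>1 e g\<close>. The normal subgroup consists of the \<open>(1, e)\<close>.\<close>

definition semidirect_product ::
    "('g, 'm) monoid_scheme \<Rightarrow> ('e, 'n) monoid_scheme \<Rightarrow> ('g \<Rightarrow> 'e \<Rightarrow> 'e) \<Rightarrow> ('g \<times> 'e) monoid" where
  "semidirect_product G E act =
     \<lparr>carrier = carrier G \<times> carrier E,
      monoid.mult = (\<lambda>(g1, e1) (g2, e2). (g1 \<otimes>\<^bsub>G\<^esub> g2, act g2 e1 \<otimes>\<^bsub>E\<^esub> e2)),
      one = (\<one>\<^bsub>G\<^esub>, \<one>\<^bsub>E\<^esub>)\<rparr>"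

definition extends_to_embedding ::
    "('g, 'm) monoid_scheme \<Rightarrow> ('e, 'n) monoid_scheme \<Rightarrow> ('g \<Rightarrow> 'e \<Rightarrow> 'e) \<Rightarrow>
     ('h, 'o) monoid_scheme \<Rightarrow> ('e \<Rightarrow> 'h) \<Rightarrow> bool" where
  "extends_to_embedding G E act H \<rho> \<longleftrightarrow>
     (\<exists>\<Phi> \<in> hom (semidirect_product G E act) H.
        inj_on \<Phi> (carrier (semidirect_product G E act)) \<and>
        (\<forall>e\<in>carrier E. \<Phi> (\<one>\<^bsub>G\<^esub>, e) = \<rho> e))"


section \<open>Representations\<close>

definition contragredient ::
    "('g, 'm) monoid_scheme \<Rightarrow> ('k, 'n) ring_scheme \<Rightarrow> ('k, 'w, 'o) module_scheme \<Rightarrow>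
     ('g \<Rightarrow> 'w \<Rightarrow> 'w) \<Rightarrow> 'g \<Rightarrow> ('w \<Rightarrow> 'k) \<Rightarrow> ('w \<Rightarrow> 'k)" where
  "contragredient G K W \<rho> g =
     (\<lambda>\<alpha>\<in>carrier (dual_space K W). \<lambda>x\<in>carrier W. \<alpha> (\<rho> (inv\<^bsub>G\<^esub> g) x))"

definition rep_sum ::
    "('k, 'v, 'm) module_scheme \<Rightarrow> ('k, 'w, 'n) module_scheme \<Rightarrow>
     ('g \<Rightarrow> 'v \<Rightarrow> 'v) \<Rightarrow> ('g \<Rightarrow> 'w \<Rightarrow> 'w) \<Rightarrow> 'g \<Rightarrow> 'v \<times> 'w \<Rightarrow> 'v \<times> 'w" where
  "rep_sum V W \<rho> \<sigma> g = (\<lambda>v\<in>carrier (direct_sum V W). (\<rho> g (fst v), \<sigma> g (snd v)))"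

definition irreducible_rep ::
    "('g, 'm) monoid_scheme \<Rightarrow> ('k, 'n) ring_scheme \<Rightarrow> ('k, 'w, 'o) module_scheme \<Rightarrow>
     ('g \<Rightarrow> 'w \<Rightarrow> 'w) \<Rightarrow> bool" where
  "irreducible_rep G K W \<rho> \<longleftrightarrow>
     carrier W \<noteq> {\<zero>\<^bsub>W\<^esub>} \<and>
     (\<forall>N. subspace K N W \<and> (\<forall>g\<in>carrier G. \<forall>x\<in>N. \<rho> g x \<in> N) \<longrightarrow>
          N = {\<zero>\<^bsub>W\<^esub>} \<or> N = carrier W)"

text \<open>Extension of scalars along a field embedding \<open>\<phi> : K \<rightarrow> L\<close>. For finite-dimensional \<open>W\<close> the
  tensor product of \<open>L\<close> and \<open>W\<close> over \<open>K\<close> is realised, without choosing a basis, as the \<open>L\<close>-space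
  of \<open>K\<close>-linear maps from the dual of \<open>W\<close> to \<open>L\<close>: the tensor \<open>c \<otimes> x\<close> is the map
  \<open>\<alpha> \<mapsto> c \<cdot> \<phi> (x \<alpha>)\<close>. The map \<open>1 \<otimes> g\<close> then becomes \<^term>\<open>extend_scalars_map K W g\<close>.\<close>

definition extend_scalars ::
    "('k, 'm) ring_scheme \<Rightarrow> ('l, 'n) ring_scheme \<Rightarrow> ('k \<Rightarrow> 'l) \<Rightarrow> ('k, 'w, 'o) module_scheme \<Rightarrow>
     ('l, ('w \<Rightarrow> 'k) \<Rightarrow> 'l) module" where
  "extend_scalars K L \<phi> W =
     (let D = dual_space K W in
      (ring.func_space L (carrier D))
        \<lparr>carrier := {t \<in> carrier D \<rightarrow>\<^sub>E carrier L.
           (\<forall>\<alpha>\<in>carrier D. \<forall>\<beta>\<in>carrier D. t (\<alpha> \<oplus>\<^bsub>D\<^esub> \<beta>) = t \<alpha> \<oplus>\<^bsub>L\<^esub> t \<beta>) \<and>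
           (\<forall>c\<in>carrier K. \<forall>\<alpha>\<in>carrier D. t (c \<odot>\<^bsub>D\<^esub> \<alpha>) = \<phi> c \<otimes>\<^bsub>L\<^esub> t \<alpha>)}\<rparr>)"

definition extend_scalars_map ::
    "('k, 'm) ring_scheme \<Rightarrow> ('k, 'w, 'o) module_scheme \<Rightarrow> ('w \<Rightarrow> 'w) \<Rightarrow>
     (('w \<Rightarrow> 'k) \<Rightarrow> 'l) \<Rightarrow> (('w \<Rightarrow> 'k) \<Rightarrow> 'l)" where
  "extend_scalars_map K W g t =
     (\<lambda>\<alpha>\<in>carrier (dual_space K W). t (\<lambda>x\<in>carrier W. \<alpha> (g x)))"

text \<open>Irreducible over the algebraic closure. Irreducibility over \<open>K\<close> itself (a consequence when
  \<open>W\<close> is finite-dimensional) is listed because it forces \<open>W\<close> to be finite-dimensional when \<open>G\<close> is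
  finite, so that \<^const>\<open>extend_scalars\<close> is the tensor product.\<close>

definition absolutely_irreducible_rep ::
    "('g, 'm) monoid_scheme \<Rightarrow> ('k, 'n) ring_scheme \<Rightarrow> ('k, 'w, 'o) module_scheme \<Rightarrow>
     ('g \<Rightarrow> 'w \<Rightarrow> 'w) \<Rightarrow> bool" where
  "absolutely_irreducible_rep G K W \<rho> \<longleftrightarrow>
     irreducible_rep G K W \<rho> \<and>
     irreducible_rep G (field.alg_closure K)
       (extend_scalars K (field.alg_closure K) (ring.indexed_const K) W)
       (\<lambda>g. extend_scalars_map K W (\<rho> g))"

end

theory Submission
 imports "Jordan_Normal_Form.Determinant" "HOL.Complex" Defs
begin

text \<open>Every isometry \<open>g\<close> of the form extends to a map \<open>T(g) = \<Sum>\<^sub>x \<rho>((x, 0)\<^sup>-\<^sup>1 (x g, 0))\<close> that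
  intertwines \<open>\<rho>\<close> and its twist by \<open>g\<close>. The products \<open>T(g) T(g')\<close> and \<open>T(g g')\<close> differ by a character sum
  \<open>S(g, g')\<close>, and \<open>T(g) T(g\<^sup>-\<^sup>1) = |V| |Fix g|\<close>. It remains to find scalars \<open>s(g)\<close> splitting this cocycle with
  \<open>s(g) \<eta>'(s(g)) = |V| |Fix g|\<close>. For odd \<open>p\<close> they come from determinants of the \<open>T(g)\<close> on the regular
  representation, because \<open>S\<^sup>4\<close> is a product of values of \<open>|V| |Fix|\<close> and \<open>|V| = 1 mod 4\<close>. For \<open>p = 2\<close> they come
  from a common eigenvector (polarized forms) or from signed powers of \<open>q\<close> (Hermitian forms over a field
  with \<open>q\<^sup>2\<close> elements). The adjoint of \<open>T(g)\<close> is \<open>T(g\<^sup>-\<^sup>1)\<close>, so that \<open>T(g) / s(g)\<close> is an isometry of any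
  invariant form.\<close>

\<comment> \<open>Schur's lemma would give intertwiners up to unknown scalars; the obstacle is to
  choose these coherently. With the explicit sum for T(g) this becomes a computation: averaging T(g)
  T(g') over conjugation keeps only the terms of the double sum that lie in the centre of
  \<open>E\<close>, and S(g, g') is what they add up to. It is a sum of values of the central
  character, so it does not depend on the representation, and the scalars may be sought in any model
  with the same character. The functions on V form such a model; its dimension |V| is an odd square
  for odd p, which is what the determinant argument needs. The number |V| |Fix g| is a power of p,
  hence invertible in K'. In case (A) all of GL(W) preserves the pairing on the sum of the dual and
  W, so a multiplicative choice of the T(g) is enough. In case (B) a form must be produced first.
  Averages of rank-one forms cannot all vanish, because the operators of the (v, 0) are linearly
  independent. For odd p such an average is made Hermitian; for p = 2 it is made alternating unless
  it is symmetric, and a symmetric form is excluded by splitting off dihedral subgroups until only a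
  quaternion group is left.\<close>
text \<open>The product of a structure \<open>R\<close> is written \<open>x **.R y\<close>.\<close>

syntax "_index" :: "logic \<Rightarrow> index" (\<open>._\<close> [1000] 1000)

abbreviation (input) Cr :: "('a, 'b) partial_object_scheme \<Rightarrow> 'a set" where "Cr \<equiv> carrier"

notation iff (infixr \<open><->\<close> 25)
notation monoid.mult (infixl \<open>**\<index>\<close> 70)

section \<open>Prime field and trace\<close>

text \<open>Serves to make the Frobenius map additive. The induction step is Pascal's rule, once
  both halves of the product are sums over the same range.\<close>

lemma (in cring) binomial:
 assumes "x : Cr R" "y : Cr R"
 shows "(x \<oplus> y) [^] (n::nat) = (\<Oplus>k\<in>{..n}. [(n choose k)] \<cdot>.R (x [^] k ** y [^] (n - k)))"
proof (induction n)
 case 0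
 then show ?case using assms by simp
next
 case (Suc n)
 note a = assms
 define t where "t = (\<lambda>n k. [(n choose k)] \<cdot>.R (x [^] k ** y [^] (n - k)))"
 have tc: "t n k : Cr R" for n k using a by (simp add: t_def)
 have X: "x ** t n k = [(n choose k)] \<cdot>.R (x [^] Suc k ** y [^] (Suc n - Suc k))" for k
  using a unfolding t_def by (simp add: add_pow_rdistr m_ac)
 have Y: "t n k ** y = [(n choose k)] \<cdot>.R (x [^] k ** y [^] (Suc n - k))" if "k \<le> n" for k
  using a that unfolding t_def by (simp add: add_pow_ldistr m_assoc Suc_diff_le)
 have "(x \<oplus> y) [^] Suc n = (x \<oplus> y) ** (\<Oplus>k\<in>{..n}. t n k)"
  using Suc a by (simp add: t_def m_comm)
 also have "... = (\<Oplus>k\<in>{..n}. x ** t n k) \<oplus> (\<Oplus>k\<in>{..n}. t n k ** y)"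
 proof -
  have "(x \<oplus> y) ** (\<Oplus>k\<in>{..n}. t n k) = x ** (\<Oplus>k\<in>{..n}. t n k) \<oplus> (\<Oplus>k\<in>{..n}. t n k) ** y"
   using a tc by (simp add: l_distr m_comm[of y])
  then show ?thesis using a tc by (simp add: finsum_rdistr finsum_ldistr Pi_def)
 qed
 also have "(\<Oplus>k\<in>{..n}. t n k ** y) = (\<Oplus>k\<in>{..n}. [(n choose k)] \<cdot>.R (x [^] k ** y [^] (Suc n - k)))"
  by (rule finsum_cong') (use a Y in auto)
 \<comment> \<open>The added term at \<open>k = Suc n\<close> has binomial coefficient zero.\<close>
 also have "(\<Oplus>k\<in>{..n}. [(n choose k)] \<cdot>.R (x [^] k ** y [^] (Suc n - k)))
   = (\<Oplus>k\<in>{..Suc n}. [(n choose k)] \<cdot>.R (x [^] k ** y [^] (Suc n - k)))"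
  using a by (simp add: finsum_Suc Pi_def binomial_eq_0)
 also have "(\<Oplus>k\<in>{..n}. x ** t n k) = (\<Oplus>k\<in>{..n}. [(n choose k)] \<cdot>.R (x [^] Suc k ** y [^] (Suc n - Suc k)))"
  by (rule finsum_cong') (use a X in auto)
 \<comment> \<open>Multiplication by \<open>x\<close> has shifted the index; a zero at
   \<open>k = 0\<close> lets this sum run over \<open>{..Suc n}\<close> as well.\<close>
 also have "... = (\<Oplus>k\<in>{..Suc n}. (case k of 0 => \<zero> | Suc j => [(n choose j)] \<cdot>.R (x [^] k ** y [^] (Suc n - k))))"
  using a by (subst finsum_Suc2) (auto simp: Pi_def split: nat.split)
 also have "... \<oplus> (\<Oplus>k\<in>{..Suc n}. [(n choose k)] \<cdot>.R (x [^] k ** y [^] (Suc n - k)))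
   = (\<Oplus>k\<in>{..Suc n}. (case k of 0 => \<zero> | Suc j => [(n choose j)] \<cdot>.R (x [^] k ** y [^] (Suc n - k)))
     \<oplus> [(n choose k)] \<cdot>.R (x [^] k ** y [^] (Suc n - k)))"
  using a by (subst finsum_addf) (auto simp: Pi_def split: nat.split)
 also have "... = (\<Oplus>k\<in>{..Suc n}. [(Suc n choose k)] \<cdot>.R (x [^] k ** y [^] (Suc n - k)))"
 proof (rule finsum_cong')
  fix k assume "k : {..Suc n}"
  have "[(i::nat)] \<cdot>.R u \<oplus> [(j::nat)] \<cdot>.R u = [(i + j)] \<cdot>.R u" if "u : Cr R" for i j u
   using that by (simp add: add.nat_pow_mult)
  then show "(case k of 0 => \<zero> | Suc j => [(n choose j)] \<cdot>.R (x [^] k ** y [^] (Suc n - k)))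
     \<oplus> [(n choose k)] \<cdot>.R (x [^] k ** y [^] (Suc n - k)) = [(Suc n choose k)] \<cdot>.R (x [^] k ** y [^] (Suc n - k))"
   using a by (auto split: nat.split)
 qed (use a in auto)
 finally show ?case .
qed

text \<open>The characteristic is encoded by \<open>p\<close> copies of one adding up to zero, which
  for prime \<open>p\<close> determines it (\<open>add_pow_one_eq_0_iff\<close>). The locale is used
  for \<open>K\<close> and for \<open>K'\<close>.\<close>

locale finite_field_char = field R for R :: "('k, 'm) ring_scheme" (structure) +
 fixes p :: nat
 assumes prime_p: "Factorial_Ring.prime p" and finite_R: "finite (Cr R)"
  and char_p: "[p] \<cdot>.R \<one> = \<zero>"
begin

lemma p_gt_0: "p > 0" using prime_p by (simp add: prime_gt_0_nat)
lemma p_ge_2: "p \<ge> 2" using prime_p by (simp add: prime_ge_2_nat)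

lemma add_pow_one_mult:
 "x : Cr R ==> [(n::nat)] \<cdot>.R \<one> ** x = [n] \<cdot>.R x"
 by (simp add: add_pow_ldistr)

lemma add_pow_p: "x : Cr R ==> [(p * n)] \<cdot>.R x = \<zero>"
 by (metis add.nat_pow_closed add.nat_pow_pow add_pow_one_mult char_p l_null mult.commute nat_pow_closed r_null add_pow_rdistr)

lemma add_pow_mod: "x : Cr R ==> [(n mod p)] \<cdot>.R x = [n] \<cdot>.R x"
 by (metis add.nat_pow_closed add.nat_pow_mult add_pow_p l_zero mult_div_mod_eq)

lemma add_pow_one_eq_0_iff: "[(n::nat)] \<cdot>.R \<one> = \<zero> <-> p dvd n"
proof
 assume n: "[n] \<cdot>.R \<one> = \<zero>"
 show "p dvd n"
 proof (rule ccontr)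
  assume "~ p dvd n"
  then have "coprime n p" using prime_p by (metis coprime_commute prime_imp_coprime)
  then obtain x where "[n * x = 1] (mod p)" using cong_solve_coprime_nat[of n p] by auto
  then have "[(n * x)] \<cdot>.R \<one> = [(1::nat)] \<cdot>.R \<one>"
   by (metis add_pow_mod cong_def one_closed)
  moreover have "[(n * x)] \<cdot>.R \<one> = [x] \<cdot>.R ([n] \<cdot>.R \<one>)"
   by (simp add: add.nat_pow_pow)
  ultimately have "\<one> = \<zero>" using n by simp
  then show False by simp
 qed
next
 assume "p dvd n"
 then show "[n] \<cdot>.R \<one> = \<zero>" using add_pow_p by auto
qed

lemma add_pow_one_eq_iff: "[(m::nat)] \<cdot>.R \<one> = [(n::nat)] \<cdot>.R \<one> <-> m mod p = n mod p"
proof -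
 have *: "m mod p = n mod p" if "[(m::nat)] \<cdot>.R \<one> = [(n::nat)] \<cdot>.R \<one>" "m \<le> n" for m n
 proof -
  have "[m] \<cdot>.R \<one> \<oplus> [(n - m)] \<cdot>.R \<one> = [n] \<cdot>.R \<one>"
   using that(2) by (simp add: add.nat_pow_mult)
  also have "... = [m] \<cdot>.R \<one> \<oplus> \<zero>"
   using that by simp
  finally have "[m] \<cdot>.R \<one> \<oplus> [(n - m)] \<cdot>.R \<one> = [m] \<cdot>.R \<one> \<oplus> \<zero>" .
  then have "[(n - m)] \<cdot>.R \<one> = \<zero>"
   by (metis add.l_cancel add.nat_pow_closed one_closed zero_closed)
  then show ?thesis using that(2) by (metis add_pow_one_eq_0_iff mod_eq_dvd_iff_nat)
 qed
 show ?thesis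
  using *[of m n] *[of n m] by (metis add_pow_mod linear one_closed)
qed

text \<open>The natural multiples of one already form a field: negatives exist because
  \<open>p\<close> copies of one vanish, and inverses come from inverses modulo \<open>p\<close>.
  This makes the prime field countable by \<open>0..<p\<close>.\<close>

lemma prime_field_eq: "prime_field R = range (\<lambda>k::nat. [k] \<cdot>.R \<one>)"
proof
 show "prime_field R <= range (\<lambda>k::nat. [k] \<cdot>.R \<one>)"
 proof
  fix x assume "x : prime_field R"
  then show "x : range (\<lambda>k::nat. [k] \<cdot>.R \<one>)"
   unfolding prime_field_def
  proof (induction rule: generate_field.induct)
   case one
   have "\<one> = [(1::nat)] \<cdot>.R \<one>" by simp
   then show ?case by blast
  next
   case (incl h)
   then show ?case by simp
  next
   case (a_inv h)
   then obtain k::nat where k: "h = [k] \<cdot>.R \<one>" by auto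
   have "[k] \<cdot>.R \<one> \<oplus> [(p * k - k)] \<cdot>.R \<one> = \<zero>"
    using p_gt_0 by (simp add: add.nat_pow_mult add_pow_one_eq_0_iff)
   then have "\<ominus> h = [(p * k - k)] \<cdot>.R \<one>"
    using k by (simp add: add.inv_equality add.m_comm)
   then show ?case by blast
  next
   case (m_inv h)
   then obtain k::nat where k: "h = [k] \<cdot>.R \<one>" by auto
   then have "~ p dvd k" using m_inv by (simp add: add_pow_one_eq_0_iff)
   then have "coprime k p" using prime_p by (metis coprime_commute prime_imp_coprime)
   then obtain x where x: "[k * x = 1] (mod p)" using cong_solve_coprime_nat[of k p] by auto
   have "h ** [x] \<cdot>.R \<one> = [(k * x)] \<cdot>.R \<one>"
    using k by (simp add: add_pow_one_mult add.nat_pow_pow mult.commute)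
   also have "... = \<one>" using x add_pow_one_eq_iff[of "k * x" 1] by (simp add: cong_def)
   finally have "inv h = [x] \<cdot>.R \<one>" using k by (simp add: comm_inv_char)
   then show ?case by blast
  next
   case (eng_add h1 h2)
   then show ?case by (auto simp: add.nat_pow_mult)
  next
   case (eng_mult h1 h2)
   then obtain k1 k2 :: nat where "h1 = [k1] \<cdot>.R \<one>" "h2 = [k2] \<cdot>.R \<one>" by auto
   then have "h1 ** h2 = [(k2 * k1)] \<cdot>.R \<one>" by (simp add: add_pow_one_mult add.nat_pow_pow)
   then show ?case by blast
  qed
 qed
 have "[k] \<cdot>.R \<one> : prime_field R" for k :: nat
  unfolding prime_field_def
  by (induction k) (auto intro: generate_field.intros zero_in_generate)
 then show "range (\<lambda>k::nat. [k] \<cdot>.R \<one>) <= prime_field R" by auto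
qed

lemma prime_field_subfield: "subfield (prime_field R) R"
 unfolding prime_field_def by (rule generate_field_is_subfield) simp

lemma prime_field_subset: "prime_field R <= Cr R"
 by (auto simp: prime_field_eq)

lemma prime_field_closed [simp]:
 "x : prime_field R ==> x : Cr R"
 "\<zero> : prime_field R" "\<one> : prime_field R"
 "x : prime_field R ==> y : prime_field R ==> x \<oplus> y : prime_field R"
 "x : prime_field R ==> y : prime_field R ==> x ** y : prime_field R"
 "x : prime_field R ==> \<ominus> x : prime_field R"
 "x : prime_field R ==> x ~= \<zero> ==> inv x : prime_field R"
 unfolding prime_field_def
 by (auto intro: generate_field.intros zero_in_generate generate_field_in_carrier)

lemma prime_field_bij: "bij_betw (\<lambda>k::nat. [k] \<cdot>.R \<one>) {..<p} (prime_field R)"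
 unfolding bij_betw_def
proof
 show "inj_on (\<lambda>k::nat. [k] \<cdot>.R \<one>) {..<p}"
  by (auto simp: inj_on_def add_pow_one_eq_iff)
 show "(\<lambda>k::nat. [k] \<cdot>.R \<one>) ` {..<p} = prime_field R"
  unfolding prime_field_eq
  using add_pow_mod[of \<one>] p_gt_0 by (auto simp: image_iff) (metis lessThan_iff mod_less_divisor one_closed)
qed

lemma card_prime_field: "card (prime_field R) = p"
 using bij_betw_same_card[OF prime_field_bij] by simp

lemma finite_prime_field [simp]: "finite (prime_field R)"
 using finite_subset[OF prime_field_subset finite_R] .

lemma frobenius_add:
 assumes "x : Cr R" "y : Cr R"
 shows "(x \<oplus> y) [^] p = x [^] p \<oplus> y [^] p"
proof -
 let ?t = "\<lambda>k. [(p choose k)] \<cdot>.R (x [^] k ** y [^] (p - k))"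
 have z: "?t k = \<zero>" if "k ~= 0" "k < p" for k
 proof -
  have "p dvd (p choose k)" using that prime_p by (simp add: dvd_choose_prime)
  then show ?thesis using add_pow_p assms by (auto elim!: dvdE)
 qed
 have "(x \<oplus> y) [^] p = finsum R ?t {..p}" using binomial[OF assms] .
 also have "... = finsum R ?t {0, p}"
  by (rule add.finprod_mono_neutral_cong_right) (auto simp: assms intro!: z)
 also have "... = x [^] p \<oplus> y [^] p"
  using assms p_gt_0 by (simp add: a_comm)
 finally show ?thesis .
qed

lemma frobenius_pow_add:
 assumes "x : Cr R" "y : Cr R"
 shows "(x \<oplus> y) [^] (p ^ i) = x [^] (p ^ i) \<oplus> y [^] (p ^ i)"
proof (induction i)
 case (Suc i)
 have pp: "u [^] (p ^ Suc i) = (u [^] (p ^ i)) [^] p" if "u : Cr R" for u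
  using that by (simp add: nat_pow_pow mult.commute)
 show ?case using pp[of x] pp[of y] pp[of "x \<oplus> y"] assms Suc by (simp add: frobenius_add)
qed (use assms in auto)

lemma prime_field_pow_p:
 assumes "x : prime_field R" shows "x [^] p = x"
proof -
 have "([(k::nat)] \<cdot>.R \<one>) [^] p = [k] \<cdot>.R \<one>" for k
 proof (induction k)
  case 0
  then show ?case using p_gt_0 by (simp add: nat_pow_zero)
 next
  case (Suc k)
  then show ?case using frobenius_add[of "[k] \<cdot>.R \<one>" \<one>] by simp
 qed
 then show ?thesis using assms by (auto simp: prime_field_eq)
qed

lemma prime_field_pow: "x : prime_field R ==> x [^] (p ^ i) = x"
proof (induction i)
 case (Suc i)
 then show ?case using nat_pow_pow[of x "p^i" p] by (simp add: prime_field_pow_p mult.commute)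
qed auto

text \<open>A solution is zero or a root of unity of order dividing \<open>d - 1\<close>, and of the
  latter there are at most \<open>d - 1\<close>.\<close>

lemma card_roots_pow_le:
 assumes "d > 1"
 shows "card {x : Cr R. x [^] (d::nat) = x} \<le> d"
proof -
 have "{x : Cr R. x [^] d = x} <= insert \<zero> {x : Cr R. x [^] (d - 1) = \<one>}"
 proof
  fix x assume "x : {x : Cr R. x [^] d = x}"
  then have x: "x : Cr R" "x [^] d = x" by auto
  have "x [^] d = x ** x [^] (d - 1)" using assms x
   using nat_pow_Suc2[of x "d - 1"] by simp
  then have "x = \<zero> \<or> x [^] (d - 1) = \<one>" using x
   by (metis m_lcancel nat_pow_closed one_closed r_one)
  then show "x : insert \<zero> {x : Cr R. x [^] (d - 1) = \<one>}" using x by auto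
 qed
 then have "card {x : Cr R. x [^] d = x} \<le> card (insert \<zero> {x : Cr R. x [^] (d - 1) = \<one>})"
  using finite_R by (auto intro!: card_mono)
 also have "... \<le> Suc (card {x : Cr R. x [^] (d - 1) = \<one>})"
  by (simp add: card_insert_if finite_R)
 also have "... \<le> Suc (d - 1)" using num_roots_le_deg[OF finite_R, of "d - 1"] assms by simp
 finally show ?thesis using assms by simp
qed

text \<open>The \<open>p\<close> elements of the prime field exhaust the at most \<open>p\<close>
  solutions of the equation.\<close>

lemma prime_field_iff_pow_p:
 assumes x: "x : Cr R" shows "x [^] p = x <-> x : prime_field R"
proof -
 have sub: "prime_field R <= {x : Cr R. x [^] p = x}"
  using prime_field_pow_p prime_field_subset by auto
 have "prime_field R = {x : Cr R. x [^] p = x}"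
 proof (rule card_seteq[OF _ sub])
  show "card {x : Cr R. x [^] p = x} \<le> card (prime_field R)"
   using card_roots_pow_le[of p] p_ge_2 card_prime_field by simp
 qed (simp add: finite_R)
 then show ?thesis using x by blast
qed

text \<open>Two expressions of one element with different coefficients of \<open>v\<close> would put
  a unit multiple of \<open>v\<close>, and so \<open>v\<close> itself, into \<open>E\<close>. This
  is the counting step for the inductive notion \<open>dimension\<close>.\<close>

lemma card_line_extension:
 assumes E: "subgroup E (add_monoid R)" "finite E" "!!k e. k : F ==> e : E ==> k ** e : E"
  and F: "subfield F R" and v: "v : Cr R" "v \<notin> E"
 shows "card (line_extension F v E) = card F * card E"
proof -
 interpret E: subgroup E "add_monoid R" by fact
 have Fc: "F <= Cr R" using F by (simp add: subfieldE(3))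
 have Ec: "E <= Cr R" using E.subset by simp
 have "line_extension F v E = (\<lambda>(k, e). k ** v \<oplus> e) ` (F \<times> E)"
  unfolding line_extension_def set_add_def set_mult_def r_coset_def by auto
 moreover have "inj_on (\<lambda>(k, e). k ** v \<oplus> e) (F \<times> E)"
 proof (rule inj_onI, clarify)
  fix k e k' e' assume a: "k : F" "e : E" "k' : F" "e' : E" "k ** v \<oplus> e = k' ** v \<oplus> e'"
  have c: "k : Cr R" "k' : Cr R" "e : Cr R" "e' : Cr R" using a Fc Ec by auto
  have "(k \<ominus> k') ** v = (k ** v \<oplus> e) \<ominus> (k' ** v \<oplus> e)" using c v by algebra
  also have "... = e' \<ominus> e" unfolding a(5) using c v by algebra
  finally have 1: "(k \<ominus> k') ** v = e' \<ominus> e" .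
  have 2: "e' \<ominus> e : E" using a E.m_closed E.m_inv_closed
   by (simp add: a_minus_def a_inv_def[symmetric])
  have kk: "k = k'"
  proof (rule ccontr)
   assume "k ~= k'"
   then have nz: "k \<ominus> k' ~= \<zero>" using c by simp
   have kF: "k \<ominus> k' : F" using a
    using subringE(5,7)[OF subfieldE(1)[OF F]] by (simp add: a_minus_def)
   then have "inv (k \<ominus> k') : F" using nz
    using kF subfield_m_inv(1)[OF F, of "k \<ominus> k'"] by blast
   then have "inv (k \<ominus> k') ** ((k \<ominus> k') ** v) : E" using 1 2 E(3) by simp
   moreover have "inv (k \<ominus> k') ** ((k \<ominus> k') ** v) = v"
    using c v nz by (simp add: m_assoc[symmetric] field_Units)
   ultimately show False using v by simp
  qed
  then show "k = k' & e = e'" using a(5) c v by simp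
 qed
 ultimately show ?thesis by (simp add: card_image card_cartesian_product)
qed

lemma card_dimension:
 assumes "dimension n F E" "subfield F R"
 shows "card E = card F ^ n"
 using assms
proof (induction n F E rule: dimension.induct)
 case (Suc_dim v E n F)
 interpret S: Embedded_Algebras.subalgebra F E R
  using finite_dimension_imp_subalgebra[OF Suc_dim(5)] Suc_dim(3) unfolding finite_dimension_def by blast
 have "finite E" using S.subset finite_R finite_subset by auto
 then show ?case
  using card_line_extension[of E F v] Suc_dim S.subgroup_axioms S.smult_closed by simp
qed auto

definition deg_prime :: nat where "deg_prime = ring.dim R (prime_field R) (Cr R)"

lemma card_carrier_eq: "card (Cr R) = p ^ deg_prime"
proof -
 obtain Us where Us: "set Us = Cr R" using finite_list[OF finite_R] by blast
 have "Span (prime_field R) Us = Cr R"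
  using Span_base_incl[OF prime_field_subfield, of Us] Span_in_carrier[OF prime_field_subset, of Us] Us by auto
 then have "finite_dimension (prime_field R) (Cr R)"
  using Span_finite_dimension[OF prime_field_subfield, of Us] Us by simp
 then obtain n where n: "dimension n (prime_field R) (Cr R)" by blast
 then have "deg_prime = n"
  using dimI[OF prime_field_subfield n] by (simp add: deg_prime_def over_def)
 then show ?thesis using card_dimension[OF n prime_field_subfield] card_prime_field by simp
qed

lemma deg_prime_pos: "deg_prime > 0"
proof (rule ccontr)
 assume "~ deg_prime > 0"
 then have "card (Cr R) = 1" using card_carrier_eq by simp
 then show False
  by (metis card_1_singletonE one_closed one_not_zero singletonD zero_closed)
qed

lemma pow_card_carrier:
 assumes x: "x : Cr R" shows "x [^] card (Cr R) = x"
proof (cases "x = \<zero>")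
 case True
 have "card (Cr R) ~= 0" using finite_R x by (auto simp: card_eq_0_iff)
 then show ?thesis using True by (simp add: nat_pow_zero)
next
 case False
 interpret M: group "Multiplicative_Group.mult_of R" by (rule field_mult_group)
 have "x [^]\<^bsub>Multiplicative_Group.mult_of R\<^esub> order (Multiplicative_Group.mult_of R) = \<one>\<^bsub>Multiplicative_Group.mult_of R\<^esub>"
  using False x finite_R by (intro M.pow_order_eq_1) auto
 then have "x [^] (card (Cr R) - 1) = \<one>"
  using finite_R by (simp add: order_def Multiplicative_Group.nat_pow_mult_of card_Diff_singleton)
 moreover have "card (Cr R) > 0" using x finite_R card_gt_0_iff by blast
 ultimately show ?thesis
  using nat_pow_Suc2[OF x, of "card (Cr R) - 1"] x by simp
qed

section \<open>The absolute trace\<close>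

abbreviation Tr where "Tr == trace_map p R"

lemma Tr_eq: "Tr x = (\<Oplus>i\<in>{..<deg_prime}. x [^] (p ^ i))"
 by (simp add: trace_map_def deg_prime_def)

lemma Tr_carrier: "x : Cr R ==> Tr x : Cr R"
 by (simp add: Tr_eq)

lemma Tr_add: "x : Cr R ==> y : Cr R ==> Tr (x \<oplus> y) = Tr x \<oplus> Tr y"
 unfolding Tr_eq by (subst finsum_addf[symmetric]) (auto intro!: finsum_cong' simp: frobenius_pow_add)

lemma Tr_smult:
 assumes "x : Cr R" "a : prime_field R" shows "Tr (a ** x) = a ** Tr x"
 unfolding Tr_eq using assms
 by (subst finsum_rdistr) (auto intro!: finsum_cong' simp: nat_pow_distrib prime_field_pow)

lemma frobenius_finsum:
 "finite A ==> f : A \<rightarrow> Cr R ==> (\<Oplus>i\<in>A. f i) [^] p = (\<Oplus>i\<in>A. f i [^] p)"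
proof (induction A rule: finite_induct)
 case empty
 then show ?case using p_gt_0 by (simp add: nat_pow_zero)
next
 case (insert x F)
 have "(\<Oplus>i\<in>F. f i) : Cr R" using insert by (intro finsum_closed) auto
 then show ?case using insert by (simp add: frobenius_add Pi_iff)
qed

text \<open>The Frobenius map permutes the summands cyclically, because the power
  \<open>p ^ deg_prime\<close> is the identity on the field. So it fixes the trace, and its fixed
  elements form the prime field.\<close>

lemma Tr_prime_field:
 assumes x: "x : Cr R" shows "Tr x : prime_field R"
proof -
 have "Tr x [^] p = (\<Oplus>i\<in>{..<deg_prime}. (x [^] (p ^ i)) [^] p)"
  unfolding Tr_eq using x by (simp add: frobenius_finsum)
 also have "... = (\<Oplus>i\<in>{..<deg_prime}. x [^] (p ^ Suc i))"
  using x by (intro finsum_cong') (auto simp: nat_pow_pow mult.commute)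
 also have "... = Tr x"
 proof -
  \<comment> \<open>The sums over the exponents \<open>0..m-1\<close> and \<open>1..m\<close> differ
    only in their end terms; at \<open>m = deg_prime\<close> both end terms are
    \<open>x\<close>.\<close>
  have "x [^] (p ^ m) \<oplus> (\<Oplus>i\<in>{..<m}. x [^] (p ^ i)) = x \<oplus> (\<Oplus>i\<in>{..<m}. x [^] (p ^ Suc i))" for m
  proof (induction m)
   case (Suc m)
   let ?a = "\<Oplus>i\<in>{..<m}. x [^] (p ^ i)" and ?b = "\<Oplus>i\<in>{..<m}. x [^] (p ^ Suc i)"
   have c: "?a : Cr R" "?b : Cr R" using x by auto
   have "x [^] (p ^ Suc m) \<oplus> (x [^] (p ^ m) \<oplus> ?a) = x [^] (p ^ Suc m) \<oplus> (x \<oplus> ?b)"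
    using Suc by simp
   also have "... = x \<oplus> (x [^] (p ^ Suc m) \<oplus> ?b)" using x c by (simp add: a_lcomm del: power_Suc)
   finally show ?case using x by (simp add: lessThan_Suc del: power_Suc)
  qed (use x in simp)
  from this[of deg_prime] have "x \<oplus> Tr x = x \<oplus> (\<Oplus>i\<in>{..<deg_prime}. x [^] (p ^ Suc i))"
   using pow_card_carrier[OF x] by (simp add: card_carrier_eq Tr_eq)
  then show ?thesis
   using x by (metis (no_types, lifting) PiE Pi_I Tr_carrier add.l_cancel finsum_closed nat_pow_closed)
 qed
 finally show ?thesis using prime_field_iff_pow_p[OF Tr_carrier[OF x]] by simp
qed

text \<open>As a polynomial the trace is monic of degree \<open>p ^ (deg_prime - 1)\<close>, which
  is less than the number of field elements, so it cannot vanish everywhere.\<close>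

lemma Tr_nonzero: "\<exists>x\<in>Cr R. Tr x ~= \<zero>"
proof (rule ccontr)
 assume *: "~ ?thesis"
 interpret U: UP_domain R "UP R" by unfold_locales
 \<comment> \<open>The trace polynomial, built one monomial at a time; the leading coefficient is
   carried along because it shows that the polynomial is not zero.\<close>
 have "\<exists>f\<in>Cr (UP R). deg R f \<le> p ^ n & up_ring.coeff (UP R) f (p ^ n) = \<one> &
   (\<forall>x\<in>Cr R. UnivPoly.eval R R id x f = (\<Oplus>i\<in>{..n}. x [^] (p ^ i)))" for n
 proof (induction n)
  case 0
  have "UnivPoly.eval R R id x (up_ring.monom (UP R) \<one> 1) = x" if "x : Cr R" for x
   unfolding U.evalRR_monom[OF one_closed that] using that by simp
  moreover have "deg R (up_ring.monom (UP R) \<one> 1) \<le> 1" by simp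
  ultimately show ?case
   by (intro bexI[of _ "up_ring.monom (UP R) \<one> 1"] conjI ballI) (simp_all add: id_def)
 next
  case (Suc n)
  then obtain f where f: "f : Cr (UP R)" "deg R f \<le> p ^ n"
   "!!x. x : Cr R ==> UnivPoly.eval R R id x f = (\<Oplus>i\<in>{..n}. x [^] (p ^ i))" by blast
  have lt: "p ^ n < p ^ Suc n" using p_ge_2 by simp
  let ?g = "f \<oplus>\<^bsub>UP R\<^esub> up_ring.monom (UP R) \<one> (p ^ Suc n)"
  have "deg R ?g \<le> max (deg R f) (deg R (up_ring.monom (UP R) \<one> (p ^ Suc n)))"
   using f by (intro U.deg_add) auto
  then have "deg R ?g \<le> p ^ Suc n" using f lt by (simp del: power_Suc)
  moreover have "up_ring.coeff (UP R) ?g (p ^ Suc n) = \<one>"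
  proof -
   have "up_ring.coeff (UP R) f (p ^ Suc n) = \<zero>" using f(1,2) lt by (intro U.deg_aboveD) (simp_all del: power_Suc)
   then show ?thesis using f by simp
  qed
  moreover have "UnivPoly.eval R R id x ?g = (\<Oplus>i\<in>{..Suc n}. x [^] (p ^ i))" if "x : Cr R" for x
   using f that by (simp add: U.evalRR_simps a_comm del: power_Suc)
  moreover have "?g : Cr (UP R)" using f(1) by simp
  ultimately show ?case by blast
 qed
 then obtain f where f: "f : Cr (UP R)" "deg R f \<le> p ^ (deg_prime - 1)"
   "up_ring.coeff (UP R) f (p ^ (deg_prime - 1)) = \<one>"
   "!!x. x : Cr R ==> UnivPoly.eval R R id x f = (\<Oplus>i\<in>{..deg_prime - 1}. x [^] (p ^ i))" by metis
 have l: "{..deg_prime - 1} = {..<deg_prime}" using deg_prime_pos by auto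
 have "f ~= \<zero>\<^bsub>UP R\<^esub>" using f(3) by auto
 then have "card {a : Cr R. UnivPoly.eval R R id a f = \<zero>} \<le> deg R f"
  using U.roots_bound[OF f(1) _ finite_R] by blast
 moreover have "{a : Cr R. UnivPoly.eval R R id a f = \<zero>} = Cr R"
  using * f(4) unfolding l Tr_eq by auto
 ultimately have "p ^ deg_prime \<le> p ^ (deg_prime - 1)"
  using f(2) card_carrier_eq by (metis le_trans)
 then have "deg_prime \<le> deg_prime - 1"
  using p_ge_2 power_le_imp_le_exp[of p deg_prime "deg_prime - 1"] by linarith
 then show False using deg_prime_pos by simp
qed

lemma automorphism_prime_field:
 assumes eta: "eta : Ring.ring_hom R R" and x: "x : prime_field R" shows "eta x = x"
proof -
 interpret h: ring_hom_cring R R eta by (simp add: ring_hom_cring_def ring_hom_cring_axioms_def is_cring eta)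
 have "eta ([(k::nat)] \<cdot>.R \<one>) = [k] \<cdot>.R \<one>" for k by (induction k) auto
 then show ?thesis using x by (auto simp: prime_field_eq)
qed

text \<open>An automorphism commutes with the power sum and fixes its value, which lies in the prime
  field. In the Hermitian case this moves \<eta> across the trace.\<close>

lemma Tr_automorphism:
 assumes eta: "eta : Ring.ring_hom R R" and x: "x : Cr R" shows "Tr (eta x) = Tr x"
proof -
 interpret h: ring_hom_cring R R eta by (simp add: ring_hom_cring_def ring_hom_cring_axioms_def is_cring eta)
 have "eta (Tr x) = Tr (eta x)"
  unfolding Tr_eq using x by (simp add: h.hom_finsum Pi_def o_def)
 then show ?thesis using automorphism_prime_field[OF eta Tr_prime_field[OF x]] by simp
qed

end

section \<open>Finite vector spaces\<close>

context vectorspace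
begin

text \<open>A set-level notion of subspace: maximal ones can be chosen among the finitely many
  subsets of \<open>V\<close>, and they can be counted without a basis.\<close>

definition lin_closed :: "'c set => bool" where
 "lin_closed H <-> H <= Cr V & \<zero>.V : H & (\<forall>x\<in>H. \<forall>y\<in>H. x \<oplus>.V y : H)
   & (\<forall>a\<in>Cr K. \<forall>x\<in>H. a \<odot>.V x : H)"

lemma lin_closedD:
 assumes "lin_closed H"
 shows "x : H ==> x : Cr V" "\<zero>.V : H" "x : H ==> y : H ==> x \<oplus>.V y : H"
  "a : Cr K ==> x : H ==> a \<odot>.V x : H" "x : H ==> \<ominus>.V x : H"
  "x : H ==> y : H ==> x \<ominus>.V y : H"
proof -
 show 1: "x : H ==> \<ominus>.V x : H" for x
 proof -
  assume x: "x : H"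
  then have "x : Cr V" using assms by (auto simp: lin_closed_def)
  then have "(\<ominus>.K \<one>.K) \<odot>.V x = \<ominus>.V x" by (simp add: smult_l_minus)
  then show ?thesis using assms x unfolding lin_closed_def by (metis R.add.inv_closed R.one_closed)
 qed
 show "x : H ==> y : H ==> x \<ominus>.V y : H"
  using 1 assms by (auto simp: lin_closed_def a_minus_def)
qed (use assms in \<open>auto simp: lin_closed_def\<close>)

lemma smult_cancel:
 assumes "a : Cr K" "a ~= \<zero>.K" "x : Cr V"
 shows "inv\<^bsub>K\<^esub> a \<odot>.V (a \<odot>.V x) = x" "a \<odot>.V (inv\<^bsub>K\<^esub> a \<odot>.V x) = x"
 using assms field_Units by (simp_all add: smult_assoc1[symmetric])

text \<open>A subspace of \<open>H\<close> that is maximal among those missing \<open>w\<close> is a complement of the line of \<open>w\<close>.\<close>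

lemma complement_of_vector:
 assumes fin: "finite (Cr V)" and H: "lin_closed H" and w: "w : H" "w ~= \<zero>.V"
 shows "\<exists>H0. lin_closed H0 & H0 <= H & w \<notin> H0 & (\<forall>x\<in>H. \<exists>!c. c : Cr K & x \<ominus>.V c \<odot>.V w : H0)"
proof -
 let ?S = "{H0. lin_closed H0 & H0 <= H & w \<notin> H0}"
 have "finite ?S" by (rule finite_subset[of _ "Pow (Cr V)"]) (auto simp: fin lin_closed_def)
 moreover have "{\<zero>.V} : ?S" using w lin_closedD(2)[OF H] by (auto simp: lin_closed_def)
 ultimately have "\<exists>H0\<in>?S. \<forall>H'\<in>?S. H0 <= H' --> H0 = H'"
  by (intro finite_has_maximal) (simp, metis empty_iff)
 then obtain H0 where H0: "H0 : ?S" and max': "\<forall>H'\<in>?S. H0 <= H' --> H0 = H'" by (elim bexE)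
 have max: "H0 = H'" if "H' : ?S" "H0 <= H'" for H' using max' that by simp
 have c: "lin_closed H0" using H0 by simp
 have wc: "w : Cr V" using lin_closedD(1)[OF H] w by simp
 have ex: "\<exists>c. c : Cr K & x \<ominus>.V c \<odot>.V w : H0" if x: "x : H" for x
 proof (cases "x : H0")
  case True
  have z: "\<ominus>.V \<zero>.V = \<zero>.V" by (metis M.a_inv_closed M.l_zero M.r_neg M.zero_closed)
  have "x \<ominus>.V \<zero>.K \<odot>.V w = x \<oplus>.V \<ominus>.V \<zero>.V" using wc by (simp add: a_minus_def)
  also have "... = x" unfolding z using True lin_closedD(1)[OF c] by simp
  finally show ?thesis using True by (intro exI[of _ "\<zero>.K"]) simp
 next
  case False
  have xc: "x : Cr V" using lin_closedD(1)[OF H] x by simp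
  \<comment> \<open>The span of \<open>H0\<close> and \<open>x\<close> is strictly larger than
    \<open>H0\<close>, so by maximality it contains \<open>w\<close>; solving for \<open>x\<close>
    gives the coefficient of \<open>w\<close>.\<close>
  let ?H' = "{h \<oplus>.V a \<odot>.V x |h a. h : H0 & a : Cr K}"
  have "lin_closed ?H'"
   unfolding lin_closed_def
  proof (intro conjI ballI)
   show "?H' <= Cr V" using lin_closedD(1)[OF c] xc by auto
   show "\<zero>.V : ?H'" using lin_closedD(2)[OF c] xc
    by (intro CollectI exI[of _ "\<zero>.V"] exI[of _ "\<zero>.K"]) simp
  next
   fix u v assume "u : ?H'" "v : ?H'"
   then obtain h a h' a' where *: "u = h \<oplus>.V a \<odot>.V x" "v = h' \<oplus>.V a' \<odot>.V x" "h : H0" "h' : H0"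
    "a : Cr K" "a' : Cr K" by blast
   then have "u \<oplus>.V v = (h \<oplus>.V h') \<oplus>.V (a \<oplus>.K a') \<odot>.V x"
    using lin_closedD(1)[OF c] xc by (simp add: smult_l_distr M.a_ac)
   then show "u \<oplus>.V v : ?H'" using * lin_closedD(3)[OF c] by blast
  next
   fix b u assume "b : Cr K" "u : ?H'"
   then obtain h a where *: "u = h \<oplus>.V a \<odot>.V x" "h : H0" "a : Cr K" "b : Cr K" by blast
   then have "b \<odot>.V u = b \<odot>.V h \<oplus>.V (b **.K a) \<odot>.V x"
    using lin_closedD(1)[OF c] xc by (simp add: smult_r_distr smult_assoc1)
   then show "b \<odot>.V u : ?H'" using * lin_closedD(4)[OF c] by blast
  qed
  moreover have "?H' <= H" using H0 lin_closedD(3,4)[OF H] x by auto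
  moreover have "H0 \<subset> ?H'"
  proof
   show "H0 <= ?H'"
   proof
    fix h assume h: "h : H0"
    then have "h = h \<oplus>.V \<zero>.K \<odot>.V x" using xc lin_closedD(1)[OF c] by simp
    then show "h : ?H'" using h by blast
   qed
   have "x = \<zero>.V \<oplus>.V \<one>.K \<odot>.V x" using xc by simp
   then have "x : ?H'" using lin_closedD(2)[OF c] by blast
   then show "H0 ~= ?H'" using False by metis
  qed
  ultimately have "w : ?H'" using max[of ?H'] by blast
  then obtain h a where *: "w = h \<oplus>.V a \<odot>.V x" "h : H0" "a : Cr K" by blast
  have hc: "h : Cr V" using * lin_closedD(1)[OF c] by simp
  have a0: "a ~= \<zero>.K" using * H0 xc hc by auto
  then have ic: "inv\<^bsub>K\<^esub> a : Cr K" using * field_Units by simp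
  have "inv\<^bsub>K\<^esub> a \<odot>.V w = inv\<^bsub>K\<^esub> a \<odot>.V h \<oplus>.V x"
   using * ic hc xc a0 by (simp add: smult_r_distr smult_cancel)
  then have "x \<ominus>.V inv\<^bsub>K\<^esub> a \<odot>.V w = \<ominus>.V (inv\<^bsub>K\<^esub> a \<odot>.V h)"
   using ic hc xc by (simp add: a_minus_def M.minus_add M.a_ac M.r_neg M.r_neg1 M.r_neg2)
  then have "x \<ominus>.V inv\<^bsub>K\<^esub> a \<odot>.V w : H0" using *(2) ic lin_closedD(4,5)[OF c] by simp
  then show ?thesis using ic by blast
 qed
 have uniq: "c = c'" if "c : Cr K" "c' : Cr K" "x : H"
  "x \<ominus>.V c \<odot>.V w : H0" "x \<ominus>.V c' \<odot>.V w : H0" for x c c'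
 proof (rule ccontr)
  assume "c ~= c'"
  then have nz: "c' \<ominus>.K c ~= \<zero>.K" "c' \<ominus>.K c : Cr K" using that by auto
  have xc: "x : Cr V" using lin_closedD(1)[OF H] that by simp
  have "(x \<ominus>.V c \<odot>.V w) \<ominus>.V (x \<ominus>.V c' \<odot>.V w) = (c' \<ominus>.K c) \<odot>.V w"
   using that wc xc
   by (simp add: a_minus_def smult_l_distr smult_l_minus M.minus_add M.a_ac M.r_neg M.r_neg1 M.r_neg2)
  then have "(c' \<ominus>.K c) \<odot>.V w : H0" using that lin_closedD(6)[OF c] by metis
  then have "inv\<^bsub>K\<^esub> (c' \<ominus>.K c) \<odot>.V ((c' \<ominus>.K c) \<odot>.V w) : H0"
   using lin_closedD(4)[OF c] nz field_Units by simp
  then show False using smult_cancel(1)[OF nz(2,1) wc] H0 by simp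
 qed
 show ?thesis using H0 ex uniq by (intro exI[of _ H0]) blast
qed

text \<open>Splitting off the line of a nonzero vector by \<open>complement_of_vector\<close>
  divides the cardinality by that of the field.\<close>

lemma lin_closed_card:
 assumes fin: "finite (Cr V)" "finite (Cr K)" and H: "lin_closed H"
 shows "\<exists>d. card H = card (Cr K) ^ d"
 using H
proof (induction "card H" arbitrary: H rule: less_induct)
 case less
 show ?case
 proof (cases "H = {\<zero>.V}")
  case True
  then show ?thesis by (intro exI[of _ 0]) simp
 next
  case False
  then obtain w where w: "w : H" "w ~= \<zero>.V" using lin_closedD(2)[OF less(2)] by auto
  have wc: "w : Cr V" using lin_closedD(1)[OF less(2)] w by simp
  obtain H0 where H0: "lin_closed H0" "H0 <= H" "w \<notin> H0"
   "!!x. x : H ==> \<exists>!c. c : Cr K & x \<ominus>.V c \<odot>.V w : H0"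
   using complement_of_vector[OF fin(1) less(2) w] by metis
  have fH: "finite H" using finite_subset[of H] fin lin_closedD(1)[OF less(2)] by blast
  have *: "(h \<oplus>.V c \<odot>.V w) \<ominus>.V c \<odot>.V w = h" "(h \<ominus>.V c \<odot>.V w) \<oplus>.V c \<odot>.V w = h"
   if "h : Cr V" "c : Cr K" for h c
   using that wc by (simp_all add: a_minus_def M.a_assoc M.r_neg M.l_neg)
  have "bij_betw (\<lambda>(c, h). h \<oplus>.V c \<odot>.V w) (Cr K \<times> H0) H"
   unfolding bij_betw_def
  proof
   show "inj_on (\<lambda>(c, h). h \<oplus>.V c \<odot>.V w) (Cr K \<times> H0)"
   proof (rule inj_onI, clarify)
    fix c h c' h' assume a: "c : Cr K" "h : H0" "c' : Cr K" "h' : H0"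
     "h \<oplus>.V c \<odot>.V w = h' \<oplus>.V c' \<odot>.V w"
    have hc: "h : Cr V" "h' : Cr V" using a lin_closedD(1)[OF H0(1)] by auto
    have "h : H" using a H0(2) by auto
    then have "h \<oplus>.V c \<odot>.V w : H" using a(1) lin_closedD(3,4)[OF less(2)] w by simp
    moreover have "(h \<oplus>.V c \<odot>.V w) \<ominus>.V c \<odot>.V w : H0" using *(1) hc a(1-4) by simp
    moreover have "(h \<oplus>.V c \<odot>.V w) \<ominus>.V c' \<odot>.V w : H0" unfolding a(5) using *(1) hc a(1-4) by simp
    ultimately have "c = c'" using H0(4) a by blast
    then show "c = c' & h = h'" using *(1)[of h c] *(1)[of h' c'] a hc by metis
   qed
   show "(\<lambda>(c, h). h \<oplus>.V c \<odot>.V w) ` (Cr K \<times> H0) = H"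
   proof (intro equalityI subsetI)
    fix x assume "x : (\<lambda>(c, h). h \<oplus>.V c \<odot>.V w) ` (Cr K \<times> H0)"
    then obtain c h where "x = h \<oplus>.V c \<odot>.V w" "c : Cr K" "h : H" using H0(2) by auto
    then show "x : H" using lin_closedD(3,4)[OF less(2)] w by simp
   next
    fix x assume x: "x : H"
    then obtain c where c: "c : Cr K" "x \<ominus>.V c \<odot>.V w : H0" using H0(4)[OF x] by (elim ex1E conjE)
    moreover have "x = (x \<ominus>.V c \<odot>.V w) \<oplus>.V c \<odot>.V w"
     using *(2) lin_closedD(1)[OF less(2)] x c by simp
    ultimately show "x : (\<lambda>(c, h). h \<oplus>.V c \<odot>.V w) ` (Cr K \<times> H0)"
     by (intro image_eqI[where x = "(c, x \<ominus>.V c \<odot>.V w)"]) auto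
   qed
  qed
  then have "card H = card (Cr K) * card H0"
   using bij_betw_same_card card_cartesian_product by metis
  moreover have "card H0 < card H" using H0(2,3) w fH by (metis psubsetI psubset_card_mono)
  ultimately show ?thesis using less(1)[of H0] H0(1) by (metis power_Suc)
 qed
qed

text \<open>The functional is the coordinate along \<open>w\<close> relative to a complement of its
  line; additivity and homogeneity follow from the uniqueness of that coordinate.\<close>

lemma dual_separates:
 assumes fin: "finite (Cr V)" and w: "w : Cr V" "w ~= \<zero>.V"
 shows "\<exists>alf\<in>Cr (dual_space K V). alf w = \<one>.K"
proof -
 have full: "lin_closed (Cr V)" by (simp add: lin_closed_def)
 obtain H0 where H0: "lin_closed H0" "w \<notin> H0"
   "!!x. x : Cr V ==> \<exists>!c. c : Cr K & x \<ominus>.V c \<odot>.V w : H0"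
  using complement_of_vector[OF fin full w] by metis
 define alf where "alf = (\<lambda>x\<in>Cr V. THE c. c : Cr K & x \<ominus>.V c \<odot>.V w : H0)"
 have alf: "alf x : Cr K & x \<ominus>.V alf x \<odot>.V w : H0" if "x : Cr V" for x
  using theI'[OF H0(3)[OF that]] that by (simp add: alf_def)
 have eq: "alf x = c" if "x : Cr V" "c : Cr K" "x \<ominus>.V c \<odot>.V w : H0" for x c
  using H0(3)[OF that(1)] alf[OF that(1)] that by blast
 have "alf (x \<oplus>.V y) = alf x \<oplus>.K alf y" if "x : Cr V" "y : Cr V" for x y
 proof (rule eq)
  have "(x \<oplus>.V y) \<ominus>.V (alf x \<oplus>.K alf y) \<odot>.V w = (x \<ominus>.V alf x \<odot>.V w) \<oplus>.V (y \<ominus>.V alf y \<odot>.V w)"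
   using alf that w by (simp add: a_minus_def smult_l_distr M.minus_add M.a_ac)
  then show "(x \<oplus>.V y) \<ominus>.V (alf x \<oplus>.K alf y) \<odot>.V w : H0"
   using alf that lin_closedD(3)[OF H0(1)] by simp
 qed (use alf that in auto)
 moreover have "alf (c \<odot>.V x) = c **.K alf x" if "x : Cr V" "c : Cr K" for x c
 proof (rule eq)
  have "(c \<odot>.V x) \<ominus>.V (c **.K alf x) \<odot>.V w = c \<odot>.V (x \<ominus>.V alf x \<odot>.V w)"
   using alf that w by (simp add: a_minus_def smult_r_distr smult_assoc1 smult_r_minus)
  then show "(c \<odot>.V x) \<ominus>.V (c **.K alf x) \<odot>.V w : H0"
   using alf that lin_closedD(4)[OF H0(1)] by simp
 qed (use alf that in auto)
 moreover have "alf w = \<one>.K"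
  by (rule eq) (use w lin_closedD(2)[OF H0(1)] in \<open>auto simp: a_minus_def M.r_neg\<close>)
 moreover have "alf : Cr V \<rightarrow>\<^sub>E Cr K" using alf by (auto simp: alf_def)
 ultimately show ?thesis by (intro bexI[of _ alf]) (auto simp: dual_space_def)
qed

end

section \<open>The extraspecial group of a form\<close>

context finite_field_char
begin

text \<open>The representative in \<open>0..<p\<close>, to be used as the exponent of a root of
  unity.\<close>

definition idx :: "'k => nat" where "idx = inv_into {..<p} (\<lambda>k::nat. [k] \<cdot>.R \<one>)"

lemma idx: assumes "z : prime_field R" shows "[idx z] \<cdot>.R \<one> = z" "idx z < p"
proof -
 have "z : (\<lambda>k::nat. [k] \<cdot>.R \<one>) ` {..<p}"
  using assms bij_betw_imp_surj_on[OF prime_field_bij] by simp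
 then show "[idx z] \<cdot>.R \<one> = z" "idx z < p"
  unfolding idx_def using f_inv_into_f[of z "\<lambda>k::nat. [k] \<cdot>.R \<one>" "{..<p}"]
   inv_into_into[of z "\<lambda>k::nat. [k] \<cdot>.R \<one>" "{..<p}"] by auto
qed

lemma idx_zero [simp]: "idx \<zero> = 0"
 using idx[of \<zero>] add_pow_one_eq_0_iff[of "idx \<zero>"] by (auto dest: dvd_imp_le)

lemma idx_add:
 assumes "z : prime_field R" "w : prime_field R"
 shows "idx (z \<oplus> w) mod p = (idx z + idx w) mod p"
proof -
 have "[idx (z \<oplus> w)] \<cdot>.R \<one> = [(idx z + idx w)] \<cdot>.R \<one>"
  using assms by (simp add: idx add.nat_pow_mult[symmetric])
 then show ?thesis using add_pow_one_eq_iff by blast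
qed

lemma idx_eq_0_iff: "z : prime_field R ==> idx z = 0 <-> z = \<zero>"
 using idx[of z] by auto

end

text \<open>The form is bilinear over the prime field only, as \<open>trace_form\<close> is, while
  \<open>V\<close> keeps its scalars from \<open>K\<close>. The condition \<open>nondeg\<close> is
  symmetric in the two arguments of \<open>h\<close>, so it speaks of both radicals of the
  difference of \<open>h\<close> and its transpose.\<close>

locale heis = F?: finite_field_char K p + module K V
 for K :: "('k, 'm) ring_scheme" (structure) and V :: "('k, 'v, 'n) module_scheme" and p :: nat +
 fixes h :: "'v => 'v => 'k"
 assumes fin_V: "finite (Cr V)"
  and h_closed: "x : Cr V ==> y : Cr V ==> h x y : prime_field K"
  and h_add_l: "x : Cr V ==> x' : Cr V ==> y : Cr V ==> h (x \<oplus>.V x') y = h x y \<oplus> h x' y"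
  and h_add_r: "x : Cr V ==> y : Cr V ==> y' : Cr V ==> h x (y \<oplus>.V y') = h x y \<oplus> h x y'"
  and h_smult_l: "a : prime_field K ==> x : Cr V ==> y : Cr V ==> h (a \<odot>.V x) y = a ** h x y"
  and h_smult_r: "a : prime_field K ==> x : Cr V ==> y : Cr V ==> h x (a \<odot>.V y) = a ** h x y"
  and nondeg: "x : Cr V ==> x ~= \<zero>.V ==> \<exists>y\<in>Cr V. h x y ~= h y x"
begin

sublocale VS: vectorspace K V
 by unfold_locales

lemma h_carrier [simp]: "x : Cr V ==> y : Cr V ==> h x y : Cr K"
 using h_closed by simp

lemma h_zero [simp]: "y : Cr V ==> h \<zero>.V y = \<zero>" "y : Cr V ==> h y \<zero>.V = \<zero>"
 using h_smult_l[of \<zero> "\<zero>.V" y] h_smult_r[of \<zero> y "\<zero>.V"] by simp_all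

lemma h_neg_l [simp]: "x : Cr V ==> y : Cr V ==> h (\<ominus>.V x) y = \<ominus> h x y"
 using h_add_l[of "\<ominus>.V x" x y] F.minus_equality[of "h (\<ominus>.V x) y" "h x y"] by (simp add: M.l_neg)

lemma h_neg_r [simp]: "x : Cr V ==> y : Cr V ==> h x (\<ominus>.V y) = \<ominus> h x y"
 using h_add_r[of x "\<ominus>.V y" y] F.minus_equality[of "h x (\<ominus>.V y)" "h x y"] by (simp add: M.l_neg)

lemma h_diff_l: "x : Cr V ==> x' : Cr V ==> y : Cr V ==> h (x \<ominus>.V x') y = h x y \<ominus> h x' y"
 by (simp add: a_minus_def h_add_l)

lemma h_diff_r: "x : Cr V ==> x' : Cr V ==> y : Cr V ==> h y (x \<ominus>.V x') = h y x \<ominus> h y x'"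
 by (simp add: a_minus_def h_add_r)

text \<open>The commutator pairing of \<open>E\<close>: the central factor by which two elements
  fail to commute (\<open>E_swap\<close>).\<close>

definition beta where "beta x y = h x y \<ominus> h y x"

lemma beta_closed [simp]: "x : Cr V ==> y : Cr V ==> beta x y : prime_field K"
 by (simp add: beta_def a_minus_def h_closed)

lemma beta_carrier [simp]: "x : Cr V ==> y : Cr V ==> beta x y : Cr K"
 using beta_closed by simp

lemma beta_add_r: "x : Cr V ==> y : Cr V ==> y' : Cr V ==> beta x (y \<oplus>.V y') = beta x y \<oplus> beta x y'"
 by (simp add: beta_def a_minus_def h_add_l h_add_r F.minus_add F.a_ac)

lemma beta_add_l: "x : Cr V ==> y : Cr V ==> y' : Cr V ==> beta (y \<oplus>.V y') x = beta y x \<oplus> beta y' x"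
 by (simp add: beta_def a_minus_def h_add_l h_add_r F.minus_add F.a_ac)

lemma beta_smult_l: "a : prime_field K ==> x : Cr V ==> y : Cr V ==> beta (a \<odot>.V x) y = a ** beta x y"
 by (simp add: beta_def a_minus_def h_smult_l h_smult_r r_distr r_minus)

lemma beta_smult_r: "a : prime_field K ==> x : Cr V ==> y : Cr V ==> beta x (a \<odot>.V y) = a ** beta x y"
 by (simp add: beta_def a_minus_def h_smult_l h_smult_r r_distr r_minus)

lemma beta_self [simp]: "x : Cr V ==> beta x x = \<zero>"
 by (simp add: beta_def)

lemma beta_swap: "x : Cr V ==> y : Cr V ==> beta y x = \<ominus> beta x y"
 by (simp add: beta_def a_minus_def F.minus_add F.minus_minus F.a_comm)

lemma beta_zero [simp]: "x : Cr V ==> beta \<zero>.V x = \<zero>" "x : Cr V ==> beta x \<zero>.V = \<zero>"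
 by (simp_all add: beta_def)

lemma beta_nondeg: "x : Cr V ==> x ~= \<zero>.V ==> \<exists>y\<in>Cr V. beta x y ~= \<zero>"
 using nondeg[of x] unfolding beta_def by (metis h_carrier F.r_right_minus_eq)

lemma add_pow_p_V: "x : Cr V ==> [p] \<cdot>.V x = \<zero>.V"
proof -
 assume x: "x : Cr V"
 have "[(k::nat)] \<cdot>.V x = ([k] \<cdot>.K \<one>) \<odot>.V x" for k
  by (induction k) (use x in \<open>simp_all add: smult_l_distr\<close>)
 then show ?thesis using x by (simp add: char_p)
qed

section \<open>The group of the form and its centre\<close>

abbreviation E where "E == form_group K V h"

lemma E_carrier: "Cr E = Cr V \<times> prime_field K"
 by (simp add: form_group_def)

lemma E_mult: "(x, z) **.E (y, w) = (x \<oplus>.V y, z \<oplus> w \<oplus> h x y)"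
 by (simp add: form_group_def)

lemma E_one: "\<one>.E = (\<zero>.V, \<zero>)"
 by (simp add: form_group_def)

lemma E_finite: "finite (Cr E)"
 by (simp add: E_carrier fin_V)

lemma E_group: "group E"
proof (rule groupI)
 fix a b assume "a : Cr E" "b : Cr E"
 then show "a **.E b : Cr E"
  by (auto simp: E_carrier E_mult h_closed)
next
 show "\<one>.E : Cr E" by (simp add: E_one E_carrier)
next
 fix a b c assume "a : Cr E" "b : Cr E" "c : Cr E"
 then show "a **.E b **.E c = a **.E (b **.E c)"
  by (auto simp: E_carrier E_mult h_add_l h_add_r M.a_assoc F.a_ac)
next
 fix a assume "a : Cr E"
 then show "\<one>.E **.E a = a" by (auto simp: E_carrier E_mult E_one)
next
 fix a assume "a : Cr E"
 then obtain x z where a: "a = (x, z)" "x : Cr V" "z : prime_field K" by (auto simp: E_carrier)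
 have "(\<ominus>.V x, \<ominus> z \<oplus> h x x) **.E a = \<one>.E"
  using a by (simp add: E_mult E_one M.l_neg F.a_ac F.l_neg F.r_neg F.r_neg1 F.r_neg2)
 then show "\<exists>b\<in>Cr E. b **.E a = \<one>.E"
  using a by (intro bexI[of _ "(\<ominus>.V x, \<ominus> z \<oplus> h x x)"]) (auto simp: E_carrier h_closed)
qed

lemma E_inv:
 assumes "x : Cr V" "z : prime_field K"
 shows "inv\<^bsub>E\<^esub> (x, z) = (\<ominus>.V x, \<ominus> z \<oplus> h x x)"
proof -
 interpret E: group E by (rule E_group)
 have "(\<ominus>.V x, \<ominus> z \<oplus> h x x) **.E (x, z) = \<one>.E"
  using assms by (simp add: E_mult E_one M.l_neg F.a_ac F.l_neg F.r_neg F.r_neg1 F.r_neg2)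
 then show ?thesis using assms
  by (intro E.inv_equality) (auto simp: E_carrier h_closed)
qed

lemma E_swap:
 assumes "x : Cr V" "z : prime_field K" "y : Cr V" "w : prime_field K"
 shows "(x, z) **.E (y, w) = (y, w) **.E (x, z) **.E (\<zero>.V, beta x y)"
 using assms by (simp add: E_mult beta_def a_minus_def M.a_comm F.a_ac F.r_neg F.r_neg1 F.r_neg2)

lemma E_conj:
 assumes "x : Cr V" "z : prime_field K" "y : Cr V" "w : prime_field K"
 shows "inv\<^bsub>E\<^esub> (y, w) **.E ((x, z) **.E (y, w)) = (x, z \<oplus> beta x y)"
proof -
 interpret E: group E by (rule E_group)
 have c: "(x, z) : Cr E" "(y, w) : Cr E" "(\<zero>.V, beta x y) : Cr E"
  using assms by (simp_all add: E_carrier)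
 then have "inv\<^bsub>E\<^esub> (y, w) **.E ((x, z) **.E (y, w)) = (x, z) **.E (\<zero>.V, beta x y)"
  unfolding E_swap[OF assms] by (simp add: E.m_assoc) (simp add: E.m_assoc[symmetric])
 then show ?thesis using assms by (simp add: E_mult)
qed

lemma E_center: "group_center E = {\<zero>.V} \<times> prime_field K"
proof (intro equalityI subsetI)
 fix e assume e: "e : group_center E"
 then obtain x z where xz: "e = (x, z)" "x : Cr V" "z : prime_field K"
  by (auto simp: group_center_def E_carrier)
 have "x = \<zero>.V"
 proof (rule ccontr)
  assume "x ~= \<zero>.V"
  then obtain y where y: "y : Cr V" "h x y ~= h y x" using nondeg xz by blast
  have "(x, z) **.E (y, \<zero>) = (y, \<zero>) **.E (x, z)"
   using e y xz by (auto simp: group_center_def E_carrier)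
  then show False using y xz by (simp add: E_mult)
 qed
 then show "e : {\<zero>.V} \<times> prime_field K" using xz by simp
next
 fix e assume "e : {\<zero>.V} \<times> prime_field K"
 then show "e : group_center E"
  by (auto simp: group_center_def E_carrier E_mult F.a_comm)
qed

text \<open>Translating the summation index by \<open>t\<close> multiplies the sum by
  \<open>f t\<close>, which is not one.\<close>

lemma sum_translate_character:
 fixes f :: "'v => complex"
 assumes S: "finite S" "S <= Cr V" "!!s t. s : S ==> t : S ==> s \<oplus>.V t : S"
  and f: "!!s t. s : S ==> t : S ==> f (s \<oplus>.V t) = f s * f t" and t: "t : S" "f t ~= 1"
 shows "sum f S = 0"
proof -
 have inj: "inj_on (\<lambda>s. s \<oplus>.V t) S"
  using S t by (auto simp: inj_on_def subset_iff)
 then have "(\<lambda>s. s \<oplus>.V t) ` S = S" using S t by (intro endo_inj_surj) auto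
 then have "sum f S = (\<Sum>s\<in>S. f (s \<oplus>.V t))" using sum.reindex[OF inj, of f] by simp
 also have "... = sum f S * f t" using f t by (simp add: sum_distrib_right)
 finally show ?thesis using t by simp
qed

text \<open>Double counting \<open>\<Sum>\<^sub>v \<Sum>\<^sub>l \<chi>(bta(v, l))\<close> for a maximal isotropic \<open>L\<close> gives \<open>|V| = |L|\<^sup>2\<close>.\<close>

lemma card_V_square: "\<exists>k. card (Cr V) = p ^ (2 * k)"
proof -
 define iso where "iso L <-> L <= Cr V & \<zero>.V : L & (\<forall>x\<in>L. \<forall>y\<in>L. x \<oplus>.V y : L & beta x y = \<zero>)" for L
 have "finite {L. iso L}" by (rule finite_subset[of _ "Pow (Cr V)"]) (auto simp: fin_V iso_def)
 moreover have "iso {\<zero>.V}" by (auto simp: iso_def)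
 ultimately obtain L where L: "iso L" and max: "!!L'. iso L' ==> L <= L' ==> L = L'"
  using finite_has_maximal[of "{L. iso L}"] by blast
 have Lc: "L <= Cr V" "\<zero>.V : L" "finite L" using L fin_V finite_subset by (auto simp: iso_def)
 have L_add: "x \<oplus>.V y : L" and L_iso: "beta x y = \<zero>" if "x : L" "y : L" for x y
  using L that by (auto simp: iso_def)
 \<comment> \<open>Adjoining a vector orthogonal to \<open>L\<close> keeps the set isotropic, so a
   maximal \<open>L\<close> contains everything orthogonal to it.\<close>
 have self: "v : L" if v: "v : Cr V" "!!l. l : L ==> beta v l = \<zero>" for v
 proof -
  let ?L = "{l \<oplus>.V a \<odot>.V v |l a. l : L & a : prime_field K}"
  have b2: "beta l v = \<zero>" if "l : L" for l using v that Lc beta_swap[of v l] by auto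
  have "iso ?L"
   unfolding iso_def
  proof (intro conjI ballI)
   show "?L <= Cr V" using Lc v by auto
   show "\<zero>.V : ?L" using Lc v by (intro CollectI exI[of _ "\<zero>.V"] exI[of _ \<zero>]) simp
   fix x y assume "x : ?L" "y : ?L"
   then obtain l a l' a' where *: "x = l \<oplus>.V a \<odot>.V v" "y = l' \<oplus>.V a' \<odot>.V v" "l : L" "l' : L"
    "a : prime_field K" "a' : prime_field K" by blast
   have c: "l : Cr V" "l' : Cr V" using * Lc by auto
   have "x \<oplus>.V y = (l \<oplus>.V l') \<oplus>.V (a \<oplus> a') \<odot>.V v"
    using * c v by (simp add: smult_l_distr M.a_ac)
   then show "x \<oplus>.V y : ?L" using *(3-6) L_add unfolding mem_Collect_eq
    by (intro exI[of _ "l \<oplus>.V l'"] exI[of _ "a \<oplus> a'"] conjI) auto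
   show "beta x y = \<zero>"
    using * c v b2 L_iso by (simp add: beta_add_l beta_add_r beta_smult_l beta_smult_r)
  qed
  moreover have "L <= ?L"
  proof
   fix l assume l: "l : L"
   then have "l = l \<oplus>.V \<zero> \<odot>.V v" using v Lc by auto
   then show "l : ?L" using l prime_field_closed(2) by blast
  qed
  moreover have "v : ?L"
  proof -
   have "v = \<zero>.V \<oplus>.V \<one> \<odot>.V v" using v by simp
   then show ?thesis using Lc prime_field_closed(3) by blast
  qed
  ultimately show ?thesis using max by blast
 qed
 \<comment> \<open>A complex root of unity is taken so that the two evaluations of the double sum
   can be compared as natural numbers.\<close>
 define zta :: complex where "zta = cis (2 * pi / real p)"
 have zpow: "zta ^ k = 1 <-> p dvd k" for k
 proof -
  have "zta ^ k = cis (2 * pi * real k / real p)" by (simp add: zta_def DeMoivre mult.commute mult.left_commute)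
  also have "... = 1 <-> (\<exists>j::int. 2 * pi * real k / real p = 2 * pi * of_int j)"
  proof -
   have "cis t = 1 <-> cos t = 1" for t using cos_one_sin_zero[of t] by (auto simp: complex_eq_iff)
   then show ?thesis by (auto simp: cos_one_2pi_int mult_ac)
  qed
  also have "... <-> (\<exists>j::int. int k = int p * j)"
  proof -
   have "2 * pi * real k / real p = 2 * pi * of_int j <-> int k = int p * j" for j
   proof -
    have "2 * pi * real k / real p = 2 * pi * of_int j <-> real k = real p * of_int j"
     using p_gt_0 by (auto simp: field_simps)
    also have "... <-> real_of_int (int k) = real_of_int (int p * j)" by simp
    finally show ?thesis by (simp only: of_int_eq_iff)
   qed
   then show ?thesis by simp
  qed
  also have "... <-> int p dvd int k" by (auto simp: dvd_def)
  also have "... <-> p dvd k" by simp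
  finally show ?thesis .
 qed
 have zmod: "zta ^ m = zta ^ n" if "m mod p = n mod p" for m n
 proof -
  have "zta ^ m = zta ^ (m mod p)" for m
   using zpow[of p] by (metis dvd_refl div_mult_mod_eq mult.commute mult_1 power_add power_mult power_one)
  then show ?thesis using that by metis
 qed
 define \<chi> where "\<chi> z = zta ^ idx z" for z
 have \<chi>_add: "\<chi> (z \<oplus> w) = \<chi> z * \<chi> w" if "z : prime_field K" "w : prime_field K" for z w
  using zmod[OF idx_add[OF that]] by (simp add: \<chi>_def power_add)
 have \<chi>_1: "\<chi> z = 1 <-> z = \<zero>" if "z : prime_field K" for z
  unfolding \<chi>_def zpow using idx(2)[OF that] idx_eq_0_iff[OF that] by (auto dest: dvd_imp_le)
 have inner: "(\<Sum>l\<in>L. \<chi> (beta v l)) = (if v : L then of_nat (card L) else 0)" if v: "v : Cr V" for v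
 proof (cases "v : L")
  case True
  then show ?thesis using L_iso \<chi>_1[of \<zero>] by simp
 next
  case False
  then obtain l where l: "l : L" "beta v l ~= \<zero>" using self[OF v] by blast
  have "(\<Sum>l\<in>L. \<chi> (beta v l)) = 0"
  proof (rule sum_translate_character[OF Lc(3,1) L_add])
   show "\<chi> (beta v (s \<oplus>.V t)) = \<chi> (beta v s) * \<chi> (beta v t)" if "s : L" "t : L" for s t
    using that Lc v by (subst \<chi>_add[symmetric]) (auto simp: beta_add_r subset_iff)
   show "\<chi> (beta v l) ~= 1" using l \<chi>_1[of "beta v l"] Lc v by auto
  qed (use l in auto)
  then show ?thesis using False by simp
 qed
 have outer: "(\<Sum>v\<in>Cr V. \<chi> (beta v l)) = (if l = \<zero>.V then of_nat (card (Cr V)) else 0)"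
  if l: "l : L" for l
 proof (cases "l = \<zero>.V")
  case True
  then show ?thesis using \<chi>_1[of \<zero>] by simp
 next
  case False
  have lc: "l : Cr V" using l Lc by auto
  then obtain v where v: "v : Cr V" "beta v l ~= \<zero>"
   using beta_nondeg[of l] False beta_swap[of _ l] by (metis beta_swap add.inv_eq_1_iff beta_carrier)
  have "(\<Sum>v\<in>Cr V. \<chi> (beta v l)) = 0"
  proof (rule sum_translate_character[OF fin_V])
   show "\<chi> (beta (s \<oplus>.V t) l) = \<chi> (beta s l) * \<chi> (beta t l)" if "s : Cr V" "t : Cr V" for s t
    using that lc by (subst \<chi>_add[symmetric]) (auto simp: beta_add_l)
   show "\<chi> (beta v l) ~= 1" using v \<chi>_1[of "beta v l"] lc by auto
  qed (use v in auto)
  then show ?thesis using False by simp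
 qed
 have "(\<Sum>v\<in>Cr V. \<Sum>l\<in>L. \<chi> (beta v l)) = (\<Sum>v\<in>Cr V. if v : L then of_nat (card L) else 0)"
  using inner by (intro sum.cong) auto
 also have "... = (\<Sum>v\<in>L. of_nat (card L))"
  using Lc fin_V by (intro sum.mono_neutral_cong_right) auto
 also have "... = of_nat (card L * card L)" by simp
 finally have 1: "(\<Sum>v\<in>Cr V. \<Sum>l\<in>L. \<chi> (beta v l)) = of_nat (card L * card L)" .
 have "(\<Sum>v\<in>Cr V. \<Sum>l\<in>L. \<chi> (beta v l)) = (\<Sum>l\<in>L. \<Sum>v\<in>Cr V. \<chi> (beta v l))" by (rule sum.swap)
 also have "... = (\<Sum>l\<in>L. if l = \<zero>.V then of_nat (card (Cr V)) else 0)"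
  using outer by (intro sum.cong) auto
 also have "... = of_nat (card (Cr V))" using Lc by (simp add: sum.delta)
 finally have "(of_nat (card (Cr V)) :: complex) = of_nat (card L * card L)" using 1 by simp
 then have sq: "card (Cr V) = card L * card L" using of_nat_eq_iff by blast
 obtain d where "card (Cr V) = card (Cr K) ^ d"
  using VS.lin_closed_card[OF fin_V finite_R, of "Cr V"] by (auto simp: VS.lin_closed_def)
 then have pw: "card (Cr V) = p ^ (deg_prime * d)" by (simp add: card_carrier_eq power_mult)
 then have "card L dvd p ^ (deg_prime * d)" using sq by (metis dvd_triv_left)
 then obtain k where "card L = p ^ k" using divides_primepow_nat[OF prime_p] by blast
 then show ?thesis using sq by (intro exI[of _ k]) (simp add: power_add mult_2)
qed

lemma E_order: "\<exists>n. order E = p ^ (2 * n + 1)"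
proof -
 obtain k where "card (Cr V) = p ^ (2 * k)" using card_V_square by blast
 then have "order E = p ^ (2 * k + 1)"
  by (simp add: order_def E_carrier card_cartesian_product card_prime_field)
 then show ?thesis by blast
qed

lemma E_extraspecial:
 assumes V0: "Cr V ~= {\<zero>.V}"
 shows "extraspecial p E"
 unfolding extraspecial_def
proof (intro conjI)
 interpret E: group E by (rule E_group)
 show "group E" "finite (Cr E)" by (rule E_group, rule E_finite)
 show "\<exists>k. order E = p ^ k" using E_order by blast
 show "card (group_center E) = p" by (simp add: E_center card_cartesian_product card_prime_field)
 have comm: "a **.E b **.E inv\<^bsub>E\<^esub> a **.E inv\<^bsub>E\<^esub> b = (\<zero>.V, beta (fst a) (fst b))"
  if ab: "a : Cr E" "b : Cr E" for a b
 proof -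
  obtain x z y w where s: "a = (x, z)" "b = (y, w)" "x : Cr V" "z : prime_field K"
   "y : Cr V" "w : prime_field K" using ab by (auto simp: E_carrier)
  define c where "c = (\<zero>.V, beta x y)"
  have c: "c : Cr E" using s by (simp add: c_def E_carrier)
  have cc: "c **.E g = g **.E c" if "g : Cr E" for g
   using that s by (auto simp: c_def E_carrier E_mult F.a_comm)
  have "a **.E b = b **.E a **.E c" using E_swap[of x z y w] s by (simp add: c_def)
  also have "... = c **.E (b **.E a)" using cc ab by simp
  finally have "a **.E b **.E inv\<^bsub>E\<^esub> a **.E inv\<^bsub>E\<^esub> b = c"
   using ab c by (simp add: E.m_assoc)
  then show ?thesis using s by (simp add: c_def)
 qed
 show "derived E (Cr E) = group_center E"
 proof (intro equalityI subsetI)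
  fix g assume "g : derived E (Cr E)"
  then show "g : group_center E"
   unfolding derived_def
  proof (induction rule: generate.induct)
   case one
   then show ?case by (simp add: E_center E_one)
  next
   case (incl g)
   then show ?case using comm by (auto simp: E_center E_carrier)
  next
   case (inv g)
   then have "g : group_center E" using comm by (auto simp: E_center E_carrier)
   then show ?case by (auto simp: E_center E_inv)
  next
   case (eng g1 g2)
   then show ?case by (auto simp: E_center E_mult)
  qed
 next
  fix g assume "g : group_center E"
  then obtain z where z: "g = (\<zero>.V, z)" "z : prime_field K" by (auto simp: E_center)
  obtain x where x: "x : Cr V" "x ~= \<zero>.V" using V0 by auto
  obtain y where y: "y : Cr V" "beta x y ~= \<zero>" using beta_nondeg[OF x] by blast
  \<comment> \<open>Rescaling \<open>x\<close> by this factor makes its commutator with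
    \<open>y\<close> the prescribed central element.\<close>
  let ?a = "z ** inv (beta x y)"
  have a: "?a : prime_field K" using z x y by simp
  have "beta (?a \<odot>.V x) y = z"
   using a x y z by (simp add: beta_smult_l m_assoc field_Units)
  then have "g = (?a \<odot>.V x, \<zero>) **.E (y, \<zero>) **.E inv\<^bsub>E\<^esub> (?a \<odot>.V x, \<zero>) **.E inv\<^bsub>E\<^esub> (y, \<zero>)"
   using comm[of "(?a \<odot>.V x, \<zero>)" "(y, \<zero>)"] a x y z by (simp add: E_carrier)
  moreover have "(?a \<odot>.V x, \<zero>) : Cr E" "(y, \<zero>) : Cr E" using a x y by (auto simp: E_carrier)
  ultimately show "g : derived E (Cr E)"
   unfolding derived_def by (blast intro: generate.incl)
 qed
 show "\<forall>g\<in>Cr E. g [^].E p : group_center E"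
 proof
  fix g assume g: "g : Cr E"
  then obtain x z where xz: "g = (x, z)" "x : Cr V" "z : prime_field K" by (auto simp: E_carrier)
  have "fst (g [^].E k) = [(k::nat)] \<cdot>.V x" for k
  proof (induction k)
   case (Suc k)
   have "g [^].E k : Cr E" using g by simp
   then show ?case using Suc xz by (cases "g [^].E k") (auto simp: E_mult add_pow_def)
  qed (simp add: E_one add_pow_def)
  then have "fst (g [^].E p) = \<zero>.V" using add_pow_p_V xz by simp
  moreover have "g [^].E p : Cr E" using g by simp
  ultimately show "g [^].E p : group_center E" by (auto simp: E_center E_carrier)
 qed
qed

section \<open>The isometry group\<close>

abbreviation G where "G == isometry_group K V h"

lemma G_iff: "g : Cr G <-> g : module_hom K V V & g : extensional (Cr V) &
  bij_betw g (Cr V) (Cr V) & (\<forall>x\<in>Cr V. \<forall>y\<in>Cr V. h (g x) (g y) = h x y)"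
 by (auto simp: isometry_group_def GL_def)

lemma G_D:
 assumes "g : Cr G"
 shows "x : Cr V ==> g x : Cr V"
  "x : Cr V ==> y : Cr V ==> g (x \<oplus>.V y) = g x \<oplus>.V g y"
  "a : Cr K ==> x : Cr V ==> g (a \<odot>.V x) = a \<odot>.V g x"
  "x : Cr V ==> y : Cr V ==> h (g x) (g y) = h x y"
  "bij_betw g (Cr V) (Cr V)" "g : extensional (Cr V)"
  "inj_on g (Cr V)" "g ` Cr V = Cr V"
 using assms unfolding G_iff by (auto simp: module_hom_def bij_betw_def)

lemma G_zero: "g : Cr G ==> g \<zero>.V = \<zero>.V"
 using G_D(3)[of g \<zero> "\<zero>.V"] G_D(1)[of g "\<zero>.V"] by simp

lemma G_neg: "g : Cr G ==> x : Cr V ==> g (\<ominus>.V x) = \<ominus>.V g x"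
 using G_D(2)[of g "\<ominus>.V x" x] G_D(1)[of g] G_zero[of g] M.minus_equality[of "g (\<ominus>.V x)" "g x"]
 by (simp add: M.l_neg)

lemma G_mult: "g **.G g' = compose (Cr V) g' g" and G_one: "\<one>.G = (\<lambda>x\<in>Cr V. x)"
 by (simp_all add: isometry_group_def GL_def)

lemma G_mult_closed: "g : Cr G ==> g' : Cr G ==> g **.G g' : Cr G"
proof (subst G_iff, intro conjI)
 assume g: "g : Cr G" "g' : Cr G"
 show "bij_betw (g **.G g') (Cr V) (Cr V)"
  unfolding G_mult by (rule bij_betw_compose[OF G_D(5)[OF g(1)] G_D(5)[OF g(2)]])
qed (auto simp: G_mult module_hom_def compose_eq G_D)

lemma G_mult_apply: "x : Cr V ==> (g **.G g') x = g' (g x)"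
 by (simp add: G_mult compose_eq)

lemma G_one_closed: "\<one>.G : Cr G"
 unfolding G_one by (subst G_iff) (auto simp: module_hom_def bij_betw_def inj_on_def)

text \<open>The inverse isometry; the restriction makes it extensional, so that it lies in the
  carrier of \<open>G\<close> again.\<close>

definition ginv where "ginv g = (\<lambda>x\<in>Cr V. inv_into (Cr V) g x)"

lemma ginv_apply:
 assumes "g : Cr G" "x : Cr V"
 shows "g (ginv g x) = x" "ginv g (g x) = x" "ginv g x : Cr V"
 using assms G_D[OF assms(1)]
 by (auto simp: ginv_def f_inv_into_f inv_into_f_f inv_into_into bij_betw_inv_into_right)

lemma ginv_closed: assumes g: "g : Cr G" shows "ginv g : Cr G"
proof (subst G_iff, intro conjI ballI)
 have inj: "x = y" if "x : Cr V" "y : Cr V" "g x = g y" for x y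
  using G_D(7)[OF g] that by (auto dest: inj_onD)
 have "ginv g (x \<oplus>.V y) = ginv g x \<oplus>.V ginv g y" if "x : Cr V" "y : Cr V" for x y
  by (rule inj) (use that g in \<open>simp_all add: ginv_apply G_D\<close>)
 moreover have "ginv g (a \<odot>.V x) = a \<odot>.V ginv g x" if "x : Cr V" "a : Cr K" for x a
  by (rule inj) (use that g in \<open>simp_all add: ginv_apply G_D\<close>)
 ultimately show "ginv g : module_hom K V V" using ginv_apply[OF g] by (auto simp: module_hom_def)
 show "ginv g : extensional (Cr V)" by (simp add: ginv_def)
 show "bij_betw (ginv g) (Cr V) (Cr V)"
  by (rule bij_betw_byWitness[of _ g]) (use ginv_apply[OF g] G_D(1)[OF g] in auto)
 fix x y assume "x : Cr V" "y : Cr V"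
 then show "h (ginv g x) (ginv g y) = h x y"
  using G_D(4)[OF g, of "ginv g x" "ginv g y"] ginv_apply[OF g] by simp
qed

lemma ginv_ginv: assumes g: "g : Cr G" shows "ginv (ginv g) = g"
proof (rule extensionalityI[of _ "Cr V"])
 fix x assume x: "x : Cr V"
 then show "ginv (ginv g) x = g x"
  using ginv_apply[OF ginv_closed[OF g], of "g x"] ginv_apply[OF g] G_D(1)[OF g]
  by (metis ginv_apply(2) ginv_closed)
qed (use G_D[OF g] in \<open>auto simp: ginv_def\<close>)

end

section \<open>The averaging operators\<close>

lemma (in abelian_monoid) finsum_Times:
 assumes "finite A" "finite B" "!!x y. x : A ==> y : B ==> f (x, y) : Cr G"
 shows "(\<Oplus>x\<in>A. \<Oplus>y\<in>B. f (x, y)) = finsum G f (A \<times> B)"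
 using assms(1,3)
proof (induction A rule: finite_induct)
 case (insert a A)
 have "finsum G f (insert a A \<times> B) = finsum G f (Pair a ` B \<union> A \<times> B)"
  by (rule arg_cong[where f = "finsum G f"]) auto
 also have "... = finsum G f (Pair a ` B) \<oplus> finsum G f (A \<times> B)"
  using insert assms(2) by (intro finsum_Un_disjoint) auto
 also have "finsum G f (Pair a ` B) = (\<Oplus>y\<in>B. f (a, y))"
  using insert assms(2) by (subst finsum_reindex) (auto simp: inj_on_def)
 finally show ?case using insert assms(2) by (auto simp: Pi_def intro!: finsum_insert[symmetric])
qed simp

lemma (in abelian_monoid) finsum_swap:
 assumes "finite A" "finite B" "!!x y. x : A ==> y : B ==> f x y : Cr G"
 shows "(\<Oplus>x\<in>A. \<Oplus>y\<in>B. f x y) = (\<Oplus>y\<in>B. \<Oplus>x\<in>A. f x y)"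
 using assms(1,3)
proof (induction A rule: finite_induct)
 case (insert a A)
 have "(\<Oplus>x\<in>insert a A. \<Oplus>y\<in>B. f x y) = (\<Oplus>y\<in>B. f a y) \<oplus> (\<Oplus>y\<in>B. \<Oplus>x\<in>A. f x y)"
  using insert by (subst finsum_insert) auto
 also have "... = (\<Oplus>y\<in>B. f a y \<oplus> (\<Oplus>x\<in>A. f x y))"
  using insert by (subst finsum_addf) auto
 also have "... = (\<Oplus>y\<in>B. \<Oplus>x\<in>insert a A. f x y)"
  using insert by (intro finsum_cong') (auto simp: Pi_def)
 finally show ?case .
qed simp

lemma (in ring) finsum_mult_finsum:
 assumes "finite A" "finite B" "f : A \<rightarrow> Cr R" "g : B \<rightarrow> Cr R"
 shows "(\<Oplus>x\<in>A. f x) ** (\<Oplus>y\<in>B. g y) = finsum R (\<lambda>(x, y). f x ** g y) (A \<times> B)"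
proof -
 have "(\<Oplus>x\<in>A. f x) ** (\<Oplus>y\<in>B. g y) = (\<Oplus>x\<in>A. \<Oplus>y\<in>B. f x ** g y)"
  using assms by (subst finsum_ldistr) (auto simp: finsum_rdistr Pi_iff intro!: finsum_cong' finsum_closed)
 also have "... = (\<Oplus>x\<in>A. \<Oplus>y\<in>B. (\<lambda>(x, y). f x ** g y) (x, y))" by simp
 also have "... = finsum R (\<lambda>(x, y). f x ** g y) (A \<times> B)"
  using assms by (intro finsum_Times) (auto simp: Pi_iff)
 finally show ?thesis .
qed

lemma (in abelian_monoid) finsum_const_filter:
 assumes "finite A" "a : Cr G"
 shows "(\<Oplus>x\<in>A. if P x then a else \<zero>) = [card {x : A. P x}] \<cdot>.G a"
proof -
 have "(\<Oplus>x\<in>A. if P x then a else \<zero>) = (\<Oplus>x\<in>{x : A. P x}. a)"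
  using assms by (intro add.finprod_mono_neutral_cong_right) auto
 also have "... = [card {x : A. P x}] \<cdot>.G a"
  using assms by (subst add.finprod_const) (auto simp: add_pow_def)
 finally show ?thesis .
qed

lemma (in abelian_group) add_diff_cancel:
 assumes "x : Cr G" "y : Cr G" "k : Cr G"
 shows "(x \<oplus> k) \<ominus> (y \<oplus> k) = x \<ominus> y"
proof -
 have "\<ominus> (y \<oplus> k) = \<ominus> k \<oplus> \<ominus> y" using assms by (simp add: minus_add a_comm)
 then show ?thesis using assms by (simp add: a_minus_def a_assoc r_neg2)
qed

lemma (in abelian_group) diff_eq_zero:
 assumes "x : Cr G" "y : Cr G" "x \<ominus> y = \<zero>"
 shows "x = y"
proof -
 have "x = (x \<ominus> y) \<oplus> y" using assms(1,2) by (simp add: a_minus_def a_assoc l_neg)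
 then show ?thesis using assms by simp
qed

context heis
begin

definition u where "u g x = inv\<^bsub>E\<^esub> (x, \<zero>) **.E (g x, \<zero>)"

lemma u_eq: "g : Cr G ==> x : Cr V ==> u g x = (g x \<ominus>.V x, \<ominus> h x (g x \<ominus>.V x))"
 unfolding u_def
 by (simp add: E_inv E_mult G_D a_minus_def h_add_r F.minus_add M.a_comm F.a_comm F.minus_minus)

lemma u_closed: "g : Cr G ==> x : Cr V ==> u g x : Cr E"
 by (simp add: u_eq E_carrier G_D h_closed)

definition Fix where "Fix g = {x : Cr V. g x = x}"

lemma Fix_lin_closed: "g : Cr G ==> VS.lin_closed (Fix g)"
 by (auto simp: VS.lin_closed_def Fix_def G_D G_zero)

lemma Fix_finite [simp]: "finite (Fix g)"
 using fin_V by (simp add: Fix_def)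

lemma card_Fix: "g : Cr G ==> \<exists>d. card (Fix g) = card (Cr K) ^ d"
 using VS.lin_closed_card[OF fin_V finite_R Fix_lin_closed] .

lemma Fix_ginv: assumes g: "g : Cr G" shows "Fix (ginv g) = Fix g"
 using ginv_apply[OF g] by (auto simp: Fix_def) (metis, metis)

text \<open>The pairs for which \<open>u g x\<close> times \<open>u g' y\<close> is central
  (\<open>u_mult_pairs\<close>). Only they contribute when the product of \<open>T g\<close> and
  \<open>T g'\<close> is averaged. They are closed under linear combinations over
  \<open>K\<close>.\<close>

definition pairs where
 "pairs g g' = {(x, y). x : Cr V & y : Cr V & (g x \<ominus>.V x) \<oplus>.V (g' y \<ominus>.V y) = \<zero>.V}"

text \<open>The central coordinate of \<open>u g x\<close> times \<open>u g' y\<close> on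
  \<open>pairs g g'\<close>. It does not mention \<open>g'\<close>, because there
  \<open>g' y - y\<close> is minus \<open>g x - x\<close>.\<close>

definition q where "q g = (\<lambda>(x, y). h (y \<ominus>.V g x) (g x \<ominus>.V x))"

lemma pairs_finite [simp]: "finite (pairs g g')"
 by (rule finite_subset[of _ "Cr V \<times> Cr V"]) (auto simp: pairs_def fin_V)

lemma q_closed: "g : Cr G ==> xi : pairs g g' ==> q g xi : prime_field K"
 by (auto simp: q_def pairs_def h_closed G_D)

lemma u_mult_pairs:
 assumes g: "g : Cr G" "g' : Cr G" and xy: "(x, y) : pairs g g'"
 shows "u g x **.E u g' y = (\<zero>.V, q g (x, y))"
proof -
 define v where "v = g x \<ominus>.V x"
 define w where "w = g' y \<ominus>.V y"
 have c: "x : Cr V" "y : Cr V" "v : Cr V" "w : Cr V" "v \<oplus>.V w = \<zero>.V"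
  "g x : Cr V"
  using xy g by (auto simp: v_def w_def pairs_def G_D)
 then have w: "w = \<ominus>.V v" by (metis M.add.inv_equality M.add.m_comm)
 have gx: "g x = v \<oplus>.V x" using c by (simp add: v_def a_minus_def M.a_assoc M.l_neg)
 have vx: "v \<oplus>.V x \<ominus>.V x = v" using c by (simp add: a_minus_def M.a_assoc M.r_neg)
 have "u g x **.E u g' y = (v, \<ominus> h x v) **.E (w, \<ominus> h y w)"
  using u_eq g c by (simp add: v_def w_def)
 also have "... = (\<zero>.V, q g (x, y))"
  unfolding E_mult q_def v_def[symmetric] using c
  by (simp add: w gx vx h_diff_l h_add_l F.minus_minus M.r_neg) (simp add: a_minus_def F.minus_add F.a_ac)
 finally show ?thesis .
qed

end

text \<open>The values of \<open>rho\<close> lie in an arbitrary ring, so that one computation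
  serves both the given representation and the functions on \<open>V\<close>. In the absence of
  scalars, \<open>central_free\<close> says that left multiplication by a nontrivial central element
  minus one is injective, and \<open>torsion\<close> that \<open>p\<close> can be cancelled.\<close>

locale intertwiner = heis K V p h + A: ring A
 for K :: "('k, 'm) ring_scheme" (structure) and V :: "('k, 'v, 'n) module_scheme" and p :: nat and h
  and A :: "('a, 'c) ring_scheme" +
 fixes rho :: "'v \<times> 'k => 'a"
 assumes rho_closed [simp]: "e : Cr E ==> rho e : Cr A"
  and rho_mult: "e : Cr E ==> e' : Cr E ==> rho (e **.E e') = rho e **.A rho e'"
  and rho_one: "rho \<one>.E = \<one>.A"
  and central_free: "z : prime_field K ==> z ~= \<zero> ==> B : Cr A ==>
    rho (\<zero>.V, z) **.A B = B ==> B = \<zero>.A"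
  and torsion: "B : Cr A ==> [p] \<cdot>.A B = \<zero>.A ==> B = \<zero>.A"
begin

sublocale E: group E by (rule E_group)

abbreviation cen where "cen z == rho (\<zero>.V, z)"

lemma cen_E [simp]: "z : prime_field K ==> (\<zero>.V, z) : Cr E"
 by (simp add: E_carrier)

lemma cen_add: "z : prime_field K ==> w : prime_field K ==> cen (z \<oplus> w) = cen z **.A cen w"
 by (subst rho_mult[symmetric]) (auto simp: E_mult)

lemma cen_zero: "cen \<zero> = \<one>.A" using rho_one by (simp add: E_one)

lemma cen_comm: "z : prime_field K ==> e : Cr E ==> cen z **.A rho e = rho e **.A cen z"
 by (subst (1 2) rho_mult[symmetric]) (auto simp: E_mult E_carrier F.a_comm)

lemma rho_inv [simp]:
 assumes "e : Cr E"
 shows "rho (inv\<^bsub>E\<^esub> e) **.A rho e = \<one>.A" "rho e **.A rho (inv\<^bsub>E\<^esub> e) = \<one>.A"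
 using assms rho_one by (simp_all flip: rho_mult)

definition T where "T g = (\<Oplus>.A x\<in>Cr V. rho (u g x))"

lemma T_closed [simp]: "g : Cr G ==> T g : Cr A"
 unfolding T_def by (rule A.finsum_closed) (simp add: u_closed)

text \<open>Every \<open>p\<close>-power is cancellable in \<open>A\<close>.\<close>

lemma torsion_pow: "B : Cr A ==> [(p ^ k)] \<cdot>.A B = \<zero>.A ==> B = \<zero>.A"
proof (induction k)
 case (Suc k)
 then have "[p] \<cdot>.A ([(p ^ k)] \<cdot>.A B) = \<zero>.A" by (simp add: A.add.nat_pow_pow mult.commute)
 then show ?case using Suc torsion[of "[(p ^ k)] \<cdot>.A B"] by simp
qed simp

lemma pow_cancel:
 assumes "B : Cr A" "Y : Cr A" "[(p ^ k)] \<cdot>.A B = [(p ^ k)] \<cdot>.A Y"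
 shows "B = Y"
proof -
 have "[(p ^ k)] \<cdot>.A (B \<ominus>.A Y) = \<zero>.A"
  using assms by (simp add: a_minus_def A.add.nat_pow_distrib A.add.nat_pow_inv A.r_neg)
 then show ?thesis using torsion_pow[of "B \<ominus>.A Y"] assms by simp
qed

lemma card_V_pow: "\<exists>k. card (Cr V) = p ^ k"
 using card_V_square by blast

lemma card_Fix_pow: "g : Cr G ==> \<exists>k. card (Fix g) = p ^ k"
 using card_Fix[of g] by (metis card_carrier_eq power_mult)

lemma card_V_cancel:
 "B : Cr A ==> Y : Cr A ==> [card (Cr V)] \<cdot>.A B = [card (Cr V)] \<cdot>.A Y ==> B = Y"
 using card_V_pow pow_cancel by metis

lemma card_Fix_cancel:
 "g : Cr G ==> B : Cr A ==> Y : Cr A ==>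
  [card (Fix g)] \<cdot>.A B = [card (Fix g)] \<cdot>.A Y ==> B = Y"
 using card_Fix_pow pow_cancel by metis

lemma translate_bij: "y : Cr V ==> bij_betw (\<lambda>x. x \<oplus>.V y) (Cr V) (Cr V)"
 by (rule bij_betw_byWitness[of _ "\<lambda>x. x \<ominus>.V y"]) (auto simp: a_minus_def M.a_assoc M.r_neg M.l_neg)

lemma finsum_translate:
 assumes "y : Cr V" "f : Cr V \<rightarrow> Cr A"
 shows "(\<Oplus>.A x\<in>Cr V. f (x \<oplus>.V y)) = (\<Oplus>.A x\<in>Cr V. f x)"
 using A.add.finprod_reindex[of f "\<lambda>x. x \<oplus>.V y" "Cr V"] translate_bij[OF assms(1)] assms(2)
 by (simp add: bij_betw_def)

text \<open>Replace \<open>x\<close> by \<open>x + y\<close> in the sum: \<open>(y, z)\<close> times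
  \<open>u g (x + y)\<close> is \<open>u g x\<close> times \<open>(g y, z)\<close>, because
  \<open>u\<close> does not change when both of its factors receive the same central
  coordinate.\<close>

lemma T_intertwines:
 assumes g: "g : Cr G" and y: "y : Cr V" "z : prime_field K"
 shows "rho (y, z) **.A T g = T g **.A rho (g y, z)"
proof -
 have e: "(y, z) : Cr E" "(g y, z) : Cr E" using y g by (simp_all add: E_carrier G_D)
 have step: "rho (y, z) **.A rho (u g (x \<oplus>.V y)) = rho (u g x) **.A rho (g y, z)" if x: "x : Cr V" for x
 proof -
  have c: "(x, \<zero>) : Cr E" "(g x, \<zero>) : Cr E" using x g by (simp_all add: E_carrier G_D)
  \<comment> \<open>The central coordinate of \<open>(x, 0)\<close> times \<open>(y, z)\<close>; as
    \<open>g\<close> preserves \<open>h\<close>, the same one appears for the images under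
    \<open>g\<close>.\<close>
  define w where "w = z \<oplus> h x y"
  have w: "w : prime_field K" using x y by (simp add: w_def h_closed)
  have 1: "(x, \<zero>) **.E (y, z) = (x \<oplus>.V y, w)" "(g x, \<zero>) **.E (g y, z) = (g (x \<oplus>.V y), w)"
   using x y g by (simp_all add: E_mult w_def G_D)
  have 2: "u g (x \<oplus>.V y) = inv\<^bsub>E\<^esub> (x \<oplus>.V y, w) **.E (g (x \<oplus>.V y), w)"
   using x y w g
   by (simp add: u_eq E_inv E_mult G_D a_minus_def M.a_comm h_add_r F.a_ac F.minus_add F.minus_minus
     F.r_neg F.r_neg1 F.r_neg2 F.l_neg)
  have 3: "(x \<oplus>.V y, w) : Cr E" "(g (x \<oplus>.V y), w) : Cr E"
   using x y w g by (simp_all add: E_carrier G_D)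
  have "(y, z) **.E u g (x \<oplus>.V y) = inv\<^bsub>E\<^esub> (x, \<zero>) **.E ((x, \<zero>) **.E (y, z)) **.E u g (x \<oplus>.V y)"
   using c e by (simp add: E.m_assoc[symmetric])
  also have "... = inv\<^bsub>E\<^esub> (x, \<zero>) **.E (g (x \<oplus>.V y), w)"
   unfolding 1 2 using 3 c by (simp add: E.m_assoc) (simp add: E.m_assoc[symmetric])
  also have "... = u g x **.E (g y, z)"
   unfolding 1(2)[symmetric] u_def using c e by (simp add: E.m_assoc)
  finally have "(y, z) **.E u g (x \<oplus>.V y) = u g x **.E (g y, z)" .
  then show ?thesis
   using e u_closed[OF g] x y by (simp flip: rho_mult)
 qed
 have "rho (y, z) **.A T g = rho (y, z) **.A (\<Oplus>.A x\<in>Cr V. rho (u g (x \<oplus>.V y)))"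
  unfolding T_def using y g u_closed by (subst finsum_translate[of y "\<lambda>x. rho (u g x)"]) auto
 also have "... = (\<Oplus>.A x\<in>Cr V. rho (u g x) **.A rho (g y, z))"
  using e y g u_closed fin_V
  by (subst A.finsum_rdistr) (auto intro!: A.finsum_cong' simp: step)
 also have "... = T g **.A rho (g y, z)"
  unfolding T_def using e g u_closed fin_V by (subst A.finsum_ldistr) auto
 finally show ?thesis .
qed

text \<open>Conjugation summed over the representatives \<open>(y, 0)\<close> of \<open>E\<close>
  modulo its centre. It is left without the factor 1 / |V| since no division is available in
  \<open>A\<close>.\<close>

definition Rey where "Rey B = (\<Oplus>.A y\<in>Cr V. rho (inv\<^bsub>E\<^esub> (y, \<zero>)) **.A (B **.A rho (y, \<zero>)))"

lemma E0 [simp]: "y : Cr V ==> (y, \<zero>) : Cr E" by (simp add: E_carrier)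

lemma Rey_closed [simp]: "B : Cr A ==> Rey B : Cr A"
 unfolding Rey_def by (intro A.finsum_closed) auto

lemma Rey_finsum:
 assumes "finite I" "f : I \<rightarrow> Cr A"
 shows "Rey (\<Oplus>.A i\<in>I. f i) = (\<Oplus>.A i\<in>I. Rey (f i))"
proof -
 have "Rey (\<Oplus>.A i\<in>I. f i) = (\<Oplus>.A y\<in>Cr V. \<Oplus>.A i\<in>I. rho (inv\<^bsub>E\<^esub> (y, \<zero>)) **.A (f i **.A rho (y, \<zero>)))"
  unfolding Rey_def using assms
  by (intro A.finsum_cong') (auto simp: A.finsum_ldistr A.finsum_rdistr Pi_iff intro!: A.finsum_closed)
 also have "... = (\<Oplus>.A i\<in>I. \<Oplus>.A y\<in>Cr V. rho (inv\<^bsub>E\<^esub> (y, \<zero>)) **.A (f i **.A rho (y, \<zero>)))"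
  using assms fin_V by (intro A.finsum_swap) (auto simp: Pi_iff)
 finally show ?thesis by (simp add: Rey_def)
qed

lemma Rey_commuting:
 assumes B: "B : Cr A" and Y: "Y : Cr A" and comm: "!!y. y : Cr V ==> Y **.A rho (y, \<zero>) = rho (y, \<zero>) **.A Y"
 shows "Rey (Y **.A B) = Y **.A Rey B" "Rey Y = [card (Cr V)] \<cdot>.A Y"
proof -
 have c: "rho (inv\<^bsub>E\<^esub> (y, \<zero>)) **.A Y = Y **.A rho (inv\<^bsub>E\<^esub> (y, \<zero>))" if y: "y : Cr V" for y
 proof -
  have "rho (inv\<^bsub>E\<^esub> (y, \<zero>)) **.A (Y **.A rho (y, \<zero>)) **.A rho (inv\<^bsub>E\<^esub> (y, \<zero>)) = Y **.A rho (inv\<^bsub>E\<^esub> (y, \<zero>))"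
   unfolding comm[OF y] using y Y by (simp add: A.m_assoc[symmetric])
  moreover have "rho (inv\<^bsub>E\<^esub> (y, \<zero>)) **.A (Y **.A rho (y, \<zero>)) **.A rho (inv\<^bsub>E\<^esub> (y, \<zero>)) = rho (inv\<^bsub>E\<^esub> (y, \<zero>)) **.A Y"
   using y Y by (simp add: A.m_assoc)
  ultimately show ?thesis by simp
 qed
 have 1: "rho (inv\<^bsub>E\<^esub> (y, \<zero>)) **.A (Y **.A B **.A rho (y, \<zero>)) = Y **.A (rho (inv\<^bsub>E\<^esub> (y, \<zero>)) **.A (B **.A rho (y, \<zero>)))"
  if "y : Cr V" "B : Cr A" for y B
  using that B Y c[of y] by (simp add: A.m_assoc[symmetric])
 show "Rey (Y **.A B) = Y **.A Rey B"
  unfolding Rey_def using B Y fin_V 1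
  by (subst A.finsum_rdistr) (auto intro!: A.finsum_cong')
 have "Rey Y = (\<Oplus>.A y\<in>Cr V. Y)"
  unfolding Rey_def using Y 1[of _ "\<one>.A"] by (intro A.finsum_cong') auto
 then show "Rey Y = [card (Cr V)] \<cdot>.A Y"
  using A.add.finprod_const[of Y "Cr V"] Y by (simp add: add_pow_def)
qed

text \<open>Conjugation by \<open>(y, 0)\<close> multiplies \<open>(x, z)\<close> by the central
  element belonging to \<open>beta x y\<close>. For nonzero \<open>x\<close> the sum of these
  elements is unchanged under multiplication by a nontrivial one of them, hence zero by
  \<open>central_free\<close>.\<close>

lemma Rey_rho:
 assumes x: "x : Cr V" and z: "z : prime_field K"
 shows "Rey (rho (x, z)) = (if x = \<zero>.V then [card (Cr V)] \<cdot>.A cen z else \<zero>.A)"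
proof -
 have e: "(x, z) : Cr E" using x z by (simp add: E_carrier)
 define \<sigma> where "\<sigma> = (\<Oplus>.A y\<in>Cr V. cen (beta x y))"
 have \<sigma>c: "\<sigma> : Cr A" unfolding \<sigma>_def using x by (intro A.finsum_closed) auto
 have "rho (inv\<^bsub>E\<^esub> (y, \<zero>)) **.A (rho (x, z) **.A rho (y, \<zero>)) = rho (x, z) **.A cen (beta x y)"
  if y: "y : Cr V" for y
 proof -
  have "rho (inv\<^bsub>E\<^esub> (y, \<zero>)) **.A (rho (x, z) **.A rho (y, \<zero>)) = rho (inv\<^bsub>E\<^esub> (y, \<zero>) **.E ((x, z) **.E (y, \<zero>)))"
   using e y by (simp add: rho_mult)
  also have "inv\<^bsub>E\<^esub> (y, \<zero>) **.E ((x, z) **.E (y, \<zero>)) = (x, z) **.E (\<zero>.V, beta x y)"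
   using x y z by (subst E_conj) (simp_all add: E_mult)
  finally show ?thesis using e x y by (simp add: rho_mult)
 qed
 then have R: "Rey (rho (x, z)) = rho (x, z) **.A \<sigma>"
  unfolding Rey_def \<sigma>_def using e x fin_V by (subst A.finsum_rdistr) (auto intro!: A.finsum_cong')
 show ?thesis
 proof (cases "x = \<zero>.V")
  case True
  then have "\<sigma> = (\<Oplus>.A y\<in>Cr V. \<one>.A)"
   unfolding \<sigma>_def by (intro A.finsum_cong') (auto simp: cen_zero)
  then have "\<sigma> = [card (Cr V)] \<cdot>.A \<one>.A"
   using A.add.finprod_const[of "\<one>.A" "Cr V"] by (simp add: add_pow_def)
  then show ?thesis using R True z by (simp add: A.add_pow_rdistr)
 next
  case False
  then obtain y0 where y0: "y0 : Cr V" "beta x y0 ~= \<zero>" using beta_nondeg[OF x] by blast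
  have "cen (beta x y0) **.A \<sigma> = (\<Oplus>.A y\<in>Cr V. cen (beta x (y \<oplus>.V y0)))"
   unfolding \<sigma>_def using x y0 fin_V
   by (subst A.finsum_rdistr) (auto intro!: A.finsum_cong' simp: beta_add_r cen_add[symmetric] F.a_comm)
  also have "... = \<sigma>"
   unfolding \<sigma>_def using x y0 by (intro finsum_translate[of y0 "\<lambda>y. cen (beta x y)"]) auto
  finally have "\<sigma> = \<zero>.A" using central_free[of "beta x y0" \<sigma>] y0 x \<sigma>c by simp
  then show ?thesis using R False e by simp
 qed
qed

text \<open>A Gauss sum of the quadratic map \<open>q g\<close>, kept as an element of
  \<open>A\<close>; \<open>Sbar\<close> is its conjugate, with inverse character values.\<close>

definition S where "S g g' = (\<Oplus>.A xi\<in>pairs g g'. cen (q g xi))"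
definition Sbar where "Sbar g g' = (\<Oplus>.A xi\<in>pairs g g'. cen (\<ominus> q g xi))"

lemma S_closed [simp]: "g : Cr G ==> S g g' : Cr A" "g : Cr G ==> Sbar g g' : Cr A"
 unfolding S_def Sbar_def by (auto intro!: A.finsum_closed simp: q_closed)

lemma S_comm:
 assumes g: "g : Cr G" and e: "e : Cr E"
 shows "S g g' **.A rho e = rho e **.A S g g'" "Sbar g g' **.A rho e = rho e **.A Sbar g g'"
 unfolding S_def Sbar_def using g e q_closed
 by (auto simp: A.finsum_ldistr A.finsum_rdistr Pi_iff cen_comm intro!: A.finsum_cong')

lemma Rey_T_T:
 assumes g: "g : Cr G" "g' : Cr G"
 shows "Rey (T g **.A T g') = [card (Cr V)] \<cdot>.A S g g'"
proof -
 have r: "rho (u g x) **.A rho (u g' y) : Cr A" if "x : Cr V" "y : Cr V" for x y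
  using that g by (simp add: u_closed)
 have cl: "cen (q g xi) : Cr A" if "xi : pairs g g'" for xi using q_closed[OF g(1) that] by simp
 have fst: "fst (u g x **.E u g' y) = (g x \<ominus>.V x) \<oplus>.V (g' y \<ominus>.V y)" if "x : Cr V" "y : Cr V" for x y
  using that g by (simp add: u_eq E_mult)
 have val: "Rey (rho (u g x) **.A rho (u g' y))
   = (if (x, y) : pairs g g' then [card (Cr V)] \<cdot>.A cen (q g (x, y)) else \<zero>.A)"
  if xy: "x : Cr V" "y : Cr V" for x y
 proof -
  have e: "u g x **.E u g' y : Cr E" using xy g by (simp add: u_closed)
  then obtain v z where vz: "u g x **.E u g' y = (v, z)" "v : Cr V" "z : prime_field K"
   by (auto simp: E_carrier)
  have "Rey (rho (u g x) **.A rho (u g' y)) = Rey (rho (v, z))"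
   using xy g vz by (simp add: u_closed rho_mult[symmetric])
  also have "... = (if v = \<zero>.V then [card (Cr V)] \<cdot>.A cen z else \<zero>.A)"
   using Rey_rho vz by simp
  finally show ?thesis
   using fst[OF xy] vz u_mult_pairs[OF g, of x y] xy by (auto simp: pairs_def)
 qed
 have "T g **.A T g' = finsum A (\<lambda>(x, y). rho (u g x) **.A rho (u g' y)) (Cr V \<times> Cr V)"
  unfolding T_def using fin_V g u_closed by (intro A.finsum_mult_finsum) auto
 then have "Rey (T g **.A T g') = (\<Oplus>.A xi\<in>Cr V \<times> Cr V. Rey (case xi of (x, y) => rho (u g x) **.A rho (u g' y)))"
  using r fin_V by (simp add: Rey_finsum split_beta Pi_iff)
 also have "... = (\<Oplus>.A xi\<in>pairs g g'. [card (Cr V)] \<cdot>.A cen (q g xi))"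
 proof (rule A.add.finprod_mono_neutral_cong_right)
  show "finite (Cr V \<times> Cr V)" "pairs g g' <= Cr V \<times> Cr V"
   using fin_V by (auto simp: pairs_def)
  show "(\<lambda>xi. Rey (case xi of (x, y) => rho (u g x) **.A rho (u g' y))) : Cr V \<times> Cr V \<rightarrow> Cr A"
   using r by auto
 next
  fix xi assume "xi : Cr V \<times> Cr V - pairs g g'"
  then show "Rey (case xi of (x, y) => rho (u g x) **.A rho (u g' y)) = \<zero>.A"
   using val[of "fst xi" "snd xi"] by auto
 next
  fix xi assume xi: "xi : pairs g g'"
  then have "fst xi : Cr V" "snd xi : Cr V" by (auto simp: pairs_def)
  then show "Rey (case xi of (x, y) => rho (u g x) **.A rho (u g' y)) = [card (Cr V)] \<cdot>.A cen (q g xi)"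
   using val[of "fst xi" "snd xi"] xi by (simp add: split_beta)
 qed
 also have "... = (\<Oplus>.A xi\<in>pairs g g'. ([card (Cr V)] \<cdot>.A \<one>.A) **.A cen (q g xi))"
  using cl by (intro A.finsum_cong') (auto simp: A.add_pow_ldistr)
 also have "... = ([card (Cr V)] \<cdot>.A \<one>.A) **.A S g g'"
  unfolding S_def using cl by (subst A.finsum_rdistr) auto
 also have "... = [card (Cr V)] \<cdot>.A S g g'"
  using g by (simp add: A.add_pow_ldistr)
 finally show ?thesis .
qed

lemma Rey_add_pow: "B : Cr A ==> Rey ([(n::nat)] \<cdot>.A B) = [n] \<cdot>.A Rey B"
 using Rey_commuting(1)[of B "[n] \<cdot>.A \<one>.A"] by (simp add: A.add_pow_ldistr A.add_pow_rdistr)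

text \<open>Only for fixed points \<open>x\<close> of \<open>g\<close> is \<open>u g x\<close>
  central, and there it is the neutral element.\<close>

lemma Rey_T:
 assumes g: "g : Cr G"
 shows "Rey (T g) = [(card (Cr V) * card (Fix g))] \<cdot>.A \<one>.A"
proof -
 have val: "Rey (rho (u g x)) = (if g x = x then [card (Cr V)] \<cdot>.A \<one>.A else \<zero>.A)" if x: "x : Cr V" for x
 proof -
  have xx: "x \<ominus>.V x = \<zero>.V" using x by (simp add: a_minus_def M.r_neg)
  have R1: "Rey \<one>.A = [card (Cr V)] \<cdot>.A \<one>.A"
   using Rey_rho[of "\<zero>.V" \<zero>] by (simp add: cen_zero)
  show ?thesis using x g M.diff_eq_zero[of "g x" x] R1
   by (cases "g x = x") (auto simp: u_eq Rey_rho G_D h_closed cen_zero xx)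
 qed
 have "Rey (T g) = (\<Oplus>.A x\<in>Cr V. Rey (rho (u g x)))"
  unfolding T_def using g fin_V by (intro Rey_finsum) (auto simp: u_closed)
 also have "... = (\<Oplus>.A x\<in>Cr V. if g x = x then [card (Cr V)] \<cdot>.A \<one>.A else \<zero>.A)"
  by (intro A.finsum_cong') (auto simp: val)
 also have "... = [card (Fix g)] \<cdot>.A ([card (Cr V)] \<cdot>.A \<one>.A)"
  unfolding Fix_def by (intro A.finsum_const_filter) (auto simp: fin_V)
 finally show ?thesis by (simp add: A.add.nat_pow_pow)
qed

text \<open>The pairs are the \<open>(x, g x + k)\<close> with \<open>k\<close> fixed by
  \<open>g\<close>, and \<open>q\<close> vanishes on them because \<open>h k (g x) = h k x\<close>.
  So the sum merely counts.\<close>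

lemma S_ginv:
 assumes g: "g : Cr G"
 shows "S g (ginv g) = [(card (Cr V) * card (Fix g))] \<cdot>.A \<one>.A"
proof -
 note gi = ginv_closed[OF g]
 have inv: "ginv g k = k" if "k : Fix g" for k using that Fix_ginv[OF g] by (auto simp: Fix_def)
 have fx: "k : Cr V" "g k = k" if "k : Fix g" for k using that by (auto simp: Fix_def)
 have bij: "bij_betw (\<lambda>(x, k). (x, g x \<oplus>.V k)) (Cr V \<times> Fix g) (pairs g (ginv g))"
 proof (rule bij_betw_byWitness[of _ "\<lambda>(x, y). (x, y \<ominus>.V g x)"])
  show "\<forall>a\<in>Cr V \<times> Fix g. (\<lambda>(x, y). (x, y \<ominus>.V g x)) ((\<lambda>(x, k). (x, g x \<oplus>.V k)) a) = a"
   using g fx by (auto simp: G_D a_minus_def M.a_ac M.r_neg2 M.r_neg)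
  show "\<forall>a\<in>pairs g (ginv g). (\<lambda>(x, k). (x, g x \<oplus>.V k)) ((\<lambda>(x, y). (x, y \<ominus>.V g x)) a) = a"
   using g by (auto simp: pairs_def G_D a_minus_def M.a_lcomm[of "g _"] M.r_neg)
  show "(\<lambda>(x, k). (x, g x \<oplus>.V k)) ` (Cr V \<times> Fix g) <= pairs g (ginv g)"
  proof clarify
   fix x k assume xk: "x : Cr V" "k : Fix g"
   have "ginv g (g x \<oplus>.V k) = x \<oplus>.V k"
    using xk g gi inv fx by (simp add: G_D ginv_apply)
   then have "(g x \<ominus>.V x) \<oplus>.V (ginv g (g x \<oplus>.V k) \<ominus>.V (g x \<oplus>.V k)) =
     (g x \<ominus>.V x) \<oplus>.V ((x \<oplus>.V k) \<ominus>.V (g x \<oplus>.V k))" by simp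
   also have "... = \<zero>.V"
    using xk g fx(1)[OF xk(2)] M.add_diff_cancel[of x "g x" k]
    by (simp add: G_D) (simp add: G_D a_minus_def M.a_assoc M.r_neg2 M.r_neg M.r_neg1)
   finally show "(x, g x \<oplus>.V k) : pairs g (ginv g)"
    using xk g fx by (simp add: pairs_def G_D)
  qed
  show "(\<lambda>(x, y). (x, y \<ominus>.V g x)) ` pairs g (ginv g) <= Cr V \<times> Fix g"
  proof clarify
   fix x y assume "(x, y) : pairs g (ginv g)"
   then have xy: "x : Cr V" "y : Cr V"
    and eq: "(g x \<ominus>.V x) \<oplus>.V (ginv g y \<ominus>.V y) = \<zero>.V" by (auto simp: pairs_def)
   have c: "g x : Cr V" "ginv g y : Cr V" "g (g x) : Cr V" "g y : Cr V"
    using xy g gi by (simp_all add: G_D)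
   have "g ((g x \<ominus>.V x) \<oplus>.V (ginv g y \<ominus>.V y)) = (g (g x) \<ominus>.V g x) \<oplus>.V (y \<ominus>.V g y)"
    using xy c g by (simp add: a_minus_def G_D G_neg ginv_apply)
   then have e2: "(g (g x) \<ominus>.V g x) \<oplus>.V (y \<ominus>.V g y) = \<zero>.V"
    unfolding eq using G_zero[OF g] by simp
   have "(y \<ominus>.V g x) \<ominus>.V (g y \<ominus>.V g (g x)) = (g (g x) \<ominus>.V g x) \<oplus>.V (y \<ominus>.V g y)"
    using xy c by (simp add: a_minus_def M.minus_add M.minus_minus M.a_ac)
   then have "y \<ominus>.V g x = g y \<ominus>.V g (g x)"
    using e2 M.diff_eq_zero[of "y \<ominus>.V g x" "g y \<ominus>.V g (g x)"] c xy by simp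
   moreover have "g (y \<ominus>.V g x) = g y \<ominus>.V g (g x)"
    using xy c g by (simp add: a_minus_def G_D G_neg)
   ultimately show "x : Cr V & y \<ominus>.V g x : Fix g"
    using xy c by (simp add: Fix_def)
  qed
 qed
 have one: "cen (q g xi) = \<one>.A" if xi: "xi : pairs g (ginv g)" for xi
 proof -
  from xi have "xi : (\<lambda>(x, k). (x, g x \<oplus>.V k)) ` (Cr V \<times> Fix g)"
   using bij by (simp add: bij_betw_def)
  then obtain x k where xk: "xi = (x, g x \<oplus>.V k)" "x : Cr V" "k : Fix g" by auto
  have kk: "g x \<oplus>.V k \<ominus>.V g x = k" using xk g fx by (simp add: a_minus_def G_D M.a_ac M.r_neg2 M.r_neg)
  have "q g xi = h k (g x) \<ominus> h k x" using xk g fx kk by (simp add: q_def h_diff_r G_D)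
  also have "h k (g x) = h k x" using G_D(4)[OF g, of k x] fx[OF xk(3)] xk by simp
  also have "h k x \<ominus> h k x = \<zero>" using xk fx by (simp add: a_minus_def F.r_neg)
  finally show ?thesis by (simp add: cen_zero)
 qed
 have "S g (ginv g) = (\<Oplus>.A xi\<in>pairs g (ginv g). \<one>.A)"
  unfolding S_def by (intro A.finsum_cong') (auto simp: one)
 also have "... = [card (pairs g (ginv g))] \<cdot>.A \<one>.A"
  using A.add.finprod_const[of "\<one>.A" "pairs g (ginv g)"] by (simp add: add_pow_def)
 also have "card (pairs g (ginv g)) = card (Cr V) * card (Fix g)"
  using bij_betw_same_card[OF bij] by (simp add: card_cartesian_product)
 finally show ?thesis .
qed

lemma T_T_comm:
 assumes g: "g : Cr G" "g' : Cr G" and y: "y : Cr V"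
 shows "rho (y, \<zero>) **.A (T g **.A T g') = T g **.A T g' **.A rho (g' (g y), \<zero>)"
proof -
 have "rho (y, \<zero>) **.A (T g **.A T g') = T g **.A rho (g y, \<zero>) **.A T g'"
  using T_intertwines[OF g(1) y, of \<zero>] g y by (simp add: A.m_assoc[symmetric])
 also have "... = T g **.A (T g' **.A rho (g' (g y), \<zero>))"
  using T_intertwines[OF g(2), of "g y" \<zero>] g y by (simp add: A.m_assoc G_D)
 finally show ?thesis using g y by (simp add: A.m_assoc G_D)
qed

text \<open>The product commutes with all \<open>rho (y, 0)\<close>, so averaging multiplies it by
  |V|; the same average is evaluated by \<open>Rey_T_T\<close>.\<close>

lemma T_ginv:
 assumes g: "g : Cr G"
 shows "T g **.A T (ginv g) = [(card (Cr V) * card (Fix g))] \<cdot>.A \<one>.A"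
proof -
 note gi = ginv_closed[OF g]
 let ?Y = "T g **.A T (ginv g)"
 have "Rey ?Y = [card (Cr V)] \<cdot>.A ?Y"
  by (rule Rey_commuting(2)) (use g gi T_T_comm[OF g gi] in \<open>auto simp: ginv_apply\<close>)
 then have "[card (Cr V)] \<cdot>.A ?Y = [card (Cr V)] \<cdot>.A S g (ginv g)"
  using Rey_T_T[OF g gi] by simp
 then show ?thesis using card_V_cancel[of ?Y "S g (ginv g)"] g gi S_ginv by simp
qed

text \<open>Let \<open>k\<close> be the product of \<open>g\<close> and \<open>g'\<close>. The
  product \<open>Y\<close> of \<open>T g\<close>, \<open>T g'\<close> and \<open>T (ginv k)\<close>
  commutes with all \<open>rho (y, 0)\<close>. The average of \<open>Y\<close> times
  \<open>T k\<close> is computed twice, by pulling out \<open>Y\<close> and by cancelling the last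
  two factors; this identifies \<open>Y\<close> with |V| times \<open>S g g'\<close>. It remains to
  multiply by \<open>T k\<close> and cancel |V|.\<close>

lemma T_mult:
 assumes g: "g : Cr G" "g' : Cr G"
 shows "[card (Fix (g **.G g'))] \<cdot>.A (T g **.A T g') = S g g' **.A T (g **.G g')"
proof -
 define k where "k = g **.G g'"
 have k: "k : Cr G" using g by (simp add: k_def G_mult_closed)
 note ki = ginv_closed[OF k]
 let ?n = "card (Cr V)" and ?f = "card (Fix k)"
 define Y where "Y = T g **.A T g' **.A T (ginv k)"
 have Y: "Y : Cr A" using g ki by (simp add: Y_def)
 have comm: "Y **.A rho (y, \<zero>) = rho (y, \<zero>) **.A Y" if y: "y : Cr V" for y
 proof -
  have ky: "k y : Cr V" using k y by (simp add: G_D)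
  have "rho (y, \<zero>) **.A Y = T g **.A T g' **.A rho (k y, \<zero>) **.A T (ginv k)"
   unfolding Y_def using T_T_comm[OF g y] g ki y
   by (simp add: A.m_assoc[symmetric] k_def G_mult_apply)
  also have "... = T g **.A T g' **.A (T (ginv k) **.A rho (y, \<zero>))"
   using T_intertwines[OF ki ky, of \<zero>] g ki y ky k by (simp add: A.m_assoc ginv_apply)
  finally show ?thesis using g ki y by (simp add: Y_def A.m_assoc)
 qed
 have "T (ginv k) **.A T k = [(?n * ?f)] \<cdot>.A \<one>.A"
  using T_ginv[OF ki] by (simp add: ginv_ginv[OF k] Fix_ginv[OF k])
 then have YT: "Y **.A T k = [(?n * ?f)] \<cdot>.A (T g **.A T g')"
  unfolding Y_def using g ki k by (simp add: A.m_assoc A.add_pow_rdistr)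
 have "[(?n * ?f)] \<cdot>.A ([?n] \<cdot>.A S g g') = Rey (Y **.A T k)"
  unfolding YT using g by (simp add: Rey_add_pow Rey_T_T)
 also have "... = [(?n * ?f)] \<cdot>.A Y"
  using Rey_commuting(1)[OF T_closed[OF k] Y comm] Y by (simp add: Rey_T[OF k] A.add_pow_rdistr)
 finally have Yeq: "[?n] \<cdot>.A S g g' = Y"
 proof -
  assume a: "[(?n * ?f)] \<cdot>.A ([?n] \<cdot>.A S g g') = [(?n * ?f)] \<cdot>.A Y"
  obtain i j where "?n = p ^ i" "?f = p ^ j" using card_V_pow card_Fix_pow[OF k] by blast
  then have "?n * ?f = p ^ (i + j)" by (simp add: power_add)
  then show ?thesis using a pow_cancel[of "[?n] \<cdot>.A S g g'" Y "i + j"] g Y by simp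
 qed
 have "[?n] \<cdot>.A (S g g' **.A T k) = Y **.A T k"
  unfolding Yeq[symmetric] using g k by (simp add: A.add_pow_ldistr)
 also have "... = [?n] \<cdot>.A ([?f] \<cdot>.A (T g **.A T g'))"
  unfolding YT using g by (simp add: A.add.nat_pow_pow mult.commute)
 finally show ?thesis
  using card_V_cancel[of "S g g' **.A T k" "[?f] \<cdot>.A (T g **.A T g')"] g k by (simp add: k_def)
qed

text \<open>The bijection from \<open>(x, y)\<close> to \<open>(g' y, g x)\<close> between the two
  sets of pairs changes the sign of \<open>q\<close>.\<close>

lemma S_swap:
 assumes g: "g : Cr G" "g' : Cr G"
 shows "S (ginv g') (ginv g) = Sbar g g'"
proof -
 note gi = ginv_closed[OF g(1)] ginv_closed[OF g(2)]
 let ?phi = "\<lambda>(x, y). (g' y, g x)"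
 have bij: "bij_betw ?phi (pairs g g') (pairs (ginv g') (ginv g))"
 proof (rule bij_betw_byWitness[of _ "\<lambda>(x, y). (ginv g y, ginv g' x)"])
  show "?phi ` pairs g g' <= pairs (ginv g') (ginv g)"
  proof clarify
   fix x y assume "(x, y) : pairs g g'"
   then have xy: "x : Cr V" "y : Cr V" and e: "(g x \<ominus>.V x) \<oplus>.V (g' y \<ominus>.V y) = \<zero>.V"
    by (auto simp: pairs_def)
   have c: "g x : Cr V" "g' y : Cr V" using xy g by (simp_all add: G_D)
   have "(y \<ominus>.V g' y) \<oplus>.V (x \<ominus>.V g x) = \<ominus>.V ((g x \<ominus>.V x) \<oplus>.V (g' y \<ominus>.V y))"
    using xy c by (simp add: a_minus_def M.minus_add M.minus_minus M.a_ac)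
   then have "(y \<ominus>.V g' y) \<oplus>.V (x \<ominus>.V g x) = \<zero>.V" unfolding e by simp
   then show "(g' y, g x) : pairs (ginv g') (ginv g)"
    using xy c g by (simp add: pairs_def ginv_apply)
  qed
  show "(\<lambda>(x, y). (ginv g y, ginv g' x)) ` pairs (ginv g') (ginv g) <= pairs g g'"
  proof clarify
   fix x y assume "(x, y) : pairs (ginv g') (ginv g)"
   then have xy: "x : Cr V" "y : Cr V"
    and e: "(ginv g' x \<ominus>.V x) \<oplus>.V (ginv g y \<ominus>.V y) = \<zero>.V"
    by (auto simp: pairs_def)
   have c: "ginv g' x : Cr V" "ginv g y : Cr V" using xy gi by (simp_all add: G_D)
   have "(y \<ominus>.V ginv g y) \<oplus>.V (x \<ominus>.V ginv g' x) = \<ominus>.V ((ginv g' x \<ominus>.V x) \<oplus>.V (ginv g y \<ominus>.V y))"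
    using xy c by (simp add: a_minus_def M.minus_add M.minus_minus M.a_ac)
   then have "(y \<ominus>.V ginv g y) \<oplus>.V (x \<ominus>.V ginv g' x) = \<zero>.V" unfolding e by simp
   then show "(ginv g y, ginv g' x) : pairs g g'"
    using xy c g by (simp add: pairs_def ginv_apply)
  qed
 qed (use g gi in \<open>auto simp: pairs_def ginv_apply\<close>)
 have val: "q (ginv g') (?phi xi) = \<ominus> q g xi" if xi: "xi : pairs g g'" for xi
 proof -
  obtain x y where xy: "xi = (x, y)" "x : Cr V" "y : Cr V"
   and e: "(g x \<ominus>.V x) \<oplus>.V (g' y \<ominus>.V y) = \<zero>.V" using xi by (auto simp: pairs_def)
  have c: "g x : Cr V" "g' y : Cr V" using xy g by (simp_all add: G_D)
  have "(y \<ominus>.V g' y) \<ominus>.V (g x \<ominus>.V x) = \<ominus>.V ((g x \<ominus>.V x) \<oplus>.V (g' y \<ominus>.V y))"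
   using xy c by (simp add: a_minus_def M.minus_add M.minus_minus M.a_ac)
  then have "(y \<ominus>.V g' y) \<ominus>.V (g x \<ominus>.V x) = \<zero>.V" unfolding e by simp
  then have yg: "y \<ominus>.V g' y = g x \<ominus>.V x"
   using M.diff_eq_zero[of "y \<ominus>.V g' y" "g x \<ominus>.V x"] xy c by simp
  have "q (ginv g') (?phi xi) = h (g x \<ominus>.V y) (g x \<ominus>.V x)"
   using xy g by (simp add: q_def ginv_apply yg)
  also have "g x \<ominus>.V y = \<ominus>.V (y \<ominus>.V g x)" using xy c by (simp add: a_minus_def M.minus_add M.minus_minus M.a_comm)
  finally show ?thesis using xy c by (simp add: q_def)
 qed
 have "S (ginv g') (ginv g) = (\<Oplus>.A xi\<in>?phi ` pairs g g'. cen (q (ginv g') xi))"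
  unfolding S_def using bij by (simp add: bij_betw_def)
 also have "... = (\<Oplus>.A xi\<in>pairs g g'. cen (q (ginv g') (?phi xi)))"
  using bij gi q_closed[of "ginv g'" _ "ginv g"] by (intro A.finsum_reindex) (auto simp: bij_betw_def)
 also have "... = Sbar g g'"
  unfolding Sbar_def using g q_closed by (intro A.finsum_cong') (auto simp: val)
 finally show ?thesis .
qed

lemma ginv_mult:
 assumes g: "g : Cr G" "g' : Cr G"
 shows "ginv (g **.G g') = ginv g' **.G ginv g"
proof (rule extensionalityI[of _ "Cr V"])
 fix x assume x: "x : Cr V"
 have k: "g **.G g' : Cr G" using g by (rule G_mult_closed)
 have c: "ginv g (ginv g' x) : Cr V" using g x by (simp add: ginv_apply)
 have "(g **.G g') (ginv g (ginv g' x)) = x" using g x c by (simp add: G_mult_apply ginv_apply)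
 then show "ginv (g **.G g') x = (ginv g' **.G ginv g) x"
  using ginv_apply(2)[OF k c] x by (simp add: G_mult_apply)
qed (auto simp: ginv_def G_mult)

text \<open>Multiply the product formula for \<open>g\<close>, \<open>g'\<close> by the one for the
  inverses in opposite order. The operators cancel from the middle outwards by
  \<open>T_ginv\<close>, and the numbers left over are powers of \<open>p\<close>, which can be
  cancelled.\<close>

lemma S_mult_Sbar:
 assumes g: "g : Cr G" "g' : Cr G"
 shows "S g g' **.A Sbar g g' = [(card (Cr V) * card (Fix g) * card (Fix g') * card (Fix (g **.G g')))] \<cdot>.A \<one>.A"
proof -
 define k where "k = g **.G g'"
 have k: "k : Cr G" using g by (simp add: k_def G_mult_closed)
 note gi = ginv_closed[OF g(1)] ginv_closed[OF g(2)]
 note ki = ginv_closed[OF k]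
 let ?n = "card (Cr V)" and ?f = "card (Fix k)" and ?a = "card (Fix g)" and ?b = "card (Fix g')"
 have kk: "ginv g' **.G ginv g = ginv k" by (simp add: k_def ginv_mult[OF g])
 have 1: "[?f] \<cdot>.A (T g **.A T g') = S g g' **.A T k" using T_mult[OF g] by (simp add: k_def)
 have 2: "[?f] \<cdot>.A (T (ginv g') **.A T (ginv g)) = Sbar g g' **.A T (ginv k)"
  using T_mult[OF gi(2,1)] unfolding kk S_swap[OF g] Fix_ginv[OF k] .
 have SbT: "Sbar g g' **.A T k = T k **.A Sbar g g'"
  unfolding T_def using fin_V k g u_closed S_comm(2)[OF g(1) u_closed[OF k], of _ g']
  by (subst A.finsum_rdistr) (auto simp: A.finsum_ldistr intro!: A.finsum_cong')
 have TT: "T g' **.A T (ginv g') = [(?n * ?b)] \<cdot>.A \<one>.A" "T g **.A T (ginv g) = [(?n * ?a)] \<cdot>.A \<one>.A"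
   "T k **.A T (ginv k) = [(?n * ?f)] \<cdot>.A \<one>.A"
  using T_ginv g k by auto
 have "[?f] \<cdot>.A (T g **.A T g') **.A [?f] \<cdot>.A (T (ginv g') **.A T (ginv g))
   = [?f] \<cdot>.A ([?f] \<cdot>.A (T g **.A (T g' **.A T (ginv g')) **.A T (ginv g)))"
  using g gi by (simp add: A.add_pow_ldistr A.add_pow_rdistr A.m_assoc)
 also have "... = [(?n * ?f)] \<cdot>.A ([(?n * ?a * ?b * ?f)] \<cdot>.A \<one>.A)"
  unfolding TT(1) using g gi by (simp add: A.add_pow_ldistr A.add_pow_rdistr TT(2) A.add.nat_pow_pow mult_ac)
 finally have L: "[?f] \<cdot>.A (T g **.A T g') **.A [?f] \<cdot>.A (T (ginv g') **.A T (ginv g))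
   = [(?n * ?f)] \<cdot>.A ([(?n * ?a * ?b * ?f)] \<cdot>.A \<one>.A)" .
 have "(S g g' **.A T k) **.A (Sbar g g' **.A T (ginv k)) = S g g' **.A (Sbar g g' **.A T k) **.A T (ginv k)"
  unfolding SbT using g k ki by (simp add: A.m_assoc)
 also have "... = [(?n * ?f)] \<cdot>.A (S g g' **.A Sbar g g')"
  using g k ki by (simp add: A.m_assoc TT(3) A.add_pow_rdistr)
 finally have eq: "[(?n * ?f)] \<cdot>.A (S g g' **.A Sbar g g') = [(?n * ?f)] \<cdot>.A ([(?n * ?a * ?b * ?f)] \<cdot>.A \<one>.A)"
  using L unfolding 1 2 by simp
 obtain i j where "?n = p ^ i" "?f = p ^ j" using card_V_pow card_Fix_pow[OF k] by blast
 then have "?n * ?f = p ^ (i + j)" by (simp add: power_add)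
 then show ?thesis
  using eq pow_cancel[of "S g g' **.A Sbar g g'" "[(?n * ?a * ?b * ?f)] \<cdot>.A \<one>.A" "i + j"] g
  by (simp add: k_def)
qed

end

text \<open>Pigeonhole: the squares and the elements \<open>- 1 - s\<close> with \<open>s\<close> a square both fill more than
 half of the field.\<close>

lemma (in field) minus_one_sum_two_squares:
 assumes fin: "finite (Cr R)" and two: "\<one> \<oplus> \<one> ~= \<zero>"
 shows "\<exists>a\<in>Cr R. \<exists>b\<in>Cr R. a ** a \<oplus> b ** b \<oplus> \<one> = \<zero>"
proof -
 define Q where "Q = (\<lambda>a. a ** a) ` Cr R"
 have Qc: "Q <= Cr R" "finite Q" using fin by (auto simp: Q_def)
 have Q0: "\<zero> : Q" unfolding Q_def by (intro image_eqI[of _ _ \<zero>]) auto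
 have fib: "card {a : Cr R. a ** a = s} \<le> 2" for s
 proof (cases "\<exists>a\<in>Cr R. a ** a = s")
  case True
  then obtain a where a: "a : Cr R" "a ** a = s" by blast
  have "{a : Cr R. a ** a = s} <= {a, \<ominus> a}"
  proof
   fix b assume "b : {a : Cr R. a ** a = s}"
   then have b: "b : Cr R" "b ** b = a ** a" using a by auto
   have "(b \<ominus> a) ** (b \<oplus> a) = b ** b \<ominus> a ** a" using a(1) b(1) by algebra
   also have "... = \<zero>" unfolding b(2) using a(1) by simp
   finally have "b \<ominus> a = \<zero> \<or> b \<oplus> a = \<zero>" using a(1) b(1) by (intro integral) auto
   then show "b : {a, \<ominus> a}" using a(1) b(1) minus_equality[of b a] by auto
  qed
  then have "card {a : Cr R. a ** a = s} \<le> card {a, \<ominus> a}" by (intro card_mono) auto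
  also have "... \<le> 2" by (simp add: card_insert_if)
  finally show ?thesis .
 next
  case False
  then have "{a : Cr R. a ** a = s} = {}" by blast
  then show ?thesis by (simp only: card.empty)
 qed
 \<comment> \<open>Zero is left out because it has a single root; this is what makes the bound
   \<open>big\<close> strict.\<close>
 have "Cr R - {\<zero>} <= (\<Union>s\<in>Q - {\<zero>}. {a : Cr R. a ** a = s})"
  using integral by (auto simp: Q_def)
 then have "card (Cr R - {\<zero>}) \<le> card (\<Union>s\<in>Q - {\<zero>}. {a : Cr R. a ** a = s})"
  using fin Qc by (intro card_mono) auto
 also have "... \<le> (\<Sum>s\<in>Q - {\<zero>}. card {a : Cr R. a ** a = s})"
  using Qc by (intro card_UN_le) auto
 also have "... \<le> (\<Sum>s\<in>Q - {\<zero>}. 2)" by (intro sum_mono fib)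
 also have "... = 2 * (card Q - 1)" using Q0 Qc by simp
 finally have "card (Cr R) - 1 \<le> 2 * (card Q - 1)" using fin by simp
 moreover have "card (Cr R) > 0" "card Q > 0" using fin Qc Q0 by (auto simp: card_gt_0_iff)
 ultimately have big: "card (Cr R) < 2 * card Q" by linarith
 let ?f = "\<lambda>s. \<ominus> (s \<oplus> \<one>)"
 have inj: "inj_on ?f Q"
 proof (rule inj_onI)
  fix s t assume st: "s : Q" "t : Q" "?f s = ?f t"
  then have c: "s : Cr R" "t : Cr R" using Qc by auto
  then have "s \<oplus> \<one> = t \<oplus> \<one>" using st(3) by (metis add.inv_inv add.m_closed one_closed)
  then show "s = t" using c by simp
 qed
 have "Q \<inter> ?f ` Q ~= {}"
 proof
  assume e: "Q \<inter> ?f ` Q = {}"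
  have "card (Q \<union> ?f ` Q) = card Q + card Q"
   using card_Un_disjoint[OF Qc(2) _ e] Qc card_image[OF inj] by simp
  moreover have "card (Q \<union> ?f ` Q) \<le> card (Cr R)" using Qc fin by (intro card_mono) auto
  ultimately show False using big by simp
 qed
 then obtain s t where st: "s : Q" "t : Q" "s = ?f t" by blast
 then have c: "s : Cr R" "t : Cr R" using Qc by auto
 have "s \<oplus> t \<oplus> \<one> = \<zero>" unfolding st(3) using c(2) by algebra
 then show ?thesis using st(1,2) by (auto simp: Q_def)
qed

context heis
begin

text \<open>The two squares must come from the prime field and not merely from \<open>K\<close>,
  since \<open>h\<close> is bilinear only over the former.\<close>

lemma prime_field_squares:
 assumes "odd p"
 shows "\<exists>a\<in>prime_field K. \<exists>b\<in>prime_field K. a ** a \<oplus> b ** b \<oplus> \<one> = \<zero>"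
proof -
 let ?P = "K\<lparr>carrier := prime_field K\<rparr>"
 have fP: "field ?P" unfolding prime_field_def by (rule generate_field_is_field) simp
 have "[(2::nat)] \<cdot>.K \<one> ~= \<zero>"
  using add_pow_one_eq_0_iff[of 2] assms prime_p by (auto dest: prime_nat_not_dvd)
   (metis dvd_imp_le even_numeral le_antisym p_ge_2 pos2)
 then have "\<one> \<oplus> \<one> ~= \<zero>" by (simp add: numeral_2_eq_2)
 then have "\<exists>a\<in>Cr ?P. \<exists>b\<in>Cr ?P. a **\<^bsub>?P\<^esub> a \<oplus>\<^bsub>?P\<^esub> b **\<^bsub>?P\<^esub> b \<oplus>\<^bsub>?P\<^esub> \<one>\<^bsub>?P\<^esub> = \<zero>\<^bsub>?P\<^esub>"
  by (intro field.minus_one_sum_two_squares[OF fP]) auto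
 then show ?thesis by simp
qed

definition comb where
 "comb a b = (\<lambda>(x, y) (x', y'). (a \<odot>.V x \<oplus>.V b \<odot>.V x', a \<odot>.V y \<oplus>.V b \<odot>.V y'))"

text \<open>The cross term of \<open>q\<close>. Both orders of its arguments occur in
  \<open>q_comb\<close>, as \<open>h\<close> need not be symmetric.\<close>

definition qpol where "qpol g = (\<lambda>(x, y) (x', y'). h (y \<ominus>.V g x) (g x' \<ominus>.V x'))"

lemma pairs_carrier: "xi : pairs g g' ==> fst xi : Cr V" "xi : pairs g g' ==> snd xi : Cr V"
 by (auto simp: pairs_def)

lemma defect_comb:
 assumes "g : Cr G" "a : Cr K" "b : Cr K" "x : Cr V" "x' : Cr V"
 shows "g (a \<odot>.V x \<oplus>.V b \<odot>.V x') \<ominus>.V (a \<odot>.V x \<oplus>.V b \<odot>.V x') = a \<odot>.V (g x \<ominus>.V x) \<oplus>.V b \<odot>.V (g x' \<ominus>.V x')"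
 using assms by (simp add: G_D a_minus_def smult_r_distr smult_r_minus M.minus_add M.a_ac)

lemma comb_pairs:
 assumes g: "g : Cr G" "g' : Cr G" and ab: "a : Cr K" "b : Cr K"
  and xi: "xi : pairs g g'" "xi' : pairs g g'"
 shows "comb a b xi xi' : pairs g g'"
proof -
 obtain x y x' y' where s: "xi = (x, y)" "xi' = (x', y')" by (cases xi, cases xi')
 have c: "x : Cr V" "y : Cr V" "x' : Cr V" "y' : Cr V"
  and e: "(g x \<ominus>.V x) \<oplus>.V (g' y \<ominus>.V y) = \<zero>.V" "(g x' \<ominus>.V x') \<oplus>.V (g' y' \<ominus>.V y') = \<zero>.V"
  using xi by (auto simp: pairs_def s)
 have d: "g x \<ominus>.V x : Cr V" "g' y \<ominus>.V y : Cr V" "g x' \<ominus>.V x' : Cr V" "g' y' \<ominus>.V y' : Cr V"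
  using c g by (simp_all add: G_D)
 have "(a \<odot>.V (g x \<ominus>.V x) \<oplus>.V b \<odot>.V (g x' \<ominus>.V x')) \<oplus>.V (a \<odot>.V (g' y \<ominus>.V y) \<oplus>.V b \<odot>.V (g' y' \<ominus>.V y'))
   = a \<odot>.V ((g x \<ominus>.V x) \<oplus>.V (g' y \<ominus>.V y)) \<oplus>.V b \<odot>.V ((g x' \<ominus>.V x') \<oplus>.V (g' y' \<ominus>.V y'))"
  using ab d by (simp add: smult_r_distr M.a_ac)
 also have "... = \<zero>.V" unfolding e using ab by simp
 finally show ?thesis
  unfolding s comb_def pairs_def using c ab g defect_comb[OF g(1) ab c(1,3)] defect_comb[OF g(2) ab c(2,4)] by simp
qed

lemma q_comb:
 assumes g: "g : Cr G" and ab: "a : prime_field K" "b : prime_field K"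
  and xi: "xi : pairs g g'" "xi' : pairs g g'"
 shows "q g (comb a b xi xi') = (a ** a) ** q g xi \<oplus> (a ** b) ** (qpol g xi xi' \<oplus> qpol g xi' xi) \<oplus> (b ** b) ** q g xi'"
proof -
 obtain x y x' y' where s: "xi = (x, y)" "xi' = (x', y')" by (cases xi, cases xi')
 have c: "x : Cr V" "y : Cr V" "x' : Cr V" "y' : Cr V"
  using xi by (auto simp: pairs_def s)
 define u u' w w' where uw: "u = y \<ominus>.V g x" "u' = y' \<ominus>.V g x'" "w = g x \<ominus>.V x" "w' = g x' \<ominus>.V x'"
 have uc: "u : Cr V" "u' : Cr V" "w : Cr V" "w' : Cr V" using c g by (simp_all add: uw G_D)
 have ac: "a : Cr K" "b : Cr K" using ab by auto
 have 1: "(a \<odot>.V y \<oplus>.V b \<odot>.V y') \<ominus>.V g (a \<odot>.V x \<oplus>.V b \<odot>.V x') = a \<odot>.V u \<oplus>.V b \<odot>.V u'"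
  using c g ac by (simp add: uw G_D a_minus_def smult_r_distr smult_r_minus M.minus_add M.a_ac)
 have "q g (comb a b xi xi') = h (a \<odot>.V u \<oplus>.V b \<odot>.V u') (a \<odot>.V w \<oplus>.V b \<odot>.V w')"
  unfolding s comb_def q_def using 1 defect_comb[OF g ac c(1,3)] by (simp add: uw)
 also have "... = a ** (a ** h u w \<oplus> b ** h u w') \<oplus> b ** (a ** h u' w \<oplus> b ** h u' w')"
  using uc ac ab by (simp add: h_add_l h_add_r h_smult_l h_smult_r F.r_distr F.a_ac F.m_ac)
 also have "... = (a ** a) ** h u w \<oplus> (a ** b) ** (h u w' \<oplus> h u' w) \<oplus> (b ** b) ** h u' w'"
  using uc ac by (simp add: F.r_distr F.a_ac F.m_ac)
 finally show ?thesis by (simp add: s q_def qpol_def uw)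
qed

lemma qpol_closed: "g : Cr G ==> xi : pairs g g' ==> xi' : pairs g g' ==> qpol g xi xi' : Cr K"
 by (auto simp: qpol_def pairs_def G_D)

lemma comb_comb:
 assumes xi: "xi : pairs g g'" "xi' : pairs g g'"
  and ab: "a : Cr K" "b : Cr K" "c : Cr K" "d : Cr K" "s : Cr K" "t : Cr K"
 shows "comb s t (comb a b xi xi') (comb c d xi xi') = comb (s ** a \<oplus> t ** c) (s ** b \<oplus> t ** d) xi xi'"
proof -
 have a4: "(x \<oplus>.V y) \<oplus>.V (z \<oplus>.V w) = (x \<oplus>.V z) \<oplus>.V (y \<oplus>.V w)"
  if "x : Cr V" "y : Cr V" "z : Cr V" "w : Cr V" for x y z w
  using that by (simp add: M.a_ac)
 have "s \<odot>.V (a \<odot>.V x \<oplus>.V b \<odot>.V x') \<oplus>.V t \<odot>.V (c \<odot>.V x \<oplus>.V d \<odot>.V x')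
   = (s ** a \<oplus> t ** c) \<odot>.V x \<oplus>.V (s ** b \<oplus> t ** d) \<odot>.V x'"
  if "x : Cr V" "x' : Cr V" for x x'
  using that ab by (simp add: smult_r_distr smult_l_distr smult_assoc1 a4)
 then show ?thesis
  using pairs_carrier[OF xi(1)] pairs_carrier[OF xi(2)] by (cases xi, cases xi') (simp add: comb_def)
qed

end

context intertwiner
begin

text \<open>If \<open>a\<^sup>2 + b\<^sup>2 = - 1\<close>, the substitution \<open>(xi, xi') \<mapsto> (a xi + b xi', b xi - a xi')\<close> turns \<open>q \<oplus> q\<close> into
 \<open>- q \<oplus> - q\<close>.\<close>

lemma S_square:
 assumes g: "g : Cr G" "g' : Cr G" and p: "odd p"
 shows "S g g' **.A S g g' = Sbar g g' **.A Sbar g g'"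
proof -
 obtain a b where ab: "a : prime_field K" "b : prime_field K" "a ** a \<oplus> b ** b \<oplus> \<one> = \<zero>"
  using prime_field_squares[OF p] by blast
 let ?c = "\<ominus> a" and ?m = "\<ominus> \<one>"
 have ac: "a : Cr K" "b : Cr K" using ab by auto
 have m: "a ** a \<oplus> b ** b = ?m"
  using F.minus_equality[of "a ** a \<oplus> b ** b" \<one>] ab(3) ac by simp
 let ?P = "pairs g g' \<times> pairs g g'"
 define phi where "phi = (\<lambda>(xi, xi'). (comb a b xi xi', comb b ?c xi xi'))"
 have phiP: "phi zta : ?P" if "zta : ?P" for zta
  using that comb_pairs[OF g] ac by (auto simp: phi_def)
 \<comment> \<open>The matrix with rows \<open>(a, b)\<close> and \<open>(b, - a)\<close> squares to
   minus one; these are the off-diagonal entries and the last entry of its square.\<close>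
 have k1: "a ** b \<oplus> b ** ?c = \<zero>" "b ** a \<oplus> ?c ** b = \<zero>" "b ** b \<oplus> ?c ** ?c = ?m"
  using ac m by (simp_all add: F.r_minus F.l_minus F.m_comm F.r_neg F.a_comm F.minus_minus)
 have neg: "comb ?m \<zero> xi xi' = (\<ominus>.V fst xi, \<ominus>.V snd xi)" "comb \<zero> ?m xi xi' = (\<ominus>.V fst xi', \<ominus>.V snd xi')"
  if "xi : pairs g g'" "xi' : pairs g g'" for xi xi'
  using pairs_carrier[OF that(1)] pairs_carrier[OF that(2)]
  by (auto simp: comb_def split_beta smult_l_minus)
 have phiphi: "phi (phi (xi, xi')) = ((\<ominus>.V fst xi, \<ominus>.V snd xi), (\<ominus>.V fst xi', \<ominus>.V snd xi'))"
  if "xi : pairs g g'" "xi' : pairs g g'" for xi xi'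
  using comb_comb[OF that, of a b b ?c a b] comb_comb[OF that, of a b b ?c b ?c] ac neg[OF that] k1 m
  by (simp add: phi_def)
 \<comment> \<open>Two applications of \<open>phi\<close> negate both pairs, so \<open>phi\<close>
   is injective, hence bijective on the finite set \<open>?P\<close>.\<close>
 have inj: "inj_on phi ?P"
 proof (rule inj_onI)
  fix zta zta' assume z: "zta : ?P" "zta' : ?P" "phi zta = phi zta'"
  obtain x y x' y' where z1: "zta = ((x, y), (x', y'))" by (metis surj_pair)
  obtain u v u' v' where z2: "zta' = ((u, v), (u', v'))" by (metis surj_pair)
  have P: "(x, y) : pairs g g'" "(x', y') : pairs g g'" "(u, v) : pairs g g'" "(u', v') : pairs g g'"
   and e: "phi ((x, y), (x', y')) = phi ((u, v), (u', v'))"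
   using z unfolding z1 z2 by (blast, blast, blast, blast, blast)
  have "phi (phi ((x, y), (x', y'))) = phi (phi ((u, v), (u', v')))" using e by simp
  then have "((\<ominus>.V x, \<ominus>.V y), (\<ominus>.V x', \<ominus>.V y')) = ((\<ominus>.V u, \<ominus>.V v), (\<ominus>.V u', \<ominus>.V v'))"
   unfolding phiphi[OF P(1,2)] phiphi[OF P(3,4)] fst_conv snd_conv .
  then have "\<ominus>.V x = \<ominus>.V u" "\<ominus>.V y = \<ominus>.V v" "\<ominus>.V x' = \<ominus>.V u'" "\<ominus>.V y' = \<ominus>.V v'"
   unfolding prod.inject by blast+
  moreover have "r = s" if "\<ominus>.V r = \<ominus>.V s" "r : Cr V" "s : Cr V" for r s
   by (rule trans[OF M.minus_minus[OF that(2), symmetric] trans[OF arg_cong[OF that(1), of "a_inv V"] M.minus_minus[OF that(3)]]])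
  ultimately show "zta = zta'"
   using P[THEN pairs_carrier(1)] P[THEN pairs_carrier(2)] unfolding z1 z2 fst_conv snd_conv by blast
 qed
 have "finite ?P" by simp
 then have surj: "phi ` ?P = ?P" by (rule endo_inj_surj[OF _ image_subsetI[OF phiP] inj])
 \<comment> \<open>The mixed terms cancel, and \<open>q g xi\<close> and \<open>q g xi'\<close> both
   receive the coefficient \<open>a a + b b\<close>, which is minus one.\<close>
 have val: "q g (comb a b xi xi') \<oplus> q g (comb b ?c xi xi') = \<ominus> q g xi \<oplus> \<ominus> q g xi'"
  if xi: "xi : pairs g g'" "xi' : pairs g g'" for xi xi'
 proof -
  have c: "q g xi : Cr K" "q g xi' : Cr K" "qpol g xi xi' \<oplus> qpol g xi' xi : Cr K"
   using xi q_closed[OF g(1)] qpol_closed[OF g(1)] by auto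
  define Q R S where QRS: "Q = q g xi" "R = qpol g xi xi' \<oplus> qpol g xi' xi" "S = q g xi'"
  have c': "Q : Cr K" "R : Cr K" "S : Cr K" using c by (auto simp: QRS)
  have "q g (comb a b xi xi') \<oplus> q g (comb b ?c xi xi')
   = ((a ** a) ** Q \<oplus> (a ** b) ** R \<oplus> (b ** b) ** S) \<oplus> ((b ** b) ** Q \<oplus> (b ** ?c) ** R \<oplus> (?c ** ?c) ** S)"
   using q_comb[OF g(1) ab(1,2) xi] q_comb[OF g(1) ab(2) _ xi, of ?c] ab by (simp add: QRS)
  also have "... = (a ** a \<oplus> b ** b) ** Q \<oplus> (a ** b \<oplus> b ** ?c) ** R \<oplus> (b ** b \<oplus> ?c ** ?c) ** S"
  proof -
   have a3: "(x \<oplus> y \<oplus> z) \<oplus> (u \<oplus> v \<oplus> w) = (x \<oplus> u) \<oplus> (y \<oplus> v) \<oplus> (z \<oplus> w)"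
    if "x : Cr K" "y : Cr K" "z : Cr K" "u : Cr K" "v : Cr K" "w : Cr K"
    for x y z u v w using that by (simp add: F.a_ac)
   show ?thesis using c' ac by (simp add: F.l_distr a3)
  qed
  also have "... = \<ominus> Q \<oplus> \<ominus> S" unfolding k1 m using c' by (simp add: F.l_minus)
  finally show ?thesis by (simp add: QRS)
 qed
 have cl: "cen (q g xi) : Cr A" "cen (\<ominus> q g xi) : Cr A" if "xi : pairs g g'" for xi
  using q_closed[OF g(1) that] by simp_all
 have 1: "S g g' **.A S g g' = (\<Oplus>.A zta\<in>?P. cen (q g (fst zta) \<oplus> q g (snd zta)))"
  unfolding S_def using cl q_closed[OF g(1)]
  by (subst A.finsum_mult_finsum) (auto intro!: A.finsum_cong' simp: cen_add)
 have 2: "Sbar g g' **.A Sbar g g' = (\<Oplus>.A zta\<in>?P. cen (\<ominus> q g (fst zta) \<oplus> \<ominus> q g (snd zta)))"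
  unfolding Sbar_def using cl q_closed[OF g(1)]
  by (subst A.finsum_mult_finsum) (auto intro!: A.finsum_cong' simp: cen_add)
 have "(\<Oplus>.A zta\<in>?P. cen (q g (fst zta) \<oplus> q g (snd zta))) = (\<Oplus>.A zta\<in>phi ` ?P. cen (q g (fst zta) \<oplus> q g (snd zta)))"
  unfolding surj ..
 also have "... = (\<Oplus>.A zta\<in>?P. cen (q g (fst (phi zta)) \<oplus> q g (snd (phi zta))))"
  using inj phiP q_closed[OF g(1)] by (intro A.finsum_reindex) (auto simp: surj)
 also have "... = (\<Oplus>.A zta\<in>?P. cen (\<ominus> q g (fst zta) \<oplus> \<ominus> q g (snd zta)))"
  using q_closed[OF g(1)] by (intro A.finsum_cong') (auto simp: phi_def val)
 finally show ?thesis unfolding 1 2 .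
qed

end

section \<open>Endomorphism rings and the regular representation\<close>

text \<open>Maps act on the right, so the product applies the left factor first.\<close>

definition endo_ring :: "('w, 'n) ring_scheme => ('w => 'w) ring" where
 "endo_ring W = \<lparr>carrier = {f : Cr W \<rightarrow>\<^sub>E Cr W. \<forall>x\<in>Cr W. \<forall>y\<in>Cr W. f (x \<oplus>.W y) = f x \<oplus>.W f y},
   monoid.mult = (\<lambda>f g. compose (Cr W) g f), monoid.one = (\<lambda>x\<in>Cr W. x),
   ring.zero = (\<lambda>x\<in>Cr W. \<zero>.W), ring.add = (\<lambda>f g. \<lambda>x\<in>Cr W. f x \<oplus>.W g x)\<rparr>"

context abelian_group
begin

abbreviation EG where "EG == endo_ring G"

lemma endo_simps:
 "f : Cr (endo_ring G) <-> f : Cr G \<rightarrow>\<^sub>E Cr G & (\<forall>x\<in>Cr G. \<forall>y\<in>Cr G. f (x \<oplus> y) = f x \<oplus> f y)"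
 "\<one>.EG = (\<lambda>x\<in>Cr G. x)" "\<zero>.EG = (\<lambda>x\<in>Cr G. \<zero>)"
 "f **.EG g = compose (Cr G) g f"
 "f \<oplus>.EG g = (\<lambda>x\<in>Cr G. f x \<oplus> g x)"
 by (auto simp: endo_ring_def)

lemma endo_apply:
 "x : Cr G ==> \<one>.EG x = x" "x : Cr G ==> \<zero>.EG x = \<zero>"
 "x : Cr G ==> (f **.EG g) x = g (f x)"
 "x : Cr G ==> (f \<oplus>.EG g) x = f x \<oplus> g x"
 by (auto simp: endo_simps compose_eq)

lemma endo_D:
 assumes "f : Cr (endo_ring G)"
 shows "x : Cr G ==> f x : Cr G" "x : Cr G ==> y : Cr G ==> f (x \<oplus> y) = f x \<oplus> f y"
  "f : extensional (Cr G)" "f \<zero> = \<zero>" "x : Cr G ==> f (\<ominus> x) = \<ominus> f x"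
proof -
 show 1: "x : Cr G ==> f x : Cr G" "x : Cr G ==> y : Cr G ==> f (x \<oplus> y) = f x \<oplus> f y"
  "f : extensional (Cr G)" for x y
  using assms by (auto simp: endo_simps PiE_def)
 have "f \<zero> \<oplus> f \<zero> = f \<zero> \<oplus> \<zero>" using 1(2)[of \<zero> \<zero>] 1(1)[of \<zero>] by simp
 then show z: "f \<zero> = \<zero>" using 1(1)[of \<zero>] by (simp only: add.l_cancel zero_closed)
 show "x : Cr G ==> f (\<ominus> x) = \<ominus> f x" for x
  using 1(2)[of "\<ominus> x" x] 1(1) z minus_equality[of "f (\<ominus> x)" "f x"] by (simp add: l_neg)
qed

lemma endo_eqI:
 assumes "f : Cr (endo_ring G)" "g : Cr (endo_ring G)" "!!x. x : Cr G ==> f x = g x"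
 shows "f = g"
 using assms endo_D(3) by (intro extensionalityI[of f "Cr G" g]) auto

lemma endo_ring_ring: "ring (endo_ring G)"
proof (rule ringI)
 show "abelian_group (endo_ring G)"
 proof (rule abelian_groupI)
  fix f g assume fg: "f : Cr (endo_ring G)" "g : Cr (endo_ring G)"
  show "f \<oplus>.EG g : Cr (endo_ring G)"
   unfolding endo_simps(1)
  proof (intro conjI ballI)
   show "f \<oplus>.EG g : Cr G \<rightarrow>\<^sub>E Cr G"
    unfolding endo_simps(5) using endo_D(1)[OF fg(1)] endo_D(1)[OF fg(2)] by auto
   fix x y assume xy: "x : Cr G" "y : Cr G"
   have c: "f x : Cr G" "f y : Cr G" "g x : Cr G" "g y : Cr G"
    using xy endo_D(1)[OF fg(1)] endo_D(1)[OF fg(2)] by auto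
   have "(f x \<oplus> f y) \<oplus> (g x \<oplus> g y) = (f x \<oplus> g x) \<oplus> (f y \<oplus> g y)" using c by (simp add: a_ac)
   then show "(f \<oplus>.EG g) (x \<oplus> y) = (f \<oplus>.EG g) x \<oplus> (f \<oplus>.EG g) y"
    using xy endo_D(2)[OF fg(1) xy] endo_D(2)[OF fg(2) xy] by (simp add: endo_apply)
  qed
  show "f \<oplus>.EG g = g \<oplus>.EG f"
   unfolding endo_simps(5) using endo_D(1)[OF fg(1)] endo_D(1)[OF fg(2)] by (intro restrict_ext) (simp add: a_comm)
  fix k assume k: "k : Cr (endo_ring G)"
  show "f \<oplus>.EG g \<oplus>.EG k = f \<oplus>.EG (g \<oplus>.EG k)"
   unfolding endo_simps(5) using endo_D(1)[OF fg(1)] endo_D(1)[OF fg(2)] endo_D(1)[OF k]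
   by (intro restrict_ext) (simp add: a_assoc)
 next
  show "\<zero>.EG : Cr (endo_ring G)" unfolding endo_simps by auto
 next
  fix f assume f: "f : Cr (endo_ring G)"
  show "\<zero>.EG \<oplus>.EG f = f"
   unfolding endo_simps using endo_D[OF f] by (auto simp: extensional_def restrict_def)
  show "\<exists>g\<in>Cr (endo_ring G). g \<oplus>.EG f = \<zero>.EG"
  proof (rule bexI[of _ "\<lambda>x\<in>Cr G. \<ominus> f x"])
   show "(\<lambda>x\<in>Cr G. \<ominus> f x) \<oplus>.EG f = \<zero>.EG"
    unfolding endo_simps using endo_D[OF f] by (auto simp: l_neg intro!: restrict_ext)
   show "(\<lambda>x\<in>Cr G. \<ominus> f x) : Cr (endo_ring G)"
    unfolding endo_simps using endo_D[OF f] by (auto simp: minus_add a_comm)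
  qed
 qed
 show "Group.monoid (endo_ring G)"
 proof (rule monoidI)
  fix f g assume fg: "f : Cr (endo_ring G)" "g : Cr (endo_ring G)"
  show "f **.EG g : Cr (endo_ring G)"
   unfolding endo_simps(1)
  proof (intro conjI ballI)
   show "f **.EG g : Cr G \<rightarrow>\<^sub>E Cr G"
    unfolding endo_simps(4) compose_def using endo_D(1)[OF fg(1)] endo_D(1)[OF fg(2)] by auto
   fix x y assume xy: "x : Cr G" "y : Cr G"
   then show "(f **.EG g) (x \<oplus> y) = (f **.EG g) x \<oplus> (f **.EG g) y"
    using endo_D(2)[OF fg(1) xy] endo_D(2)[OF fg(2)] endo_D(1)[OF fg(1)] by (simp add: endo_apply)
  qed
  fix k assume k: "k : Cr (endo_ring G)"
  show "f **.EG g **.EG k = f **.EG (g **.EG k)"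
   unfolding endo_simps(4) compose_def using endo_D(1)[OF fg(1)] by (intro restrict_ext) simp
 next
  show "\<one>.EG : Cr (endo_ring G)" unfolding endo_simps by auto
 next
  fix f assume f: "f : Cr (endo_ring G)"
  show "\<one>.EG **.EG f = f" "f **.EG \<one>.EG = f"
   unfolding endo_simps using endo_D[OF f] by (auto simp: compose_def extensional_def restrict_def)
 qed
 fix f g k assume c: "f : Cr (endo_ring G)" "g : Cr (endo_ring G)" "k : Cr (endo_ring G)"
 note d = endo_D(1,2)[OF c(1)] endo_D(1,2)[OF c(2)] endo_D(1,2)[OF c(3)]
 show "(f \<oplus>.EG g) **.EG k = f **.EG k \<oplus>.EG g **.EG k"
  "k **.EG (f \<oplus>.EG g) = k **.EG f \<oplus>.EG k **.EG g"
  unfolding endo_simps(4,5) compose_def by (intro restrict_ext, simp add: d)+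
qed

lemma endo_finsum_apply:
 assumes "finite I" "!!i. i : I ==> f i : Cr (endo_ring G)" "x : Cr G"
 shows "(\<Oplus>.EG i\<in>I. f i) x = (\<Oplus>i\<in>I. f i x)"
proof -
 interpret A: ring "endo_ring G" by (rule endo_ring_ring)
 show ?thesis
  using assms(1,2)
 proof (induction I rule: finite_induct)
  case empty
  then show ?case using assms(3) by (simp add: endo_apply)
 next
  case (insert i I)
  have "f j x : Cr G" if "j : insert i I" for j using insert that endo_D(1) assms(3) by blast
  then show ?case using insert assms(3) by (simp add: Pi_iff endo_apply)
 qed
qed

lemma endo_add_pow_apply:
 assumes "f : Cr (endo_ring G)" "x : Cr G"
 shows "([(n::nat)] \<cdot>.EG f) x = [n] \<cdot>.G (f x)"
proof -
 interpret A: ring "endo_ring G" by (rule endo_ring_ring)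
 show ?thesis
  using assms by (induction n) (auto simp: endo_apply endo_D)
qed

end

lemma (in cring) geometric_sum:
 assumes "c : Cr R"
 shows "(c \<ominus> \<one>) ** (\<Oplus>i\<in>{..<n::nat}. c [^] i) = c [^] n \<ominus> \<one>"
proof (induction n)
 case 0
 then show ?case using assms by (simp add: a_minus_def r_neg)
next
 case (Suc n)
 have s: "(\<Oplus>i\<in>{..<n}. c [^] i) : Cr R" using assms by auto
 have "(\<Oplus>i\<in>{..<Suc n}. c [^] i) = c [^] n \<oplus> (\<Oplus>i\<in>{..<n}. c [^] i)"
  using assms by (simp add: lessThan_Suc)
 then have "(c \<ominus> \<one>) ** (\<Oplus>i\<in>{..<Suc n}. c [^] i) = (c \<ominus> \<one>) ** c [^] n \<oplus> (c [^] n \<ominus> \<one>)"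
  using assms s Suc by (simp add: r_distr)
 also have "... = c ** c [^] n \<ominus> \<one>"
 proof -
  have d: "d : Cr R ==> (c \<ominus> \<one>) ** d \<oplus> (d \<ominus> \<one>) = c ** d \<ominus> \<one>" for d
   using assms by algebra
  show ?thesis by (rule d) (use assms in simp)
 qed
 finally show ?case using assms by (simp add: m_comm)
qed

text \<open>As \<open>B\<close> is only additive, its invariance under \<open>c\<close> is not a
  scalar equation. Summing over the powers of \<open>c\<close> instead exhibits \<open>n\<close>
  times \<open>B x\<close> as the value of \<open>B\<close> at zero.\<close>

lemma (in module) invariant_additive_torsion:
 assumes B: "!!x. x : Cr M ==> B x : Cr M"
  "!!x y. x : Cr M ==> y : Cr M ==> B (x \<oplus>.M y) = B x \<oplus>.M B y"
  and c: "c : Cr R" "!!x. x : Cr M ==> B (c \<odot>.M x) = B x"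
  and sum: "(\<Oplus>.R i\<in>{..<n::nat}. c [^].R i) = \<zero>.R" and x: "x : Cr M"
 shows "[n] \<cdot>.M B x = \<zero>.M"
proof -
 have pow: "B (c [^].R i \<odot>.M x) = B x" for i :: nat
 proof (induction i)
  case (Suc i)
  have "c [^].R Suc i \<odot>.M x = c \<odot>.M (c [^].R i \<odot>.M x)"
   using c x by (simp add: smult_assoc1[symmetric] R.m_comm)
  then show ?case using Suc c x by simp
 qed (use x in simp)
 have z: "B \<zero>.M = \<zero>.M"
  using B(2)[of "\<zero>.M" "\<zero>.M"] B(1)[of "\<zero>.M"] M.add.l_cancel[of "B \<zero>.M" "B \<zero>.M" "\<zero>.M"] by simp
 have "B ((\<Oplus>.R i\<in>{..<m}. c [^].R i) \<odot>.M x) = [m] \<cdot>.M B x" for m :: nat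
 proof (induction m)
  case (Suc m)
  have "(\<Oplus>.R i\<in>{..<m}. c [^].R i) : Cr R" using c by auto
  then show ?case using Suc c x pow B by (simp add: lessThan_Suc smult_l_distr M.a_comm)
 qed (use x z in simp)
 from this[of n] show ?thesis using sum x z by simp
qed

lemma (in module) smult_finsum_l:
 "finite I ==> (!!i. i : I ==> f i : Cr R) ==> x : Cr M ==>
  (\<Oplus>.R i\<in>I. f i) \<odot>.M x = (\<Oplus>.M i\<in>I. f i \<odot>.M x)"
 by (induction I rule: finite_induct) (auto simp: smult_l_distr Pi_iff)

text \<open>A root of unity \<open>\<epsilon>\<close> of order \<open>p\<close> turns \<open>F\<^sub>p\<close> into scalars by \<open>z \<mapsto> \<epsilon>\<^sup>z\<close>.\<close>

locale char_data = heis K V p h + Q: "domain" Q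
 for K :: "('k, 'm) ring_scheme" (structure) and V :: "('k, 'v, 'n) module_scheme" and p :: nat and h
  and Q :: "('q, 'c) ring_scheme" +
 fixes eps :: 'q
 assumes eps: "eps : Cr Q" "eps [^].Q p = \<one>.Q" "eps ~= \<one>.Q"
  and pQ: "[p] \<cdot>.Q \<one>.Q ~= \<zero>.Q"
begin

definition chi where "chi z = eps [^].Q idx z"

lemma chi_closed [simp]: "chi z : Cr Q"
 by (simp add: chi_def eps)

lemma eps_pow_mod: "eps [^].Q (n mod p) = eps [^].Q n"
proof -
 have "eps [^].Q n = eps [^].Q (n div p * p + n mod p)" by simp
 also have "... = (eps [^].Q p) [^].Q (n div p) **.Q eps [^].Q (n mod p)"
  using eps(1) Q.nat_pow_mult[of eps "n div p * p" "n mod p"] Q.nat_pow_pow[of eps p "n div p"]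
  by (simp only: mult.commute[of p])
 finally show ?thesis using eps by simp
qed

lemma chi_add: "z : prime_field K ==> w : prime_field K ==> chi (z \<oplus> w) = chi z **.Q chi w"
 using idx_add[of z w] eps_pow_mod[of "idx (z \<oplus> w)"] eps_pow_mod[of "idx z + idx w"] eps(1)
 by (simp add: chi_def Q.nat_pow_mult)

lemma chi_zero [simp]: "chi \<zero> = \<one>.Q"
 by (simp add: chi_def)

lemma eps_pow_inj: "eps [^].Q (n::nat) = \<one>.Q <-> p dvd n"
proof
 assume n: "eps [^].Q n = \<one>.Q"
 show "p dvd n"
 proof (rule ccontr)
  assume "~ p dvd n"
  then have "coprime n p" using prime_p by (metis coprime_commute prime_imp_coprime)
  then obtain x where "[n * x = 1] (mod p)" using cong_solve_coprime_nat[of n p] by auto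
  then have "eps [^].Q (n * x) = eps [^].Q (1::nat)"
   using eps_pow_mod[of "n * x"] eps_pow_mod[of 1] by (simp add: cong_def)
  moreover have "eps [^].Q (n * x) = \<one>.Q" using n eps(1) by (simp add: Q.nat_pow_pow[symmetric])
  ultimately show False using eps by simp
 qed
next
 assume "p dvd n"
 then show "eps [^].Q n = \<one>.Q" using eps_pow_mod[of n] by auto
qed

lemma chi_eq_1_iff: "z : prime_field K ==> chi z = \<one>.Q <-> z = \<zero>"
 unfolding chi_def eps_pow_inj using idx(2)[of z] idx_eq_0_iff[of z] by (auto dest: dvd_imp_le)

text \<open>For nonzero \<open>z\<close> the scalar \<open>chi z\<close> is a root of unity other
  than one, so its first \<open>p\<close> powers add up to zero. By the preceding lemma, invariance
  under it then means being killed by \<open>p\<close>, which \<open>tors\<close> excludes.\<close>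

lemma intertwiner_scalar:
 assumes M: "module Q W"
  and rho: "!!e. e : Cr E ==> rho e : Cr (endo_ring W)"
   "!!e e'. e : Cr E ==> e' : Cr E ==> rho (e **.E e') = rho e **\<^bsub>endo_ring W\<^esub> rho e'"
  and scal: "!!z w. z : prime_field K ==> w : Cr W ==> rho (\<zero>.V, z) w = chi z \<odot>.W w"
  and tors: "!!w. w : Cr W ==> [p] \<cdot>.W w = \<zero>.W ==> w = \<zero>.W"
 shows "intertwiner K V p h (endo_ring W) rho"
proof -
 interpret W: module Q W by fact
 interpret A: ring "endo_ring W" by (rule W.endo_ring_ring)
 have cE: "z : prime_field K ==> (\<zero>.V, z) : Cr E" for z by (simp add: E_carrier)
 show ?thesis
 proof (intro intertwiner.intro intertwiner_axioms.intro heis_axioms W.endo_ring_ring)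
  show "rho \<one>.E = \<one>\<^bsub>endo_ring W\<^esub>"
   by (rule W.endo_eqI) (use rho(1)[OF cE, of \<zero>] scal[of \<zero>] in \<open>auto simp: E_one W.endo_apply\<close>)
 next
  fix z B assume z: "z : prime_field K" "z ~= \<zero>" and B: "B : Cr (endo_ring W)"
   and eq: "rho (\<zero>.V, z) **\<^bsub>endo_ring W\<^esub> B = B"
  have inv: "B (chi z \<odot>.W w) = B w" if w: "w : Cr W" for w
   using arg_cong[OF eq, of "\<lambda>f. f w"] w z by (simp add: W.endo_apply scal)
  have "(chi z \<ominus>.Q \<one>.Q) **.Q (\<Oplus>.Q i\<in>{..<p}. chi z [^].Q i) = \<zero>.Q"
  proof -
   have "chi z [^].Q p = (eps [^].Q p) [^].Q idx z"
    using eps(1) by (simp add: chi_def Q.nat_pow_pow mult.commute)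
   then show ?thesis using eps by (simp add: Q.geometric_sum)
  qed
  moreover have "chi z \<ominus>.Q \<one>.Q ~= \<zero>.Q" using chi_eq_1_iff z by simp
  ultimately have sum: "(\<Oplus>.Q i\<in>{..<p}. chi z [^].Q i) = \<zero>.Q"
   using Q.integral[of "chi z \<ominus>.Q \<one>.Q" "\<Oplus>.Q i\<in>{..<p}. chi z [^].Q i"] by auto
  show "B = \<zero>\<^bsub>endo_ring W\<^esub>"
  proof (rule W.endo_eqI[OF B A.zero_closed])
   fix w assume w: "w : Cr W"
   have "[p] \<cdot>.W B w = \<zero>.W"
    using W.invariant_additive_torsion[of B "chi z" p w] W.endo_D[OF B] inv sum w by simp
   then show "B w = \<zero>\<^bsub>endo_ring W\<^esub> w" using tors W.endo_D(1)[OF B w] w by (simp add: W.endo_apply)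
  qed
 next
  fix B assume B: "B : Cr (endo_ring W)" and eq: "[p] \<cdot>\<^bsub>endo_ring W\<^esub> B = \<zero>\<^bsub>endo_ring W\<^esub>"
  show "B = \<zero>\<^bsub>endo_ring W\<^esub>"
  proof (rule W.endo_eqI[OF B A.zero_closed])
   fix w assume w: "w : Cr W"
   have "[p] \<cdot>.W B w = \<zero>.W"
    using W.endo_add_pow_apply[OF B w, of p] eq w by (simp add: W.endo_apply)
   then show "B w = \<zero>\<^bsub>endo_ring W\<^esub> w" using tors W.endo_D(1)[OF B w] w by (simp add: W.endo_apply)
  qed
 qed (use rho in auto)
qed

text \<open>The regular representation: \<open>(x, z)\<close> translates a function on \<open>V\<close> by \<open>x\<close> and twists it by a power
 of \<open>\<epsilon>\<close>.\<close>

abbreviation Fun where "Fun == Q.func_space (Cr V)"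

abbreviation EF where "EF == endo_ring Fun"

sublocale Fun: module Q Fun by (rule Q.func_space_is_module)

lemma Fun_simps: "Cr Fun = Cr V \<rightarrow>\<^sub>E Cr Q" "\<zero>.Fun = (\<lambda>v\<in>Cr V. \<zero>.Q)"
 "phi \<oplus>.Fun psi = (\<lambda>v\<in>Cr V. phi v \<oplus>.Q psi v)"
 by (simp_all add: Q.func_space_def)

lemma Fun_finsum_apply:
 assumes "finite I" "!!i. i : I ==> f i : Cr Fun" "v : Cr V"
 shows "(\<Oplus>.Fun i\<in>I. f i) v = (\<Oplus>.Q i\<in>I. f i v)"
 using assms(1,2)
proof (induction I rule: finite_induct)
 case empty
 then show ?case using assms(3) by (simp add: Fun_simps)
next
 case (insert i I)
 have "f j v : Cr Q" if "j : insert i I" for j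
  using insert(4)[OF that] assms(3) by (auto simp: Fun_simps)
 then show ?case using insert assms(3) by (simp add: Pi_iff Fun_simps(3))
qed

lemma Fun_add_pow_apply:
 assumes "f : Cr Fun" "v : Cr V"
 shows "([(n::nat)] \<cdot>.Fun f) v = [n] \<cdot>.Q (f v)"
proof -
 have "f v : Cr Q" using assms by (auto simp: Fun_simps)
 then show ?thesis using assms by (induction n) (auto simp: Fun_simps(2,3))
qed

definition reg where
 "reg = (\<lambda>(x, z). \<lambda>phi\<in>Cr Fun. \<lambda>w\<in>Cr V. chi (z \<oplus> h x w) **.Q phi (w \<oplus>.V x))"

lemma reg_apply: "phi : Cr Fun ==> w : Cr V ==> reg (x, z) phi w = chi (z \<oplus> h x w) **.Q phi (w \<oplus>.V x)"
 by (simp add: reg_def)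

lemma reg_maps:
 assumes "x : Cr V" "phi : Cr Fun" shows "reg (x, z) phi : Cr Fun"
proof -
 have "phi v : Cr Q" if "v : Cr V" for v using assms that by (auto simp: Fun_simps)
 then show ?thesis using assms by (auto simp: reg_def Fun_simps)
qed

lemma Fun_eqI: "phi : Cr Fun ==> psi : Cr Fun ==> (!!v. v : Cr V ==> phi v = psi v) ==> phi = psi"
 unfolding Fun_simps by (rule PiE_ext)

lemma reg_closed:
 assumes "e : Cr E" shows "reg e : Cr (endo_ring Fun)"
proof -
 obtain x z where e: "e = (x, z)" "x : Cr V" "z : prime_field K" using assms by (auto simp: E_carrier)
 have "reg (x, z) (phi \<oplus>.Fun psi) = reg (x, z) phi \<oplus>.Fun reg (x, z) psi"
  if p: "phi : Cr Fun" "psi : Cr Fun" for phi psi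
 proof (rule Fun_eqI)
  show "reg (x, z) (phi \<oplus>.Fun psi) : Cr Fun" using reg_maps e p by simp
  show "reg (x, z) phi \<oplus>.Fun reg (x, z) psi : Cr Fun" using reg_maps e p by simp
  fix w assume w: "w : Cr V"
  have "phi (w \<oplus>.V x) : Cr Q" "psi (w \<oplus>.V x) : Cr Q" using p w e by (auto simp: Fun_simps)
  then show "reg (x, z) (phi \<oplus>.Fun psi) w = (reg (x, z) phi \<oplus>.Fun reg (x, z) psi) w"
   using w e p reg_apply[OF p(1) w] reg_apply[OF p(2) w]
   by (simp add: reg_apply[OF Fun.a_closed[OF p] w]) (simp add: Fun_simps(3) Q.r_distr)
 qed
 moreover have "reg (x, z) : extensional (Cr Fun)" by (simp add: reg_def)
 ultimately show ?thesis
  using reg_maps e by (auto simp: Fun.endo_simps PiE_def)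
qed

lemma reg_mult:
 assumes e: "e : Cr E" "e' : Cr E"
 shows "reg (e **.E e') = reg e **.EF reg e'"
proof -
 interpret E: group E by (rule E_group)
 interpret A: ring "endo_ring Fun" by (rule Fun.endo_ring_ring)
 obtain x z y w where s: "e = (x, z)" "x : Cr V" "z : prime_field K"
   "e' = (y, w)" "y : Cr V" "w : prime_field K" using assms by (auto simp: E_carrier)
 show ?thesis
 proof (rule Fun.endo_eqI)
  show "reg (e **.E e') : Cr (endo_ring Fun)" using reg_closed e by simp
  show "reg e **.EF reg e' : Cr (endo_ring Fun)" using reg_closed e by simp
  fix phi assume phi: "phi : Cr Fun"
  have "(reg e **.EF reg e') phi = reg (y, w) (reg (x, z) phi)"
   using Fun.endo_apply(3)[OF phi] by (simp add: s)
  moreover have "reg (e **.E e') phi = reg (y, w) (reg (x, z) phi)"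
  proof (rule Fun_eqI)
   show "reg (e **.E e') phi : Cr Fun" using Fun.endo_D(1)[OF reg_closed] e phi by simp
   show "reg (y, w) (reg (x, z) phi) : Cr Fun" using reg_maps s phi by simp
   fix v assume v: "v : Cr V"
   have c: "phi (v \<oplus>.V y \<oplus>.V x) : Cr Q" using phi s v by (auto simp: Fun_simps)
   have "reg (y, w) (reg (x, z) phi) v = chi (w \<oplus> h y v) **.Q (chi (z \<oplus> h x (v \<oplus>.V y)) **.Q phi (v \<oplus>.V y \<oplus>.V x))"
    using s v phi reg_maps by (simp add: reg_apply)
   also have "... = chi ((w \<oplus> h y v) \<oplus> (z \<oplus> h x (v \<oplus>.V y))) **.Q phi (v \<oplus>.V y \<oplus>.V x)"
    using s v c by (simp add: Q.m_assoc[symmetric] chi_add h_closed)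
   also have "(w \<oplus> h y v) \<oplus> (z \<oplus> h x (v \<oplus>.V y)) = (z \<oplus> w \<oplus> h x y) \<oplus> h (x \<oplus>.V y) v"
    using s v by (simp add: h_add_l h_add_r F.a_ac)
   also have "v \<oplus>.V y \<oplus>.V x = v \<oplus>.V (x \<oplus>.V y)" using s v by (simp add: M.a_ac)
   also have "chi ((z \<oplus> w \<oplus> h x y) \<oplus> h (x \<oplus>.V y) v) **.Q phi (v \<oplus>.V (x \<oplus>.V y)) = reg (e **.E e') phi v"
    using s v phi by (simp add: E_mult reg_apply)
   finally show "reg (e **.E e') phi v = reg (y, w) (reg (x, z) phi) v" ..
  qed
  ultimately show "reg (e **.E e') phi = (reg e **.EF reg e') phi" by simp
 qed
qed

lemma reg_central: "z : prime_field K ==> phi : Cr Fun ==> v : Cr V ==> reg (\<zero>.V, z) phi v = chi z **.Q phi v"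
 by (simp add: reg_apply)

sublocale reg: intertwiner K V p h "endo_ring Fun" reg
proof (rule intertwiner_scalar[OF Fun.module_axioms reg_closed reg_mult])
 fix z phi assume z: "z : prime_field K" and phi: "phi : Cr Fun"
 show "reg (\<zero>.V, z) phi = chi z \<odot>.Fun phi"
  by (rule Fun_eqI) (use z phi reg_maps in \<open>auto simp: reg_central\<close>, simp add: Q.func_space_def)
next
 fix phi assume phi: "phi : Cr Fun" and eq: "[p] \<cdot>.Fun phi = \<zero>.Fun"
 show "phi = \<zero>.Fun"
 proof (rule Fun_eqI[OF phi])
  fix v assume v: "v : Cr V"
  have c: "phi v : Cr Q" using phi v by (auto simp: Fun_simps)
  have "[p] \<cdot>.Q phi v = \<zero>.Q"
   using Fun_add_pow_apply[OF phi v, of p] eq v by (simp add: Fun_simps)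
  then have "([p] \<cdot>.Q \<one>.Q) **.Q phi v = \<zero>.Q" using c by (simp add: Q.add_pow_ldistr)
  then show "phi v = \<zero>.Fun v" using pQ c v Q.integral[of "[p] \<cdot>.Q \<one>.Q" "phi v"] by (simp add: Fun_simps)
 qed simp
qed

lemma reg_T_apply:
 assumes g: "g : Cr G" and phi: "phi : Cr Fun" and v: "v : Cr V"
 shows "reg.T g phi v = (\<Oplus>.Q x\<in>Cr V. reg (u g x) phi v)"
proof -
 have "reg.T g phi = (\<Oplus>.Fun x\<in>Cr V. reg (u g x) phi)"
  unfolding reg.T_def using fin_V g u_closed phi reg_closed by (intro Fun.endo_finsum_apply) auto
 then show ?thesis
  using fin_V g u_closed phi v reg_closed Fun.endo_D(1)[OF reg_closed] by (simp add: Fun_finsum_apply)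
qed

definition Schar where "Schar g g' = (\<Oplus>.Q xi\<in>pairs g g'. chi (q g xi))"
definition Scharbar where "Scharbar g g' = (\<Oplus>.Q xi\<in>pairs g g'. chi (\<ominus> q g xi))"

lemma Schar_closed [simp]: "Schar g g' : Cr Q" "Scharbar g g' : Cr Q"
 by (simp_all add: Schar_def Scharbar_def)

text \<open>The scalar is the same for every module with central character \<open>chi\<close>. This
  is why relations between the sums may be proved on the functions on \<open>V\<close> and used on
  \<open>W\<close>.\<close>

lemma S_scalar:
 assumes M: "module Q W" and i: "intertwiner K V p h (endo_ring W) rho"
  and scal: "!!z w. z : prime_field K ==> w : Cr W ==> rho (\<zero>.V, z) w = chi z \<odot>.W w"
  and g: "g : Cr G" and w: "w : Cr W"
 shows "intertwiner.S V h (endo_ring W) rho g g' w = Schar g g' \<odot>.W w"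
  "intertwiner.Sbar K V h (endo_ring W) rho g g' w = Scharbar g g' \<odot>.W w"
proof -
 interpret W: module Q W by fact
 interpret I: intertwiner K V p h "endo_ring W" rho by fact
 note qc = q_closed[OF g]
 show "I.S g g' w = Schar g g' \<odot>.W w"
  unfolding I.S_def Schar_def using w qc
  by (subst W.endo_finsum_apply) (auto simp: W.smult_finsum_l scal intro!: W.M.finsum_cong')
 show "I.Sbar g g' w = Scharbar g g' \<odot>.W w"
  unfolding I.Sbar_def Scharbar_def using w qc
  by (subst W.endo_finsum_apply) (auto simp: W.smult_finsum_l scal intro!: W.M.finsum_cong')
qed

end

section \<open>Determinants over a ring given as a record\<close>

text \<open>Determinants are only available for type classes, so a matrix whose entries are integer
 polynomials in \<open>\<epsilon>\<close> is lifted to a matrix over \<open>\<int>[t]\<close>; the evaluation at \<open>\<epsilon>\<close> of the determinant of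
 the lift depends only on the entries, by the Leibniz formula.\<close>

lemma det_transfer:
 fixes rel :: "'a::comm_ring_1 \<Rightarrow> 'b::comm_ring_1 \<Rightarrow> bool"
 assumes "rel 0 0" "rel 1 1" "\<And>x y x' y'. rel x x' ==> rel y y' ==> rel (x + y) (x' + y')"
  "\<And>x y x' y'. rel x x' ==> rel y y' ==> rel (x * y) (x' * y')" "\<And>x x'. rel x x' ==> rel (- x) (- x')"
  and A: "A \<in> carrier_mat n n" and B: "B \<in> carrier_mat n n"
  and AB: "\<And>i j. i < n ==> j < n ==> rel (A $$ (i, j)) (B $$ (i, j))"
 shows "rel (det A) (det B)"
proof -
 have sum: "rel (sum f S) (sum g S)" if "\<And>i. i \<in> S ==> rel (f i) (g i)" for f g and S :: "(nat \<Rightarrow> nat) set"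
  using that by (induction S rule: infinite_finite_induct) (auto intro: assms)
 have prod: "rel (prod f S) (prod g S)" if "\<And>i. i \<in> S ==> rel (f i) (g i)" for f g and S :: "nat set"
  using that by (induction S rule: infinite_finite_induct) (auto intro: assms)
 have "rel (signof q * (\<Prod>i = 0..<n. A $$ (i, q i))) (signof q * (\<Prod>i = 0..<n. B $$ (i, q i)))"
  if q: "q permutes {0..<n}" for q
 proof -
  have "rel (signof q) (signof q)" by (auto simp: sign_def intro: assms)
  moreover have "rel (\<Prod>i = 0..<n. A $$ (i, q i)) (\<Prod>i = 0..<n. B $$ (i, q i))"
   using permutes_in_image[OF q] by (intro prod AB) auto
  ultimately show ?thesis by (rule assms(4))
 qed
 then show ?thesis unfolding det_def'[OF A] det_def'[OF B] by (intro sum) auto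
qed

context cring
begin

text \<open>The ring homomorphism from the integer polynomials that sends the variable to
  \<open>e\<close>, by Horner's rule.\<close>

definition pev :: "'a \<Rightarrow> int poly \<Rightarrow> 'a" where
 "pev e f = fold_coeffs (\<lambda>a x. [a] \<cdot>.R \<one> \<oplus> e \<otimes> x) f \<zero>"

lemma add_pow_int_zero [simp]: "[(0::int)] \<cdot>.R x = \<zero>"
 by (simp add: add_pow_int_ge)

lemma pev_0 [simp]: "pev e 0 = \<zero>"
 by (simp add: pev_def)

lemma pev_pCons: "e \<in> Cr R ==> pev e (pCons a f) = [a] \<cdot>.R \<one> \<oplus> e \<otimes> pev e f"
 by (cases "a = 0 \<and> f = 0") (auto simp: pev_def fold_coeffs_pCons_not_0_0_eq fold_coeffs_pCons_coeff_not_0_eq)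

lemma pev_closed [simp]: "e \<in> Cr R ==> pev e f \<in> Cr R"
 by (induction f) (auto simp: pev_pCons)

lemma pev_1 [simp]: "e \<in> Cr R ==> pev e 1 = \<one>"
 by (simp add: one_pCons pev_pCons)

lemma pev_add:
 assumes e: "e \<in> Cr R" shows "pev e (f + g) = pev e f \<oplus> pev e g"
proof (induction f g rule: poly_induct2)
 case (pCons a f b g)
 have "[(a + b)] \<cdot>.R \<one> = [a] \<cdot>.R \<one> \<oplus> [b] \<cdot>.R \<one>" by (simp add: add.int_pow_mult)
 then show ?case using e pCons by (simp add: pev_pCons r_distr a_ac)
qed simp

lemma pev_uminus:
 assumes e: "e \<in> Cr R" shows "pev e (- f) = \<ominus> pev e f"
 using pev_add[OF e, of "- f" f] e minus_equality[of "pev e (- f)" "pev e f"] by simp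

lemma pev_smult:
 assumes e: "e \<in> Cr R" shows "pev e (Polynomial.smult c f) = [c] \<cdot>.R pev e f"
proof (induction f)
 case (pCons a f)
 have "[(c * a)] \<cdot>.R \<one> = [c] \<cdot>.R ([a] \<cdot>.R \<one>)" by (simp add: add.int_pow_pow mult.commute)
 then show ?case using e pCons by (simp add: pev_pCons add.int_pow_distrib add_pow_rdistr_int)
qed simp

lemma pev_mult:
 assumes e: "e \<in> Cr R" shows "pev e (f * g) = pev e f \<otimes> pev e g"
proof (induction f)
 case (pCons a f)
 have "pev e (pCons a f * g) = [a] \<cdot>.R pev e g \<oplus> e \<otimes> (pev e f \<otimes> pev e g)"
  using e pCons by (simp add: pev_add pev_smult pev_pCons)
 also have "... = pev e (pCons a f) \<otimes> pev e g"
  using e by (simp add: pev_pCons l_distr m_assoc add_pow_ldistr_int)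
 finally show ?case .
qed (use e in simp)

lemma pev_power: "e \<in> Cr R ==> pev e (f ^ (k::nat)) = pev e f [^] k"
 by (induction k) (auto simp: pev_mult m_comm)

lemma pev_var: "e \<in> Cr R ==> pev e [:0, 1:] = e"
 by (simp add: pev_pCons)

lemma pev_of_nat: "e \<in> Cr R ==> pev e (of_nat k) = [k] \<cdot>.R \<one>"
 by (induction k) (auto simp: pev_add a_comm)

lemma pev_sum:
 "finite S ==> e \<in> Cr R ==> pev e (sum f S) = (\<Oplus>i\<in>S. pev e (f i))"
 by (induction S rule: finite_induct) (auto simp: pev_add)

definition pdet :: "'a \<Rightarrow> nat \<Rightarrow> (nat \<Rightarrow> nat \<Rightarrow> int poly) \<Rightarrow> 'a" where
 "pdet e n M = pev e (det (mat n n (\<lambda>(i, j). M i j)))"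

lemma pdet_closed [simp]: "e \<in> Cr R ==> pdet e n M \<in> Cr R"
 by (simp add: pdet_def)

text \<open>The factors \<open>a\<close> and \<open>b\<close> multiply whole matrices and so leave
  the determinant as \<open>n\<close>-th powers. Equality is assumed only after evaluation, as the
  lifts themselves need not agree.\<close>

lemma pdet_mult:
 assumes e: "e \<in> Cr R"
  and eq: "\<And>i j. i < n ==> j < n ==> pev e (b * (\<Sum>k<n. M i k * M' k j)) = pev e (a * M'' i j)"
 shows "pev e b [^] n \<otimes> (pdet e n M \<otimes> pdet e n M') = pev e a [^] n \<otimes> pdet e n M''"
proof -
 let ?m = "\<lambda>M. mat n n (\<lambda>(i, j). M i j)"
 have "pev e (det (b \<cdot>\<^sub>m (?m M * ?m M'))) = pev e (det (a \<cdot>\<^sub>m ?m M''))"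
 proof (rule det_transfer[where rel = "\<lambda>x y. pev e x = pev e y" and n = n])
  fix i j assume ij: "i < n" "j < n"
  then show "pev e ((b \<cdot>\<^sub>m (?m M * ?m M')) $$ (i, j)) = pev e ((a \<cdot>\<^sub>m ?m M'') $$ (i, j))"
   using eq[OF ij] by (simp add: scalar_prod_def lessThan_atLeast0)
 qed (auto simp: e pev_add pev_mult pev_uminus)
 moreover have "det (?m M * ?m M') = det (?m M) * det (?m M')" by (rule det_mult) auto
 ultimately show ?thesis
  using e by (simp add: pdet_def pev_mult pev_power)
qed

lemma pdet_one: "e \<in> Cr R ==> pdet e n (\<lambda>i j. if i = j then 1 else 0) = \<one>"
proof -
 assume e: "e \<in> Cr R"
 have "mat n n (\<lambda>(i, j). if i = j then 1 else 0) = (1\<^sub>m n :: int poly mat)" by (intro eq_matI) auto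
 then show ?thesis using e by (simp add: pdet_def)
qed

text \<open>The relation transferred through the Leibniz formula compares \<eta> of one evaluation
  with another evaluation, since \<eta> does not act on the polynomials.\<close>

lemma pdet_hom_transpose:
 assumes e: "e \<in> Cr R" and \<eta>: "\<eta> \<in> Ring.ring_hom R R"
  and eq: "\<And>i j. i < n ==> j < n ==> \<eta> (pev e (M i j)) = pev e (M' j i)"
 shows "\<eta> (pdet e n M) = pdet e n M'"
proof -
 interpret h: ring_hom_cring R R \<eta>
  by (simp add: ring_hom_cring_def ring_hom_cring_axioms_def is_cring \<eta>)
 let ?m = "\<lambda>M. mat n n (\<lambda>(i, j). M i j)"
 have "\<eta> (pev e (det (?m M))) = pev e (det (transpose_mat (?m M')))"
  by (rule det_transfer[where rel = "\<lambda>x y. \<eta> (pev e x) = pev e y" and n = n])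
   (auto simp: e eq pev_add pev_mult pev_uminus)
 moreover have "det (transpose_mat (?m M')) = det (?m M')" by (rule det_transpose) auto
 ultimately show ?thesis by (simp add: pdet_def)
qed

end

section \<open>Extraspecial 2-groups\<close>

lemma dihedral_group_group: "group (dihedral_group 4)"
proof (rule groupI)
 fix x y assume "x : Cr (dihedral_group 4)" "y : Cr (dihedral_group 4)"
 then show "x **\<^bsub>dihedral_group 4\<^esub> y : Cr (dihedral_group 4)"
  by (cases x; cases y) (auto simp: dihedral_group_def)
next
 show "\<one>\<^bsub>dihedral_group 4\<^esub> : Cr (dihedral_group 4)" by (auto simp: dihedral_group_def)
next
 fix x y z assume "x : Cr (dihedral_group 4)" "y : Cr (dihedral_group 4)" "z : Cr (dihedral_group 4)"
 show "x **\<^bsub>dihedral_group 4\<^esub> y **\<^bsub>dihedral_group 4\<^esub> z = x **\<^bsub>dihedral_group 4\<^esub> (y **\<^bsub>dihedral_group 4\<^esub> z)"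
  by (cases x; cases y; cases z) (auto simp: dihedral_group_def mod_simps algebra_simps)
next
 fix x assume x: "x : Cr (dihedral_group 4)"
 then show "\<one>\<^bsub>dihedral_group 4\<^esub> **\<^bsub>dihedral_group 4\<^esub> x = x"
  by (cases x) (auto simp: dihedral_group_def)
 obtain a s where as: "x = (a, s)" by (cases x)
 show "\<exists>y\<in>Cr (dihedral_group 4). y **\<^bsub>dihedral_group 4\<^esub> x = \<one>\<^bsub>dihedral_group 4\<^esub>"
  by (rule bexI[of _ "(if s then a else (- a) mod 4, s)"])
   (use x as in \<open>auto simp: dihedral_group_def mod_simps\<close>)
qed

lemma dihedral_carrier: "Cr (dihedral_group 4) = {0, 1, 2, 3} \<times> UNIV"
 by (auto simp: dihedral_group_def)

lemma dihedral_center: "group_center (dihedral_group 4) = {(0, False), (2, False)}"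
proof (intro equalityI subsetI)
 fix x assume x: "x : group_center (dihedral_group 4)"
 then obtain a s where as: "x = (a, s)" "a : {0, 1, 2, 3}" by (auto simp: group_center_def dihedral_carrier)
 have "x **\<^bsub>dihedral_group 4\<^esub> (1, False) = (1, False) **\<^bsub>dihedral_group 4\<^esub> x"
  "x **\<^bsub>dihedral_group 4\<^esub> (0, True) = (0, True) **\<^bsub>dihedral_group 4\<^esub> x"
  using x by (auto simp: group_center_def dihedral_carrier)
 then show "x : {(0, False), (2, False)}"
  using as by (auto simp: dihedral_group_def split: if_splits)
next
 fix x :: "int \<times> bool" assume "x : {(0, False), (2, False)}"
 then show "x : group_center (dihedral_group 4)"
  by (auto simp: group_center_def dihedral_group_def algebra_simps mod_simps) presburger+
qed

text \<open>Modulo \<open>{1, z}\<close> such a group is a vector space over the field with two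
  elements: commutators give an alternating form, nondegenerate by \<open>central\<close>, and
  squares give a quadratic form. What follows decomposes this quadratic space, phrased in group
  elements.\<close>

locale extraspecial2 = group E for E :: "('e, 'm) monoid_scheme" (structure) +
 fixes z :: 'e
 assumes fin: "finite (Cr E)" and z: "z : Cr E" "z ~= \<one>" "z ** z = \<one>"
  and z_central: "x : Cr E ==> x ** z = z ** x"
  and comm_cases: "x : Cr E ==> y : Cr E ==> x ** y = y ** x \<or> x ** y = y ** x ** z"
  and square: "x : Cr E ==> x ** x = \<one> \<or> x ** x = z"
  and central: "x : Cr E ==> (!!y. y : Cr E ==> x ** y = y ** x) ==> x = \<one> \<or> x = z"
begin

definition com where "com x y <-> x ** y = y ** x"

lemma com_sym: "com x y <-> com y x" by (auto simp: com_def)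

lemma z_ne: "x : Cr E ==> x ** z ~= x"
 using z by simp

lemma not_com: "x : Cr E ==> y : Cr E ==> ~ com x y <-> x ** y = y ** x ** z"
 using comm_cases[of x y] z_ne[of "y ** x"] by (auto simp: com_def)

text \<open>Additivity of the commutator form: \<open>com\<close> means value zero, and equivalence
  of truth values is the corresponding addition modulo two.\<close>

lemma com_mult:
 assumes c: "x : Cr E" "y : Cr E" "w : Cr E"
 shows "com x (y ** w) <-> (com x y <-> com x w)"
proof -
 define s where "s = (if com x y then \<one> else z)"
 define t where "t = (if com x w then \<one> else z)"
 have st: "s : Cr E" "t : Cr E" using z by (auto simp: s_def t_def)
 have 1: "x ** y = y ** x ** s" "x ** w = w ** x ** t"
  using c not_com[of x y] not_com[of x w] by (auto simp: s_def t_def com_def)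
 have sc: "u ** s = s ** u" if "u : Cr E" for u using that z_central by (auto simp: s_def)
 have "x ** (y ** w) = y ** x ** s ** w" using c 1 by (simp add: m_assoc[symmetric])
 also have "... = y ** (x ** w) ** s" using c st sc[of w] by (simp add: m_assoc)
 also have "... = (y ** w) ** x ** (t ** s)" unfolding 1 using c st by (simp add: m_assoc)
 finally have eq: "x ** (y ** w) = ((y ** w) ** x) ** (t ** s)" .
 have "com x (y ** w) <-> t ** s = \<one>"
  unfolding com_def eq using c st by simp
 also have "... <-> (com x y <-> com x w)" using z by (auto simp: s_def t_def)
 finally show ?thesis .
qed

lemma com_simps [simp]: "x : Cr E ==> com x \<one>" "x : Cr E ==> com x z" "com x x"
 "x : Cr E ==> com \<one> x" "x : Cr E ==> com z x"
 using z_central by (auto simp: com_def)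

lemma com_mult_l:
 "x : Cr E ==> y : Cr E ==> w : Cr E ==> com (y ** w) x <-> (com y x <-> com w x)"
 using com_mult by (simp add: com_sym)

text \<open>Mutually orthogonal hyperbolic planes, each spanned by two singular vectors; every pair
  \<open>a i\<close>, \<open>b i\<close> generates a dihedral group of order 8 containing
  \<open>z\<close>.\<close>

definition hyperbolic :: "(nat => 'e) => (nat => 'e) => nat => bool" where
 "hyperbolic a b m <-> (\<forall>i<m. a i : Cr E & b i : Cr E & a i ** a i = \<one> & b i ** b i = \<one> & ~ com (a i) (b i))
   & (\<forall>i<m. \<forall>j<m. i ~= j --> com (a i) (a j) & com (a i) (b j) & com (b i) (b j))"

definition cent :: "(nat => 'e) => (nat => 'e) => nat => 'e set" where
 "cent a b m = {x : Cr E. \<forall>i<m. com x (a i) & com x (b i)}"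

lemma hyperbolic_D:
 assumes "hyperbolic a b m" "i < m"
 shows "a i : Cr E" "b i : Cr E" "a i ** a i = \<one>" "b i ** b i = \<one>" "~ com (a i) (b i)" "~ com (b i) (a i)"
  "j < m ==> com (a i) (a j)" "j < m ==> i ~= j ==> com (a i) (b j)"
  "j < m ==> i ~= j ==> com (b i) (a j)" "j < m ==> com (b i) (b j)"
proof -
 have 1: "a i : Cr E & b i : Cr E & a i ** a i = \<one> & b i ** b i = \<one> & ~ com (a i) (b i)"
  if "i < m" for i using assms(1) that unfolding hyperbolic_def by blast
 have 2: "com (a i) (a j) & com (a i) (b j) & com (b i) (b j)" if "i < m" "j < m" "i ~= j" for i j
  using assms(1) that unfolding hyperbolic_def by blast
 show "a i : Cr E" "b i : Cr E" "a i ** a i = \<one>" "b i ** b i = \<one>" "~ com (a i) (b i)"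
  using 1[OF assms(2)] by simp_all
 then show "~ com (b i) (a i)" using com_sym by blast
 show "com (a i) (a j)" if "j < m" using 2[OF assms(2) that] by (cases "i = j") simp_all
 show "com (b i) (b j)" if "j < m" using 2[OF assms(2) that] by (cases "i = j") simp_all
 show "com (a i) (b j)" if "j < m" "i ~= j" using 2[OF assms(2) that] by simp
 show "com (b i) (a j)" if "j < m" "i ~= j" using 2[OF that(1) assms(2)] that(2) com_sym by metis
qed

lemma hyperbolic_mono: "hyperbolic a b m ==> k \<le> m ==> hyperbolic a b k"
 unfolding hyperbolic_def by (meson less_le_trans)

lemma square_mult:
 assumes c: "x : Cr E" "y : Cr E"
 shows "(x ** y) ** (x ** y) = (if com x y then (x ** x) ** (y ** y) else (x ** x) ** (y ** y) ** z)"
proof -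
 have "(x ** y) ** (x ** y) = x ** (y ** x) ** y" using c by (simp add: m_assoc)
 moreover have "y ** x = (if com x y then x ** y else x ** y ** z)"
  using c not_com[of y x] by (auto simp: com_def)
 ultimately show ?thesis using c z z_central[OF c(2), symmetric] by (simp add: m_assoc)
qed

text \<open>One plane is split off: each element of the larger centralizer is uniquely an element of
  the smaller one times a product of \<open>a k\<close> and \<open>b k\<close>, the four products
  realising the four commutation patterns.\<close>

lemma cent_card:
 assumes H: "hyperbolic a b m" and k: "k < m"
 shows "card (cent a b k) = 4 * card (cent a b (Suc k))"
proof -
 note D = hyperbolic_D[OF H k]
 let ?f = "\<lambda>(s, t). (if s then a k else \<one>) ** (if t then b k else \<one>)"
 have fc: "?f st : Cr E" for st using D by (auto split: prod.split)
 have fcent: "com (?f st) (a i) & com (?f st) (b i)" if "i < k" for st i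
 proof -
  have i: "i < m" "k ~= i" using that k by auto
  note Di = hyperbolic_D[OF H i(1)]
  show ?thesis using D Di i by (auto simp: com_mult_l split: prod.split)
 qed
 have ca: "com (?f (s, t)) (a k) <-> ~ t" and cb: "com (?f (s, t)) (b k) <-> ~ s" for s t
  using D by (auto simp: com_mult_l)
 have "bij_betw (\<lambda>(x, st). x ** ?f st) (cent a b (Suc k) \<times> UNIV) (cent a b k)"
  unfolding bij_betw_def
 proof
  show "inj_on (\<lambda>(x, st). x ** ?f st) (cent a b (Suc k) \<times> UNIV)"
  proof (rule inj_onI)
   fix v v' assume v: "v : cent a b (Suc k) \<times> UNIV" "v' : cent a b (Suc k) \<times> UNIV"
    and eqv: "(\<lambda>(x, st). x ** ?f st) v = (\<lambda>(x, st). x ** ?f st) v'"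
   obtain x s t where vx: "v = (x, s, t)" by (cases v) auto
   obtain x' s' t' where vx': "v' = (x', s', t')" by (cases v') auto
   have x: "x : cent a b (Suc k)" "x' : cent a b (Suc k)" and eq: "x ** ?f (s, t) = x' ** ?f (s', t')"
    using v eqv by (simp_all add: vx vx')
   have xc: "x : Cr E" "x' : Cr E" "com x (a k)" "com x (b k)" "com x' (a k)" "com x' (b k)"
    using x by (auto simp: cent_def)
   have "com (x ** ?f (s, t)) (a k) <-> com (x' ** ?f (s', t')) (a k)"
    "com (x ** ?f (s, t)) (b k) <-> com (x' ** ?f (s', t')) (b k)" unfolding eq by simp_all
   then have "t = t'" "s = s'" using xc D fc ca cb by (simp_all only: com_mult_l) blast+
   moreover from this have "x = x'" using eq xc(1,2) fc[of "(s', t')"] by (simp only: r_cancel)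
   ultimately show "v = v'" by (simp add: vx vx')
  qed
  show "(\<lambda>(x, st). x ** ?f st) ` (cent a b (Suc k) \<times> UNIV) = cent a b k"
  proof (intro equalityI subsetI)
   fix y assume "y : (\<lambda>(x, st). x ** ?f st) ` (cent a b (Suc k) \<times> UNIV)"
   then obtain x st where "y = x ** ?f st" "x : cent a b (Suc k)" by auto
   then show "y : cent a b k"
    using fc fcent hyperbolic_D(1,2)[OF H] k by (auto simp: cent_def com_mult_l simp del: split_paired_All)
  next
   fix y assume y: "y : cent a b k"
   then have yc: "y : Cr E" by (simp add: cent_def)
   \<comment> \<open>The exchange is intended: the factor \<open>a k\<close> repairs commutation
     with \<open>b k\<close>, and conversely.\<close>
   define st where "st = (~ com y (b k), ~ com y (a k))"
   let ?x = "y ** inv (?f st)"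
   have inv: "com (inv (?f st)) w <-> com (?f st) w" if "w : Cr E" for w
    using com_mult_l[OF that fc[of st] inv_closed[OF fc[of st]]] that fc[of st] by simp
   have "?x : cent a b (Suc k)"
    using yc y fc[of st] inv fcent[of _ st] hyperbolic_D(1,2)[OF H] k ca[of "fst st" "snd st"] cb[of "fst st" "snd st"]
    by (auto simp: cent_def com_mult_l less_Suc_eq st_def)
   moreover have "y = ?x ** ?f st" using yc fc[of st] by (simp add: m_assoc)
   ultimately show "y : (\<lambda>(x, st). x ** ?f st) ` (cent a b (Suc k) \<times> UNIV)"
    by (intro image_eqI[of _ _ "(?x, st)"]) auto
  qed
 qed
 then have "card (cent a b k) = card (cent a b (Suc k) \<times> (UNIV :: (bool \<times> bool) set))"
  using bij_betw_same_card by metis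
 also have "... = 4 * card (cent a b (Suc k))" by (simp add: card_cartesian_product card_UNIV_bool flip: UNIV_Times_UNIV)
 finally show ?thesis .
qed

lemma card_hyperbolic: "hyperbolic a b m ==> card (Cr E) = 4 ^ m * card (cent a b m)"
proof (induction m)
 case 0
 then show ?case by (simp add: cent_def)
next
 case (Suc m)
 then have "card (Cr E) = 4 ^ m * card (cent a b m)" using hyperbolic_mono[of a b "Suc m" m] by simp
 then show ?case using cent_card[OF Suc(2), of m] by simp
qed

text \<open>For noncommuting involutions \<open>x\<close>, \<open>y\<close> the product
  \<open>x y\<close> is a rotation of order 4 inverted by the reflection \<open>y\<close>
  (\<open>rot_sq\<close>, \<open>refl_rot\<close>), so this embeds the abstract dihedral
  group.\<close>

definition dih where
 "dih x y = (\<lambda>(k, s). (x ** y) [^] (k::int) ** (if s then y else \<one>))"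

context
 fixes x y assumes c: "x : Cr E" "y : Cr E" and sq: "x ** x = \<one>" "y ** y = \<one>"
  and nc: "~ com x y"
begin

lemma rot_sq: "(x ** y) ** (x ** y) = z"
 using square_mult[OF c] sq nc z by simp

lemma rot_pow_even: "(x ** y) [^] (2 * k :: int) = z [^] k"
proof -
 have "(x ** y) [^] (2 * k :: int) = ((x ** y) [^] (2::int)) [^] k" using c by (simp add: int_pow_pow)
 moreover have "(x ** y) [^] (2::int) = z" using rot_sq c int_pow_mult[of "x ** y" 1 1] by simp
 ultimately show ?thesis by simp
qed

lemma rot_pow4: "(x ** y) [^] (k mod 4 :: int) = (x ** y) [^] k"
proof -
 have z2: "z [^] (2 * j :: int) = \<one>" for j
 proof -
  have "z [^] (2 * j :: int) = (z [^] (2::int)) [^] j" using z by (simp add: int_pow_pow)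
  moreover have "z [^] (2::int) = \<one>" using z int_pow_mult[of z 1 1] by simp
  ultimately show ?thesis by (simp add: int_pow_one)
 qed
 have "(x ** y) [^] k = (x ** y) [^] (2 * (2 * (k div 4)) + k mod 4)" by simp
 also have "... = (x ** y) [^] (2 * (2 * (k div 4))) ** (x ** y) [^] (k mod 4)"
  using c by (simp only: int_pow_mult m_closed)
 also have "... = (x ** y) [^] (k mod 4)" unfolding rot_pow_even z2 using c by simp
 finally show ?thesis ..
qed

lemma refl_rot: "y ** (x ** y) [^] (k::int) = (x ** y) [^] (- k) ** y"
proof -
 let ?r = "x ** y"
 have r: "?r : Cr E" using c by simp
 have invr: "inv ?r = y ** x"
 proof (rule inv_equality)
  have "(y ** x) ** ?r = y ** (x ** x) ** y" using c by (simp add: m_assoc)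
  then show "(y ** x) ** ?r = \<one>" using c sq by simp
 qed (use c in auto)
 have 1: "y ** ?r = inv ?r ** y" unfolding invr using c by (simp add: m_assoc)
 have 2: "y ** inv ?r = ?r ** y"
 proof -
  have "y ** inv ?r = (y ** y) ** x" unfolding invr using c by (simp add: m_assoc)
  also have "... = x ** (y ** y)" using c sq by simp
  finally show ?thesis using c by (simp add: m_assoc)
 qed
 have pow: "y ** u [^] (n::nat) = v [^] n ** y" if "y ** u = v ** y" "u : Cr E" "v : Cr E" for u v n
 proof (induction n)
  case (Suc n)
  have "y ** u [^] Suc n = (v [^] n ** y) ** u" using Suc that c by (simp add: m_assoc[symmetric])
  also have "... = v [^] n ** (v ** y)" using that c by (simp add: m_assoc)
  finally show ?case using that c by (simp add: m_assoc)
 qed (use c in simp)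
 show ?thesis
 proof (cases "k \<ge> 0")
  case True
  then obtain n where n: "k = int n" using nonneg_int_cases by blast
  have "?r [^] (- int n) = inv ?r [^] n" using r by (simp add: int_pow_neg int_pow_int nat_pow_inv)
  then show ?thesis unfolding n using pow[OF 1, of n] r by (simp add: int_pow_int)
 next
  case False
  then obtain n where n: "k = - int n" by (metis linear neg_int_cases not_le)
  have "?r [^] (- int n) = inv ?r [^] n" using r by (simp add: int_pow_neg int_pow_int nat_pow_inv)
  then show ?thesis unfolding n using pow[OF 2, of n] r by (simp add: int_pow_int)
 qed
qed

lemma dih_closed [simp]: "dih x y d : Cr E"
 using c by (auto simp: dih_def split: prod.split)

lemma dih_mult: "dih x y (d **\<^bsub>dihedral_group 4\<^esub> d') = dih x y d ** dih x y d'"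
proof -
 obtain k s l t where d: "d = (k, s)" "d' = (l, t)" by (cases d, cases d')
 let ?r = "x ** y"
 have r: "?r : Cr E" using c by simp
 have st: "(if s then y else \<one>) ** (if t then y else \<one>) = (if s ~= t then y else \<one>)" using c sq by auto
 have "dih x y d ** dih x y d' = ?r [^] k ** ((if s then y else \<one>) ** ?r [^] l) ** (if t then y else \<one>)"
  using c r by (simp add: d dih_def m_assoc)
 also have "(if s then y else \<one>) ** ?r [^] l = ?r [^] (if s then - l else l) ** (if s then y else \<one>)"
  using refl_rot[of l] r by simp
 also have "?r [^] k ** (?r [^] (if s then - l else l) ** (if s then y else \<one>)) ** (if t then y else \<one>)
   = (?r [^] k ** ?r [^] (if s then - l else l)) ** ((if s then y else \<one>) ** (if t then y else \<one>))"
  using r c by (simp add: m_assoc)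
 also have "... = ?r [^] (if s then k - l else k + l) ** (if s ~= t then y else \<one>)"
  unfolding st using int_pow_mult[OF r, of k "if s then - l else l"] by auto
 also have "... = dih x y (d **\<^bsub>dihedral_group 4\<^esub> d')"
  using rot_pow4 by (auto simp: d dih_def dihedral_group_def)
 finally show ?thesis ..
qed

lemma dih_values:
 "dih x y (0, s) = (if s then y else \<one>)" "dih x y (1, s) = (x ** y) ** (if s then y else \<one>)"
 "dih x y (2, s) = z ** (if s then y else \<one>)" "dih x y (3, s) = z ** (x ** y) ** (if s then y else \<one>)"
proof -
 have 2: "(x ** y) [^] (2::int) = z" using rot_pow_even[of 1] z by simp
 moreover have "(x ** y) [^] (3::int) = z ** (x ** y)"
  using 2 int_pow_mult[of "x ** y" 2 1] c by simp
 ultimately show "dih x y (0, s) = (if s then y else \<one>)" "dih x y (1, s) = (x ** y) ** (if s then y else \<one>)"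
  "dih x y (2, s) = z ** (if s then y else \<one>)" "dih x y (3, s) = z ** (x ** y) ** (if s then y else \<one>)"
  using c by (simp_all add: dih_def)
qed

lemma dih_com_other: "w : Cr E ==> com w x ==> com w y ==> d : Cr (dihedral_group 4) ==> com w (dih x y d)"
 using c z unfolding dihedral_carrier by (auto simp: dih_values com_mult)

lemma dih_com:
 assumes "d : Cr (dihedral_group 4)"
 shows "com x (dih x y d) & com y (dih x y d) <-> d : group_center (dihedral_group 4)"
 using assms nc c z com_sym[of x y] unfolding dihedral_carrier dihedral_center
 by (auto simp: dih_values com_mult split: if_splits)

lemma dih_exists:
 assumes "w : Cr E"
 shows "\<exists>d\<in>Cr (dihedral_group 4). (com x (dih x y d) <-> com x w) & (com y (dih x y d) <-> com y w)"
proof -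
 \<comment> \<open>The four possible values stand for \<open>1\<close>, \<open>y\<close>,
   \<open>x y\<close> and \<open>x\<close>, one for each commutation pattern.\<close>
 define d :: "int \<times> bool" where "d = (if com y w then 0 else 1, com x w ~= com y w)"
 have "d : Cr (dihedral_group 4)" by (simp add: d_def dihedral_carrier)
 moreover have "(com x (dih x y d) <-> com x w) & (com y (dih x y d) <-> com y w)"
  using nc c com_sym[of x y] by (auto simp: d_def dih_values com_mult)
 ultimately show ?thesis by blast
qed

end

primrec cprod where
 "cprod a b 0 d = \<one>"
| "cprod a b (Suc m) d = cprod a b m d ** dih (a m) (b m) (d m)"

abbreviation DD where "DD m == product_group {..<m::nat} (\<lambda>_. dihedral_group 4)"

lemma cprod_closed: "hyperbolic a b m ==> cprod a b m d : Cr E"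
proof (induction m)
 case (Suc m)
 then show ?case using hyperbolic_mono[of a b "Suc m" m] hyperbolic_D[OF Suc(2), of m] by (simp add: dih_closed)
qed simp

lemma cprod_com_other:
 assumes "hyperbolic a b m" "w : Cr E" "!!i. i < m ==> com w (a i) & com w (b i)"
  "!!i. i < m ==> d i : Cr (dihedral_group 4)"
 shows "com w (cprod a b m d)"
 using assms
proof (induction m)
 case (Suc m)
 note H = hyperbolic_mono[OF Suc(2), of m, simplified]
 note D = hyperbolic_D[OF Suc(2), of m, simplified]
 have "com w (cprod a b m d)" using Suc H by auto
 moreover have "com w (dih (a m) (b m) (d m))" using D Suc by (intro dih_com_other) auto
 ultimately show ?case using Suc H D by (simp add: com_mult cprod_closed dih_closed)
qed simp

lemma cprod_com:
 assumes H: "hyperbolic a b m" and "j < m" and d: "!!i. i < m ==> d i : Cr (dihedral_group 4)"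
 shows "com (a j) (cprod a b m d) <-> com (a j) (dih (a j) (b j) (d j))"
  "com (b j) (cprod a b m d) <-> com (b j) (dih (a j) (b j) (d j))"
proof -
 have "(com (a j) (cprod a b k d) <-> (j < k --> com (a j) (dih (a j) (b j) (d j)))) &
    (com (b j) (cprod a b k d) <-> (j < k --> com (b j) (dih (a j) (b j) (d j))))" if "k \<le> m" for k
  using that
 proof (induction k)
  case 0
  then show ?case using hyperbolic_D[OF H \<open>j < m\<close>] by simp
 next
  case (Suc k)
  then have k: "k < m" by simp
  note D = hyperbolic_D[OF H k] and Dj = hyperbolic_D[OF H \<open>j < m\<close>]
  have cc: "cprod a b k d : Cr E" "dih (a k) (b k) (d k) : Cr E"
   using cprod_closed[OF hyperbolic_mono[OF H, of k]] k D by (auto simp: dih_closed)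
  have other: "com (a j) (dih (a k) (b k) (d k))" "com (b j) (dih (a k) (b k) (d k))" if "k ~= j"
   using that D Dj k d by (auto intro!: dih_com_other)
  show ?case
   using Suc cc Dj other by (cases "k = j") (auto simp: com_mult)
 qed
 from this[of m] show "com (a j) (cprod a b m d) <-> com (a j) (dih (a j) (b j) (d j))"
  "com (b j) (cprod a b m d) <-> com (b j) (dih (a j) (b j) (d j))" using \<open>j < m\<close> by auto
qed

lemma cprod_mult:
 assumes H: "hyperbolic a b m" and d: "!!i. i < m ==> d i : Cr (dihedral_group 4)"
  "!!i. i < m ==> d' i : Cr (dihedral_group 4)" "!!i. i < m ==> e i = d i **\<^bsub>dihedral_group 4\<^esub> d' i"
 shows "cprod a b m e = cprod a b m d ** cprod a b m d'"
 using assms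
proof (induction m)
 case (Suc m)
 note H = hyperbolic_mono[OF Suc(2), of m, simplified]
 note D = hyperbolic_D[OF Suc(2), of m, simplified]
 let ?P = "cprod a b m" and ?q = "dih (a m) (b m)"
 have cc: "?P u : Cr E" "?q v : Cr E" for u v using H D by (auto simp: cprod_closed dih_closed)
 have aux: "com (?q (d m)) (a i)" "com (?q (d m)) (b i)" if "i < m" for i
 proof -
  have i: "i < Suc m" "m ~= i" using that by auto
  note Di = hyperbolic_D[OF Suc(2) i(1)]
  have "com (a i) (?q (d m))" "com (b i) (?q (d m))"
   using D Di i Suc by (auto intro!: dih_com_other)
  then show "com (?q (d m)) (a i)" "com (?q (d m)) (b i)" using com_sym by auto
 qed
 have "com (?q (d m)) (?P d')" using aux Suc cc H by (intro cprod_com_other) auto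
 then have cm: "?q (d m) ** ?P d' = ?P d' ** ?q (d m)" by (simp add: com_def)
 have "cprod a b (Suc m) e = (?P d ** ?P d') ** (?q (d m) ** ?q (d' m))"
  using Suc H D by (simp add: dih_mult)
 also have "... = ?P d ** (?P d' ** ?q (d m)) ** ?q (d' m)" using cc by (simp add: m_assoc)
 also have "... = ?P d ** ?q (d m) ** (?P d' ** ?q (d' m))" unfolding cm[symmetric] using cc by (simp add: m_assoc)
 finally show ?case by simp
qed simp

text \<open>Orthogonal projection: for each plane, a dihedral element with the commutation pattern
  of \<open>u\<close> is multiplied on, which cancels that pattern.\<close>

lemma project:
 assumes H: "hyperbolic a b m" and u: "u : Cr E"
 shows "\<exists>d\<in>Cr (DD m). u ** cprod a b m d : cent a b m"
proof -
 have "\<exists>e\<in>Cr (dihedral_group 4). (com (a i) (dih (a i) (b i) e) <-> com (a i) u) & (com (b i) (dih (a i) (b i) e) <-> com (b i) u)"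
  if "i < m" for i using hyperbolic_D[OF H that] u by (intro dih_exists) auto
 then obtain e where e: "!!i. i < m ==> e i : Cr (dihedral_group 4) & (com (a i) (dih (a i) (b i) (e i)) <-> com (a i) u) & (com (b i) (dih (a i) (b i) (e i)) <-> com (b i) u)"
  by metis
 define d where "d = (\<lambda>i\<in>{..<m}. e i)"
 have d: "d i : Cr (dihedral_group 4)" "d i = e i" if "i < m" for i using that e by (auto simp: d_def)
 have "u ** cprod a b m d : cent a b m"
  unfolding cent_def
 proof (intro CollectI conjI allI impI)
  show "u ** cprod a b m d : Cr E" using u cprod_closed[OF H] by simp
  fix i assume i: "i < m"
  note D = hyperbolic_D[OF H i]
  have "com (a i) (u ** cprod a b m d)" "com (b i) (u ** cprod a b m d)"
   using D u cprod_closed[OF H] cprod_com[OF H i d(1)] e[OF i] d[OF i] by (auto simp: com_mult)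
  then show "com (u ** cprod a b m d) (a i)" "com (u ** cprod a b m d) (b i)" by (auto simp: com_sym)
 qed
 moreover have "d : Cr (DD m)" using e by (auto simp: d_def)
 ultimately show ?thesis by blast
qed

text \<open>The map \<open>cprod\<close> from the direct power is onto, because
  \<open>project\<close> reduces every element to \<open>1\<close> or \<open>z\<close>. An element
  of its kernel commutes with all \<open>a i\<close> and \<open>b i\<close>, which forces its
  components to be central, and on central tuples the map is the product in the centre.\<close>

lemma iso_central_power:
 assumes H: "hyperbolic a b m" and C: "cent a b m = {\<one>, z}" and m: "m > 0"
 shows "E \<cong> central_power (dihedral_group 4) m"
proof -
 interpret Di: group "dihedral_group 4" by (rule dihedral_group_group)
 interpret DDg: group "DD m" by (rule product_group) (rule Di.group_axioms)
 let ?Z = "(dihedral_group 4)\<lparr>carrier := group_center (dihedral_group 4)\<rparr>"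
 define phi where "phi = cprod a b m"
 have DDc: "d : Cr (DD m) ==> i < m ==> d i : Cr (dihedral_group 4)" for d i by (auto simp: PiE_iff)
 have hom: "phi : hom (DD m) E"
 proof (rule homI)
  show "phi d : Cr E" for d by (simp add: phi_def cprod_closed[OF H])
  fix d d' assume d: "d : Cr (DD m)" "d' : Cr (DD m)"
  show "phi (d **\<^bsub>DD m\<^esub> d') = phi d ** phi d'"
   unfolding phi_def by (rule cprod_mult[OF H DDc[OF d(1)] DDc[OF d(2)]]) simp_all
 qed
 interpret h: group_hom "DD m" E phi by (unfold_locales) (rule hom)
 have one_D: "\<one>\<^bsub>dihedral_group 4\<^esub> = (0, False)" by (simp add: dihedral_group_def)
 have zim: "z : phi ` Cr (DD m)"
 proof -
  \<comment> \<open>The central involution in the first factor alone maps to \<open>z\<close>; a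
    first factor exists since \<open>m > 0\<close>.\<close>
  define d where "d = (\<lambda>i\<in>{..<m}. if i = 0 then (2::int, False) else (0, False))"
  have "cprod a b k d = (if k = 0 then \<one> else z)" if "k \<le> m" for k
   using that
  proof (induction k)
   case (Suc k)
   then have k: "k < m" by simp
   show ?case using Suc k z hyperbolic_D[OF H k] by (cases k) (auto simp: d_def dih_values)
  qed simp
  then have "phi d = z" using m by (simp add: phi_def)
  moreover have "d : Cr (DD m)" by (auto simp: d_def dihedral_carrier)
  ultimately show ?thesis by blast
 qed
 have surj: "phi ` Cr (DD m) = Cr E"
 proof
  show "phi ` Cr (DD m) <= Cr E" using h.hom_closed by blast
  interpret I: subgroup "phi ` Cr (DD m)" E by (rule h.img_is_subgroup)
  show "Cr E <= phi ` Cr (DD m)"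
  proof
   fix u assume u: "u : Cr E"
   then obtain d where d: "d : Cr (DD m)" "u ** phi d : {\<one>, z}" using project[OF H u] C by (auto simp: phi_def)
   have "phi d : Cr E" by (simp add: phi_def cprod_closed[OF H])
   then have "u = (u ** phi d) ** inv (phi d)" using u by (simp add: m_assoc)
   moreover have "u ** phi d : phi ` Cr (DD m)" using d(2) zim I.one_closed by (metis insertE singletonD)
   moreover have "inv (phi d) : phi ` Cr (DD m)" using d(1) by blast
   ultimately show "u : phi ` Cr (DD m)" by (metis I.m_closed)
  qed
 qed
 have Zcm: "comm_monoid ?Z"
 proof (rule comm_monoidI)
  show "x **\<^bsub>?Z\<^esub> y : Cr ?Z" if "x : Cr ?Z" "y : Cr ?Z" for x y
  proof -
   have "x : {(0, False), (2, False)}" "y : {(0, False), (2, False)}"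
    using that unfolding dihedral_center[symmetric] by simp_all
   then have "x **\<^bsub>dihedral_group 4\<^esub> y : {(0, False), (2, False)}"
    by (elim insertE emptyE) (simp_all add: dihedral_group_def)
   then show ?thesis unfolding dihedral_center[symmetric] by simp
  qed
  show "\<one>\<^bsub>?Z\<^esub> : Cr ?Z" by (simp add: dihedral_center one_D)
  have cm: "x : group_center (dihedral_group 4) ==> y : Cr (dihedral_group 4)
   ==> x **\<^bsub>dihedral_group 4\<^esub> y = y **\<^bsub>dihedral_group 4\<^esub> x"
   and cc: "x : group_center (dihedral_group 4) ==> x : Cr (dihedral_group 4)" for x y
   unfolding group_center_def by blast+
  show "x **\<^bsub>?Z\<^esub> y = y **\<^bsub>?Z\<^esub> x" if "x : Cr ?Z" "y : Cr ?Z" for x y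
   using cm[of x y] cc[of y] that by simp
  show "x **\<^bsub>?Z\<^esub> y **\<^bsub>?Z\<^esub> w = x **\<^bsub>?Z\<^esub> (y **\<^bsub>?Z\<^esub> w)" if "x : Cr ?Z" "y : Cr ?Z" "w : Cr ?Z" for x y w
   using Di.m_assoc[of x y w] cc that by simp
  show "\<one>\<^bsub>?Z\<^esub> **\<^bsub>?Z\<^esub> x = x" if "x : Cr ?Z" for x using Di.l_one[of x] cc that by simp
 qed
 interpret Z: comm_monoid ?Z by (rule Zcm)
 \<comment> \<open>On the centre of the dihedral group this is the isomorphism to
   \<open>{1, z}\<close>.\<close>
 define zta where "zta = (\<lambda>d::int \<times> bool. if d = (0, False) then \<one> else z)"
 have zeta_prod: "cprod a b k d = zta (finprod ?Z d {..<k})"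
  if "k \<le> m" "d : {..<m} \<rightarrow> group_center (dihedral_group 4)" for k d
  using that(1)
 proof (induction k)
  case 0
  then show ?case by (simp add: zta_def one_D)
 next
  case (Suc k)
  then have k: "k < m" by simp
  have dk: "d k : Cr ?Z" using that k by auto
  have fc: "finprod ?Z d {..<k} : Cr ?Z" using that k by (intro Z.finprod_closed) auto
  have "finprod ?Z d {..<Suc k} = d k **\<^bsub>?Z\<^esub> finprod ?Z d {..<k}"
   unfolding lessThan_Suc using that k dk by (intro Z.finprod_insert) auto
  moreover have "zta (x **\<^bsub>?Z\<^esub> y) = zta y ** zta x" if "x : Cr ?Z" "y : Cr ?Z" for x y
  proof -
   have xy: "x : {(0, False), (2, False)}" "y : {(0, False), (2, False)}"
    using that unfolding dihedral_center[symmetric] by simp_all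
   have "zta (x **\<^bsub>dihedral_group 4\<^esub> y) = zta y ** zta x"
    using xy z by (elim insertE emptyE) (simp_all add: zta_def dihedral_group_def)
   then show ?thesis by simp
  qed
  moreover have "dih (a k) (b k) (d k) = zta (d k)"
   using dk z hyperbolic_D[OF H k] by (auto simp: dihedral_center zta_def dih_values)
  ultimately show ?case using Suc dk fc by simp
 qed
 have kernel: "kernel (DD m) E phi = {d : {..<m} \<rightarrow>\<^sub>E group_center (dihedral_group 4). finprod ?Z d {..<m} = \<one>\<^bsub>dihedral_group 4\<^esub>}"
 proof (intro equalityI subsetI)
  fix d assume "d : kernel (DD m) E phi"
  then have d: "d : Cr (DD m)" "cprod a b m d = \<one>" by (auto simp: kernel_def phi_def)
  have cen: "d i : group_center (dihedral_group 4)" if i: "i < m" for i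
   using dih_com[of "a i" "b i" "d i"] cprod_com[OF H i, of d] DDc[OF d(1)] hyperbolic_D[OF H i] d(2) i by auto
  have "d : extensional {..<m}" using d(1) by (simp add: PiE_def)
  moreover have dP: "d : {..<m} \<rightarrow> group_center (dihedral_group 4)" using cen by (simp add: Pi_iff)
  ultimately have dE: "d : {..<m} \<rightarrow>\<^sub>E group_center (dihedral_group 4)" unfolding PiE_def by blast
  have "finprod ?Z d {..<m} : Cr ?Z" by (rule Z.finprod_closed) (use dP in simp)
  then have fc: "finprod ?Z d {..<m} : {(0, False), (2, False)}" unfolding dihedral_center[symmetric] by simp
  have "zta (finprod ?Z d {..<m}) = \<one>" using zeta_prod[OF order_refl dP] d(2) by (rule trans[OF sym])
  then have "finprod ?Z d {..<m} = (0, False)"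
   using z(2) unfolding zta_def by (metis (full_types))
  then show "d : {d : {..<m} \<rightarrow>\<^sub>E group_center (dihedral_group 4). finprod ?Z d {..<m} = \<one>\<^bsub>dihedral_group 4\<^esub>}"
   using dE by (simp only: one_D mem_Collect_eq simp_thms)
 next
  fix d assume d: "d : {d : {..<m} \<rightarrow>\<^sub>E group_center (dihedral_group 4). finprod ?Z d {..<m} = \<one>\<^bsub>dihedral_group 4\<^esub>}"
  then have dP: "d : {..<m} \<rightarrow> group_center (dihedral_group 4)" and d1: "finprod ?Z d {..<m} = (0, False)"
   and dE: "d : {..<m} \<rightarrow>\<^sub>E group_center (dihedral_group 4)"
   by (simp_all add: one_D PiE_def)
  have "cprod a b m d = \<one>" using zeta_prod[OF order_refl dP] d1 by (simp only: zta_def simp_thms if_True)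
  moreover have "d : Cr (DD m)"
  proof -
   have "group_center (dihedral_group 4) <= Cr (dihedral_group 4)" unfolding group_center_def by blast
   then show ?thesis using PiE_mono[of "{..<m}" "\<lambda>_. group_center (dihedral_group 4)" "\<lambda>_. Cr (dihedral_group 4)"] dE
    by auto
  qed
  ultimately show "d : kernel (DD m) E phi" by (simp add: kernel_def phi_def)
 qed
 have "DD m Mod kernel (DD m) E phi \<cong> E"
  using h.FactGroup_iso_set[OF surj] by (auto simp: is_iso_def)
 then have "central_power (dihedral_group 4) m \<cong> E"
  unfolding kernel central_power_def .
 moreover have "group (central_power (dihedral_group 4) m)"
  unfolding central_power_def kernel[symmetric] using h.normal_kernel by (rule normal.factorgroup_is_group)
 ultimately show ?thesis by (rule group.iso_sym[rotated])
qed

text \<open>A maximal hyperbolic family splits \<open>E\<close> completely, or leaves a quaternion group.\<close>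

theorem dihedral_or_quaternion:
 assumes nontriv: "Cr E ~= {\<one>, z}"
 shows "(\<exists>m. order E = 2 * 4 ^ m & E \<cong> central_power (dihedral_group 4) m) \<or>
  (\<exists>a b m i j. hyperbolic a b m & i : cent a b m & j : cent a b m & i ** i = z & j ** j = z & ~ com i j &
    (\<forall>x\<in>cent a b m. \<exists>c\<in>{\<one>, z}. \<exists>y\<in>{\<one>, i, j, i ** j}. x = y ** c))"
proof -
 define P where "P m <-> (\<exists>a b. hyperbolic a b m)" for m
 have bound: "m \<le> card (Cr E)" if Pm: "P m" for m
 proof -
  obtain a b where H: "hyperbolic a b m" using Pm unfolding P_def by blast
  have "\<one> : cent a b m" using hyperbolic_D[OF H] by (auto simp: cent_def)
  moreover have "finite (cent a b m)" using fin by (simp add: cent_def)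
  ultimately have "card (cent a b m) \<ge> 1" by (metis One_nat_def Suc_leI card_gt_0_iff empty_iff)
  then have "4 ^ m \<le> card (Cr E)" unfolding card_hyperbolic[OF H] by simp
  moreover have "m < 4 ^ m" by (rule less_exp[THEN less_le_trans]) (simp add: power_mono)
  ultimately show ?thesis by simp
 qed
 have "P 0" by (auto simp: P_def hyperbolic_def)
 then obtain m where m: "P m" and max: "!!k. P k ==> k \<le> m"
  using Nat.ex_has_greatest_nat[of P 0 "card (Cr E)"] bound by auto
 obtain a b where H: "hyperbolic a b m" using m unfolding P_def by blast
 have Cc: "x : Cr E" if "x : cent a b m" for x using that by (simp add: cent_def)
 have Cmult: "x ** y : cent a b m" if "x : cent a b m" "y : cent a b m" for x y
  using that hyperbolic_D[OF H] by (auto simp: cent_def com_mult_l)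
 have Z: "\<one> : cent a b m" "z : cent a b m" using hyperbolic_D[OF H] z by (auto simp: cent_def)
 \<comment> \<open>A noncommuting partner of \<open>v\<close> is moved into the centralizer by
   \<open>project\<close>; the correcting factor commutes with \<open>v\<close>, so the two still do
   not commute.\<close>
 have partner: "\<exists>w\<in>cent a b m. ~ com v w" if v: "v : cent a b m" "v \<notin> {\<one>, z}" for v
 proof -
  obtain w where w: "w : Cr E" "~ com v w" using central[of v] v Cc by (auto simp: com_def)
  obtain d where d: "d : Cr (DD m)" "w ** cprod a b m d : cent a b m" using project[OF H w(1)] by blast
  have "com v (cprod a b m d)"
  proof (rule cprod_com_other[OF H Cc[OF v(1)]])
   fix i assume "i < m"
   then show "com v (a i) & com v (b i)" "d i : Cr (dihedral_group 4)"
    using v(1) d(1) by (simp_all add: cent_def PiE_iff)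
  qed
  then have "~ com v (w ** cprod a b m d)" using w v Cc cprod_closed[OF H] by (simp add: com_mult)
  then show ?thesis using d by blast
 qed
 \<comment> \<open>Otherwise \<open>v\<close> and a noncommuting involution would enlarge the
   maximal family. If the partner \<open>w\<close> is no involution, then \<open>v w\<close> is one,
   because \<open>v\<close> and \<open>w\<close> do not commute.\<close>
 have aniso: "v ** v = z" if v: "v : cent a b m" "v \<notin> {\<one>, z}" for v
 proof (rule ccontr)
  assume "v ** v ~= z"
  then have v1: "v ** v = \<one>" using square v Cc by blast
  obtain w where w: "w : cent a b m" "~ com v w" using partner[OF v] by blast
  obtain w' where w': "w' : cent a b m" "~ com v w'" "w' ** w' = \<one>"
  proof (cases "w ** w = \<one>")
   case True
   then show ?thesis using that w by blast
  next
   case False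
   then have "w ** w = z" using square w Cc by blast
   then have "(v ** w) ** (v ** w) = \<one>" using square_mult[of v w] v w v1 Cc z by simp
   moreover have "~ com v (v ** w)" using v w Cc by (simp add: com_mult)
   ultimately show ?thesis using that[of "v ** w"] Cmult v w by blast
  qed
  have "hyperbolic (a(m := v)) (b(m := w')) (Suc m)"
   unfolding hyperbolic_def
  proof (intro conjI allI impI)
   fix i j assume "i < Suc m" "j < Suc m" "i ~= j"
   then show "com ((a(m := v)) i) ((a(m := v)) j)" "com ((a(m := v)) i) ((b(m := w')) j)" "com ((b(m := w')) i) ((b(m := w')) j)"
    using hyperbolic_D[OF H] v w' com_sym by (auto simp: cent_def less_Suc_eq)
  qed (use hyperbolic_D[OF H] v w' v1 Cc in \<open>auto simp: less_Suc_eq\<close>)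
  then have "P (Suc m)" unfolding P_def by blast
  then show False using max by fastforce
 qed
 show ?thesis
 proof (cases "cent a b m = {\<one>, z}")
  case True
  have "m > 0"
  proof (rule ccontr)
   assume "~ m > 0"
   then have "cent a b m = Cr E" by (simp add: cent_def)
   then show False using True nontriv by simp
  qed
  moreover have "order E = 2 * 4 ^ m"
   using card_hyperbolic[OF H] True z by (simp add: order_def)
  ultimately show ?thesis using iso_central_power[OF H True] by blast
 next
  case False
  then obtain i where i: "i : cent a b m" "i \<notin> {\<one>, z}" using Z by blast
  obtain j where j: "j : cent a b m" "~ com i j" using partner[OF i] by blast
  have j2: "j \<notin> {\<one>, z}" using j i Cc by auto
  \<comment> \<open>Dividing \<open>x\<close> by the element with the same commutation pattern
    leaves \<open>c\<close> commuting with \<open>i\<close> and \<open>j\<close>. Were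
    \<open>c\<close> not in \<open>{1, z}\<close>, then \<open>c i\<close> would have square one
    without commuting with \<open>j\<close>, against \<open>aniso\<close>.\<close>
  have cov: "\<exists>c\<in>{\<one>, z}. \<exists>y\<in>{\<one>, i, j, i ** j}. x = y ** c" if x: "x : cent a b m" for x
  proof -
   define y where "y = (if com x i then (if com x j then \<one> else i) else (if com x j then j else i ** j))"
   have y: "y : {\<one>, i, j, i ** j}" "y : cent a b m" using i j Z Cmult by (auto simp: y_def)
   have ij: "~ com j i" using j com_sym by blast
   have yinv: "inv y : Cr E" using y Cc by blast
   have yi: "com (inv y) w <-> com y w" if "w : Cr E" for w
    using com_mult_l[OF that Cc[OF y(2)] yinv] that y(2) Cc by simp
   define c where "c = inv y ** x"
   have cC: "c : cent a b m"
    using y(2) x yi hyperbolic_D[OF H] yinv by (auto simp: c_def cent_def com_mult_l)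
   have ci: "com c i" "com c j"
    using x y(2) i j ij yinv yi Cc unfolding c_def y_def by (auto simp: com_mult_l split: if_splits)
   have "c : {\<one>, z}"
   proof (rule ccontr)
    assume nc: "c \<notin> {\<one>, z}"
    have "(c ** i) ** (c ** i) = \<one>"
     using square_mult[of c i] aniso[OF cC nc] aniso[OF i] ci cC i Cc z by simp
    then have "c ** i : {\<one>, z}" using aniso[of "c ** i"] Cmult[OF cC i(1)] z by metis
    then have "com (c ** i) j"
     using com_simps(4,5)[OF Cc[OF j(1)]] by (metis insertE singletonD)
    then show False using ci j cC i Cc by (simp add: com_mult_l)
   qed
   moreover have "x = y ** c" using x y(2) Cc by (simp add: c_def m_assoc[symmetric])
   ultimately show ?thesis using y(1) by blast
  qed
  show ?thesis
   using H i j aniso[OF i] aniso[OF j(1) j2] cov by (intro disjI2 exI conjI ballI) auto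
 qed
qed

text \<open>Multiplication by \<open>a k\<close> changes commutation with \<open>b k\<close> and
  with no other member of the family, so the \<open>b k\<close> can be dealt with one at a
  time.\<close>

lemma clear_b:
 assumes H: "hyperbolic a b m" and u: "u : Cr E" "!!i. i < m ==> com u (a i)"
 shows "\<exists>t\<in>generate E (a ` {..<m}). u ** t : cent a b m"
proof -
 have gc: "t : Cr E" if "t : generate E (a ` {..<m})" for t
  by (rule generate_in_carrier[OF _ that]) (auto simp: hyperbolic_D(1)[OF H])
 have "\<exists>t\<in>generate E (a ` {..<m}). (\<forall>i<m. com (u ** t) (a i)) & (\<forall>i<k. com (u ** t) (b i))" if "k \<le> m" for k
  using that
 proof (induction k)
  case 0
  then show ?case using u by (intro bexI[of _ \<one>]) (auto intro: generate.one)
 next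
  case (Suc k)
  then obtain t where t: "t : generate E (a ` {..<m})" "!!i. i < m ==> com (u ** t) (a i)" "!!i. i < k ==> com (u ** t) (b i)"
   by auto
  have k: "k < m" using Suc by simp
  note D = hyperbolic_D[OF H k]
  show ?case
  proof (cases "com (u ** t) (b k)")
   case True
   then show ?thesis using t by (intro bexI[of _ t]) (auto simp: less_Suc_eq)
  next
   case False
   have "t ** a k : generate E (a ` {..<m})"
    using t(1) k by (intro generate.eng) (auto intro: generate.incl)
   moreover have eq: "u ** (t ** a k) = (u ** t) ** a k" using u t gc D by (simp add: m_assoc)
   have "com (u ** (t ** a k)) (a i)" if "i < m" for i
    unfolding eq using t(2)[OF that] hyperbolic_D[OF H that] D that u gc[OF t(1)] by (simp add: com_mult_l)
   moreover have "com (u ** (t ** a k)) (b i)" if i: "i < Suc k" for i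
   proof -
    have im: "i < m" using i k by simp
    show ?thesis
     unfolding eq using t(3)[of i] False hyperbolic_D[OF H im] D i im u gc[OF t(1)]
     by (cases "i = k") (auto simp: com_mult_l)
   qed
   ultimately show ?thesis by blast
  qed
 qed
 from this[of m] show ?thesis using u gc by (auto simp: cent_def)
qed

end

section \<open>Normalizing factors for odd \<open>p\<close>\<close>

lemma (in intertwiner) S_T_comm:
 assumes "g : Cr G" "k : Cr G"
 shows "S g g' **.A T k = T k **.A S g g'"
 unfolding T_def using fin_V assms u_closed S_comm(1)[OF assms(1) u_closed[OF assms(2)], of _ g']
 by (subst A.finsum_rdistr) (auto simp: A.finsum_ldistr intro!: A.finsum_cong')

context char_data
begin

abbreviation num :: "nat => 'q" where "num n == [n] \<cdot>.Q \<one>.Q"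

text \<open>Such a homomorphism replaces every character value by its inverse and so plays the part
  of complex conjugation.\<close>

definition inverts_eps where
 "inverts_eps eta <-> eta : Ring.ring_hom Q Q & eta eps **.Q eps = \<one>.Q"

text \<open>The factors by which the averaging operators must be divided to become multiplicative and
 isometric.\<close>

definition normalizing :: "(('v => 'v) => 'q) => bool" where
 "normalizing s <-> (\<forall>g\<in>Cr G. s g : Cr Q & s g ~= \<zero>.Q) &
  (\<forall>g\<in>Cr G. \<forall>g'\<in>Cr G. num (card (Fix (g **.G g'))) **.Q (s g **.Q s g') = Schar g g' **.Q s (g **.G g')) &
  (\<forall>eta g. inverts_eps eta --> g : Cr G --> s g **.Q eta (s g) = num (card (Cr V) * card (Fix g)))"

lemma num_mult: "num m **.Q num n = num (m * n)"
 by (simp add: Q.add_pow_ldistr Q.add.nat_pow_pow mult.commute)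

lemma num_pow_p_nonzero: "num (p ^ k) ~= \<zero>.Q"
proof (induction k)
 case (Suc k)
 have "num (p ^ Suc k) = num p **.Q num (p ^ k)" by (simp add: num_mult)
 then show ?case using Suc pQ Q.integral[of "num p" "num (p ^ k)"] by auto
qed simp

lemma card_V_power: "\<exists>k. card (Cr V) = p ^ k"
 using card_V_square by blast

lemma num_card_nonzero:
 "num (card (Cr V)) ~= \<zero>.Q" "g : Cr G ==> num (card (Fix g)) ~= \<zero>.Q"
proof -
 show "num (card (Cr V)) ~= \<zero>.Q" using card_V_power num_pow_p_nonzero by metis
 assume "g : Cr G"
 then obtain d where "card (Fix g) = p ^ (deg_prime * d)"
  using card_Fix by (auto simp: card_carrier_eq power_mult)
 then show "num (card (Fix g)) ~= \<zero>.Q" using num_pow_p_nonzero by metis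
qed

definition one_fun where "one_fun = (\<lambda>v\<in>Cr V. \<one>.Q)"

lemma one_fun: "one_fun : Cr Fun" by (auto simp: one_fun_def Fun_simps)

lemma Fun_smult_apply: "v : Cr V ==> (c \<odot>.Fun phi) v = c **.Q phi v"
 by (simp add: Q.func_space_def)

lemma reg_central_smult:
 "z : prime_field K ==> phi : Cr Fun ==> reg (\<zero>.V, z) phi = chi z \<odot>.Fun phi"
 by (rule Fun_eqI) (auto simp: reg_central Fun_smult_apply reg_maps)

lemmas reg_S_scalar = S_scalar[OF Fun.module_axioms reg.intertwiner_axioms reg_central_smult]

lemma scalar_eqI:
 assumes "a : Cr Q" "b : Cr Q" "a \<odot>.Fun one_fun = b \<odot>.Fun one_fun"
 shows "a = b"
 using arg_cong[OF assms(3), of "\<lambda>f. f \<zero>.V"] assms(1,2) by (simp add: Fun_smult_apply one_fun_def)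

text \<open>An operator identity on the functions on \<open>V\<close> becomes an identity of scalars
  by applying it to the constant function one and reading off a value.\<close>

lemma Schar_mult_Scharbar:
 assumes g: "g : Cr G" "g' : Cr G"
 shows "Schar g g' **.Q Scharbar g g' = num (card (Cr V) * card (Fix g) * card (Fix g') * card (Fix (g **.G g')))"
proof -
 let ?n = "card (Cr V) * card (Fix g) * card (Fix g') * card (Fix (g **.G g'))"
 have "(reg.S g g' **.EF reg.Sbar g g') one_fun = ([?n] \<cdot>.EF \<one>.EF) one_fun"
  unfolding reg.S_mult_Sbar[OF g] ..
 moreover have "(reg.S g g' **.EF reg.Sbar g g') one_fun = (Scharbar g g' **.Q Schar g g') \<odot>.Fun one_fun"
  using reg_S_scalar[OF _ _ g(1)] one_fun by (simp add: Fun.endo_apply Fun.smult_assoc1)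
 moreover have "([?n] \<cdot>.EF \<one>.EF) one_fun = num ?n \<odot>.Fun one_fun"
 proof (rule Fun_eqI)
  show "([?n] \<cdot>.EF \<one>.EF) one_fun : Cr Fun" "num ?n \<odot>.Fun one_fun : Cr Fun"
   using one_fun Fun.endo_add_pow_apply[of "\<one>.EF" one_fun ?n] by (simp_all add: Fun.endo_apply)
  fix v assume "v : Cr V"
  then show "([?n] \<cdot>.EF \<one>.EF) one_fun v = (num ?n \<odot>.Fun one_fun) v"
   using one_fun Fun.endo_add_pow_apply[of "\<one>.EF" one_fun ?n] Fun_add_pow_apply[OF one_fun, of v ?n]
   by (simp add: Fun.endo_apply Fun_smult_apply) (simp add: one_fun_def)
 qed
 ultimately have "(Scharbar g g' **.Q Schar g g') \<odot>.Fun one_fun = num ?n \<odot>.Fun one_fun" by simp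
 then show ?thesis using scalar_eqI by (simp add: Q.m_comm)
qed

lemma Schar_square:
 assumes g: "g : Cr G" "g' : Cr G" and p: "odd p"
 shows "Schar g g' **.Q Schar g g' = Scharbar g g' **.Q Scharbar g g'"
proof -
 have "(reg.S g g' **.EF reg.S g g') one_fun = (reg.Sbar g g' **.EF reg.Sbar g g') one_fun"
  unfolding reg.S_square[OF g p] ..
 then have "(Schar g g' **.Q Schar g g') \<odot>.Fun one_fun = (Scharbar g g' **.Q Scharbar g g') \<odot>.Fun one_fun"
  using reg_S_scalar[OF _ _ g(1)] one_fun by (simp add: Fun.endo_apply Fun.smult_assoc1)
 then show ?thesis using scalar_eqI by simp
qed

section \<open>The matrices and determinants of the averaging operators on functions\<close>

definition kap where "kap g x v = snd (u g x) \<oplus> h (fst (u g x)) v"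

text \<open>The sum of roots of unity is kept as a polynomial; its value at \<open>eps\<close> is
  the matrix entry of \<open>reg.T g\<close> (\<open>reg_T_delta\<close>).\<close>

definition entry :: "('v => 'v) => 'v => 'v => int poly" where
 "entry g v w = (\<Sum>x\<in>{x : Cr V. v \<oplus>.V fst (u g x) = w}. [:0, 1:] ^ idx (kap g x v))"

lemma kap_closed: "g : Cr G ==> x : Cr V ==> v : Cr V ==> kap g x v : prime_field K"
 by (simp add: kap_def u_eq G_D h_closed)

lemma pev_entry:
 "Q.pev eps (entry g v w) = (\<Oplus>.Q x\<in>{x : Cr V. v \<oplus>.V fst (u g x) = w}. chi (kap g x v))"
 using fin_V eps by (simp add: entry_def Q.pev_sum Q.pev_power Q.pev_var chi_def)

lemma pev_entry_closed [simp]: "Q.pev eps f : Cr Q"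
 using eps by simp

lemma reg_T_entry:
 assumes g: "g : Cr G" and phi: "phi : Cr Fun" and v: "v : Cr V"
 shows "reg.T g phi v = (\<Oplus>.Q w\<in>Cr V. Q.pev eps (entry g v w) **.Q phi w)"
proof -
 have phic: "phi w : Cr Q" if "w : Cr V" for w using phi that by (auto simp: Fun_simps)
 have uc: "fst (u g x) : Cr V" if "x : Cr V" for x using g that by (simp add: u_eq G_D)
 have one: "reg (u g x) phi v = (\<Oplus>.Q w\<in>Cr V. if v \<oplus>.V fst (u g x) = w then chi (kap g x v) **.Q phi w else \<zero>.Q)"
  if x: "x : Cr V" for x
 proof -
  have "reg (u g x) phi v = chi (kap g x v) **.Q phi (v \<oplus>.V fst (u g x))"
   using reg_apply[OF phi v, of "fst (u g x)" "snd (u g x)"] by (simp add: kap_def)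
  also have "... = (\<Oplus>.Q w\<in>Cr V. if v \<oplus>.V fst (u g x) = w then chi (kap g x v) **.Q phi w else \<zero>.Q)"
   using fin_V v uc[OF x] phic
   by (subst Q.finsum_singleton[of "v \<oplus>.V fst (u g x)" "Cr V" "\<lambda>w. chi (kap g x v) **.Q phi w"]) auto
  finally show ?thesis .
 qed
 have "reg.T g phi v = (\<Oplus>.Q x\<in>Cr V. \<Oplus>.Q w\<in>Cr V. if v \<oplus>.V fst (u g x) = w then chi (kap g x v) **.Q phi w else \<zero>.Q)"
  unfolding reg_T_apply[OF g phi v] using phic by (intro Q.finsum_cong') (auto simp: one intro!: Q.finsum_closed)
 also have "... = (\<Oplus>.Q w\<in>Cr V. \<Oplus>.Q x\<in>Cr V. if v \<oplus>.V fst (u g x) = w then chi (kap g x v) **.Q phi w else \<zero>.Q)"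
  using phic fin_V by (intro Q.finsum_swap) auto
 also have "... = (\<Oplus>.Q w\<in>Cr V. Q.pev eps (entry g v w) **.Q phi w)"
 proof (rule Q.finsum_cong')
  fix w assume w: "w : Cr V"
  have "(\<Oplus>.Q x\<in>Cr V. if v \<oplus>.V fst (u g x) = w then chi (kap g x v) **.Q phi w else \<zero>.Q)
   = (\<Oplus>.Q x\<in>{x : Cr V. v \<oplus>.V fst (u g x) = w}. chi (kap g x v) **.Q phi w)"
   using fin_V phic w by (intro Q.add.finprod_mono_neutral_cong_right) auto
  then show "(\<Oplus>.Q x\<in>Cr V. if v \<oplus>.V fst (u g x) = w then chi (kap g x v) **.Q phi w else \<zero>.Q)
   = Q.pev eps (entry g v w) **.Q phi w"
   unfolding pev_entry using fin_V phic w by (simp add: Q.finsum_ldistr)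
 qed (use phic in auto)
 finally show ?thesis .
qed

definition delta where "delta w = (\<lambda>v\<in>Cr V. if v = w then \<one>.Q else \<zero>.Q)"

lemma delta_closed: "delta w : Cr Fun" by (auto simp: delta_def Fun_simps)

lemma reg_T_delta:
 assumes g: "g : Cr G" and v: "v : Cr V" and w: "w : Cr V"
 shows "reg.T g (delta w) v = Q.pev eps (entry g v w)"
proof -
 have "reg.T g (delta w) v = (\<Oplus>.Q w'\<in>Cr V. if w = w' then Q.pev eps (entry g v w') else \<zero>.Q)"
  unfolding reg_T_entry[OF g delta_closed v] by (intro Q.finsum_cong') (auto simp: delta_def)
 then show ?thesis using w fin_V by (simp add: Q.finsum_singleton)
qed

lemma reg_T_T_delta:
 assumes g: "g : Cr G" "g' : Cr G" and v: "v : Cr V" and w: "w : Cr V"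
 shows "(reg.T g **.EF reg.T g') (delta w) v
  = (\<Oplus>.Q x\<in>Cr V. Q.pev eps (entry g' v x) **.Q Q.pev eps (entry g x w))"
proof -
 have c: "reg.T g (delta w) : Cr Fun" using Fun.endo_D(1)[OF reg.T_closed[OF g(1)]] delta_closed by simp
 have "(reg.T g **.EF reg.T g') (delta w) v = reg.T g' (reg.T g (delta w)) v"
  using delta_closed by (simp add: Fun.endo_apply)
 also have "... = (\<Oplus>.Q x\<in>Cr V. Q.pev eps (entry g' v x) **.Q reg.T g (delta w) x)"
  by (rule reg_T_entry[OF g(2) c v])
 also have "... = (\<Oplus>.Q x\<in>Cr V. Q.pev eps (entry g' v x) **.Q Q.pev eps (entry g x w))"
  by (intro Q.finsum_cong') (auto simp: reg_T_delta[OF g(1) _ w])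
 finally show ?thesis .
qed

lemma entry_mult:
 assumes g: "g : Cr G" "g' : Cr G" and v: "v : Cr V" and w: "w : Cr V"
 shows "num (card (Fix (g **.G g'))) **.Q (\<Oplus>.Q x\<in>Cr V. Q.pev eps (entry g' v x) **.Q Q.pev eps (entry g x w))
  = Schar g g' **.Q Q.pev eps (entry (g **.G g') v w)"
proof -
 let ?f = "card (Fix (g **.G g'))"
 have k: "g **.G g' : Cr G" using g by (rule G_mult_closed)
 have TTc: "reg.T g **.EF reg.T g' : Cr (endo_ring Fun)" using g by simp
 have TTd: "(reg.T g **.EF reg.T g') (delta w) : Cr Fun"
  using Fun.endo_D(1)[OF TTc] delta_closed by simp
 have Td: "reg.T (g **.G g') (delta w) : Cr Fun" using Fun.endo_D(1)[OF reg.T_closed[OF k]] delta_closed by simp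
 have "([?f] \<cdot>.EF (reg.T g **.EF reg.T g')) (delta w) v = (reg.T (g **.G g') **.EF reg.S g g') (delta w) v"
  unfolding reg.T_mult[OF g] reg.S_T_comm[OF g(1) k] ..
 moreover have "(reg.T (g **.G g') **.EF reg.S g g') (delta w) v = Schar g g' **.Q Q.pev eps (entry (g **.G g') v w)"
  using reg_S_scalar(1)[OF _ _ g(1) Td] Fun_smult_apply[OF v] reg_T_delta[OF k v w] delta_closed
  by (simp add: Fun.endo_apply)
 moreover have "([?f] \<cdot>.EF (reg.T g **.EF reg.T g')) (delta w) v = [?f] \<cdot>.Q ((reg.T g **.EF reg.T g') (delta w) v)"
  unfolding Fun.endo_add_pow_apply[OF TTc delta_closed] by (rule Fun_add_pow_apply[OF TTd v])
 moreover have "(\<Oplus>.Q x\<in>Cr V. Q.pev eps (entry g' v x) **.Q Q.pev eps (entry g x w)) : Cr Q"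
  by (intro Q.finsum_closed) auto
 ultimately show ?thesis
  using reg_T_T_delta[OF g v w] by (simp add: Q.add_pow_ldistr)
qed

lemma entry_ginv_mult:
 assumes g: "g : Cr G" and v: "v : Cr V" and w: "w : Cr V"
 shows "(\<Oplus>.Q x\<in>Cr V. Q.pev eps (entry (ginv g) v x) **.Q Q.pev eps (entry g x w))
  = num (card (Cr V) * card (Fix g)) **.Q (if v = w then \<one>.Q else \<zero>.Q)"
proof -
 let ?n = "card (Cr V) * card (Fix g)"
 have "(reg.T g **.EF reg.T (ginv g)) (delta w) v = ([?n] \<cdot>.EF \<one>.EF) (delta w) v"
  unfolding reg.T_ginv[OF g] ..
 also have "... = [?n] \<cdot>.Q (delta w v)"
  using Fun.endo_add_pow_apply[of "\<one>.EF" "delta w" ?n] delta_closed Fun_add_pow_apply[OF delta_closed v]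
  by (simp add: Fun.endo_apply)
 also have "... = num ?n **.Q (if v = w then \<one>.Q else \<zero>.Q)"
  using v by (simp add: delta_def)
 finally show ?thesis using reg_T_T_delta[OF g ginv_closed[OF g] v w] by simp
qed

lemma ring_hom_nat_pow:
 assumes etah: "eta : Ring.ring_hom Q Q" and x: "x : Cr Q"
 shows "eta (x [^].Q (n :: nat)) = eta x [^].Q n"
proof -
 interpret h: ring_hom_cring Q Q eta
  by (simp add: ring_hom_cring_def ring_hom_cring_axioms_def Q.is_cring etah)
 show ?thesis using x by (induction n) simp_all
qed

lemma inverts_eps_chi:
 assumes eta: "inverts_eps eta" and z: "z : prime_field K"
 shows "eta (chi z) = chi (\<ominus> z)"
proof -
 have etah: "eta : Ring.ring_hom Q Q" and e: "eta eps **.Q eps = \<one>.Q" using eta by (auto simp: inverts_eps_def)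
 interpret h: ring_hom_cring Q Q eta
  by (simp add: ring_hom_cring_def ring_hom_cring_axioms_def Q.is_cring etah)
 have "eta (chi z) **.Q chi z = (eta eps **.Q eps) [^].Q idx z"
  using eps by (simp add: chi_def Q.nat_pow_distrib ring_hom_nat_pow[OF etah])
 also have "... = chi (\<ominus> z) **.Q chi z"
  unfolding e using z by (simp add: F.l_neg chi_add[symmetric])
 finally have "eta (chi z) **.Q chi z = chi (\<ominus> z) **.Q chi z" .
 moreover have "chi z ~= \<zero>.Q"
 proof
  assume "chi z = \<zero>.Q"
  then have "chi (\<ominus> z \<oplus> z) = \<zero>.Q" using chi_add[of "\<ominus> z" z] z by simp
  then show False using z by (simp add: F.l_neg)
 qed
 ultimately show ?thesis using Q.m_rcancel[of "chi z" "eta (chi z)" "chi (\<ominus> z)"] by simp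
qed

text \<open>The substitution of \<open>g x\<close> for the summation variable exchanges the two
  indices and negates the exponent \<open>kap\<close>, because \<open>u (ginv g) (g x)\<close> is
  the inverse of \<open>u g x\<close>.\<close>

lemma entry_conj:
 assumes g: "g : Cr G" and eta: "inverts_eps eta" and v: "v : Cr V" and w: "w : Cr V"
 shows "eta (Q.pev eps (entry g v w)) = Q.pev eps (entry (ginv g) w v)"
proof -
 note gi = ginv_closed[OF g]
 have etah: "eta : Ring.ring_hom Q Q" using eta by (auto simp: inverts_eps_def)
 interpret h: ring_hom_cring Q Q eta
  by (simp add: ring_hom_cring_def ring_hom_cring_axioms_def Q.is_cring etah)
 let ?A = "{x : Cr V. v \<oplus>.V fst (u g x) = w}"
 let ?B = "{y : Cr V. w \<oplus>.V fst (u (ginv g) y) = v}"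
 have flip: "(w \<oplus>.V (x \<ominus>.V y) = v) <-> (v \<oplus>.V (y \<ominus>.V x) = w)" if "x : Cr V" "y : Cr V" for x y
 proof -
  have "w = v \<oplus>.V (y \<ominus>.V x)" if "w \<oplus>.V (x \<ominus>.V y) = v"
   using that[symmetric] \<open>x : Cr V\<close> \<open>y : Cr V\<close> w
   by (simp add: a_minus_def M.a_assoc M.r_neg1 M.r_neg2) (simp add: M.a_assoc[symmetric] M.l_neg M.r_neg M.a_lcomm[of x] )
  moreover have "v = w \<oplus>.V (x \<ominus>.V y)" if "v \<oplus>.V (y \<ominus>.V x) = w"
   using that[symmetric] \<open>x : Cr V\<close> \<open>y : Cr V\<close> v
   by (simp add: a_minus_def M.a_assoc M.r_neg1 M.r_neg2) (simp add: M.a_assoc[symmetric] M.l_neg M.r_neg)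
  ultimately show ?thesis by metis
 qed
 have fA: "fst (u g x) = g x \<ominus>.V x" "fst (u (ginv g) (g x)) = x \<ominus>.V g x" if "x : Cr V" for x
  using that g gi by (simp_all add: u_eq ginv_apply G_D)
 have img: "g ` ?A = ?B"
 proof (intro equalityI subsetI)
  fix y assume "y : g ` ?A"
  then show "y : ?B" using fA flip g by (auto simp: G_D)
 next
  fix y assume y: "y : ?B"
  then have gy: "g (ginv g y) = y" "ginv g y : Cr V" using g by (auto simp: ginv_apply)
  have "ginv g y : ?A" using y gy fA[of "ginv g y"] flip[of "ginv g y" y] g by simp
  then show "y : g ` ?A" by (rule rev_image_eqI) (simp add: gy)
 qed
 have inj: "inj_on g ?A" using G_D(7)[OF g] by (rule inj_on_subset) auto
 have neg: "kap (ginv g) (g x) w = \<ominus> kap g x v" if x: "x : ?A" for x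
 proof -
  define d where "d = g x \<ominus>.V x"
  have c: "x : Cr V" "g x : Cr V" "d : Cr V" using x g by (auto simp: d_def G_D)
  have wd: "w = v \<oplus>.V d" using x fA(1)[of x] by (auto simp: d_def)
  have md: "x \<ominus>.V g x = \<ominus>.V d" using c(1,2) by (simp add: d_def a_minus_def M.minus_add M.minus_minus M.a_comm)
  have gx: "g x = d \<oplus>.V x" using c(1,2) by (simp add: d_def a_minus_def M.a_assoc M.l_neg)
  have k1: "kap g x v = \<ominus> h x d \<oplus> h d v" using c g by (simp add: kap_def u_eq d_def)
  have "kap (ginv g) (g x) w = \<ominus> h (g x) (\<ominus>.V d) \<oplus> h (\<ominus>.V d) w"
   using c g gi by (simp add: kap_def u_eq ginv_apply md)
  also have "... = h d d \<oplus> h x d \<oplus> (\<ominus> h d v \<oplus> \<ominus> h d d)"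
   using c v by (simp add: gx wd h_add_l h_add_r F.minus_add F.minus_minus)
  also have "... = h x d \<oplus> \<ominus> h d v"
  proof -
   have "(a \<oplus> b) \<oplus> (e \<oplus> \<ominus> a) = (b \<oplus> e) \<oplus> (a \<oplus> \<ominus> a)"
    if "a : Cr K" "b : Cr K" "e : Cr K" for a b e
    using that by (simp only: F.a_ac F.add.m_closed F.add.inv_closed)
   then show ?thesis using c v by (simp add: F.r_neg)
  qed
  finally show ?thesis unfolding k1 using c v by (simp add: F.minus_add F.minus_minus)
 qed
 have "eta (Q.pev eps (entry g v w)) = (\<Oplus>.Q x\<in>?A. eta (chi (kap g x v)))"
  unfolding pev_entry by (simp add: h.hom_finsum o_def Pi_def)
 also have "... = (\<Oplus>.Q x\<in>?A. chi (kap (ginv g) (g x) w))"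
  using inverts_eps_chi[OF eta] kap_closed[OF g] v neg by (intro Q.finsum_cong') auto
 also have "... = (\<Oplus>.Q y\<in>g ` ?A. chi (kap (ginv g) y w))"
  by (rule Q.finsum_reindex[symmetric]) (use inj in auto)
 finally show ?thesis unfolding img pev_entry .
qed

definition enum where "enum = (SOME e. bij_betw e {..<card (Cr V)} (Cr V))"

lemma enum: "bij_betw enum {..<card (Cr V)} (Cr V)"
 unfolding enum_def using ex_bij_betw_nat_finite[OF fin_V] by (metis (mono_tags) lessThan_atLeast0 someI_ex)

lemma enum_closed: "i < card (Cr V) ==> enum i : Cr V"
 using enum by (auto simp: bij_betw_def)

definition Del where "Del g = Q.pdet eps (card (Cr V)) (\<lambda>i j. entry g (enum i) (enum j))"

lemma Del_closed [simp]: "Del g : Cr Q"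
 using eps by (simp add: Del_def)

lemma pev_matrix_product:
 assumes "i < card (Cr V)" "j < card (Cr V)"
 shows "Q.pev eps (\<Sum>k<card (Cr V). entry g (enum i) (enum k) * entry g' (enum k) (enum j))
  = (\<Oplus>.Q x\<in>Cr V. Q.pev eps (entry g (enum i) x) **.Q Q.pev eps (entry g' x (enum j)))"
proof -
 have "(\<Oplus>.Q x\<in>Cr V. Q.pev eps (entry g (enum i) x) **.Q Q.pev eps (entry g' x (enum j)))
  = (\<Oplus>.Q x\<in>enum ` {..<card (Cr V)}. Q.pev eps (entry g (enum i) x) **.Q Q.pev eps (entry g' x (enum j)))"
  using enum by (simp add: bij_betw_def)
 also have "... = (\<Oplus>.Q k\<in>{..<card (Cr V)}. Q.pev eps (entry g (enum i) (enum k)) **.Q Q.pev eps (entry g' (enum k) (enum j)))"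
  using enum by (intro Q.finsum_reindex) (auto simp: bij_betw_def)
 finally show ?thesis using eps by (simp add: Q.pev_sum Q.pev_mult)
qed

lemma Del_mult:
 assumes g: "g : Cr G" "g' : Cr G"
 defines "N == card (Cr V)"
 shows "num (card (Fix (g **.G g'))) [^].Q N **.Q (Del g' **.Q Del g) = Schar g g' [^].Q N **.Q Del (g **.G g')"
proof -
 let ?b = "of_nat (card (Fix (g **.G g'))) :: int poly"
 let ?a = "(\<Sum>xi\<in>pairs g g'. [:0, 1:] ^ idx (q g xi)) :: int poly"
 have a: "Q.pev eps ?a = Schar g g'"
  using eps by (simp add: Q.pev_sum Q.pev_power Q.pev_var Schar_def chi_def)
 have b: "Q.pev eps ?b = num (card (Fix (g **.G g')))" using eps by (simp add: Q.pev_of_nat)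
 have "Q.pev eps ?b [^].Q N **.Q (Del g' **.Q Del g) = Q.pev eps ?a [^].Q N **.Q Del (g **.G g')"
  unfolding Del_def N_def
 proof (rule Q.pdet_mult[OF eps(1)])
  fix i j assume ij: "i < card (Cr V)" "j < card (Cr V)"
  have "Q.pev eps (?b * (\<Sum>k<card (Cr V). entry g' (enum i) (enum k) * entry g (enum k) (enum j)))
   = num (card (Fix (g **.G g'))) **.Q (\<Oplus>.Q x\<in>Cr V. Q.pev eps (entry g' (enum i) x) **.Q Q.pev eps (entry g x (enum j)))"
   using pev_matrix_product[OF ij, of g' g] b eps by (simp add: Q.pev_mult)
  also have "... = Schar g g' **.Q Q.pev eps (entry (g **.G g') (enum i) (enum j))"
   using entry_mult[OF g] enum_closed ij by simp
  finally show "Q.pev eps (?b * (\<Sum>k<card (Cr V). entry g' (enum i) (enum k) * entry g (enum k) (enum j)))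
   = Q.pev eps (?a * entry (g **.G g') (enum i) (enum j))"
   using a eps by (simp add: Q.pev_mult)
 qed
 then show ?thesis unfolding a b .
qed

lemma Del_ginv:
 assumes g: "g : Cr G"
 shows "Del (ginv g) **.Q Del g = num (card (Cr V) * card (Fix g)) [^].Q card (Cr V)"
proof -
 let ?N = "card (Cr V)" and ?a = "of_nat (card (Cr V) * card (Fix g)) :: int poly"
 have a: "Q.pev eps ?a = num (card (Cr V) * card (Fix g))" using eps by (simp only: Q.pev_of_nat)
 have "Q.pev eps 1 [^].Q ?N **.Q (Del (ginv g) **.Q Del g) = Q.pev eps ?a [^].Q ?N **.Q Q.pdet eps ?N (\<lambda>i j. if i = j then 1 else 0)"
  unfolding Del_def
 proof (rule Q.pdet_mult[OF eps(1)])
  fix i j assume ij: "i < ?N" "j < ?N"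
  have inj: "enum i = enum j <-> i = j" using enum ij by (auto simp: bij_betw_def inj_on_def)
  have "Q.pev eps (1 * (\<Sum>k<?N. entry (ginv g) (enum i) (enum k) * entry g (enum k) (enum j)))
   = num (card (Cr V) * card (Fix g)) **.Q (if i = j then \<one>.Q else \<zero>.Q)"
   using pev_matrix_product[OF ij, of "ginv g" g] entry_ginv_mult[OF g] enum_closed ij inj by simp
  then show "Q.pev eps (1 * (\<Sum>k<?N. entry (ginv g) (enum i) (enum k) * entry g (enum k) (enum j)))
   = Q.pev eps (?a * (if i = j then 1 else 0))"
   unfolding Q.pev_mult[OF eps(1), of ?a] a using eps by simp
 qed
 then show ?thesis unfolding a using eps by (simp add: Q.pdet_one)
qed

lemma Del_conj:
 assumes g: "g : Cr G" and eta: "inverts_eps eta"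
 shows "eta (Del g) = Del (ginv g)"
 unfolding Del_def
 by (rule Q.pdet_hom_transpose) (use eps eta entry_conj[OF g eta] enum_closed in \<open>auto simp: inverts_eps_def\<close>)

lemma ring_hom_num: "eta : Ring.ring_hom Q Q ==> eta (num n) = num n"
proof -
 assume etah: "eta : Ring.ring_hom Q Q"
 interpret h: ring_hom_cring Q Q eta
  by (simp add: ring_hom_cring_def ring_hom_cring_axioms_def Q.is_cring etah)
 show ?thesis by (induction n) auto
qed

text \<open>Since \<open>|V| = 1 + 4 c\<close>, a power of \<open>phi g = |V| |Fix g|\<close> divides the determinant of the averaging
 operator on the regular representation well enough to leave a normalizing factor.\<close>

lemma normalizing_odd:
 assumes p: "odd p" and fQ: "field Q"
 shows "\<exists>s. normalizing s"
proof -
 let ?N = "card (Cr V)"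
 define phi where "phi g = num (?N * card (Fix g))" for g
 obtain k where k: "?N = p ^ (2 * k)" using card_V_square by blast
 define c where "c = ?N div 4"
 \<comment> \<open>|V| is the square of the odd number \<open>p ^ k\<close>.\<close>
 have N4: "?N = 1 + 4 * c"
 proof -
  obtain r where r: "p ^ k = 2 * r + 1" using p by (metis oddE even_power)
  have "?N = (2 * r + 1) * (2 * r + 1)" using k r by (simp add: mult_2 power_add)
  then have "?N = 4 * (r * r + r) + 1" by (simp add: algebra_simps)
  then show ?thesis unfolding c_def by presburger
 qed
 have phic: "phi g : Cr Q" for g by (simp add: phi_def)
 have phi0: "phi g ~= \<zero>.Q" if "g : Cr G" for g
  unfolding phi_def num_mult[symmetric] using num_card_nonzero(1) num_card_nonzero(2)[OF that] Q.integral by blast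
 have pow0: "x [^].Q (n :: nat) ~= \<zero>.Q" if "x : Cr Q" "x ~= \<zero>.Q" for x n
  using that by (induction n) (use Q.integral in auto)
 \<comment> \<open>Heuristically, \<open>Del g\<close> is the power \<open>1 + 4 c\<close> of a
   scalar whose square has the size of \<open>phi g\<close>. Dividing by \<open>phi g\<close> to the
   power \<open>2 c\<close> leaves the exponent one.\<close>
 define s where "s g = Del g **.Q inv\<^bsub>Q\<^esub> (phi g [^].Q (2 * c))" for g
 have U: "phi g [^].Q (2 * c) : Units Q" if "g : Cr G" for g
  using field.field_Units[OF fQ] pow0[OF phic phi0[OF that]] phic by simp
 have sc: "s g : Cr Q" and sD: "s g **.Q phi g [^].Q (2 * c) = Del g" if "g : Cr G" for g
  using U[OF that] phic by (simp_all add: s_def Q.m_assoc Q.Units_l_inv)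
 have D: "Del (ginv g) **.Q Del g = phi g [^].Q ?N" if "g : Cr G" for g
  using Del_ginv[OF that] by (simp add: phi_def)
 have s0: "s g ~= \<zero>.Q" if g: "g : Cr G" for g
 proof
  assume "s g = \<zero>.Q"
  then have "Del g = \<zero>.Q" using sD[OF g] phic by simp
  then show False using D[OF g] pow0[OF phic phi0[OF g], of ?N] by simp
 qed
 \<comment> \<open>\<open>Del g\<close> times its conjugate is \<open>phi g\<close> to the power |V|
   = \<open>1 + 4 c\<close>; the two divisors take away \<open>4 c\<close> of this.\<close>
 have N2: "s g **.Q eta (s g) = phi g" if eta: "inverts_eps eta" and g: "g : Cr G" for eta g
 proof -
  have etah: "eta : Ring.ring_hom Q Q" using eta by (auto simp: inverts_eps_def)
  let ?P = "phi g [^].Q (2 * c)"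
  have Pc: "?P : Cr Q" using phic by simp
  have ec: "eta (s g) : Cr Q" using etah sc[OF g] by (rule ring_hom_closed)
  have "eta (s g) **.Q ?P = eta (s g **.Q ?P)"
   using ring_hom_mult[OF etah sc[OF g] Pc] ring_hom_nat_pow[OF etah phic] ring_hom_num[OF etah]
   by (simp add: phi_def)
  also have "... = Del (ginv g)" unfolding sD[OF g] by (rule Del_conj[OF g eta])
  finally have "(eta (s g) **.Q ?P) **.Q (s g **.Q ?P) = phi g [^].Q (1 + 4 * c)"
   using D[OF g] sD[OF g] N4 by simp
  moreover have "phi g [^].Q (1 + 4 * c) = phi g **.Q (?P **.Q ?P)"
   using phic Q.m_comm[OF _ phic] by (simp add: Q.nat_pow_mult)
  ultimately have "(s g **.Q eta (s g)) **.Q (?P **.Q ?P) = phi g **.Q (?P **.Q ?P)"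
   using ec sc[OF g] Pc by (simp add: Q.m_ac)
  moreover have "?P **.Q ?P ~= \<zero>.Q" using pow0[OF phic phi0[OF g]] Pc Q.integral by blast
  ultimately show ?thesis using Q.m_rcancel[of "?P **.Q ?P"] Pc ec sc[OF g] phic by simp
 qed
 have N1: "num (card (Fix (g **.G g'))) **.Q (s g **.Q s g') = Schar g g' **.Q s (g **.G g')"
  if g: "g : Cr G" "g' : Cr G" for g g'
 proof -
  define k where "k = g **.G g'"
  have kG: "k : Cr G" using g by (simp add: k_def G_mult_closed)
  define F where "F = num (card (Fix k))"
  define C where "C = Schar g g'"
  define P P' R Y Z where PP: "P = phi g [^].Q (2 * c)" "P' = phi g' [^].Q (2 * c)" "R = phi k [^].Q (2 * c)"
   "Y = C [^].Q (4 * c)" "Z = F [^].Q (4 * c)"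
  have cl: "F : Cr Q" "C : Cr Q" "P : Cr Q" "P' : Cr Q" "R : Cr Q" "Y : Cr Q" "Z : Cr Q"
   "s g : Cr Q" "s g' : Cr Q" "s k : Cr Q" "Scharbar g g' : Cr Q"
   using phic sc g kG by (simp_all add: PP F_def C_def)
  have pw: "x [^].Q (4 * c) = ((x **.Q x) **.Q (x **.Q x)) [^].Q c" "x [^].Q (2 * c) = (x **.Q x) [^].Q c"
   "x [^].Q (1 + 4 * c) = x **.Q x [^].Q (4 * c)"
   if "x : Cr Q" for x
  proof -
   have "4 * c = (c + c) + (c + c)" "2 * c = c + c" by simp_all
   then show "x [^].Q (4 * c) = ((x **.Q x) **.Q (x **.Q x)) [^].Q c"
    "x [^].Q (2 * c) = (x **.Q x) [^].Q c"
    using that by (simp_all only: Q.nat_pow_distrib Q.nat_pow_mult[symmetric] Q.m_closed)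
   have "x [^].Q (1 + 4 * c) = x [^].Q (1 :: nat) **.Q x [^].Q (4 * c)"
    by (rule Q.nat_pow_mult[OF that, symmetric])
   then show "x [^].Q (1 + 4 * c) = x **.Q x [^].Q (4 * c)"
    unfolding Q.nat_pow_eone[OF that] .
  qed
  define B where "B = Scharbar g g'"
  \<comment> \<open>Since the sum and its conjugate have equal squares, the fourth power of
    \<open>C\<close> is the square of the known product of \<open>C\<close> and its
    conjugate.\<close>
  have CB: "C **.Q C = B **.Q B" and Bc: "B : Cr Q"
   using Schar_square[OF g p] by (simp_all add: C_def B_def)
  have "C **.Q C **.Q (B **.Q B) = (C **.Q B) **.Q (C **.Q B)"
   using cl(2) Bc by (simp add: Q.m_ac)
  then have "C **.Q C **.Q (C **.Q C) = (C **.Q Scharbar g g') **.Q (C **.Q Scharbar g g')"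
   unfolding CB[symmetric] by (simp only: B_def)
  also have "... = num ((?N * card (Fix g) * card (Fix g') * card (Fix k)) * (?N * card (Fix g) * card (Fix g') * card (Fix k)))"
   using Schar_mult_Scharbar[OF g] by (simp only: C_def k_def num_mult)
  finally have "(C **.Q C **.Q (C **.Q C)) **.Q (phi k **.Q phi k)
   = (F **.Q F **.Q (F **.Q F)) **.Q ((phi g **.Q phi g) **.Q (phi g' **.Q phi g'))"
   by (simp only: F_def phi_def num_mult) (simp only: ac_simps)
  \<comment> \<open>The power \<open>c\<close> of this identity accounts for exactly the exponent
    \<open>4 c\<close> by which the determinant relation exceeds the one wanted for
    \<open>s\<close>.\<close>
  from arg_cong[OF this, of "\<lambda>x. x [^].Q c"]
  have YR: "Y **.Q R = Z **.Q (P **.Q P')"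
   using cl phic by (simp only: PP pw) (simp add: Q.nat_pow_distrib)
  have "(F **.Q Z) **.Q (Del g' **.Q Del g) = (C **.Q Y) **.Q Del k"
   using Del_mult[OF g] unfolding N4 k_def[symmetric] F_def[symmetric] C_def[symmetric] PP
    pw(3)[OF cl(1)] pw(3)[OF cl(2)] .
  then have "(F **.Q Z) **.Q ((s g' **.Q P') **.Q (s g **.Q P)) = (C **.Q Y) **.Q (s k **.Q R)"
   using sD g kG by (simp add: PP)
  also have "... = (C **.Q s k) **.Q (Y **.Q R)" using cl by (simp add: Q.m_ac)
  also have "... = (C **.Q s k) **.Q (Z **.Q (P **.Q P'))" unfolding YR ..
  finally have "(F **.Q (s g **.Q s g')) **.Q (Z **.Q (P **.Q P')) = (C **.Q s k) **.Q (Z **.Q (P **.Q P'))"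
   using cl by (simp add: Q.m_ac)
  moreover have "Z **.Q (P **.Q P') ~= \<zero>.Q"
  proof -
   have "Z ~= \<zero>.Q" "P ~= \<zero>.Q" "P' ~= \<zero>.Q"
    using pow0[OF cl(1)] num_card_nonzero(2)[OF kG] pow0[OF phic phi0] g by (simp_all add: PP F_def)
   then show ?thesis using Q.integral cl Q.m_closed by metis
  qed
  ultimately show ?thesis
   using Q.m_rcancel[of "Z **.Q (P **.Q P')" "F **.Q (s g **.Q s g')" "C **.Q s k"] cl
   by (simp add: F_def C_def k_def)
 qed
 have "normalizing s"
  unfolding normalizing_def using sc s0 N1 N2 by (auto simp: phi_def)
 then show ?thesis by blast
qed

end

section \<open>Normalizing factors for \<open>p = 2\<close>\<close>

context heis
begin

text \<open>For the form on the sum of the dual of \<open>U\<close> and \<open>U\<close>, the left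
  radical is the dual and the right radical is \<open>U\<close>. Both are preserved by every
  isometry.\<close>

definition rad_l where "rad_l = {x : Cr V. \<forall>y\<in>Cr V. h x y = \<zero>}"
definition rad_r where "rad_r = {x : Cr V. \<forall>y\<in>Cr V. h y x = \<zero>}"

lemma rad_l_D: "x : rad_l ==> x : Cr V" "x : rad_l ==> y : Cr V ==> h x y = \<zero>"
 and rad_r_D: "x : rad_r ==> x : Cr V" "x : rad_r ==> y : Cr V ==> h y x = \<zero>"
 by (auto simp: rad_l_def rad_r_def)

lemma rad_finite [simp]: "finite rad_l" "finite rad_r"
 by (rule finite_subset[OF _ fin_V], auto simp: rad_l_def rad_r_def)+

lemma rad_inter: "x : rad_l ==> x : rad_r ==> x = \<zero>.V"
 using nondeg[of x] rad_l_D rad_r_D by metis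

lemma rad_ops:
 "x : rad_l ==> y : rad_l ==> x \<ominus>.V y : rad_l"
 "x : rad_r ==> y : rad_r ==> x \<ominus>.V y : rad_r"
 "x : rad_r ==> y : rad_r ==> x \<oplus>.V y : rad_r"
 "\<zero>.V : rad_r"
 by (simp_all add: rad_l_def rad_r_def h_diff_l h_diff_r h_add_r)

lemma rad_r_add_iff: "x : rad_r ==> y : Cr V ==> y \<oplus>.V x : rad_r <-> y : rad_r"
 by (auto simp: rad_r_def h_add_r)

lemma rad_G:
 assumes g: "g : Cr G"
 shows "x : rad_l ==> g x : rad_l" "x : rad_r ==> g x : rad_r"
proof -
 have sur: "\<exists>y'\<in>Cr V. y = g y'" if "y : Cr V" for y
  using ginv_apply[OF g that] by metis
 show "g x : rad_l" if x: "x : rad_l"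
 proof -
  have "h (g x) y = \<zero>" if "y : Cr V" for y
   using sur[OF that] G_D(4)[OF g rad_l_D(1)[OF x]] rad_l_D(2)[OF x] by auto
  then show ?thesis using G_D(1)[OF g rad_l_D(1)[OF x]] by (simp add: rad_l_def)
 qed
 show "g x : rad_r" if x: "x : rad_r"
 proof -
  have "h y (g x) = \<zero>" if "y : Cr V" for y
   using sur[OF that] G_D(4)[OF g _ rad_r_D(1)[OF x]] rad_r_D(2)[OF x] by auto
  then show ?thesis using G_D(1)[OF g rad_r_D(1)[OF x]] by (simp add: rad_r_def)
 qed
qed

end

context char_data
begin

text \<open>Translation by \<open>t\<close> multiplies the sum by \<open>chi (f t)\<close>, which is
  not one, and a nonzero sum could be cancelled in a domain.\<close>

lemma sum_character:
 assumes S: "finite S" "S <= Cr V" "!!s t. s : S ==> t : S ==> s \<oplus>.V t : S"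
  and f: "!!s. s : S ==> f s : prime_field K" "!!s t. s : S ==> t : S ==> f (s \<oplus>.V t) = f s \<oplus> f t"
  and t: "t : S" "f t ~= \<zero>"
 shows "(\<Oplus>.Q s\<in>S. chi (f s)) = \<zero>.Q"
proof -
 let ?S = "\<Oplus>.Q s\<in>S. chi (f s)"
 have Sc: "?S : Cr Q" by (intro Q.finsum_closed) auto
 have tV: "t : Cr V" using t S by auto
 have inj: "inj_on (\<lambda>s. s \<oplus>.V t) S"
 proof (rule inj_onI)
  fix a b assume "a : S" "b : S" "a \<oplus>.V t = b \<oplus>.V t"
  then show "a = b" using S(2) tV M.add.right_cancel[of t a b] by blast
 qed
 have img: "(\<lambda>s. s \<oplus>.V t) ` S = S"
  by (rule endo_inj_surj[OF S(1) _ inj]) (use S(3) t in auto)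
 have "?S = (\<Oplus>.Q s\<in>(\<lambda>s. s \<oplus>.V t) ` S. chi (f s))" unfolding img ..
 also have "... = (\<Oplus>.Q s\<in>S. chi (f (s \<oplus>.V t)))"
  by (rule Q.finsum_reindex) (use inj in auto)
 also have "... = (\<Oplus>.Q s\<in>S. chi (f s) **.Q chi (f t))"
  by (intro Q.finsum_cong') (use f t in \<open>auto simp: chi_add\<close>)
 also have "... = ?S **.Q chi (f t)" using S(1) by (simp add: Q.finsum_ldistr)
 finally have e: "?S **.Q chi (f t) = ?S **.Q \<one>.Q" using Sc by simp
 show ?thesis
 proof (rule ccontr)
  assume "?S ~= \<zero>.Q"
  then have "chi (f t) = \<one>.Q" using e Sc Q.m_lcancel[of ?S "chi (f t)" "\<one>.Q"] by simp
  then show False using chi_eq_1_iff[OF f(1)[OF t(1)]] t(2) by simp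
 qed
qed

definition pol_fun where "pol_fun = (\<lambda>w\<in>Cr V. if w : rad_r then \<one>.Q else \<zero>.Q)"

lemma pol_fun_closed: "pol_fun : Cr Fun" by (auto simp: pol_fun_def Fun_simps)

text \<open>Where the function does not vanish, the exponent collapses to \<open>h (g r) w\<close>:
  most values of \<open>h\<close> on the components are zero, and the remaining
  \<open>- h r d\<close> equals \<open>h r w\<close>, because \<open>w + d\<close> lies in the right
  radical.\<close>

lemma reg_u_pol_fun:
 assumes g: "g : Cr G" and l: "l : rad_l" and r: "r : rad_r" and w: "w : Cr V"
 shows "reg (u g (l \<oplus>.V r)) pol_fun w = (if w \<oplus>.V (g l \<ominus>.V l) : rad_r then chi (h (g r) w) else \<zero>.Q)"
proof -
 define d e where de: "d = g l \<ominus>.V l" "e = g r \<ominus>.V r"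
 have lV: "l : Cr V" and rV: "r : Cr V" using l r rad_l_D rad_r_D by auto
 have gV: "g l : Cr V" "g r : Cr V" using lV rV g by (auto simp: G_D)
 have d: "d : rad_l" and e: "e : rad_r" using rad_G[OF g] l r rad_ops by (auto simp: de)
 have dV: "d : Cr V" and eV: "e : Cr V" using d e rad_l_D rad_r_D by auto
 have diff: "g (l \<oplus>.V r) \<ominus>.V (l \<oplus>.V r) = d \<oplus>.V e"
  using lV rV gV g by (simp add: de G_D a_minus_def M.minus_add M.a_ac)
 have "reg (u g (l \<oplus>.V r)) pol_fun w
   = chi (\<ominus> h (l \<oplus>.V r) (d \<oplus>.V e) \<oplus> h (d \<oplus>.V e) w) **.Q pol_fun (w \<oplus>.V (d \<oplus>.V e))"
  using u_eq[OF g, of "l \<oplus>.V r"] lV rV diff reg_apply[OF pol_fun_closed w] by simp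
 moreover have "w \<oplus>.V (d \<oplus>.V e) : rad_r <-> w \<oplus>.V d : rad_r"
  using rad_r_add_iff[OF e, of "w \<oplus>.V d"] w dV eV by (simp add: M.a_assoc)
 moreover have "\<ominus> h (l \<oplus>.V r) (d \<oplus>.V e) \<oplus> h (d \<oplus>.V e) w = h (g r) w" if "w \<oplus>.V d : rad_r"
 proof -
  have "h r w \<oplus> h r d = \<zero>" using rad_r_D(2)[OF that rV] rV w dV by (simp add: h_add_r)
  then have m: "\<ominus> h r d = h r w" using rV w dV by (intro F.minus_equality) auto
  have "h (l \<oplus>.V r) (d \<oplus>.V e) = h r d"
   using l e lV rV dV eV by (simp add: h_add_l h_add_r rad_l_D(2) rad_r_D(2))
  moreover have "h (d \<oplus>.V e) w = h (g r) w \<ominus> h r w"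
   using d dV eV w gV rV rad_l_D(2)[OF d w] by (simp add: h_add_l de h_diff_l)
  moreover have "h r w \<oplus> (h (g r) w \<ominus> h r w) = h (g r) w"
   using rV w gV by (simp add: a_minus_def F.a_lcomm[of "h r w"] F.r_neg)
  ultimately show ?thesis using m by simp
 qed
 ultimately show ?thesis
  using w dV eV by (simp add: pol_fun_def de)
qed

context
 assumes dec: "!!x. x : Cr V ==> \<exists>l\<in>rad_l. \<exists>r\<in>rad_r. x = l \<oplus>.V r"
begin

lemma rad_bij: "inj_on (\<lambda>(l, r). l \<oplus>.V r) (rad_l \<times> rad_r)" "(\<lambda>(l, r). l \<oplus>.V r) ` (rad_l \<times> rad_r) = Cr V"
proof -
 have "l = l' & r = r'" if a: "l : rad_l" "l' : rad_l" "r : rad_r" "r' : rad_r" "l \<oplus>.V r = l' \<oplus>.V r'" for l l' r r'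
 proof -
  have c: "l : Cr V" "l' : Cr V" "r : Cr V" "r' : Cr V" using a rad_l_D rad_r_D by auto
  have "l \<ominus>.V l' = (l \<oplus>.V r) \<ominus>.V (l' \<oplus>.V r)" using M.add_diff_cancel[of l l' r] c by simp
  also have "... = (r' \<oplus>.V l') \<ominus>.V (r \<oplus>.V l')" unfolding a(5) using c by (simp add: M.a_comm)
  also have "... = r' \<ominus>.V r" using M.add_diff_cancel[of r' r l'] c by simp
  finally have e: "l \<ominus>.V l' = r' \<ominus>.V r" .
  have "l \<ominus>.V l' = \<zero>.V" using rad_ops(1)[OF a(1,2)] rad_ops(2)[OF a(4,3)] by (intro rad_inter) (auto simp: e)
  then show ?thesis using M.diff_eq_zero[of l l'] M.diff_eq_zero[of r' r] c e by auto
 qed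
 then show "inj_on (\<lambda>(l, r). l \<oplus>.V r) (rad_l \<times> rad_r)" by (auto simp: inj_on_def)
 show "(\<lambda>(l, r). l \<oplus>.V r) ` (rad_l \<times> rad_r) = Cr V"
 proof
  show "(\<lambda>(l, r). l \<oplus>.V r) ` (rad_l \<times> rad_r) <= Cr V" using rad_l_D(1) rad_r_D(1) by auto
  show "Cr V <= (\<lambda>(l, r). l \<oplus>.V r) ` (rad_l \<times> rad_r)" using dec by force
 qed
qed

text \<open>The indicator function of the right radical is fixed by \<open>rho (x, 0)\<close> for \<open>x\<close> in the right
 radical; it turns out to be a common eigenvector of all averaging operators.\<close>

lemma reg_T_pol_fun:
 assumes g: "g : Cr G" and w: "w : Cr V"
 shows "reg.T g pol_fun w = num (card (Fix g \<inter> rad_l) * card rad_r) **.Q pol_fun w"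
proof -
 let ?c = "\<lambda>l. w \<oplus>.V (g l \<ominus>.V l) : rad_r"
 define C where "C = (\<Oplus>.Q r\<in>rad_r. chi (h (g r) w))"
 have Cc: "C : Cr Q" unfolding C_def by (intro Q.finsum_closed) auto
 have reg_c: "reg (u g x) pol_fun w : Cr Q" if "x : Cr V" for x
 proof -
  obtain y z where yz: "u g x = (y, z)" by (cases "u g x")
  have "y : Cr V" using u_closed[OF g that] by (simp add: yz E_carrier)
  then have "reg (y, z) pol_fun : Cr Fun" by (rule reg_maps[OF _ pol_fun_closed])
  then show ?thesis using w by (auto simp: yz Fun_simps)
 qed
 have "reg.T g pol_fun w = (\<Oplus>.Q x\<in>(\<lambda>(l, r). l \<oplus>.V r) ` (rad_l \<times> rad_r). reg (u g x) pol_fun w)"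
  unfolding rad_bij(2) by (rule reg_T_apply[OF g pol_fun_closed w])
 also have "... = finsum Q (\<lambda>xi. reg (u g (case xi of (l, r) => l \<oplus>.V r)) pol_fun w) (rad_l \<times> rad_r)"
  by (rule Q.finsum_reindex[OF _ rad_bij(1)]) (use reg_c in \<open>auto simp: rad_l_D(1) rad_r_D(1)\<close>)
 also have "... = (\<Oplus>.Q l\<in>rad_l. \<Oplus>.Q r\<in>rad_r. reg (u g (l \<oplus>.V r)) pol_fun w)"
  by (subst Q.finsum_Times[symmetric]) (use reg_c in \<open>auto simp: rad_l_D(1) rad_r_D(1)\<close>)
 also have "... = (\<Oplus>.Q l\<in>rad_l. if ?c l then C else \<zero>.Q)"
 proof (rule Q.finsum_cong')
  fix l assume l: "l : rad_l"
  have "(\<Oplus>.Q r\<in>rad_r. reg (u g (l \<oplus>.V r)) pol_fun w)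
   = (\<Oplus>.Q r\<in>rad_r. if ?c l then chi (h (g r) w) else \<zero>.Q)"
   by (rule Q.finsum_cong') (use reg_u_pol_fun[OF g l _ w] in auto)
  then show "(\<Oplus>.Q r\<in>rad_r. reg (u g (l \<oplus>.V r)) pol_fun w) = (if ?c l then C else \<zero>.Q)"
   by (cases "?c l") (simp_all add: C_def)
 qed (use Cc in auto)
 also have "... = [card {l : rad_l. ?c l}] \<cdot>.Q C" by (rule Q.finsum_const_filter) (use Cc in auto)
 also have "... = num (card (Fix g \<inter> rad_l) * card rad_r) **.Q pol_fun w"
 proof (cases "w : rad_r")
  case True
  have "C = (\<Oplus>.Q r\<in>rad_r. if True then \<one>.Q else \<zero>.Q)"
   unfolding C_def
  proof (rule Q.finsum_cong')
   fix r assume "r : rad_r"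
   then have "h (g r) w = \<zero>" using rad_r_D(2)[OF True] G_D(1)[OF g] rad_r_D(1) by blast
   then show "chi (h (g r) w) = (if True then \<one>.Q else \<zero>.Q)" by simp
  qed auto
  also have "... = [card {r : rad_r. True}] \<cdot>.Q \<one>.Q" by (rule Q.finsum_const_filter) auto
  finally have C1: "C = num (card rad_r)" by simp
  \<comment> \<open>For \<open>w\<close> in the right radical the condition places
    \<open>g l - l\<close> in both radicals, which meet only in zero.\<close>
  have "{l : rad_l. ?c l} = Fix g \<inter> rad_l"
  proof -
   have "?c l <-> g l = l" if l: "l : rad_l" for l
   proof -
    have lV: "l : Cr V" "g l : Cr V" using rad_l_D(1)[OF l] g by (auto simp: G_D)
    have "?c l <-> g l \<ominus>.V l : rad_r"
     using rad_r_add_iff[OF True, of "g l \<ominus>.V l"] lV w by (simp add: M.a_comm)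
    also have "... <-> g l \<ominus>.V l = \<zero>.V"
     using rad_inter[of "g l \<ominus>.V l"] rad_ops(1)[OF rad_G(1)[OF g l] l] rad_ops(4) by auto
    also have "... <-> g l = l" using M.diff_eq_zero[of "g l" l] lV by (auto simp: a_minus_def M.r_neg)
    finally show ?thesis .
   qed
   then show ?thesis by (auto simp: Fix_def rad_l_D(1))
  qed
  then have "[card {l : rad_l. ?c l}] \<cdot>.Q C = num (card (Fix g \<inter> rad_l)) **.Q num (card rad_r)"
   unfolding C1 by (simp add: Q.add_pow_ldistr)
  then show ?thesis using True w by (simp add: num_mult pol_fun_def)
 next
  case False
  have img: "g ` rad_r = rad_r"
   by (rule endo_inj_surj) (use rad_G(2)[OF g] inj_on_subset[OF G_D(7)[OF g]] rad_r_D(1) in auto)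
  have "C = (\<Oplus>.Q r\<in>g ` rad_r. chi (h r w))"
   unfolding C_def
   by (rule Q.finsum_reindex[symmetric]) (use inj_on_subset[OF G_D(7)[OF g]] rad_r_D(1) in auto)
  also have "... = \<zero>.Q"
  proof -
   \<comment> \<open>Off the right radical, \<open>r\<close> to \<open>h r w\<close> is a nontrivial
     character on \<open>rad_r\<close>, so its sum vanishes.\<close>
   obtain y where y: "y : Cr V" "h y w ~= \<zero>" using False w by (auto simp: rad_r_def)
   then obtain l r where lr: "l : rad_l" "r : rad_r" "y = l \<oplus>.V r" using dec by blast
   have "h r w ~= \<zero>" using y lr w rad_l_D[OF lr(1)] rad_r_D(1)[OF lr(2)] by (simp add: h_add_l)
   then show ?thesis
    unfolding img using lr(2) w by (intro sum_character[of rad_r "\<lambda>r. h r w" r]) (auto simp: rad_ops(3) h_add_l h_closed rad_r_D(1))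
  qed
  finally show ?thesis using False w by (simp add: pol_fun_def)
 qed
 finally show ?thesis .
qed

lemma reg_T_smult:
 assumes g: "g : Cr G" and c: "c : Cr Q" and phi: "phi : Cr Fun" and v: "v : Cr V"
 shows "reg.T g (c \<odot>.Fun phi) v = c **.Q reg.T g phi v"
proof -
 have phic: "phi w : Cr Q" if "w : Cr V" for w using phi that by (auto simp: Fun_simps)
 have "reg.T g (c \<odot>.Fun phi) v = (\<Oplus>.Q w\<in>Cr V. c **.Q (Q.pev eps (entry g v w) **.Q phi w))"
  unfolding reg_T_entry[OF g Fun.smult_closed[OF c phi] v]
  by (intro Q.finsum_cong') (use c phic in \<open>auto simp: Fun_smult_apply Q.m_lcomm\<close>)
 then show ?thesis
  unfolding reg_T_entry[OF g phi v] using fin_V c phic by (simp add: Q.finsum_rdistr)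
qed

text \<open>The eigenvalues on a common eigenvector satisfy the relations of the operators, so they
  are the factors sought. Being multiples of one, they are fixed by every ring endomorphism.\<close>

lemma normalizing_polarized: "\<exists>s. normalizing s"
proof -
 define s where "s g = num (card (Fix g \<inter> rad_l) * card rad_r)" for g
 have sc: "s g : Cr Q" for g by (simp add: s_def)
 have T: "reg.T g pol_fun = s g \<odot>.Fun pol_fun" if g: "g : Cr G" for g
  by (rule Fun_eqI)
   (use Fun.endo_D(1)[OF reg.T_closed[OF g] pol_fun_closed] Fun.smult_closed[OF sc pol_fun_closed]
    reg_T_pol_fun[OF g] in \<open>auto simp: Fun_smult_apply s_def\<close>)
 have p0: "pol_fun \<zero>.V = \<one>.Q" by (simp add: pol_fun_def rad_ops(4))
 have TT: "(reg.T g **.EF reg.T g') pol_fun \<zero>.V = s g **.Q s g'"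
  if "g : Cr G" "g' : Cr G" for g g'
  using that sc by (simp add: Fun.endo_apply pol_fun_closed T reg_T_smult Fun_smult_apply p0)
 have sq: "s g **.Q s g = num (card (Cr V) * card (Fix g))" if g: "g : Cr G" for g
 proof -
  let ?n = "card (Cr V) * card (Fix g)"
  have "s g **.Q s (ginv g) = ([?n] \<cdot>.EF \<one>.EF) pol_fun \<zero>.V"
   unfolding TT[OF g ginv_closed[OF g], symmetric] reg.T_ginv[OF g] ..
  also have "... = num ?n"
   using Fun.endo_add_pow_apply[of "\<one>.EF" pol_fun ?n] pol_fun_closed
    Fun_add_pow_apply[OF pol_fun_closed, of "\<zero>.V" ?n]
   by (simp add: Fun.endo_apply p0)
  finally show ?thesis using Fix_ginv[OF g] by (simp add: s_def)
 qed
 have s0: "s g ~= \<zero>.Q" if g: "g : Cr G" for g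
 proof
  assume "s g = \<zero>.Q"
  then have "num (card (Cr V)) **.Q num (card (Fix g)) = \<zero>.Q"
   using sq[OF g] unfolding num_mult by simp
  then show False using Q.integral[of "num (card (Cr V))" "num (card (Fix g))"] num_card_nonzero(1) num_card_nonzero(2)[OF g]
   by auto
 qed
 have N1: "num (card (Fix (g **.G g'))) **.Q (s g **.Q s g') = Schar g g' **.Q s (g **.G g')"
  if g: "g : Cr G" "g' : Cr G" for g g'
 proof -
  let ?f = "card (Fix (g **.G g'))"
  have k: "g **.G g' : Cr G" using g by (rule G_mult_closed)
  have TTc: "reg.T g **.EF reg.T g' : Cr (endo_ring Fun)" using g by simp
  have TTp: "(reg.T g **.EF reg.T g') pol_fun : Cr Fun"
   using Fun.endo_D(1)[OF TTc pol_fun_closed] .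
  have z: "\<zero>.V : Cr V" by simp
  have "([?f] \<cdot>.EF (reg.T g **.EF reg.T g')) pol_fun \<zero>.V = (reg.T (g **.G g') **.EF reg.S g g') pol_fun \<zero>.V"
   unfolding reg.T_mult[OF g] reg.S_T_comm[OF g(1) k] ..
  moreover have "(reg.T (g **.G g') **.EF reg.S g g') pol_fun \<zero>.V = Schar g g' **.Q s (g **.G g')"
   using reg_S_scalar(1)[OF _ _ g(1), of "s (g **.G g') \<odot>.Fun pol_fun" g'] Fun.smult_closed[OF sc pol_fun_closed] sc
   by (simp add: Fun.endo_apply pol_fun_closed T[OF k] Fun_smult_apply p0)
  moreover have "([?f] \<cdot>.EF (reg.T g **.EF reg.T g')) pol_fun \<zero>.V = [?f] \<cdot>.Q (s g **.Q s g')"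
   unfolding Fun.endo_add_pow_apply[OF TTc pol_fun_closed] TT[OF g, symmetric] by (rule Fun_add_pow_apply[OF TTp z])
  ultimately show ?thesis using sc by (simp add: Q.add_pow_ldistr)
 qed
 have "normalizing s"
  unfolding normalizing_def using sc s0 N1 sq
  by (auto simp: inverts_eps_def s_def ring_hom_num)
 then show ?thesis by blast
qed

end

end

text \<open>All orbits have |N| elements and \<open>F\<close> is constant on each. Inverses in
  \<open>N\<close> are not assumed: two meeting orbits agree because one contains the other and both
  have the same size.\<close>

lemma card_dvd_sum_free_action:
 fixes F :: "'x => int"
 assumes fin: "finite A" "finite N"
  and closed: "!!xi c. xi : A ==> c : N ==> act c xi : A"
  and free: "!!xi. xi : A ==> inj_on (\<lambda>c. act c xi) N"
  and comp: "!!xi c d. xi : A ==> c : N ==> d : N ==> \<exists>e\<in>N. act d (act c xi) = act e xi"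
  and unit: "!!xi. xi : A ==> xi : (\<lambda>c. act c xi) ` N"
  and inv: "!!xi c. xi : A ==> c : N ==> F (act c xi) = F xi"
 shows "int (card N) dvd sum F A"
proof -
 define orb where "orb xi = (\<lambda>c. act c xi) ` N" for xi
 have orb_card: "card (orb xi) = card N" if "xi : A" for xi
  unfolding orb_def by (rule card_image[OF free[OF that]])
 have orb_eq: "orb zta = orb xi" if xi: "xi : A" and zta: "zta : orb xi" for xi zta
 proof -
  obtain c where c: "c : N" "zta = act c xi" using zta by (auto simp: orb_def)
  have sub: "orb zta <= orb xi" using comp[OF xi c(1)] by (force simp: orb_def c(2))
  have "zta : A" using closed[OF xi c(1)] c(2) by simp
  then have "card (orb zta) = card (orb xi)" using orb_card xi by simp
  moreover have "finite (orb xi)" using fin by (simp add: orb_def)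
  ultimately show ?thesis using card_subset_eq[OF _ sub] by blast
 qed
 have orb_self: "xi : orb xi" if "xi : A" for xi using unit[OF that] by (simp add: orb_def)
 have un: "\<Union> (orb ` A) = A"
 proof
  show "\<Union> (orb ` A) <= A" using closed by (auto simp: orb_def)
  show "A <= \<Union> (orb ` A)" using orb_self by blast
 qed
 have dis: "B \<inter> C = {}" if "B : orb ` A" "C : orb ` A" "B ~= C" for B C
 proof (rule ccontr)
  assume "B \<inter> C ~= {}"
  then obtain zta where "zta : B" "zta : C" by blast
  then show False using that orb_eq by (metis imageE)
 qed
 have "sum F (\<Union> (orb ` A)) = (sum \<circ> sum) F (orb ` A)"
  by (rule sum.Union_disjoint) (use dis fin in \<open>auto simp: orb_def\<close>)
 then have "sum F A = (\<Sum>B\<in>orb ` A. sum F B)" by (simp add: un)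
 moreover have "int (card N) dvd sum F B" if B: "B : orb ` A" for B
 proof -
  obtain xi where xi: "xi : A" "B = orb xi" using B by blast
  have "sum F B = (\<Sum>c\<in>N. F (act c xi))"
   unfolding xi(2) orb_def by (simp add: sum.reindex[OF free[OF xi(1)]])
  also have "... = (\<Sum>c\<in>N. F xi)" by (rule sum.cong) (use inv[OF xi(1)] in auto)
  finally show ?thesis by simp
 qed
 ultimately show ?thesis by (simp add: dvd_sum)
qed

lemma int_ring_nat_pow: "x [^]\<^bsub>int_ring\<^esub> (n::nat) = x ^ n"
 by (induction n) (simp_all add: nat_pow_def)

lemma int_ring_add_pow: "[(n::nat)] \<cdot>\<^bsub>int_ring\<^esub> (1 :: int) = int n"
 by (induction n) (simp_all add: add_pow_def nat_pow_def)

lemma neg_power_cong_one: "(int r + 1) dvd (- int r) ^ n - 1"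
proof (induction n)
 case (Suc n)
 have "(- int r) ^ Suc n - 1 = (- int r) * ((- int r) ^ n - 1) - (int r + 1)" by (simp add: algebra_simps)
 then show ?case using Suc by (metis dvd_diff dvd_mult dvd_refl)
qed simp

lemma dvd_mult_minus_one: "(m::int) dvd x - 1 ==> m dvd y - 1 ==> m dvd x * y - 1"
proof -
 assume "m dvd x - 1" "m dvd y - 1"
 then have "m dvd (x - 1) * y + (y - 1)" by simp
 then show ?thesis by (simp add: algebra_simps)
qed

context char_data
begin

lemma eps_eq_minus_one:
 assumes p2: "p = 2" shows "eps = \<ominus>.Q \<one>.Q"
proof -
 have "(eps \<ominus>.Q \<one>.Q) **.Q (\<Oplus>.Q i\<in>{..<2::nat}. eps [^].Q i) = eps [^].Q (2::nat) \<ominus>.Q \<one>.Q"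
  using eps by (intro Q.geometric_sum)
 also have "... = \<zero>.Q" using eps(2) p2 by (simp add: a_minus_def Q.r_neg)
 finally have z: "(eps \<ominus>.Q \<one>.Q) **.Q (\<Oplus>.Q i\<in>{..<2::nat}. eps [^].Q i) = \<zero>.Q" .
 have "eps \<ominus>.Q \<one>.Q ~= \<zero>.Q" using Q.diff_eq_zero[of eps "\<one>.Q"] eps by auto
 moreover have "(\<Oplus>.Q i\<in>{..<2::nat}. eps [^].Q i) : Cr Q" using eps by (intro Q.finsum_closed) auto
 ultimately have "(\<Oplus>.Q i\<in>{..<2::nat}. eps [^].Q i) = \<zero>.Q"
  using z Q.integral[of "eps \<ominus>.Q \<one>.Q"] eps by auto
 moreover have "(\<Oplus>.Q i\<in>{..<2::nat}. eps [^].Q i) = eps \<oplus>.Q \<one>.Q"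
  using eps by (simp add: numeral_2_eq_2 lessThan_Suc)
 ultimately show ?thesis using Q.minus_equality[of eps "\<one>.Q"] eps by simp
qed

text \<open>Scalars from \<open>K\<close> act on the pairs, but \<open>q\<close> is not homogeneous
  for them, as \<open>h\<close> is bilinear over the prime field only. The right-hand side shows
  that \<open>q\<close> is preserved by those scalars that preserve \<open>h\<close>.\<close>

lemma pairs_smult:
 assumes g: "g : Cr G" "g' : Cr G" and c: "c : Cr K" and xi: "(x, y) : pairs g g'"
 shows "(c \<odot>.V x, c \<odot>.V y) : pairs g g'"
  and "q g (c \<odot>.V x, c \<odot>.V y) = h (c \<odot>.V (y \<ominus>.V g x)) (c \<odot>.V (g x \<ominus>.V x))"
proof -
 have V: "x : Cr V" "y : Cr V" and e: "(g x \<ominus>.V x) \<oplus>.V (g' y \<ominus>.V y) = \<zero>.V"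
  using xi by (auto simp: pairs_def)
 have gV: "g x : Cr V" "g' y : Cr V" using V g by (auto simp: G_D)
 have sd: "c \<odot>.V (a \<ominus>.V b) = c \<odot>.V a \<ominus>.V c \<odot>.V b" if "a : Cr V" "b : Cr V" for a b
  using that c by (simp add: a_minus_def smult_r_distr smult_r_minus)
 have "(c \<odot>.V g x \<ominus>.V c \<odot>.V x) \<oplus>.V (c \<odot>.V g' y \<ominus>.V c \<odot>.V y)
  = c \<odot>.V ((g x \<ominus>.V x) \<oplus>.V (g' y \<ominus>.V y))"
  using V gV c by (simp add: sd smult_r_distr)
 also have "... = \<zero>.V" unfolding e using c by simp
 finally show "(c \<odot>.V x, c \<odot>.V y) : pairs g g'"
  unfolding pairs_def using V c g by (simp add: G_D(3))
 show "q g (c \<odot>.V x, c \<odot>.V y) = h (c \<odot>.V (y \<ominus>.V g x)) (c \<odot>.V (g x \<ominus>.V x))"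
  using V gV c g by (simp add: q_def G_D(3) sd)
qed

lemma smult_right_inj:
 assumes "c : Cr K" "d : Cr K" "x : Cr V" "x ~= \<zero>.V" "c \<odot>.V x = d \<odot>.V x"
 shows "c = d"
proof (rule ccontr)
 assume "c ~= d"
 then have n: "c \<ominus> d ~= \<zero>" using F.diff_eq_zero assms by blast
 have "(c \<ominus> d) \<odot>.V x = d \<odot>.V x \<ominus>.V d \<odot>.V x"
  using assms by (simp add: a_minus_def smult_l_distr smult_l_minus)
 also have "... = \<zero>.V" using assms by (simp add: a_minus_def M.r_neg)
 finally have "x = inv (c \<ominus> d) \<odot>.V \<zero>.V" using VS.smult_cancel(1)[of "c \<ominus> d" x] n assms by simp
 also have "... = \<zero>.V" using n assms F.field_Units by (simp add: F.Units_inv_closed)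
 finally show False using assms by simp
qed

text \<open>The integral character sum is \<open>1\<close> modulo \<open>r + 1\<close>, where \<open>|K| = r\<^sup>2\<close>, since the \<open>r + 1\<close> scalars of
 norm \<open>1\<close> act freely on the nonzero pairs. This fixes the sign of \<open>s g = (- r)\<^bsup>e g\<^esup>\<close>, where
 \<open>|V| |Fix g| = r\<^bsup>2 e g\<^esup>\<close>.\<close>

lemma normalizing_hermitian:
 assumes p2: "p = 2" and r: "card (Cr K) = r * r" "r \<ge> 2"
  and N: "N <= Cr K" "card N = r + 1" "\<zero> \<notin> N" "\<one> : N" "!!c d. c : N ==> d : N ==> c ** d : N"
  and inv: "!!c x y. c : N ==> x : Cr V ==> y : Cr V ==> h (c \<odot>.V x) (c \<odot>.V y) = h x y"
 shows "\<exists>s. normalizing s"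
proof -
 \<comment> \<open>The scalars of \<open>char_data\<close> need only form a domain, so the same sums
   can be taken in the integers, with root of unity minus one. There signs and congruences make
   sense.\<close>
 interpret I: char_data K V p h int_ring "- 1"
 proof (unfold_locales)
  show "- 1 [^]\<^bsub>int_ring\<^esub> p = \<one>\<^bsub>int_ring\<^esub>" by (simp add: int_ring_nat_pow p2)
  show "[p] \<cdot>\<^bsub>int_ring\<^esub> \<one>\<^bsub>int_ring\<^esub> ~= \<zero>\<^bsub>int_ring\<^esub>" by (simp add: int_ring_add_pow p2)
 qed (use int.integral in auto)
 define SI where "SI g g' = (\<Sum>xi\<in>pairs g g'. (- 1) ^ idx (q g xi) :: int)" for g g'
 have finN: "finite N" using N(2) by (intro card_ge_0_finite) simp
 have neg: "\<ominus> z = z" if "z : prime_field K" for z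
 proof -
  have "z \<oplus> z = \<zero>" using F.add_pow_p[of z 1] that p2 by (simp add: numeral_2_eq_2)
  then show ?thesis using F.minus_equality[of z z] that by simp
 qed
 have SI1: "I.Schar g g' = SI g g'" for g g'
  by (simp add: I.Schar_def SI_def I.chi_def int_ring_nat_pow int_finsum_eq)
 have "I.Scharbar g g' = (\<Sum>xi\<in>pairs g g'. (- 1) ^ idx (\<ominus> q g xi) :: int)" for g g'
  by (simp add: I.Scharbar_def I.chi_def int_ring_nat_pow int_finsum_eq)
 then have SI2: "I.Scharbar g g' = SI g g'" if "g : Cr G" for g g'
  using neg q_closed[OF that] by (simp add: SI_def)
 \<comment> \<open>In characteristic two every value of \<open>q\<close> is its own negative, so the
   sum equals its conjugate and its square is known.\<close>
 have SS: "SI g g' * SI g g' = int (card (Cr V) * card (Fix g) * card (Fix g') * card (Fix (g **.G g')))"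
  if "g : Cr G" "g' : Cr G" for g g'
  using I.Schar_mult_Scharbar[OF that] SI1[of g g'] SI2[OF that(1), of g'] by (simp add: int_ring_add_pow)
 have cong: "(int r + 1) dvd SI g g' - 1" if g: "g : Cr G" "g' : Cr G" for g g'
 proof -
  let ?F = "\<lambda>xi. (- 1) ^ idx (q g xi) :: int"
  let ?A = "pairs g g' - {(\<zero>.V, \<zero>.V)}"
  let ?act = "\<lambda>c xi. (c \<odot>.V fst xi, c \<odot>.V snd xi)"
  have AV: "fst xi : Cr V" "snd xi : Cr V" "fst xi ~= \<zero>.V \<or> snd xi ~= \<zero>.V" if "xi : ?A" for xi
  proof -
   have "xi : pairs g g'" "xi ~= (\<zero>.V, \<zero>.V)" using that by blast+
   then show "fst xi : Cr V" "snd xi : Cr V" "fst xi ~= \<zero>.V \<or> snd xi ~= \<zero>.V"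
    by (simp_all only: pairs_carrier prod_eq_iff fst_conv snd_conv de_Morgan_conj simp_thms)
  qed
  have z0: "\<ominus>.V \<zero>.V = \<zero>.V" by (rule M.minus_equality) simp_all
  have NK: "c : Cr K" "c ~= \<zero>" if "c : N" for c using that N by auto
  have "int (card N) dvd sum ?F ?A"
  proof (rule card_dvd_sum_free_action[where act = ?act])
   show "finite ?A" "finite N" using finN by simp_all
   show "?act c xi : ?A" if "xi : ?A" "c : N" for xi c
   proof -
    have "x = \<zero>.V" if "c \<odot>.V x = \<zero>.V" "x : Cr V" for x
     using VS.smult_cancel(1)[of c x] NK[OF \<open>c : N\<close>] that F.field_Units by (auto simp: F.Units_inv_closed)
    then show ?thesis
     using pairs_smult(1)[OF g NK(1)[OF that(2)], of "fst xi" "snd xi"] that AV[OF that(1)] by auto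
   qed
   show "inj_on (\<lambda>c. ?act c xi) N" if "xi : ?A" for xi
    using AV[OF that] smult_right_inj NK by (auto simp: inj_on_def)
   show "\<exists>e\<in>N. ?act d (?act c xi) = ?act e xi" if "xi : ?A" "c : N" "d : N" for xi c d
    by (rule bexI[of _ "d ** c"]) (use AV[OF that(1)] NK that N(5) in \<open>auto simp: smult_assoc1\<close>)
   show "xi : (\<lambda>c. ?act c xi) ` N" if "xi : ?A" for xi
    by (rule image_eqI[of _ _ \<one>]) (use AV[OF that] N(4) in auto)
   show "?F (?act c xi) = ?F xi" if "xi : ?A" "c : N" for xi c
   proof -
    have "q g (?act c xi) = h (snd xi \<ominus>.V g (fst xi)) (g (fst xi) \<ominus>.V fst xi)"
     using pairs_smult(2)[OF g NK(1)[OF that(2)], of "fst xi" "snd xi"] inv[OF that(2)] that AV[OF that(1)] g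
     by (simp add: G_D(1))
    also have "... = q g xi" by (simp add: q_def split_beta)
    finally show ?thesis by simp
   qed
  qed
  \<comment> \<open>The pair of zeros, which the scalars do not move, contributes one.\<close>
  moreover have "SI g g' = ?F (\<zero>.V, \<zero>.V) + sum ?F ?A"
  proof -
   have "(\<zero>.V, \<zero>.V) : pairs g g'" using g by (simp add: pairs_def G_zero a_minus_def z0)
   then show ?thesis unfolding SI_def by (rule sum.remove[OF pairs_finite])
  qed
  moreover have "?F (\<zero>.V, \<zero>.V) = 1" using g by (simp add: q_def G_zero a_minus_def z0)
  ultimately show ?thesis using N(2) by (simp add: add.commute)
 qed
 obtain d0 where d0: "card (Cr V) = card (Cr K) ^ d0"
  using VS.lin_closed_card[OF fin_V F.finite_R, of "Cr V"] by (auto simp: VS.lin_closed_def)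
 define d where "d g = (SOME d. card (Fix g) = card (Cr K) ^ d)" for g
 have d: "card (Fix g) = card (Cr K) ^ d g" if "g : Cr G" for g
  unfolding d_def using someI_ex[OF card_Fix[OF that]] .
 define sI :: "('v => 'v) => int" where "sI g = (- int r) ^ (d0 + d g)" for g
 have sq: "sI g * sI g = int (card (Cr V) * card (Fix g))" if "g : Cr G" for g
 proof -
  have "sI g * sI g = (int r * int r) ^ (d0 + d g)" by (simp add: sI_def power_mult_distrib[symmetric])
  also have "... = int (card (Cr V) * card (Fix g))" using d0 d[OF that] r by (simp add: power_add)
  finally show ?thesis .
 qed
 have main: "int (card (Fix (g **.G g'))) * (sI g * sI g') = SI g g' * sI (g **.G g')" (is "?a = ?b")
  if g: "g : Cr G" "g' : Cr G" for g g'
 proof -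
  let ?k = "g **.G g'"
  have k: "?k : Cr G" using g by (rule G_mult_closed)
  have "?a * ?a = int (card (Fix ?k)) * int (card (Fix ?k)) * ((sI g * sI g) * (sI g' * sI g'))" by (simp add: ac_simps)
  also have "... = (SI g g' * SI g g') * (sI ?k * sI ?k)"
   unfolding sq[OF g(1)] sq[OF g(2)] sq[OF k] SS[OF g] by (simp add: ac_simps)
  also have "... = ?b * ?b" by (simp add: ac_simps)
  finally have "?a = ?b \<or> ?a = - ?b" by (simp add: square_eq_iff)
  \<comment> \<open>Modulo \<open>r + 1\<close> all powers of \<open>- r\<close> are one, and hence
    so are both sides. Opposite signs would make \<open>r + 1\<close>, which is at least 3, divide
    2.\<close>
  moreover have "?a ~= - ?b"
  proof
   assume e: "?a = - ?b"
   have "int (card (Fix ?k)) = (- int r) ^ (2 * d ?k)" using d[OF k] r by (simp add: power_mult power2_eq_square)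
   then have "(int r + 1) dvd int (card (Fix ?k)) - 1"
    using neg_power_cong_one[of r "2 * d ?k"] by (simp only:)
   then have "(int r + 1) dvd ?a - 1" using neg_power_cong_one[of r] by (intro dvd_mult_minus_one) (auto simp: sI_def)
   moreover have "(int r + 1) dvd ?b - 1" using neg_power_cong_one[of r] cong[OF g] by (intro dvd_mult_minus_one) (auto simp: sI_def)
   ultimately have "(int r + 1) dvd (?a - 1) + (?b - 1)" by (rule dvd_add)
   then have "(int r + 1) dvd - 2" unfolding e by simp
   then show False using r(2) zdvd_imp_le[of "int r + 1" 2] by simp
  qed
  ultimately show ?thesis by blast
 qed
 \<comment> \<open>Integers are carried over to \<open>Q\<close> as constant polynomials; as
   \<open>eps\<close> is minus one, the integral sum becomes \<open>Schar\<close>.\<close>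
 define \<iota> where "\<iota> n = Q.pev eps (of_int n)" for n :: int
 have \<iota>_mult: "\<iota> (a * b) = \<iota> a **.Q \<iota> b" for a b using eps by (simp add: \<iota>_def Q.pev_mult)
 have \<iota>_nat: "\<iota> (int n) = num n" for n using eps by (simp add: \<iota>_def Q.pev_of_nat)
 have \<iota>c: "\<iota> n : Cr Q" for n using eps by (simp add: \<iota>_def)
 have \<iota>_SI: "\<iota> (SI g g') = Schar g g'" for g g'
 proof -
  have "\<iota> (SI g g') = Q.pev eps (\<Sum>xi\<in>pairs g g'. (- 1) ^ idx (q g xi))"
   by (simp add: \<iota>_def SI_def)
  also have "... = (\<Oplus>.Q xi\<in>pairs g g'. Q.pev eps (- 1) [^].Q idx (q g xi))"
   using eps by (simp add: Q.pev_sum Q.pev_power)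
  also have "Q.pev eps (- 1) = eps" using eps eps_eq_minus_one[OF p2] Q.pev_uminus[of eps 1] by simp
  finally show ?thesis by (simp add: Schar_def chi_def)
 qed
 define s where "s g = \<iota> (sI g)" for g
 have s_pow: "s g = (\<ominus>.Q num r) [^].Q (d0 + d g)" for g
  using eps by (simp add: s_def \<iota>_def sI_def Q.pev_power Q.pev_uminus Q.pev_of_nat)
 have ssq: "s g **.Q s g = num (card (Cr V) * card (Fix g))" if "g : Cr G" for g
  unfolding s_def \<iota>_mult[symmetric] sq[OF that] \<iota>_nat ..
 have s0: "s g ~= \<zero>.Q" if g: "g : Cr G" for g
 proof
  assume "s g = \<zero>.Q"
  then have "num (card (Cr V)) **.Q num (card (Fix g)) = \<zero>.Q"
   using ssq[OF g] unfolding num_mult by simp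
  then show False using Q.integral[of "num (card (Cr V))" "num (card (Fix g))"] num_card_nonzero(1) num_card_nonzero(2)[OF g]
   by auto
 qed
 have N1: "num (card (Fix (g **.G g'))) **.Q (s g **.Q s g') = Schar g g' **.Q s (g **.G g')"
  if g: "g : Cr G" "g' : Cr G" for g g'
  unfolding s_def \<iota>_mult[symmetric] \<iota>_nat[symmetric] \<iota>_SI[symmetric] main[OF g] ..
 have etas: "eta (s g) = s g" if "inverts_eps eta" for eta g
 proof -
  have etah: "eta : Ring.ring_hom Q Q" using that by (auto simp: inverts_eps_def)
  interpret h: ring_hom_cring Q Q eta
   by (simp add: ring_hom_cring_def ring_hom_cring_axioms_def Q.is_cring etah)
  show ?thesis unfolding s_pow using ring_hom_nat_pow[OF etah] ring_hom_num[OF etah] by simp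
 qed
 have N2: "s g **.Q eta (s g) = num (card (Cr V) * card (Fix g))" if "inverts_eps eta" "g : Cr G" for eta g
  unfolding etas[OF that(1)] by (rule ssq[OF that(2)])
 have sc: "s g : Cr Q" for g unfolding s_def by (rule \<iota>c)
 have "normalizing s"
  unfolding normalizing_def using s0 N1 N2 sc by blast
 then show ?thesis by blast
qed

end

section \<open>Lifting a representation of \<open>E\<close> to the semidirect product\<close>

lemma GL_iff: "A : Cr (GL R W) <-> A : Cr W \<rightarrow> Cr W &
  (\<forall>x\<in>Cr W. \<forall>y\<in>Cr W. A (x \<oplus>.W y) = A x \<oplus>.W A y) &
  (\<forall>c\<in>Cr R. \<forall>x\<in>Cr W. A (c \<odot>.W x) = c \<odot>.W A x) &
  A : extensional (Cr W) & bij_betw A (Cr W) (Cr W)"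
 by (auto simp: GL_def module_hom_def)

lemma GL_D:
 assumes "A : Cr (GL R W)"
 shows "x : Cr W ==> A x : Cr W"
  "x : Cr W ==> y : Cr W ==> A (x \<oplus>.W y) = A x \<oplus>.W A y"
  "c : Cr R ==> x : Cr W ==> A (c \<odot>.W x) = c \<odot>.W A x"
  "A : extensional (Cr W)" "inj_on A (Cr W)" "A ` Cr W = Cr W"
  "bij_betw A (Cr W) (Cr W)"
 using assms by (auto simp: GL_iff bij_betw_def)

lemma GL_mult: "A **\<^bsub>GL R W\<^esub> B = compose (Cr W) B A"
 by (simp add: GL_def)

lemma GL_mult_closed:
 assumes W: "module R W" and A: "A : Cr (GL R W)" and B: "B : Cr (GL R W)"
 shows "compose (Cr W) B A : Cr (GL R W)"
proof -
 interpret module R W by (rule W)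
 have "bij_betw (compose (Cr W) B A) (Cr W) (Cr W)"
  using GL_D(7)[OF A] GL_D(7)[OF B] by (rule bij_betw_compose)
 then show ?thesis
  using GL_D(1-3)[OF A] GL_D(1-3)[OF B] by (auto simp: GL_iff compose_def)
qed

lemma GL_inv_into:
 assumes A: "A : Cr (GL R W)" and x: "x : Cr W"
 shows "inv_into (Cr W) A x : Cr W" "A (inv_into (Cr W) A x) = x" "inv_into (Cr W) A (A x) = x"
 using GL_D[OF A] x by (auto simp: f_inv_into_f inv_into_f_f inv_into_into)

text \<open>That a faithful absolutely irreducible representation has a central action of this kind
  is shown in \<open>central_character\<close>.\<close>

locale heis_rep = char_data K V p h Q eps + W: vectorspace Q W
 for K :: "('k, 'm) ring_scheme" (structure) and V :: "('k, 'v, 'n) module_scheme" and p :: nat and h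
  and Q :: "('q, 'c) ring_scheme" and eps :: 'q and W :: "('q, 'w, 'd) module_scheme" +
 fixes rho :: "'v \<times> 'k => 'w => 'w"
 assumes rho_hom: "rho : hom (form_group K V h) (GL Q W)"
  and rho_inj: "inj_on rho (Cr (form_group K V h))"
  and rho_central: "z : prime_field K ==> w : Cr W ==> rho (\<zero>.V, z) w = chi z \<odot>.W w"
begin

lemma rho_GL: "e : Cr E ==> rho e : Cr (GL Q W)"
 using rho_hom by (rule hom_in_carrier)

lemmas rho_D = GL_D[OF rho_GL]

lemma rho_mult_apply:
 "e : Cr E ==> e' : Cr E ==> w : Cr W ==> rho (e **.E e') w = rho e' (rho e w)"
 using hom_mult[OF rho_hom] by (simp add: GL_mult compose_def)

lemma rho_one_apply: "w : Cr W ==> rho \<one>.E w = w"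
 using rho_central[of \<zero>] by (simp add: E_one)

lemma rho_inv_apply:
 assumes e: "e : Cr E" and w: "w : Cr W"
 shows "rho e (rho (inv\<^bsub>E\<^esub> e) w) = w" "rho (inv\<^bsub>E\<^esub> e) (rho e w) = w"
proof -
 have ie: "inv\<^bsub>E\<^esub> e : Cr E" using e by (rule reg.E.inv_closed)
 show "rho e (rho (inv\<^bsub>E\<^esub> e) w) = w"
  unfolding rho_mult_apply[OF ie e w, symmetric] reg.E.l_inv[OF e] by (rule rho_one_apply[OF w])
 show "rho (inv\<^bsub>E\<^esub> e) (rho e w) = w"
  unfolding rho_mult_apply[OF e ie w, symmetric] reg.E.r_inv[OF e] by (rule rho_one_apply[OF w])
qed

lemma num_smult: "w : Cr W ==> num n \<odot>.W w = [n] \<cdot>.W w"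
 by (induction n) (simp_all add: W.smult_l_distr)

lemma smult_left_cancel:
 assumes "c : Cr Q" "c ~= \<zero>.Q" "x : Cr W" "y : Cr W" "c \<odot>.W x = c \<odot>.W y"
 shows "x = y"
 using W.smult_cancel(1)[OF assms(1,2,3), unfolded assms(5)] W.smult_cancel(1)[OF assms(1,2,4)]
 by (rule trans[OF sym])

abbreviation EW where "EW == endo_ring W"

sublocale R: intertwiner K V p h "endo_ring W" rho
proof (rule intertwiner_scalar[OF W.module_axioms])
 show "rho e : Cr (endo_ring W)" if "e : Cr E" for e
  using rho_D[OF that] by (auto simp: W.endo_simps PiE_iff)
 show "rho (e **.E e') = rho e **.EW rho e'" if "e : Cr E" "e' : Cr E" for e e'
  using hom_mult[OF rho_hom that] by (simp add: GL_mult W.endo_simps)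
 show "rho (\<zero>.V, z) w = chi z \<odot>.W w" if "z : prime_field K" "w : Cr W" for z w
  using that by (rule rho_central)
 show "w = \<zero>.W" if w: "w : Cr W" "[p] \<cdot>.W w = \<zero>.W" for w
 proof (rule smult_left_cancel[OF _ pQ w(1)])
  have "num p \<odot>.W w = \<zero>.W" using num_smult[OF w(1)] w(2) by (rule trans)
  also have "... = num p \<odot>.W \<zero>.W" by (rule W.smult_r_null[symmetric]) simp
  finally show "num p \<odot>.W w = num p \<odot>.W \<zero>.W" .
  show "num p : Cr Q" "\<zero>.W : Cr W" by simp_all
 qed
qed

lemma T_apply:
 assumes "g : Cr G" "w : Cr W"
 shows "R.T g w = (\<Oplus>.W x\<in>Cr V. rho (u g x) w)"
 unfolding R.T_def by (rule W.endo_finsum_apply[OF fin_V]) (use assms u_closed in auto)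

lemma T_D:
 assumes g: "g : Cr G"
 shows "w : Cr W ==> R.T g w : Cr W"
  "w : Cr W ==> w' : Cr W ==> R.T g (w \<oplus>.W w') = R.T g w \<oplus>.W R.T g w'"
  "c : Cr Q ==> w : Cr W ==> R.T g (c \<odot>.W w) = c \<odot>.W R.T g w"
proof -
 show "w : Cr W ==> R.T g w : Cr W"
  "w : Cr W ==> w' : Cr W ==> R.T g (w \<oplus>.W w') = R.T g w \<oplus>.W R.T g w'"
  using W.endo_D[OF R.T_closed[OF g]] by auto
 assume c: "c : Cr Q" and w: "w : Cr W"
 have uw: "rho (u g x) w : Cr W" if "x : Cr V" for x using rho_D(1)[OF u_closed[OF g that]] w .
 have "R.T g (c \<odot>.W w) = (\<Oplus>.W x\<in>Cr V. c \<odot>.W rho (u g x) w)"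
  unfolding T_apply[OF g W.smult_closed[OF c w]]
  by (rule W.finsum_cong') (use c w uw rho_D(3)[OF u_closed[OF g]] in auto)
 also have "... = c \<odot>.W R.T g w"
  unfolding T_apply[OF g w] using fin_V c uw by (intro W.finsum_smult_ldistr[symmetric]) auto
 finally show "R.T g (c \<odot>.W w) = c \<odot>.W R.T g w" .
qed

lemma T_T_ginv:
 assumes g: "g : Cr G" and w: "w : Cr W"
 shows "R.T (ginv g) (R.T g w) = num (card (Cr V) * card (Fix g)) \<odot>.W w"
proof -
 let ?n = "card (Cr V) * card (Fix g)"
 have "R.T (ginv g) (R.T g w) = (R.T g **.EW R.T (ginv g)) w" using w by (simp add: W.endo_apply)
 also have "... = ([?n] \<cdot>.EW \<one>.EW) w" unfolding R.T_ginv[OF g] ..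
 also have "... = num ?n \<odot>.W w"
  using W.endo_add_pow_apply[of "\<one>.EW" w ?n] w num_smult[OF w, of ?n] by (simp add: W.endo_apply)
 finally show ?thesis .
qed

lemma T_T_mult:
 assumes g: "g : Cr G" "g' : Cr G" and w: "w : Cr W"
 shows "num (card (Fix (g **.G g'))) \<odot>.W R.T g' (R.T g w) = Schar g g' \<odot>.W R.T (g **.G g') w"
proof -
 let ?f = "card (Fix (g **.G g'))"
 have k: "g **.G g' : Cr G" using g by (rule G_mult_closed)
 have TTc: "R.T g **.EW R.T g' : Cr (endo_ring W)" using g by simp
 have TT: "(R.T g **.EW R.T g') w = R.T g' (R.T g w)" using w by (simp add: W.endo_apply)
 have "num ?f \<odot>.W R.T g' (R.T g w) = ([?f] \<cdot>.EW (R.T g **.EW R.T g')) w"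
  unfolding W.endo_add_pow_apply[OF TTc w] TT using T_D(1)[OF g(2) T_D(1)[OF g(1) w]] by (rule num_smult)
 also have "... = (R.T (g **.G g') **.EW R.S g g') w"
  unfolding R.T_mult[OF g] R.S_T_comm[OF g(1) k] ..
 also have "... = Schar g g' \<odot>.W R.T (g **.G g') w"
  using S_scalar(1)[OF W.module_axioms R.intertwiner_axioms rho_central g(1) T_D(1)[OF k w]] w
  by (simp add: W.endo_apply)
 finally show ?thesis .
qed

lemma T_rho:
 assumes g: "g : Cr G" and e: "y : Cr V" "z : prime_field K" and w: "w : Cr W"
 shows "R.T g (rho (y, z) w) = rho (g y, z) (R.T g w)"
proof -
 have "(rho (y, z) **.EW R.T g) w = (R.T g **.EW rho (g y, z)) w"
  unfolding R.T_intertwines[OF g e] ..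
 then show ?thesis using w by (simp add: W.endo_apply)
qed

section \<open>Normalized intertwiners and the extended representation\<close>

context
 fixes s assumes norm: "normalizing s"
begin

lemma s_D:
 "g : Cr G ==> s g : Cr Q" "g : Cr G ==> s g ~= \<zero>.Q"
 "g : Cr G ==> g' : Cr G ==>
  num (card (Fix (g **.G g'))) **.Q (s g **.Q s g') = Schar g g' **.Q s (g **.G g')"
 "inverts_eps eta ==> g : Cr G ==> s g **.Q eta (s g) = num (card (Cr V) * card (Fix g))"
 using norm by (auto simp: normalizing_def)

lemma s_inv:
 assumes "g : Cr G"
 shows "inv\<^bsub>Q\<^esub> s g : Cr Q" "inv\<^bsub>Q\<^esub> s g **.Q s g = \<one>.Q" "inv\<^bsub>Q\<^esub> s g ~= \<zero>.Q"
proof -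
 have u: "s g : Units Q" using field.field_Units[OF W.field_axioms] s_D(1,2)[OF assms] by simp
 then show 1: "inv\<^bsub>Q\<^esub> s g : Cr Q" "inv\<^bsub>Q\<^esub> s g **.Q s g = \<one>.Q" by simp_all
 then show "inv\<^bsub>Q\<^esub> s g ~= \<zero>.Q" using s_D(1)[OF assms] by auto
qed

definition Mo where "Mo g = (\<lambda>w\<in>Cr W. inv\<^bsub>Q\<^esub> s g \<odot>.W R.T g w)"

lemma Mo_linear:
 assumes g: "g : Cr G"
 shows "w : Cr W ==> Mo g w : Cr W"
  "w : Cr W ==> w' : Cr W ==> Mo g (w \<oplus>.W w') = Mo g w \<oplus>.W Mo g w'"
  "c : Cr Q ==> w : Cr W ==> Mo g (c \<odot>.W w) = c \<odot>.W Mo g w"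
 using T_D[OF g] s_inv[OF g]
 by (simp_all add: Mo_def W.smult_r_distr W.smult_assoc1[symmetric] Q.m_comm)

text \<open>The product formulas for the operators and for \<open>s\<close> contain the same two
  factors. \<open>Schar\<close> is eliminated between them without being inverted, and the number of
  fixed points is cancelled at the end.\<close>

lemma Mo_mult:
 assumes g: "g : Cr G" "g' : Cr G" and w: "w : Cr W"
 shows "Mo (g **.G g') w = Mo g' (Mo g w)"
proof -
 let ?k = "g **.G g'"
 have k: "?k : Cr G" using g by (rule G_mult_closed)
 define a b c F S where d: "a = s g" "b = s g'" "c = s ?k" "F = num (card (Fix ?k))" "S = Schar g g'"
 define a' b' c' where d': "a' = inv\<^bsub>Q\<^esub> a" "b' = inv\<^bsub>Q\<^esub> b" "c' = inv\<^bsub>Q\<^esub> c"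
 have cl: "a : Cr Q" "b : Cr Q" "c : Cr Q" "F : Cr Q" "S : Cr Q"
  "a' : Cr Q" "b' : Cr Q" "c' : Cr Q"
  using s_D(1) s_inv(1) g k by (simp_all add: d d')
 have iv: "a' **.Q a = \<one>.Q" "b' **.Q b = \<one>.Q" "c' **.Q c = \<one>.Q"
  using s_inv(2) g k by (simp_all add: d d')
 define x y where xy: "x = R.T g' (R.T g w)" "y = R.T ?k w"
 have xyc: "x : Cr W" "y : Cr W" using T_D(1) g k w by (simp_all add: xy)
 have FX: "F \<odot>.W x = S \<odot>.W y" using T_T_mult[OF g w] by (simp add: d xy)
 have FS: "F **.Q (a **.Q b) = S **.Q c" using s_D(3)[OF g] by (simp add: d)
 have F0: "F ~= \<zero>.Q" using num_card_nonzero(2)[OF k] by (simp add: d)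
 have "Mo g' (Mo g w) = b' \<odot>.W (a' \<odot>.W x)"
  using w T_D[OF g(1)] T_D[OF g(2)] cl by (simp add: Mo_def d d' xy)
 moreover have "Mo ?k w = c' \<odot>.W y" using w by (simp add: Mo_def d d' xy)
 moreover have "F \<odot>.W (c' \<odot>.W y) = F \<odot>.W (b' \<odot>.W (a' \<odot>.W x))"
 proof -
  have "F = F **.Q ((a' **.Q a) **.Q (b' **.Q b))" unfolding iv using cl by simp
  also have "... = (F **.Q (a **.Q b)) **.Q (a' **.Q b')" using cl by (simp add: Q.m_ac)
  finally have F1: "F = (S **.Q c) **.Q (a' **.Q b')" unfolding FS .
  have "F **.Q c' = ((c' **.Q c) **.Q (a' **.Q b')) **.Q S"
   by (subst F1) (use cl in \<open>simp add: Q.m_ac\<close>)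
  also have "... = (b' **.Q a') **.Q S" unfolding iv using cl by (simp add: Q.m_comm)
  finally have "F \<odot>.W (c' \<odot>.W y) = (b' **.Q a') \<odot>.W (S \<odot>.W y)"
   using cl xyc by (simp add: W.smult_assoc1[symmetric])
  also have "... = F \<odot>.W (b' \<odot>.W (a' \<odot>.W x))"
   unfolding FX[symmetric] using cl xyc by (simp add: W.smult_assoc1[symmetric] Q.m_ac)
  finally show ?thesis .
 qed
 ultimately show ?thesis
  using smult_left_cancel[OF cl(4) F0, of "c' \<odot>.W y" "b' \<odot>.W (a' \<odot>.W x)"] cl xyc by simp
qed

lemma T_inj:
 assumes g: "g : Cr G" and w: "w : Cr W" "R.T g w = \<zero>.W"
 shows "w = \<zero>.W"
proof -
 let ?n = "num (card (Cr V) * card (Fix g))"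
 have n0: "?n ~= \<zero>.Q"
  unfolding num_mult[symmetric] using num_card_nonzero(1) num_card_nonzero(2)[OF g] Q.integral by blast
 have "?n \<odot>.W w = R.T (ginv g) \<zero>.W" unfolding T_T_ginv[OF g w(1), symmetric] w(2) ..
 also have "... = ?n \<odot>.W \<zero>.W" using W.endo_D(4)[OF R.T_closed[OF ginv_closed[OF g]]] W.smult_r_null[of ?n] by simp
 finally show ?thesis by (rule smult_left_cancel[OF _ n0 w(1), rotated 2]) simp_all
qed

lemma G_ginv_mult:
 assumes g: "g : Cr G"
 shows "g **.G ginv g = \<one>.G" "ginv g **.G g = \<one>.G" "\<one>.G **.G \<one>.G = \<one>.G"
 using ginv_apply[OF g] by (auto simp: G_mult G_one compose_def G_D(1)[OF g])

text \<open>At the identity, \<open>Mo\<close> is idempotent by \<open>Mo_mult\<close> and injective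
  by \<open>T_inj\<close>.\<close>

lemma Mo_one:
 assumes g: "g : Cr G" and w: "w : Cr W" shows "Mo \<one>.G w = w"
proof -
 note o = G_one_closed
 have c: "Mo \<one>.G w : Cr W" using Mo_linear(1)[OF o w] .
 define y where "y = Mo \<one>.G w \<ominus>.W w"
 have yc: "y : Cr W" using c w by (simp add: y_def)
 have "Mo \<one>.G (Mo \<one>.G w) = Mo \<one>.G w" using Mo_mult[OF o o w] G_ginv_mult(3)[OF g] by simp
 moreover have "Mo \<one>.G (y \<oplus>.W w) = Mo \<one>.G y \<oplus>.W Mo \<one>.G w" by (rule Mo_linear(2)[OF o yc w])
 moreover have "y \<oplus>.W w = Mo \<one>.G w" using c w by (simp add: y_def a_minus_def W.a_assoc W.l_neg)
 ultimately have "Mo \<one>.G y \<oplus>.W Mo \<one>.G w = \<zero>.W \<oplus>.W Mo \<one>.G w" using c by simp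
 then have "Mo \<one>.G y = \<zero>.W"
  using W.add.right_cancel[OF c Mo_linear(1)[OF o yc] W.zero_closed] by simp
 then have "inv\<^bsub>Q\<^esub> s \<one>.G \<odot>.W R.T \<one>.G y = inv\<^bsub>Q\<^esub> s \<one>.G \<odot>.W \<zero>.W"
  using yc s_inv(1)[OF o] W.smult_r_null by (simp add: Mo_def)
 then have "R.T \<one>.G y = \<zero>.W"
  by (rule smult_left_cancel[OF s_inv(1,3)[OF o] T_D(1)[OF o yc], rotated]) simp
 then have "y = \<zero>.W" by (rule T_inj[OF o yc])
 then show ?thesis using W.diff_eq_zero[OF c w] by (simp add: y_def)
qed

lemma Mo_GL:
 assumes g: "g : Cr G" shows "Mo g : Cr (GL Q W)"
proof -
 note gi = ginv_closed[OF g]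
 have "Mo (ginv g) (Mo g w) = w" "Mo g (Mo (ginv g) w) = w" if w: "w : Cr W" for w
  using Mo_mult[OF g gi w] Mo_mult[OF gi g w] Mo_one[OF g w] G_ginv_mult[OF g] by simp_all
 then have "bij_betw (Mo g) (Cr W) (Cr W)"
  using Mo_linear(1)[OF g] Mo_linear(1)[OF gi] by (intro bij_betw_byWitness[where f' = "Mo (ginv g)"]) auto
 moreover have "Mo g : extensional (Cr W)" unfolding Mo_def by (rule restrict_extensional)
 ultimately show ?thesis using Mo_linear[OF g] by (simp add: GL_iff)
qed

lemma Mo_rho:
 assumes g: "g : Cr G" and e: "y : Cr V" "z : prime_field K" and w: "w : Cr W"
 shows "Mo g (rho (y, z) w) = rho (g y, z) (Mo g w)"
proof -
 have eE: "(y, z) : Cr E" "(g y, z) : Cr E" using e g by (simp_all add: E_carrier G_D)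
 show ?thesis
  using T_rho[OF g e w] rho_D(1)[OF eE(1) w] rho_D(3)[OF eE(2) s_inv(1)[OF g] T_D(1)[OF g w]] w
  by (simp add: Mo_def)
qed

abbreviation act :: "('v => 'v) => 'v \<times> 'k => 'v \<times> 'k" where "act == (\<lambda>g (x, z). (g x, z))"

definition Phi where "Phi = (\<lambda>(g, e). compose (Cr W) (rho e) (Mo g))"

lemma Phi_apply: "w : Cr W ==> Phi (g, e) w = rho e (Mo g w)"
 by (simp add: Phi_def compose_def)

lemma Phi_one:
 assumes e: "e : Cr E" shows "Phi (\<one>.G, e) = rho e"
proof (rule extensionalityI)
 show "Phi (\<one>.G, e) : extensional (Cr W)" by (simp add: Phi_def compose_def)
 show "rho e : extensional (Cr W)" using rho_D(4)[OF e] .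
qed (simp add: Phi_apply Mo_one[OF G_one_closed])

lemma Phi_hom: "Phi : hom (semidirect_product G E act) (GL Q W)"
proof (rule homI)
 fix a assume "a : Cr (semidirect_product G E act)"
 then obtain g e where a: "a = (g, e)" "g : Cr G" "e : Cr E" by (auto simp: semidirect_product_def)
 then show "Phi a : Cr (GL Q W)" using GL_mult_closed[OF W.module_axioms Mo_GL rho_GL] by (simp add: Phi_def)
next
 fix a a' assume "a : Cr (semidirect_product G E act)" "a' : Cr (semidirect_product G E act)"
 then obtain g y z g' y' z' where a: "a = (g, (y, z))" "a' = (g', (y', z'))" "g : Cr G" "g' : Cr G"
  "(y, z) : Cr E" "(y', z') : Cr E" by (auto simp: semidirect_product_def)
 have c: "y : Cr V" "z : prime_field K" using a(5) by (simp_all add: E_carrier)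
 have e': "(g' y, z) : Cr E" using c a(4) by (simp add: E_carrier G_D)
 have m: "a **\<^bsub>semidirect_product G E act\<^esub> a' = (g **.G g', (g' y, z) **.E (y', z'))"
  by (simp add: a semidirect_product_def)
 show "Phi (a **\<^bsub>semidirect_product G E act\<^esub> a') = Phi a **\<^bsub>GL Q W\<^esub> Phi a'"
 proof (rule extensionalityI[of _ "Cr W"])
  fix w assume w: "w : Cr W"
  have mw: "Mo g w : Cr W" "Mo g' (Mo g w) : Cr W" "rho (y, z) (Mo g w) : Cr W"
   using Mo_linear(1) rho_D(1)[OF a(5)] a w by auto
  have "Phi (a **\<^bsub>semidirect_product G E act\<^esub> a') w = rho ((g' y, z) **.E (y', z')) (Mo g' (Mo g w))"
   unfolding m Phi_apply[OF w] Mo_mult[OF a(3,4) w] ..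
  also have "... = rho (y', z') (rho (g' y, z) (Mo g' (Mo g w)))"
   by (rule rho_mult_apply[OF e' a(6) mw(2)])
  also have "rho (g' y, z) (Mo g' (Mo g w)) = Mo g' (rho (y, z) (Mo g w))"
   by (rule Mo_rho[OF a(4) c mw(1), symmetric])
  also have "rho (y', z') (Mo g' (rho (y, z) (Mo g w))) = (Phi a **\<^bsub>GL Q W\<^esub> Phi a') w"
   unfolding GL_mult a using w mw by (simp add: compose_def Phi_apply)
  finally show "Phi (a **\<^bsub>semidirect_product G E act\<^esub> a') w = (Phi a **\<^bsub>GL Q W\<^esub> Phi a') w" .
 qed (simp_all add: GL_mult Phi_def compose_def split_beta)
qed

text \<open>Conjugation by the image of \<open>(g, e)\<close> carries \<open>rho (y, 0)\<close> to
  the image of an element with first coordinate \<open>g y\<close>. This makes \<open>g\<close>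
  recoverable from \<open>Phi\<close>.\<close>

lemma Phi_conj:
 assumes g: "g : Cr G" and e: "x : Cr V" "z : prime_field K" and y: "y : Cr V" and w: "w : Cr W"
 shows "Phi (g, (x, z)) (rho (y, \<zero>) w) = rho (g y, beta (g y) x) (Phi (g, (x, z)) w)"
proof -
 have gy: "g y : Cr V" using g y by (simp add: G_D)
 have E1: "(x, z) : Cr E" "(y, \<zero>) : Cr E" "(g y, \<zero>) : Cr E" "(g y, beta (g y) x) : Cr E"
  using e y gy by (simp_all add: E_carrier)
 have ec: "(x, z) **.E (g y, beta (g y) x) = (g y, \<zero>) **.E (x, z)"
  using E_conj[OF gy prime_field_closed(2) e] E1 gy e
  by (metis reg.E.inv_solve_left reg.E.m_closed F.l_zero beta_carrier)
 have mw: "Mo g w : Cr W" using Mo_linear(1)[OF g w] .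
 have "Phi (g, (x, z)) (rho (y, \<zero>) w) = rho (x, z) (rho (g y, \<zero>) (Mo g w))"
  unfolding Phi_apply[OF rho_D(1)[OF E1(2) w]] Mo_rho[OF g y prime_field_closed(2) w] ..
 also have "... = rho ((x, z) **.E (g y, beta (g y) x)) (Mo g w)"
  unfolding ec by (rule rho_mult_apply[OF E1(3,1) mw, symmetric])
 also have "... = rho (g y, beta (g y) x) (Phi (g, (x, z)) w)"
  unfolding Phi_apply[OF w] by (rule rho_mult_apply[OF E1(1,4) mw])
 finally show ?thesis .
qed

text \<open>The isometry is read off from the conjugation action on the faithful image of
  \<open>E\<close>; then \<open>rho e\<close> is determined because \<open>Mo g\<close> is onto, and
  \<open>rho\<close> is injective.\<close>

lemma Phi_inj: "inj_on Phi (Cr (semidirect_product G E act))"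
proof (rule inj_onI)
 fix a a' assume "a : Cr (semidirect_product G E act)" "a' : Cr (semidirect_product G E act)"
  and eq: "Phi a = Phi a'"
 then obtain g x z g' x' z' where a: "a = (g, (x, z))" "a' = (g', (x', z'))" "g : Cr G" "g' : Cr G"
  and E1: "(x, z) : Cr E" "(x', z') : Cr E" by (auto simp: semidirect_product_def)
 have e: "x : Cr V" "z : prime_field K" "x' : Cr V" "z' : prime_field K" using E1 by (simp_all add: E_carrier)
 have surj: "Phi a ` Cr W = Cr W"
  using GL_D(6)[OF GL_mult_closed[OF W.module_axioms Mo_GL[OF a(3)] rho_GL[OF E1(1)]]] by (simp add: Phi_def a)
 have gg: "g y = g' y" if y: "y : Cr V" for y
 proof -
  have gy: "g y : Cr V" "g' y : Cr V" using a y by (auto simp: G_D)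
  have c: "(g y, beta (g y) x) : Cr E" "(g' y, beta (g' y) x') : Cr E" using gy e by (simp_all add: E_carrier)
  have "rho (g y, beta (g y) x) = rho (g' y, beta (g' y) x')"
  proof (rule extensionalityI[OF rho_D(4)[OF c(1)] rho_D(4)[OF c(2)]])
   fix v assume "v : Cr W"
   then obtain w where w: "w : Cr W" "v = Phi a w" using surj by blast
   show "rho (g y, beta (g y) x) v = rho (g' y, beta (g' y) x') v"
    using Phi_conj[OF a(3) e(1,2) y w(1)] Phi_conj[OF a(4) e(3,4) y w(1)] eq unfolding w(2) a by simp
  qed
  then show ?thesis using inj_onD[OF rho_inj _ c] by simp
 qed
 have g: "g = g'" using gg by (intro extensionalityI[OF G_D(6)[OF a(3)] G_D(6)[OF a(4)]])
 have "rho (x, z) = rho (x', z')"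
 proof (rule extensionalityI[OF rho_D(4)[OF E1(1)] rho_D(4)[OF E1(2)]])
  fix v assume "v : Cr W"
  then obtain w where w: "w : Cr W" "v = Mo g w" using GL_D(6)[OF Mo_GL[OF a(3)]] by blast
  show "rho (x, z) v = rho (x', z') v"
   unfolding w(2) using fun_cong[OF eq, of w] Phi_apply[OF w(1)] by (simp add: a g)
 qed
 then have "(x, z) = (x', z')" using inj_onD[OF rho_inj _ E1] by simp
 then show "a = a'" by (simp add: a g)
qed

theorem extends_to_isometries:
 assumes f: "sesquilinear Q W eta f" and eta: "inverts_eps eta"
  and inv: "!!e x y. e : Cr E ==> x : Cr W ==> y : Cr W ==> f (rho e x) (rho e y) = f x y"
 shows "extends_to_embedding G E act (isometry_group Q W f) rho"
proof -
 have etah: "eta : Ring.ring_hom Q Q" using eta by (auto simp: inverts_eps_def)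
 have fc: "x : Cr W ==> y : Cr W ==> f x y : Cr Q"
  and fal: "x : Cr W ==> x' : Cr W ==> y : Cr W ==> f (x \<oplus>.W x') y = f x y \<oplus>.Q f x' y"
  and far: "x : Cr W ==> y : Cr W ==> y' : Cr W ==> f x (y \<oplus>.W y') = f x y \<oplus>.Q f x y'"
  and fsl: "c : Cr Q ==> x : Cr W ==> y : Cr W ==> f (c \<odot>.W x) y = c **.Q f x y"
  and fsr: "c : Cr Q ==> x : Cr W ==> y : Cr W ==> f x (c \<odot>.W y) = eta c **.Q f x y"
  for x x' y y' c using f by (auto simp: sesquilinear_def)
 have f0l: "f \<zero>.W y = \<zero>.Q" if "y : Cr W" for y
  using fsl[of "\<zero>.Q" "\<zero>.W" y] fc[of "\<zero>.W" y] that W.smult_l_null[of "\<zero>.W"] by simp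
 have f0r: "f y \<zero>.W = \<zero>.Q" if y: "y : Cr W" for y
 proof -
  have "f y \<zero>.W \<oplus>.Q f y \<zero>.W = \<zero>.Q \<oplus>.Q f y \<zero>.W" using far[of y "\<zero>.W" "\<zero>.W"] y fc[of y "\<zero>.W"] by simp
  then show ?thesis using Q.add.right_cancel[of "f y \<zero>.W" "f y \<zero>.W" "\<zero>.Q"] fc[of y "\<zero>.W"] y by simp
 qed
 have sum_l: "f (\<Oplus>.W i\<in>I. b i) y = (\<Oplus>.Q i\<in>I. f (b i) y)"
  if "finite I" "!!i. i : I ==> b i : Cr W" "y : Cr W" for I :: "'v set" and b y
  using that by (induction I rule: finite_induct) (auto simp: f0l fal fc Pi_def W.finsum_insert Q.finsum_insert)
 have sum_r: "f y (\<Oplus>.W i\<in>I. b i) = (\<Oplus>.Q i\<in>I. f y (b i))"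
  if "finite I" "!!i. i : I ==> b i : Cr W" "y : Cr W" for I :: "'v set" and b y
  using that by (induction I rule: finite_induct) (auto simp: f0r far fc Pi_def W.finsum_insert Q.finsum_insert)
 have adj: "f (R.T g x) y = f x (R.T (ginv g) y)" if g: "g : Cr G" and x: "x : Cr W" and y: "y : Cr W" for g x y
 proof -
  note gi = ginv_closed[OF g]
  \<comment> \<open>The terms of \<open>T\<close> at \<open>ginv g\<close> are the inverses of those
    at \<open>g\<close>, and an invariant form moves each operator to the other side as its
    inverse.\<close>
  have ug: "u (ginv g) (g v) = inv\<^bsub>E\<^esub> (u g v)" if v: "v : Cr V" for v
  proof -
   have "(v, \<zero>) : Cr E" "(g v, \<zero>) : Cr E" using v g by (simp_all add: E_carrier G_D)
   then show ?thesis by (simp add: u_def reg.E.inv_mult_group ginv_apply(2)[OF g v])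
  qed
  have uE: "u g v : Cr E" if "v : Cr V" for v using u_closed[OF g that] .
  have "f (R.T g x) y = (\<Oplus>.Q v\<in>Cr V. f (rho (u g v) x) y)"
   unfolding T_apply[OF g x] by (rule sum_l[OF fin_V]) (use rho_D(1)[OF uE] x y in auto)
  also have "... = (\<Oplus>.Q v\<in>Cr V. f x (rho (u (ginv g) (g v)) y))"
  proof (rule Q.finsum_cong')
   fix v assume v: "v : Cr V"
   have "f (rho (u g v) x) (rho (u g v) (rho (inv\<^bsub>E\<^esub> (u g v)) y)) = f x (rho (inv\<^bsub>E\<^esub> (u g v)) y)"
    using uE[OF v] x y rho_D(1) by (intro inv) auto
   then show "f (rho (u g v) x) y = f x (rho (u (ginv g) (g v)) y)"
    using rho_inv_apply(1)[OF uE[OF v] y] ug[OF v] by simp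
  next
   show "(\<lambda>v. f x (rho (u (ginv g) (g v)) y)) : Cr V \<rightarrow> Cr Q"
    using rho_D(1)[OF u_closed[OF gi]] x y fc G_D(1)[OF g] by auto
  qed simp
  also have "... = (\<Oplus>.Q v\<in>g ` Cr V. f x (rho (u (ginv g) v) y))"
   by (rule Q.finsum_reindex[symmetric]) (use rho_D(1)[OF u_closed[OF gi]] x y fc G_D(7,8)[OF g] in auto)
  also have "... = f x (R.T (ginv g) y)"
   unfolding G_D(8)[OF g] T_apply[OF gi y] by (rule sum_r[OF fin_V, symmetric]) (use rho_D(1)[OF u_closed[OF gi]] x y in auto)
  finally show ?thesis .
 qed
 \<comment> \<open>Moving \<open>T g\<close> across the form produces |V| |Fix g|, which equals
   \<open>s g\<close> times its conjugate; the division by \<open>s g\<close> in both arguments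
   removes exactly this.\<close>
 have Mo_iso: "f (Mo g x) (Mo g y) = f x y" if g: "g : Cr G" and x: "x : Cr W" and y: "y : Cr W" for g x y
 proof -
  let ?n = "num (card (Cr V) * card (Fix g))"
  define a a' where a: "a = s g" "a' = inv\<^bsub>Q\<^esub> s g"
  have ac: "a : Cr Q" "a' : Cr Q" "a' **.Q a = \<one>.Q" using s_D(1)[OF g] s_inv[OF g] by (simp_all add: a)
  have hc: "eta a : Cr Q" "eta a' : Cr Q" using ring_hom_closed[OF etah] ac by auto
  have h1: "eta a' **.Q eta a = \<one>.Q" using ring_hom_mult[OF etah ac(2,1)] ac(3) ring_hom_one[OF etah] by simp
  have Tc: "R.T g x : Cr W" "R.T g y : Cr W" using T_D(1)[OF g] x y by auto
  have "f (R.T g x) (R.T g y) = f x (?n \<odot>.W y)" unfolding adj[OF g x Tc(2)] T_T_ginv[OF g y] ..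
  also have "... = ?n **.Q f x y" using fsr[OF _ x y, of ?n] ring_hom_num[OF etah] by simp
  also have "?n = a **.Q eta a" using s_D(4)[OF eta g] by (simp add: a)
  finally have TT: "f (R.T g x) (R.T g y) = (a **.Q eta a) **.Q f x y" .
  have "f (Mo g x) (Mo g y) = a' **.Q (eta a' **.Q f (R.T g x) (R.T g y))"
   using x y Tc ac hc fc[OF Tc] fsl fsr by (simp add: Mo_def a(2)[symmetric] Q.m_lcomm)
  also have "... = ((a' **.Q a) **.Q (eta a' **.Q eta a)) **.Q f x y"
   unfolding TT using ac(1,2) hc fc[OF x y] by (simp add: Q.m_ac)
  finally show ?thesis unfolding ac(3) h1 using fc[OF x y] by simp
 qed
 have iso: "Phi a : Cr (isometry_group Q W f)" if a: "a : Cr (semidirect_product G E act)" for a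
 proof -
  obtain g e where a': "a = (g, e)" "g : Cr G" "e : Cr E" using a by (auto simp: semidirect_product_def)
  have "Phi a : Cr (GL Q W)" using Phi_hom a by (rule hom_in_carrier)
  moreover have "f (Phi a x) (Phi a y) = f x y" if "x : Cr W" "y : Cr W" for x y
   using that inv[OF a'(3)] Mo_iso[OF a'(2)] Mo_linear(1)[OF a'(2)] by (simp add: a'(1) Phi_apply)
  ultimately show ?thesis by (simp add: isometry_group_def)
 qed
 have "Phi : hom (semidirect_product G E act) (isometry_group Q W f)"
  using iso hom_mult[OF Phi_hom] by (intro homI) (auto simp: isometry_group_def)
 then show ?thesis
  unfolding extends_to_embedding_def using Phi_inj Phi_one by blast
qed

end

end

section \<open>The dual sum\<close>

definition dual_sum_map where
 "dual_sum_map R W A = (\<lambda>v\<in>Cr (direct_sum (dual_space R W) W).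
   (\<lambda>x\<in>Cr W. fst v (inv_into (Cr W) A x), A (snd v)))"

context vectorspace
begin

lemma dual_iff: "alf : Cr (dual_space K V) <-> alf : Cr V \<rightarrow>\<^sub>E Cr K &
  (\<forall>x\<in>Cr V. \<forall>y\<in>Cr V. alf (x \<oplus>.V y) = alf x \<oplus>.K alf y) &
  (\<forall>c\<in>Cr K. \<forall>x\<in>Cr V. alf (c \<odot>.V x) = c **.K alf x)"
 by (simp add: dual_space_def)

lemma dual_ops:
 "alf \<oplus>\<^bsub>dual_space K V\<^esub> bta = (\<lambda>x\<in>Cr V. alf x \<oplus>.K bta x)"
 "c \<odot>\<^bsub>dual_space K V\<^esub> alf = (\<lambda>x\<in>Cr V. c **.K alf x)"
 by (simp_all add: dual_space_def func_space_def)

lemma dual_precompose: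
 assumes alf: "alf : Cr (dual_space K V)"
  and B: "!!x. x : Cr V ==> B x : Cr V"
   "!!x y. x : Cr V ==> y : Cr V ==> B (x \<oplus>.V y) = B x \<oplus>.V B y"
   "!!c x. c : Cr K ==> x : Cr V ==> B (c \<odot>.V x) = c \<odot>.V B x"
 shows "(\<lambda>x\<in>Cr V. alf (B x)) : Cr (dual_space K V)"
 using alf B by (auto simp: dual_iff PiE_iff)

lemma inv_into_linear:
 assumes A: "A : Cr (GL K V)"
 shows "x : Cr V ==> y : Cr V ==>
   inv_into (Cr V) A (x \<oplus>.V y) = inv_into (Cr V) A x \<oplus>.V inv_into (Cr V) A y"
  "c : Cr K ==> x : Cr V ==> inv_into (Cr V) A (c \<odot>.V x) = c \<odot>.V inv_into (Cr V) A x"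
proof -
 note i = GL_inv_into[OF A] and D = GL_D[OF A]
 show "inv_into (Cr V) A (x \<oplus>.V y) = inv_into (Cr V) A x \<oplus>.V inv_into (Cr V) A y"
  if "x : Cr V" "y : Cr V" for x y
  by (rule inv_into_f_eq[OF D(5)]) (simp_all add: i(1,2) D(2) that)
 show "inv_into (Cr V) A (c \<odot>.V x) = c \<odot>.V inv_into (Cr V) A x"
  if "c : Cr K" "x : Cr V" for c x
  by (rule inv_into_f_eq[OF D(5)]) (simp_all add: i(1,2) D(3) that)
qed

lemma GL_inverse:
 assumes A: "A : Cr (GL K V)"
 shows "(\<lambda>x\<in>Cr V. inv_into (Cr V) A x) : Cr (GL K V)"
proof -
 note i = GL_inv_into[OF A]
 have "bij_betw (\<lambda>x\<in>Cr V. inv_into (Cr V) A x) (Cr V) (Cr V)"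
  by (rule bij_betw_byWitness[where f' = A]) (use i GL_D(1)[OF A] in auto)
 then show ?thesis using i inv_into_linear[OF A] by (simp add: GL_iff)
qed

abbreviation DS where "DS == direct_sum (dual_space K V) V"

lemma DS_simps: "Cr DS = Cr (dual_space K V) \<times> Cr V"
 "v \<oplus>.DS w = (fst v \<oplus>\<^bsub>dual_space K V\<^esub> fst w, snd v \<oplus>.V snd w)"
 "c \<odot>.DS v = (c \<odot>\<^bsub>dual_space K V\<^esub> fst v, c \<odot>.V snd v)"
 by (simp_all add: direct_sum_def)

lemma DS_closed:
 assumes "v : Cr DS"
 shows "fst v : Cr (dual_space K V)" "snd v : Cr V" "fst v : extensional (Cr V)"
  "x : Cr V ==> fst v x : Cr K"
 using assms by (auto simp: DS_simps dual_iff PiE_iff)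

lemma DS_op_closed:
 assumes "v : Cr DS" "w : Cr DS" "c : Cr K"
 shows "v \<oplus>.DS w : Cr DS" "c \<odot>.DS v : Cr DS"
 using assms by (auto simp: DS_simps dual_ops dual_iff PiE_iff R.a_ac R.r_distr R.m_lcomm)

lemma dual_sum_map_closed:
 assumes A: "A : Cr (GL K V)" and v: "v : Cr DS"
 shows "dual_sum_map K V A v : Cr DS"
proof -
 have "(\<lambda>x\<in>Cr V. fst v (inv_into (Cr V) A x)) : Cr (dual_space K V)"
  by (rule dual_precompose[OF DS_closed(1)[OF v]]) (use GL_inv_into[OF A] inv_into_linear[OF A] in auto)
 then show ?thesis using v GL_D(1)[OF A DS_closed(2)[OF v]] by (simp add: dual_sum_map_def DS_simps)
qed

lemma dual_sum_map_inverse: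
 assumes A: "A : Cr (GL K V)" and v: "v : Cr DS"
 shows "dual_sum_map K V (\<lambda>x\<in>Cr V. inv_into (Cr V) A x) (dual_sum_map K V A v) = v"
  "dual_sum_map K V A (dual_sum_map K V (\<lambda>x\<in>Cr V. inv_into (Cr V) A x) v) = v"
proof -
 let ?B = "\<lambda>x\<in>Cr V. inv_into (Cr V) A x"
 note i = GL_inv_into[OF A] and B = GL_inverse[OF A] and D = GL_D[OF A]
 have Binv: "inv_into (Cr V) ?B x = A x" if "x : Cr V" for x
  by (rule inv_into_f_eq[OF GL_D(5)[OF B] D(1)[OF that]]) (simp add: D(1)[OF that] i(3)[OF that])
 have "fst v : extensional (Cr V)" "snd v : Cr V" using DS_closed[OF v] by auto
 then have ext: "(\<lambda>x\<in>Cr V. fst v x) = fst v" by (simp add: extensional_restrict)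
 have r1: "(\<lambda>x\<in>Cr V. fst v (inv_into (Cr V) A (A x))) = fst v"
  "(\<lambda>x\<in>Cr V. fst v (A (inv_into (Cr V) A x))) = fst v"
  by (rule trans[OF restrict_ext ext], simp add: i)+
 have "dual_sum_map K V ?B (dual_sum_map K V A v)
  = (\<lambda>x\<in>Cr V. fst (dual_sum_map K V A v) (A x), ?B (snd (dual_sum_map K V A v)))"
  unfolding dual_sum_map_def[of K V ?B] using dual_sum_map_closed[OF A v] Binv by (simp cong: restrict_cong)
 also have "... = (\<lambda>x\<in>Cr V. fst v (inv_into (Cr V) A (A x)), ?B (A (snd v)))"
  using v D(1) by (simp add: dual_sum_map_def cong: restrict_cong)
 also have "... = v" unfolding r1 using i(3)[OF DS_closed(2)[OF v]] D(1)[OF DS_closed(2)[OF v]] by simp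
 finally show "dual_sum_map K V ?B (dual_sum_map K V A v) = v" .
 have "dual_sum_map K V A (dual_sum_map K V ?B v)
  = (\<lambda>x\<in>Cr V. fst (dual_sum_map K V ?B v) (inv_into (Cr V) A x), A (snd (dual_sum_map K V ?B v)))"
  unfolding dual_sum_map_def[of K V A] using dual_sum_map_closed[OF B v] by simp
 also have "... = (\<lambda>x\<in>Cr V. fst v (A (inv_into (Cr V) A x)), A (inv_into (Cr V) A (snd v)))"
  using v i(1) Binv DS_closed(2)[OF v] by (simp add: dual_sum_map_def cong: restrict_cong)
 also have "... = v" unfolding r1 using i(2)[OF DS_closed(2)[OF v]] by simp
 finally show "dual_sum_map K V A (dual_sum_map K V ?B v) = v" .
qed

text \<open>A functional composed with the inverse of \<open>A\<close> and evaluated at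
  \<open>A x\<close> has its old value at \<open>x\<close>.\<close>

lemma dual_sum_map_isometry:
 assumes A: "A : Cr (GL K V)"
 shows "dual_sum_map K V A : Cr (isometry_group K DS pairing_form)"
proof -
 note i = GL_inv_into[OF A] and D = GL_D[OF A]
 have "dual_sum_map K V A (v \<oplus>.DS w) = dual_sum_map K V A v \<oplus>.DS dual_sum_map K V A w"
  if "v : Cr DS" "w : Cr DS" for v w
  using that DS_op_closed(1)[OF that R.zero_closed] i(1) D(2) DS_closed(2)
  by (simp add: dual_sum_map_def DS_simps(2) dual_ops cong: restrict_cong)
 moreover have "dual_sum_map K V A (c \<odot>.DS v) = c \<odot>.DS dual_sum_map K V A v"
  if "c : Cr K" "v : Cr DS" for c v
  using that DS_op_closed(2)[OF that(2,2,1)] i(1) D(3) DS_closed(2)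
  by (simp add: dual_sum_map_def DS_simps(3) dual_ops cong: restrict_cong)
 moreover have "bij_betw (dual_sum_map K V A) (Cr DS) (Cr DS)"
  by (rule bij_betw_byWitness[where f' = "dual_sum_map K V (\<lambda>x\<in>Cr V. inv_into (Cr V) A x)"])
   (use dual_sum_map_inverse[OF A] dual_sum_map_closed[OF A] dual_sum_map_closed[OF GL_inverse[OF A]] in auto)
 moreover have "dual_sum_map K V A : extensional (Cr DS)" by (simp add: dual_sum_map_def)
 ultimately have "dual_sum_map K V A : Cr (GL K DS)"
  using dual_sum_map_closed[OF A] by (simp add: GL_iff)
 moreover have "pairing_form (dual_sum_map K V A v) (dual_sum_map K V A w) = pairing_form v w"
  if "v : Cr DS" "w : Cr DS" for v w
  using that D(1) i(3) DS_closed(2)[OF that(1)] by (simp add: dual_sum_map_def pairing_form_def split_beta)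
 ultimately show ?thesis by (simp add: isometry_group_def)
qed

lemma dual_sum_map_mult:
 assumes A: "A : Cr (GL K V)" and B: "B : Cr (GL K V)"
 shows "dual_sum_map K V (compose (Cr V) B A) = compose (Cr DS) (dual_sum_map K V B) (dual_sum_map K V A)"
proof (rule extensionalityI[of _ "Cr DS"])
 fix v assume v: "v : Cr DS"
 have ii: "inv_into (Cr V) (compose (Cr V) B A) x = inv_into (Cr V) A (inv_into (Cr V) B x)"
  if "x : Cr V" for x
  by (rule inv_into_f_eq[OF GL_D(5)[OF GL_mult_closed[OF module_axioms A B]]])
   (simp_all add: GL_inv_into(1,2)[OF A] GL_inv_into(1,2)[OF B] that compose_def)
 have "compose (Cr DS) (dual_sum_map K V B) (dual_sum_map K V A) v
  = (\<lambda>x\<in>Cr V. fst (dual_sum_map K V A v) (inv_into (Cr V) B x), B (snd (dual_sum_map K V A v)))"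
  using v dual_sum_map_closed[OF A v] by (simp add: compose_def dual_sum_map_def[of K V B])
 also have "... = dual_sum_map K V (compose (Cr V) B A) v"
  using v GL_inv_into(1)[OF B] ii DS_closed(2)[OF v] by (simp add: dual_sum_map_def compose_def cong: restrict_cong)
 finally show "dual_sum_map K V (compose (Cr V) B A) v = compose (Cr DS) (dual_sum_map K V B) (dual_sum_map K V A) v" ..
qed (simp_all add: dual_sum_map_def compose_def)

lemma dual_sum_map_inj:
 assumes A: "A : Cr (GL K V)" and B: "B : Cr (GL K V)" and e: "dual_sum_map K V A = dual_sum_map K V B"
 shows "A = B"
proof (rule extensionalityI[OF GL_D(4)[OF A] GL_D(4)[OF B]])
 fix x assume x: "x : Cr V"
 have "((\<lambda>x\<in>Cr V. \<zero>.K), x) : Cr DS" using x by (auto simp: DS_simps dual_iff)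
 then show "A x = B x" using fun_cong[OF e, of "((\<lambda>x\<in>Cr V. \<zero>.K), x)"] by (simp add: dual_sum_map_def)
qed

end

context heis_rep
begin

lemma rep_sum_contragredient:
 assumes e: "e : Cr E"
 shows "rep_sum (dual_space Q W) W (contragredient E Q W rho) rho e = dual_sum_map Q W (rho e)"
proof -
 have ie: "inv\<^bsub>E\<^esub> e : Cr E" using e by (rule reg.E.inv_closed)
 have "inv_into (Cr W) (rho e) x = rho (inv\<^bsub>E\<^esub> e) x" if x: "x : Cr W" for x
  by (rule inv_into_f_eq[OF rho_D(5)[OF e] rho_D(1)[OF ie x] rho_inv_apply(1)[OF e x]])
 then show ?thesis
  by (auto simp: rep_sum_def dual_sum_map_def contragredient_def W.DS_simps fun_eq_iff restrict_def)
qed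

text \<open>Since all of GL(W) acts on the sum by isometries of the pairing, it suffices to compose
  \<open>Phi\<close> with \<open>dual_sum_map\<close>.\<close>

theorem extends_to_dual_sum:
 assumes norm: "normalizing s"
 shows "extends_to_embedding G E (\<lambda>g (x, z). (g x, z)) (isometry_group Q (direct_sum (dual_space Q W) W) pairing_form)
  (rep_sum (dual_space Q W) W (contragredient E Q W rho) rho)"
proof -
 let ?H = "semidirect_product G E (\<lambda>g (x, z). (g x, z))"
 define \<Psi> where "\<Psi> a = dual_sum_map Q W (Phi s a)" for a
 have cl: "Phi s a : Cr (GL Q W)" if "a : Cr ?H" for a using Phi_hom[OF norm] that by (rule hom_in_carrier)
 have "\<Psi> : hom ?H (isometry_group Q (direct_sum (dual_space Q W) W) pairing_form)"
 proof (rule homI)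
  show "\<Psi> a : Cr (isometry_group Q (direct_sum (dual_space Q W) W) pairing_form)" if "a : Cr ?H" for a
   unfolding \<Psi>_def by (rule W.dual_sum_map_isometry[OF cl[OF that]])
  show "\<Psi> (a **\<^bsub>?H\<^esub> b) = \<Psi> a **\<^bsub>isometry_group Q (direct_sum (dual_space Q W) W) pairing_form\<^esub> \<Psi> b"
   if "a : Cr ?H" "b : Cr ?H" for a b
   using hom_mult[OF Phi_hom[OF norm] that] W.dual_sum_map_mult[OF cl[OF that(1)] cl[OF that(2)]]
   by (simp add: \<Psi>_def isometry_group_def GL_mult)
 qed
 moreover have "inj_on \<Psi> (Cr ?H)"
 proof (rule inj_onI)
  fix a b assume ab: "a : Cr ?H" "b : Cr ?H" "\<Psi> a = \<Psi> b"
  then have "Phi s a = Phi s b" using W.dual_sum_map_inj[OF cl[OF ab(1)] cl[OF ab(2)]] by (simp add: \<Psi>_def)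
  then show "a = b" by (rule inj_onD[OF Phi_inj[OF norm] _ ab(1,2)])
 qed
 moreover have "\<Psi> (\<one>.G, e) = rep_sum (dual_space Q W) W (contragredient E Q W rho) rho e" if "e : Cr E" for e
  unfolding \<Psi>_def Phi_one[OF norm that] rep_sum_contragredient[OF that] ..
 ultimately show ?thesis unfolding extends_to_embedding_def by blast
qed

end

section \<open>Central elements of absolutely irreducible representations\<close>

context vectorspace
begin

lemma smult_right_cancel:
 assumes "a : Cr K" "b : Cr K" "x : Cr V" "x ~= \<zero>.V" "a \<odot>.V x = b \<odot>.V x"
 shows "a = b"
proof (rule ccontr)
 assume "a ~= b"
 then have n: "a \<ominus>.K b ~= \<zero>.K" using R.diff_eq_zero[of a b] assms by blast
 have c: "a \<ominus>.K b : Cr K" using assms by simp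
 have "(a \<ominus>.K b) \<odot>.V x = b \<odot>.V x \<ominus>.V b \<odot>.V x"
  using assms by (simp add: a_minus_def smult_l_distr smult_l_minus)
 also have "... = \<zero>.V" using assms by (simp add: a_minus_def M.r_neg)
 finally have "x = inv\<^bsub>K\<^esub> (a \<ominus>.K b) \<odot>.V \<zero>.V" using smult_cancel(1)[OF c n assms(3)] by simp
 also have "... = \<zero>.V" using n c field_Units smult_r_null by simp
 finally show False using assms by simp
qed

lemma finite_span_finite:
 assumes S: "finite S" "S <= Cr V" and K: "finite (Cr K)"
 shows "finite (span S)"
proof -
 have "span S <= (\<lambda>a. lincomb a S) ` (S \<rightarrow>\<^sub>E Cr K)"
 proof
  fix v assume "v : span S"
  then obtain a where a: "a : S \<rightarrow> Cr K" "v = lincomb a S" using finite_span[OF S] by auto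
  have "lincomb (restrict a S) S = lincomb a S"
   unfolding lincomb_def by (rule M.finsum_cong') (use a S in auto)
  moreover have "restrict a S : S \<rightarrow>\<^sub>E Cr K" using a by auto
  ultimately show "v : (\<lambda>a. lincomb a S) ` (S \<rightarrow>\<^sub>E Cr K)" using a(2) by (metis imageI)
 qed
 then show ?thesis using finite_PiE[OF S(1)] K by (meson finite_imageI finite_subset)
qed

lemma finite_of_fin_dim:
 assumes "fin_dim" "finite (Cr K)" shows "finite (Cr V)"
proof -
 obtain A where "finite A" "A <= Cr V" "span A = Cr V" using assms(1) unfolding fin_dim_def by auto
 then show ?thesis using finite_span_finite[of A] assms(2) by simp
qed

text \<open>The span of the orbit of a nonzero vector is invariant, hence everything, and it is
  finite because the orbit and the field are.\<close>

lemma irreducible_finite: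
 assumes E: "group E" "finite (Cr E)" and K: "finite (Cr K)"
  and rho: "rho : hom E (GL K V)" and irr: "irreducible_rep E K V rho"
 shows "finite (Cr V)"
proof -
 interpret E: group E by (rule E)
 have V0: "Cr V ~= {\<zero>.V}" and sub: "!!N. subspace K N V ==> (\<forall>g\<in>Cr E. \<forall>x\<in>N. rho g x : N) ==>
   N = {\<zero>.V} \<or> N = Cr V"
  using irr by (auto simp: irreducible_rep_def)
 have D: "rho e : Cr (GL K V)" if "e : Cr E" for e using rho that by (rule hom_in_carrier)
 obtain w where w: "w : Cr V" "w ~= \<zero>.V" using V0 M.zero_closed by blast
 define S where "S = (\<lambda>e. rho e w) ` Cr E"
 have S: "finite S" "S <= Cr V" using E(2) GL_D(1)[OF D w(1)] by (auto simp: S_def)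
 have mod: "submodule K (span S) V" using S(2) by (rule span_is_submodule)
 have SS: "S <= span S" using S(2) by (rule in_own_span)
 have rS: "rho f v : S" if f: "f : Cr E" and v: "v : S" for f v
 proof -
  obtain e where e: "e : Cr E" "v = rho e w" using v by (auto simp: S_def)
  have "rho f v = rho (e **.E f) w" using hom_mult[OF rho e(1) f] w by (simp add: e(2) GL_mult compose_def)
  then show ?thesis using e f by (auto simp: S_def)
 qed
 have inv: "rho f x : span S" if f: "f : Cr E" and x: "x : span S" for f x
 proof -
  obtain a where a: "a : S \<rightarrow> Cr K" "x = lincomb a S" using x finite_span[OF S] by auto
  have "(\<Oplus>.V v\<in>A. a v \<odot>.V v) : Cr V & rho f (\<Oplus>.V v\<in>A. a v \<odot>.V v) : span S" if "finite A" "A <= S" for A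
   using that
  proof (induction A rule: finite_induct)
   case empty
   have "rho f (\<zero>.K \<odot>.V w) = \<zero>.K \<odot>.V rho f w" by (rule GL_D(3)[OF D[OF f] R.zero_closed w(1)])
   then have "rho f \<zero>.V = \<zero>.V" using GL_D(1)[OF D[OF f] w(1)] w by simp
   then show ?case using submodule.zero_closed[OF mod] by simp
  next
   case (insert v A)
   have v: "v : S" "v : Cr V" "a v : Cr K" using insert S a by auto
   have fc: "(\<lambda>v. a v \<odot>.V v) : A \<rightarrow> Cr V" using insert S a by auto
   have sm: "(\<Oplus>.V v\<in>insert v A. a v \<odot>.V v) = a v \<odot>.V v \<oplus>.V (\<Oplus>.V v\<in>A. a v \<odot>.V v)"
    using insert v fc by (intro M.finsum_insert) auto
   have ih: "(\<Oplus>.V v\<in>A. a v \<odot>.V v) : Cr V" "rho f (\<Oplus>.V v\<in>A. a v \<odot>.V v) : span S" using insert by auto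
   have "rho f (a v \<odot>.V v \<oplus>.V (\<Oplus>.V v\<in>A. a v \<odot>.V v)) = a v \<odot>.V rho f v \<oplus>.V rho f (\<Oplus>.V v\<in>A. a v \<odot>.V v)"
    using GL_D(2,3)[OF D[OF f]] v ih(1) by simp
   moreover have "a v \<odot>.V rho f v : span S"
    using submodule.smult_closed[OF mod v(3)] rS[OF f v(1)] SS by blast
   ultimately show ?case unfolding sm using submodule.m_closed[OF mod _ ih(2)] v ih(1) by simp
  qed
  from this[OF S(1) subset_refl] show ?thesis by (simp add: a(2) lincomb_def)
 qed
 have "rho \<one>.E w = w"
 proof -
  have o: "rho \<one>.E : Cr (GL K V)" using D by simp
  have "rho \<one>.E (rho \<one>.E w) = rho \<one>.E w"
   using hom_mult[OF rho E.one_closed E.one_closed] w by (simp add: GL_mult compose_def fun_eq_iff split: if_splits)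
  then show ?thesis using inj_onD[OF GL_D(5)[OF o]] GL_D(1)[OF o w(1)] w(1) by blast
 qed
 then have "w : span S" using SS by (force simp: S_def)
 then have "span S = Cr V" using sub[of "span S"] mod inv w(2) vectorspace_axioms by (auto simp: subspace_def)
 then show ?thesis using finite_span_finite[OF S K] by simp
qed

text \<open>The average of \<open>mu\<^bsup>i k\<^esup> N\<^sup>k t\<close> over \<open>k\<close> is the component of \<open>t\<close> in an eigenspace of \<open>N\<close>.\<close>

lemma cyclic_eigenvector:
 assumes N: "!!x. x : Cr V ==> N x : Cr V"
   "!!x y. x : Cr V ==> y : Cr V ==> N (x \<oplus>.V y) = N x \<oplus>.V N y"
   "!!c x. c : Cr K ==> x : Cr V ==> N (c \<odot>.V x) = c \<odot>.V N x"
   "!!x. x : Cr V ==> (N ^^ p) x = x"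
  and mu: "mu : Cr K" "mu [^].K p = \<one>.K" "!!k. 0 < k ==> k < p ==> mu [^].K k ~= \<one>.K"
  and p: "p > 0" "[(p::nat)] \<cdot>.K \<one>.K ~= \<zero>.K" and t: "t : Cr V" "t ~= \<zero>.V"
 shows "\<exists>c\<in>Cr K. \<exists>v\<in>Cr V. v ~= \<zero>.V & N v = c \<odot>.V v"
proof -
 have Nk: "(N ^^ k) t : Cr V" for k by (induction k) (use t N in auto)
 have N0: "N \<zero>.V = \<zero>.V" using N(3)[of "\<zero>.K" "\<zero>.V"] N(1)[of "\<zero>.V"] smult_l_null[of "\<zero>.V"] by simp
 have Nsum: "N (\<Oplus>.V k\<in>A. b k) = (\<Oplus>.V k\<in>A. N (b k))" if "finite A" "!!k. b k : Cr V" for A :: "nat set" and b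
  using that by (induction A rule: finite_induct) (auto simp: N0 N(1,2) Pi_def M.finsum_insert)
 \<comment> \<open>Both sides are the sum over \<open>0..n\<close>, with one end term or the other
   split off.\<close>
 have shift: "(\<Oplus>.V k\<in>{..<n}. b (Suc k)) \<oplus>.V b 0 = (\<Oplus>.V k\<in>{..<n}. b k) \<oplus>.V b n"
  if b: "!!k. b k : Cr V" for b and n :: nat
 proof (induction n)
  case (Suc n)
  have c: "(\<Oplus>.V k\<in>{..<n}. b (Suc k)) : Cr V" "(\<Oplus>.V k\<in>{..<n}. b k) : Cr V"
   using b by (auto intro!: M.finsum_closed)
  have "(\<Oplus>.V k\<in>{..<Suc n}. b (Suc k)) \<oplus>.V b 0 = b (Suc n) \<oplus>.V ((\<Oplus>.V k\<in>{..<n}. b (Suc k)) \<oplus>.V b 0)"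
   using b c by (simp add: lessThan_Suc M.finsum_insert Pi_def M.a_assoc)
  also have "... = (b n \<oplus>.V (\<Oplus>.V k\<in>{..<n}. b k)) \<oplus>.V b (Suc n)" unfolding Suc using b c by (simp add: M.a_ac)
  also have "... = (\<Oplus>.V k\<in>{..<Suc n}. b k) \<oplus>.V b (Suc n)" using b by (simp add: lessThan_Suc M.finsum_insert Pi_def)
  finally show ?case .
 qed (use b in simp)
 define nu where "nu i = mu [^].K i" for i :: nat
 have nu: "nu i : Cr K" "nu i [^].K p = \<one>.K" for i
  using mu(1,2) by (simp_all add: nu_def nat_pow_pow mult.commute[of i] nat_pow_pow[symmetric])
 have nu0: "nu i ~= \<zero>.K" for i
 proof
  assume "nu i = \<zero>.K"
  then show False using nu(2)[of i] p(1) by (simp add: nat_pow_zero)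
 qed
 define P where "P i = (\<Oplus>.V k\<in>{..<p}. nu i [^].K k \<odot>.V (N ^^ k) t)" for i
 have bc: "nu i [^].K k \<odot>.V (N ^^ k) t : Cr V" for i k :: nat using nu Nk by simp
 have Pc: "P i : Cr V" for i unfolding P_def using bc by (auto intro!: M.finsum_closed)
 \<comment> \<open>Applying the scalar times \<open>N\<close> shifts the summation index by one, and
   the sum is cyclic because both have trivial \<open>p\<close>-th power.\<close>
 have eig: "nu i \<odot>.V N (P i) = P i" for i
 proof -
  let ?b = "\<lambda>k. nu i [^].K k \<odot>.V (N ^^ k) t"
  have Sc: "(\<Oplus>.V k\<in>{..<p}. ?b (Suc k)) : Cr V"
   by (rule M.finsum_closed, rule funcsetI, rule bc)
  have "nu i \<odot>.V N (P i) = nu i \<odot>.V (\<Oplus>.V k\<in>{..<p}. N (?b k))" unfolding P_def using Nsum[of "{..<p}" ?b] bc by simp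
  also have "... = (\<Oplus>.V k\<in>{..<p}. nu i \<odot>.V N (?b k))"
   using nu N(1) bc by (intro finsum_smult_ldistr) auto
  also have "... = (\<Oplus>.V k\<in>{..<p}. ?b (Suc k))"
  proof (rule M.finsum_cong'[OF refl])
   show "(\<lambda>k. ?b (Suc k)) : {..<p} \<rightarrow> Cr V" by (rule funcsetI) (rule bc)
  next
   fix k assume "k : {..<p}"
   have "N (?b k) = nu i [^].K k \<odot>.V N ((N ^^ k) t)" using nu Nk by (intro N(3)) auto
   then show "nu i \<odot>.V N (?b k) = ?b (Suc k)"
    using nu Nk N(1) by (simp add: smult_assoc1[symmetric] R.m_comm)
  qed
  finally have e: "nu i \<odot>.V N (P i) = (\<Oplus>.V k\<in>{..<p}. ?b (Suc k))" .
  have "?b p = ?b 0" using nu(2) N(4) t by simp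
  then have "(\<Oplus>.V k\<in>{..<p}. ?b (Suc k)) \<oplus>.V ?b 0 = P i \<oplus>.V ?b 0" using shift[of ?b p] bc by (simp add: P_def)
  then show ?thesis unfolding e by (rule M.add.right_cancel[OF bc[of i 0] Sc Pc, THEN iffD1])
 qed
 \<comment> \<open>The components add up to \<open>p\<close> times \<open>t\<close>, since for
   \<open>k\<close> nonzero the sum of the roots of unity over \<open>i\<close> vanishes; so they
   are not all zero.\<close>
 have "\<exists>i. P i ~= \<zero>.V"
 proof (rule ccontr)
  assume "\<nexists>i. P i ~= \<zero>.V"
  then have "(\<Oplus>.V i\<in>{..<p}. P i) = \<zero>.V" by simp
  moreover have "(\<Oplus>.V i\<in>{..<p}. P i) = (\<Oplus>.V k\<in>{..<p}. \<Oplus>.V i\<in>{..<p}. nu i [^].K k \<odot>.V (N ^^ k) t)"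
   unfolding P_def by (rule M.finsum_swap) (use bc in auto)
  moreover have "... = (\<Oplus>.V k\<in>{..<p}. if 0 = k then [p] \<cdot>.K \<one>.K \<odot>.V t else \<zero>.V)"
  proof (rule M.finsum_cong')
   fix k assume k: "k : {..<p}"
   have "(\<Oplus>.V i\<in>{..<p}. nu i [^].K k \<odot>.V (N ^^ k) t) = (\<Oplus>.K i\<in>{..<p}. nu i [^].K k) \<odot>.V (N ^^ k) t"
    by (rule smult_finsum_l[symmetric]) (use nu Nk in auto)
   moreover have "(\<Oplus>.K i\<in>{..<p}. nu i [^].K k) = (if 0 = k then [p] \<cdot>.K \<one>.K else \<zero>.K)"
   proof (cases "k = 0")
    case True
    have "(\<Oplus>.K i\<in>{..<p}. if True then \<one>.K else \<zero>.K) = [card {i : {..<p}. True}] \<cdot>.K \<one>.K"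
     by (rule R.finsum_const_filter) auto
    then show ?thesis using True by simp
   next
    case False
    define c where "c = mu [^].K k"
    have c: "c : Cr K" "c ~= \<one>.K" "c [^].K p = \<one>.K" using mu k False nu(2)[of k] by (auto simp: c_def nu_def)
    have eq: "(\<Oplus>.K i\<in>{..<p}. nu i [^].K k) = (\<Oplus>.K i\<in>{..<p}. c [^].K i)"
     by (rule R.finsum_cong') (use mu c in \<open>auto simp: nu_def c_def nat_pow_pow mult.commute\<close>)
    have Sc: "(\<Oplus>.K i\<in>{..<p}. c [^].K i) : Cr K" using c by (intro R.finsum_closed) auto
    have z0: "(c \<ominus>.K \<one>.K) **.K (\<Oplus>.K i\<in>{..<p}. c [^].K i) = \<zero>.K"
     unfolding R.geometric_sum[OF c(1)] c(3) by (simp add: a_minus_def R.r_neg)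
    have "c \<ominus>.K \<one>.K ~= \<zero>.K" using R.diff_eq_zero[OF c(1) R.one_closed] c(2) by blast
    moreover have "c \<ominus>.K \<one>.K : Cr K" using c(1) by simp
    ultimately have "(\<Oplus>.K i\<in>{..<p}. c [^].K i) = \<zero>.K" using integral[OF z0 _ Sc] by blast
    then show ?thesis using eq False by simp
   qed
   ultimately show "(\<Oplus>.V i\<in>{..<p}. nu i [^].K k \<odot>.V (N ^^ k) t) = (if 0 = k then [p] \<cdot>.K \<one>.K \<odot>.V t else \<zero>.V)"
    using Nk[of k] t(1) smult_l_null by (cases "0 = k") auto
  qed (use t in auto)
  moreover have "... = [p] \<cdot>.K \<one>.K \<odot>.V t"
   using p(1) t M.finsum_singleton[of 0 "{..<p}" "\<lambda>_. [p] \<cdot>.K \<one>.K \<odot>.V t"] by simp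
  ultimately have z: "[p] \<cdot>.K \<one>.K \<odot>.V t = \<zero>.V" by simp
  have "[p] \<cdot>.K \<one>.K = \<zero>.K"
   by (rule smult_right_cancel[OF _ _ t]) (use z t smult_l_null in auto)
  then show False using p(2) by simp
 qed
 then obtain i where i: "P i ~= \<zero>.V" by blast
 have u: "nu i : Units K" using nu0 nu(1) field_Units by simp
 have "N (P i) = inv\<^bsub>K\<^esub> nu i \<odot>.V P i"
  using arg_cong[OF eig[of i], of "\<lambda>x. inv\<^bsub>K\<^esub> nu i \<odot>.V x"] smult_cancel(1)[OF nu(1) nu0 N(1)[OF Pc]] by simp
 then show ?thesis using i Pc u by blast
qed

end

text \<open>A root of the polynomial with \<open>p\<close> coefficients equal to one is a
  \<open>p\<close>-th root of unity, and it is not one itself because \<open>p\<close> is not zero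
  in the field.\<close>

lemma (in algebraically_closed) primitive_root_exists:
 assumes p: "Factorial_Ring.prime (p::nat)" and pL: "[p] \<cdot>.L \<one>.L ~= \<zero>.L"
 shows "\<exists>mu\<in>Cr L. mu [^].L p = \<one>.L & (\<forall>k. 0 < k & k < p --> mu [^].L k ~= \<one>.L)"
proof -
 have p2: "p \<ge> 2" using p by (rule prime_ge_2_nat)
 define P where "P = replicate p \<one>.L"
 have Pp: "P : Cr (poly_ring L)"
  using p2 by (cases p) (auto simp: P_def univ_poly_def polynomial_def)
 have "splitted P" using Pp by (rule roots_over_carrier)
 then have "size (roots P) = p - 1" by (simp add: splitted_def P_def)
 then have "roots P ~= {#}" using p2 by auto
 then obtain mu where "mu \<in># roots P" by auto
 then have "is_root P mu" using roots_mem_iff_is_root[OF Pp] by simp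
 then have mu: "mu : Cr L" "eval P mu = \<zero>.L" by (auto simp: is_root_def)
 have ev: "eval (replicate n \<one>.L) mu = (\<Oplus>.L i\<in>{..<n}. mu [^].L i)" for n
  by (induction n) (use mu in \<open>auto simp: lessThan_Suc\<close>)
 have S: "(\<Oplus>.L i\<in>{..<p}. mu [^].L i) = \<zero>.L" using mu(2) ev[of p] by (simp add: P_def)
 have "mu [^].L p \<ominus>.L \<one>.L = \<zero>.L"
  using geometric_sum[OF mu(1), of p] mu(1) unfolding S by simp
 then have mup: "mu [^].L p = \<one>.L" using diff_eq_zero[of "mu [^].L p" "\<one>.L"] mu(1) by simp
 have mu1: "mu ~= \<one>.L"
 proof
  assume "mu = \<one>.L"
  then have "(\<Oplus>.L i\<in>{..<p}. if True then \<one>.L else \<zero>.L) = \<zero>.L" using S by simp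
  moreover have "(\<Oplus>.L i\<in>{..<p}. if True then \<one>.L else \<zero>.L) = [card {i : {..<p}. True}] \<cdot>.L \<one>.L"
   by (rule finsum_const_filter) auto
  ultimately show False using pL by simp
 qed
 have "mu [^].L k ~= \<one>.L" if k: "0 < k" "k < p" for k
 proof
  assume e: "mu [^].L k = \<one>.L"
  have "coprime k p" using k p by (metis coprime_commute nat_dvd_not_less prime_imp_coprime)
  then obtain x where "[k * x = Suc 0] (mod p)" using cong_solve_coprime_nat by blast
  then have "(k * x) mod p = 1" using p2 by (simp add: cong_def)
  then have kx: "k * x = p * (k * x div p) + 1" by (metis mult_div_mod_eq)
  have "\<one>.L = (mu [^].L k) [^].L x" unfolding e by simp
  also have "... = mu [^].L (p * (k * x div p) + 1)" using mu(1) kx by (simp add: nat_pow_pow)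
  also have "... = (mu [^].L p) [^].L (k * x div p) **.L mu"
   using mu(1) by (simp add: nat_pow_mult[symmetric] nat_pow_pow)
  also have "... = mu" unfolding mup using mu(1) by simp
  finally show False using mu1 by simp
 qed
 then show ?thesis using mu(1) mup by blast
qed

section \<open>Extension of scalars and a form of Schur's lemma\<close>

context vectorspace
begin

lemma dual_op_closed:
 "alf : Cr (dual_space K V) ==> bta : Cr (dual_space K V) ==> alf \<oplus>\<^bsub>dual_space K V\<^esub> bta : Cr (dual_space K V)"
 "c : Cr K ==> alf : Cr (dual_space K V) ==> c \<odot>\<^bsub>dual_space K V\<^esub> alf : Cr (dual_space K V)"
 by (auto simp: dual_ops dual_iff PiE_iff R.a_ac R.r_distr R.m_lcomm)

lemma extend_scalars_iff:
 "t : Cr (extend_scalars K L phi V) <-> t : Cr (dual_space K V) \<rightarrow>\<^sub>E Cr L &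
   (\<forall>alf\<in>Cr (dual_space K V). \<forall>bta\<in>Cr (dual_space K V). t (alf \<oplus>\<^bsub>dual_space K V\<^esub> bta) = t alf \<oplus>.L t bta) &
   (\<forall>c\<in>Cr K. \<forall>alf\<in>Cr (dual_space K V). t (c \<odot>\<^bsub>dual_space K V\<^esub> alf) = phi c **.L t alf)"
 by (simp add: extend_scalars_def Let_def)

lemma extend_scalars_module:
 assumes L: "field L" and phi: "phi : Ring.ring_hom K L"
 shows "vectorspace L (extend_scalars K L phi V)"
  "x \<oplus>\<^bsub>extend_scalars K L phi V\<^esub> y = (\<lambda>alf\<in>Cr (dual_space K V). x alf \<oplus>.L y alf)"
  "c \<odot>\<^bsub>extend_scalars K L phi V\<^esub> x = (\<lambda>alf\<in>Cr (dual_space K V). c **.L x alf)"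
  "\<zero>\<^bsub>extend_scalars K L phi V\<^esub> = (\<lambda>alf\<in>Cr (dual_space K V). \<zero>.L)"
proof -
 interpret L: field L by (rule L)
 let ?D = "Cr (dual_space K V)" and ?C = "Cr (extend_scalars K L phi V)"
 interpret FS: module L "L.func_space ?D" by (rule L.func_space_is_module)
 have eq: "extend_scalars K L phi V = (L.func_space ?D)\<lparr>carrier := ?C\<rparr>"
  by (simp add: extend_scalars_def Let_def)
 have cl: "phi c : Cr L" if "c : Cr K" for c using ring_hom_closed[OF phi that] .
 have "submodule L ?C (L.func_space ?D)"
 proof (rule submodule.intro)
  show "module L (L.func_space ?D)" by (rule FS.module_axioms)
  show "?C <= Cr (L.func_space ?D)" by (auto simp: extend_scalars_iff L.func_space_def)
  show "x \<oplus>\<^bsub>L.func_space ?D\<^esub> y : ?C" if "x : ?C" "y : ?C" for x y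
   using that dual_op_closed cl
   by (auto simp: extend_scalars_iff L.func_space_def PiE_iff L.a_ac L.r_distr)
  show "\<zero>\<^bsub>L.func_space ?D\<^esub> : ?C"
   using dual_op_closed cl by (auto simp: extend_scalars_iff L.func_space_def PiE_iff)
  show "c \<odot>\<^bsub>L.func_space ?D\<^esub> x : ?C" if "c : Cr L" "x : ?C" for c x
   using that dual_op_closed cl
   by (auto simp: extend_scalars_iff L.func_space_def PiE_iff L.r_distr L.m_lcomm)
 qed
 then have "module L (extend_scalars K L phi V)" by (subst eq) (rule FS.submodule_is_module)
 then show "vectorspace L (extend_scalars K L phi V)" using L by (simp add: vectorspace_def)
 show "x \<oplus>\<^bsub>extend_scalars K L phi V\<^esub> y = (\<lambda>alf\<in>?D. x alf \<oplus>.L y alf)"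
  "c \<odot>\<^bsub>extend_scalars K L phi V\<^esub> x = (\<lambda>alf\<in>?D. c **.L x alf)"
  "\<zero>\<^bsub>extend_scalars K L phi V\<^esub> = (\<lambda>alf\<in>?D. \<zero>.L)"
  by (subst eq, simp add: L.func_space_def)+
qed

text \<open>Over the algebraic closure \<open>C\<close> has an eigenvector by
  \<open>cyclic_eigenvector\<close>, because its \<open>p\<close>-th power is the identity; the
  eigenspace is invariant, hence everything. Pairing vectors with functionals over \<open>K\<close>
  then shows that the eigenvalue comes from \<open>K\<close>.\<close>

lemma central_scalar:
 fixes rho :: "'e => 'c => 'c" and p :: nat
 assumes fin: "finite (Cr V)" and V0: "Cr V ~= {\<zero>.V}"
  and irr: "irreducible_rep E alg_closure (extend_scalars K alg_closure indexed_const V) (\<lambda>g. extend_scalars_map K V (rho g))"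
  and rho: "!!e. e : Cr E ==> rho e : Cr (GL K V)" and C: "C : Cr (GL K V)"
  and comm: "!!e x. e : Cr E ==> x : Cr V ==> rho e (C x) = C (rho e x)"
  and p: "Factorial_Ring.prime p" "[p] \<cdot>.K \<one>.K ~= \<zero>.K" and Cp: "!!x. x : Cr V ==> (C ^^ p) x = x"
 shows "\<exists>\<epsilon>\<in>Cr K. \<forall>x\<in>Cr V. C x = \<epsilon> \<odot>.V x"
proof -
 let ?L = "alg_closure" and ?phi = "indexed_const" and ?D = "dual_space K V"
 let ?W = "extend_scalars K ?L ?phi V" and ?ext = "extend_scalars_map K V :: _ => (('c => 'a) => _) => _"
 interpret L: algebraic_closure ?L "?phi ` Cr K" by (rule alg_closureE(1))
 have phi: "?phi : Ring.ring_hom K ?L" by (rule alg_closureE(2))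
 have phiinj: "a = b" if "?phi a = ?phi b" for a b
  using fun_cong[OF that, of "{#}"] by (simp add: indexed_const_def)
 have phic: "?phi a : Cr ?L" if "a : Cr K" for a using ring_hom_closed[OF phi that] .
 have phinum: "?phi ([n] \<cdot>.K \<one>.K) = [n] \<cdot>\<^bsub>?L\<^esub> \<one>\<^bsub>?L\<^esub>" for n :: nat
 proof -
  interpret h: ring_hom_cring K ?L ?phi
   by (simp add: ring_hom_cring_def ring_hom_cring_axioms_def R.is_cring L.is_cring phi)
  show ?thesis by (induction n) auto
 qed
 have phi0: "?phi \<zero>.K = \<zero>\<^bsub>?L\<^esub>" using phinum[of 0] by simp
 have pL: "[p] \<cdot>\<^bsub>?L\<^esub> \<one>\<^bsub>?L\<^esub> ~= \<zero>\<^bsub>?L\<^esub>" using phiinj p(2) phi0 phinum by metis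
 obtain mu where mu: "mu : Cr ?L" "mu [^]\<^bsub>?L\<^esub> p = \<one>\<^bsub>?L\<^esub>"
  "!!k. 0 < k ==> k < p ==> mu [^]\<^bsub>?L\<^esub> k ~= \<one>\<^bsub>?L\<^esub>"
  using L.primitive_root_exists[OF p(1) pL] by blast
 note ops = extend_scalars_module(2-4)[OF L.field_axioms phi]
 interpret W: vectorspace ?L ?W by (rule extend_scalars_module(1)[OF L.field_axioms phi])
 define pre where "pre A alf = (\<lambda>x\<in>Cr V. alf (A x))" for A :: "'c => 'c" and alf :: "'c => 'a"
 have ext_apply: "?ext A t alf = t (pre A alf)" if "alf : Cr ?D" for A t alf
  using that by (simp add: extend_scalars_map_def pre_def)
 have pre_c: "pre A alf : Cr ?D" if "A : Cr (GL K V)" "alf : Cr ?D" for A alf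
  unfolding pre_def using dual_precompose[OF that(2)] GL_D[OF that(1)] by blast
 have pre_lin: "pre A (alf \<oplus>\<^bsub>?D\<^esub> bta) = pre A alf \<oplus>\<^bsub>?D\<^esub> pre A bta" "pre A (c \<odot>\<^bsub>?D\<^esub> alf) = c \<odot>\<^bsub>?D\<^esub> pre A alf"
  if "A : Cr (GL K V)" for A alf bta c
  using GL_D(1)[OF that] by (auto simp: pre_def dual_ops fun_eq_iff restrict_def)
 have ext_ext: "?ext A t : extensional (Cr ?D)" for A t by (simp add: extend_scalars_map_def)
 have W_ext: "t : extensional (Cr ?D)" if "t : Cr ?W" for t using that by (auto simp: extend_scalars_iff PiE_iff)
 have W_cl: "t alf : Cr ?L" if "t : Cr ?W" "alf : Cr ?D" for t alf using that by (auto simp: extend_scalars_iff)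
 have ext_c: "?ext A t : Cr ?W" if A: "A : Cr (GL K V)" and t: "t : Cr ?W" for A t
  using t pre_c[OF A] pre_lin[OF A] dual_op_closed ext_ext[of A t]
  by (simp add: extend_scalars_iff PiE_iff ext_apply)
 have ext_add: "?ext A (x \<oplus>\<^bsub>?W\<^esub> y) = ?ext A x \<oplus>\<^bsub>?W\<^esub> ?ext A y"
  and ext_smult: "?ext A (c \<odot>\<^bsub>?W\<^esub> x) = c \<odot>\<^bsub>?W\<^esub> ?ext A x" if "A : Cr (GL K V)" for A x y c
  using pre_c[OF that] by (auto simp: ops extend_scalars_map_def fun_eq_iff restrict_def pre_def)
 have ext_comm: "?ext (rho e) (?ext C t) = ?ext C (?ext (rho e) t)" if e: "e : Cr E" for e t
 proof (rule extensionalityI[OF ext_ext ext_ext])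
  fix alf assume alf: "alf : Cr ?D"
  have "pre C (pre (rho e) alf) = pre (rho e) (pre C alf)"
   using comm[OF e] GL_D(1)[OF C] GL_D(1)[OF rho[OF e]] by (auto simp: pre_def restrict_def fun_eq_iff)
  then show "?ext (rho e) (?ext C t) alf = ?ext C (?ext (rho e) t) alf"
   using alf pre_c[OF C] pre_c[OF rho[OF e]] by (simp add: ext_apply)
 qed
 have Ck: "(C ^^ k) x : Cr V" if "x : Cr V" for k x by (induction k) (use that GL_D(1)[OF C] in auto)
 have extk: "(?ext C ^^ k) t alf = t (\<lambda>x\<in>Cr V. alf ((C ^^ k) x)) & (?ext C ^^ k) t : Cr ?W"
  if "t : Cr ?W" "alf : Cr ?D" for k t alf
  using that(2)
 proof (induction k arbitrary: alf)
  case 0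
  then have "(\<lambda>x\<in>Cr V. alf x) = alf" by (intro extensional_restrict) (auto simp: dual_iff PiE_iff)
  then show ?case using that(1) by simp
 next
  case (Suc k)
  have "(\<lambda>x\<in>Cr V. pre C alf ((C ^^ k) x)) = (\<lambda>x\<in>Cr V. alf ((C ^^ Suc k) x))"
   using Ck by (auto simp: pre_def)
  note IH = Suc.IH[OF pre_c[OF C Suc.prems]]
  have "(?ext C ^^ Suc k) t alf = (?ext C ^^ k) t (pre C alf)" using ext_apply[OF Suc.prems] by simp
  also have "... = t (\<lambda>x\<in>Cr V. pre C alf ((C ^^ k) x))" using IH by (rule conjunct1)
  also note \<open>(\<lambda>x\<in>Cr V. pre C alf ((C ^^ k) x)) = _\<close>
  finally have 1: "(?ext C ^^ Suc k) t alf = t (\<lambda>x\<in>Cr V. alf ((C ^^ Suc k) x))" .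
  have "(?ext C ^^ Suc k) t : Cr ?W" using ext_c[OF C conjunct2[OF IH]] by simp
  with 1 show ?case by (rule conjI)
 qed
 have extp: "(?ext C ^^ p) t = t" if t: "t : Cr ?W" for t
 proof -
  have z: "(\<lambda>x\<in>Cr V. \<zero>.K) : Cr ?D" by (auto simp: dual_iff)
  show ?thesis
  proof (rule extensionalityI[OF _ W_ext[OF t]])
   show "(?ext C ^^ p) t : extensional (Cr ?D)" using extk[OF t z, of p] W_ext by blast
   fix alf assume alf: "alf : Cr ?D"
   have "(\<lambda>x\<in>Cr V. alf ((C ^^ p) x)) = (\<lambda>x\<in>Cr V. alf x)" using Cp by (auto simp: restrict_def fun_eq_iff)
   also have "... = alf" using alf by (intro extensional_restrict) (auto simp: dual_iff PiE_iff)
   finally show "(?ext C ^^ p) t alf = t alf" using extk[OF t alf, of p] by simp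
  qed
 qed
 have W0: "Cr ?W ~= {\<zero>\<^bsub>?W\<^esub>}" and sub: "!!N. subspace ?L N ?W ==> (\<forall>g\<in>Cr E. \<forall>x\<in>N. ?ext (rho g) x : N) ==>
   N = {\<zero>\<^bsub>?W\<^esub>} \<or> N = Cr ?W"
  using irr by (auto simp: irreducible_rep_def)
 obtain t where t: "t : Cr ?W" "t ~= \<zero>\<^bsub>?W\<^esub>" using W0 W.M.zero_closed by blast
 have pp: "p > 0" using p(1) by (rule prime_gt_0_nat)
 obtain c v where c: "c : Cr ?L" and v: "v : Cr ?W" "v ~= \<zero>\<^bsub>?W\<^esub>" "?ext C v = c \<odot>\<^bsub>?W\<^esub> v"
  using W.cyclic_eigenvector[OF ext_c[OF C] ext_add[OF C] ext_smult[OF C] extp mu pp pL t] by blast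
 define N where "N = {x : Cr ?W. ?ext C x = c \<odot>\<^bsub>?W\<^esub> x}"
 have "submodule ?L N ?W"
 proof (rule submodule.intro)
  show "module ?L ?W" by (rule W.module_axioms)
  show "N <= Cr ?W" by (auto simp: N_def)
  show "x \<oplus>\<^bsub>?W\<^esub> y : N" if "x : N" "y : N" for x y
   using that c by (simp add: N_def ext_add[OF C] W.smult_r_distr)
  show "\<zero>\<^bsub>?W\<^esub> : N"
  proof -
   have "?ext C (\<zero>\<^bsub>?L\<^esub> \<odot>\<^bsub>?W\<^esub> v) = \<zero>\<^bsub>?L\<^esub> \<odot>\<^bsub>?W\<^esub> ?ext C v" by (rule ext_smult[OF C])
   then show ?thesis using v c W.smult_l_null W.smult_r_null ext_c[OF C v(1)] by (simp add: N_def)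
  qed
  show "d \<odot>\<^bsub>?W\<^esub> x : N" if "d : Cr ?L" "x : N" for d x
   using that c by (simp add: N_def ext_smult[OF C] W.smult_assoc1[symmetric] L.m_comm)
 qed
 then have "subspace ?L N ?W" using W.vectorspace_axioms by (simp add: subspace_def)
 moreover have "?ext (rho g) x : N" if g: "g : Cr E" and x: "x : N" for g x
 proof -
  have x': "x : Cr ?W" "?ext C x = c \<odot>\<^bsub>?W\<^esub> x" using x by (auto simp: N_def)
  have "?ext C (?ext (rho g) x) = c \<odot>\<^bsub>?W\<^esub> ?ext (rho g) x"
   unfolding ext_comm[OF g, symmetric] x'(2) by (rule ext_smult[OF rho[OF g]])
  then show ?thesis using ext_c[OF rho[OF g] x'(1)] by (simp add: N_def)
 qed
 ultimately have "N = {\<zero>\<^bsub>?W\<^esub>} \<or> N = Cr ?W" using sub by blast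
 moreover have "v : N" using v by (simp add: N_def)
 ultimately have Nall: "?ext C x = c \<odot>\<^bsub>?W\<^esub> x" if "x : Cr ?W" for x using that v(2) by (auto simp: N_def)
 \<comment> \<open>The scalar equation is applied to the tensor of one and \<open>w\<close>, which
   sends a functional to the image of its value at \<open>w\<close>.\<close>
 have key: "?phi (alf (C w)) = c **\<^bsub>?L\<^esub> ?phi (alf w)" if alf: "alf : Cr ?D" and w: "w : Cr V" for alf w
 proof -
  define e :: "('c => 'a) => ('a list \<times> nat) multiset => 'a"
   where "e = (\<lambda>alf\<in>Cr ?D. ?phi (alf w))"
  have dc: "bta w : Cr K" if "bta : Cr ?D" for bta using that w by (auto simp: dual_iff)
  have "e : Cr ?W"
   using dual_op_closed dc phic w ring_hom_add[OF phi] ring_hom_mult[OF phi]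
   by (simp add: extend_scalars_iff e_def PiE_iff) (simp add: dual_ops)
  from fun_cong[OF Nall[OF this], of alf] show ?thesis
   using alf w pre_c[OF C alf] by (simp add: ext_apply ops e_def) (simp add: pre_def)
 qed
 obtain w0 where w0: "w0 : Cr V" "w0 ~= \<zero>.V" using V0 M.zero_closed by blast
 obtain alf0 where alf0: "alf0 : Cr ?D" "alf0 w0 = \<one>.K" using dual_separates[OF fin w0] by blast
 \<comment> \<open>As \<open>alf0 w0\<close> is one, \<open>key\<close> shows the eigenvalue to be
   the image of this element.\<close>
 define \<epsilon> where "\<epsilon> = alf0 (C w0)"
 have Dc: "alf x : Cr K" if "alf : Cr ?D" "x : Cr V" for alf x using that by (auto simp: dual_iff)
 have \<epsilon>c: "\<epsilon> : Cr K" unfolding \<epsilon>_def by (rule Dc[OF alf0(1) GL_D(1)[OF C w0(1)]])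
 have c\<epsilon>: "c = ?phi \<epsilon>" using key[OF alf0(1) w0(1)] ring_hom_one[OF phi] c alf0(2) by (simp add: \<epsilon>_def)
 \<comment> \<open>A functional that tells \<open>C w\<close> from the expected multiple of
   \<open>w\<close> would contradict \<open>key\<close>.\<close>
 have "C w = \<epsilon> \<odot>.V w" if w: "w : Cr V" for w
 proof (rule ccontr)
  assume ne: "C w ~= \<epsilon> \<odot>.V w"
  define d where "d = C w \<ominus>.V \<epsilon> \<odot>.V w"
  have cc: "C w : Cr V" "\<epsilon> \<odot>.V w : Cr V" "d : Cr V" using GL_D(1)[OF C w] \<epsilon>c w by (simp_all add: d_def)
  have "d ~= \<zero>.V" using M.diff_eq_zero[OF cc(1,2)] ne by (auto simp: d_def)
  then obtain alf where alf: "alf : Cr ?D" "alf d = \<one>.K" using dual_separates[OF fin cc(3)] by blast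
  have "(?phi (alf (C w)) :: ('a list \<times> nat) multiset => 'a) = ?phi (\<epsilon> **.K alf w)"
   unfolding key[OF alf(1) w] c\<epsilon> by (rule ring_hom_mult[OF phi \<epsilon>c Dc[OF alf(1) w], symmetric])
  then have "alf (C w) = \<epsilon> **.K alf w" by (rule phiinj)
  also have "... = alf (\<epsilon> \<odot>.V w)" using alf(1) \<epsilon>c w by (simp add: dual_iff)
  finally have "alf (C w) = \<zero>.K \<oplus>.K alf (\<epsilon> \<odot>.V w)" using Dc[OF alf(1) cc(2)] by simp
  moreover have "d \<oplus>.V \<epsilon> \<odot>.V w = C w" using cc by (simp add: d_def a_minus_def M.a_assoc M.l_neg)
  then have "alf (C w) = alf d \<oplus>.K alf (\<epsilon> \<odot>.V w)" using alf(1) cc(2,3) by (metis dual_iff)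
  ultimately have "alf d = \<zero>.K"
   using R.add.right_cancel[OF Dc[OF alf(1) cc(2)] Dc[OF alf(1) cc(3)] R.zero_closed] by simp
  then show False using alf(2) by simp
 qed
 then show ?thesis using \<epsilon>c by blast
qed

end

context heis
begin

text \<open>The element \<open>(0, 1)\<close> generates the centre, so its scalar determines the
  other central ones as powers. Its \<open>p\<close>-th power is trivial, and faithfulness keeps the
  scalar from being one.\<close>

lemma central_character:
 assumes Q: "field Q" "finite (Cr Q)" "[p] \<cdot>.Q \<one>.Q ~= \<zero>.Q" and W: "vectorspace Q W"
  and rho: "rho : hom E (GL Q W)" "inj_on rho (Cr E)" and irr: "absolutely_irreducible_rep E Q W rho"
 shows "\<exists>eps. heis_rep K V p h Q eps W rho & finite (Cr W) &
  (\<forall>k. 0 < k & k < p --> eps [^].Q k ~= \<one>.Q) & rho (\<zero>.V, \<one>) = (\<lambda>w\<in>Cr W. eps \<odot>.W w)"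
proof -
 interpret Q: field Q by (rule Q)
 interpret W: vectorspace Q W by (rule W)
 interpret E: group E by (rule E_group)
 have irr1: "irreducible_rep E Q W rho" and irr2: "irreducible_rep E Q.alg_closure
   (extend_scalars Q Q.alg_closure Q.indexed_const W) (\<lambda>g. extend_scalars_map Q W (rho g))"
  using irr by (auto simp: absolutely_irreducible_rep_def)
 have W0: "Cr W ~= {\<zero>.W}" using irr1 by (simp add: irreducible_rep_def)
 have fin: "finite (Cr W)" by (rule W.irreducible_finite[OF E_group E_finite Q(2) rho(1) irr1])
 have GL: "rho e : Cr (GL Q W)" if "e : Cr E" for e using rho(1) that by (rule hom_in_carrier)
 have mult: "rho (e **.E e') w = rho e' (rho e w)" if "e : Cr E" "e' : Cr E" "w : Cr W" for e e' w
  using hom_mult[OF rho(1) that(1,2)] that(3) by (simp add: GL_mult compose_def)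
 have one: "rho \<one>.E w = w" if w: "w : Cr W" for w
 proof -
  have "rho \<one>.E (rho \<one>.E w) = rho \<one>.E w" using mult[of "\<one>.E" "\<one>.E" w] w by simp
  then show ?thesis using inj_onD[OF GL_D(5)[OF GL[OF E.one_closed]]] GL_D(1)[OF GL[OF E.one_closed] w] w by blast
 qed
 define z where "z = (\<zero>.V, \<one>)"
 have zE: "z : Cr E" by (simp add: z_def E_carrier)
 have zpow: "z [^].E n = (\<zero>.V, [n] \<cdot>.K \<one>)" for n :: nat
  by (induction n) (simp_all add: z_def E_mult E_one)
 have Cpow: "(rho z ^^ n) w = rho (z [^].E n) w" if w: "w : Cr W" for n w
 proof (induction n)
  case (Suc n)
  then show ?case using mult[OF E.nat_pow_closed[OF zE] zE w] by simp
 qed (use one w in simp)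
 have Cp: "(rho z ^^ p) w = w" if w: "w : Cr W" for w
  using Cpow[OF w, of p] one[OF w] by (simp add: zpow F.char_p E_one)
 have comm: "rho e (rho z w) = rho z (rho e w)" if e: "e : Cr E" and w: "w : Cr W" for e w
 proof -
  have "z : group_center E" by (simp add: E_center z_def)
  then have "z **.E e = e **.E z" using e by (simp add: group_center_def)
  then show ?thesis using mult[OF zE e w] mult[OF e zE w] by simp
 qed
 obtain eps where eps: "eps : Cr Q" "\<forall>w\<in>Cr W. rho z w = eps \<odot>.W w"
  using W.central_scalar[OF fin W0 irr2 GL GL[OF zE] comm F.prime_p Q(3) Cp] by blast
 obtain w0 where w0: "w0 : Cr W" "w0 ~= \<zero>.W" using W0 W.M.zero_closed by blast
 have Cn: "(rho z ^^ n) w = eps [^].Q n \<odot>.W w" if w: "w : Cr W" for n w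
 proof (induction n)
  case (Suc n)
  then show ?case using eps w by (simp add: W.smult_assoc1[symmetric] Q.m_comm)
 qed (use w in simp)
 have epsp: "eps [^].Q p = \<one>.Q"
  by (rule W.smult_right_cancel[OF _ _ w0]) (use eps w0 Cn[OF w0(1), of p] Cp[OF w0(1)] in auto)
 have eps1: "eps ~= \<one>.Q"
 proof
  assume e: "eps = \<one>.Q"
  have "rho z = rho \<one>.E"
   by (rule extensionalityI[OF GL_D(4)[OF GL[OF zE]] GL_D(4)[OF GL[OF E.one_closed]]]) (use e eps one in auto)
  then have "z = \<one>.E" using inj_onD[OF rho(2) _ zE E.one_closed] by simp
  then show False by (simp add: z_def E_one)
 qed
 interpret CD: char_data K V p h Q eps
  by unfold_locales (use eps epsp eps1 Q(3) in auto)
 have "heis_rep K V p h Q eps W rho"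
 proof unfold_locales
  show "rho : hom E (GL Q W)" "inj_on rho (Cr E)" by (rule rho)+
  show "rho (\<zero>.V, y) w = CD.chi y \<odot>.W w" if y: "y : prime_field K" and w: "w : Cr W" for y w
   using Cn[OF w, of "idx y"] Cpow[OF w, of "idx y"] F.idx(1)[OF y] by (simp add: zpow CD.chi_def)
 qed
 moreover have "eps [^].Q k ~= \<one>.Q" if "0 < k" "k < p" for k
  using CD.eps_pow_inj[of k] that nat_dvd_not_less[of k p] by auto
 moreover have "rho (\<zero>.V, \<one>) = (\<lambda>w\<in>Cr W. eps \<odot>.W w)"
 proof (rule extensionalityI[OF GL_D(4)[OF GL[OF zE[unfolded z_def]]]])
  show "rho (\<zero>.V, \<one>) w = (\<lambda>w\<in>Cr W. eps \<odot>.W w) w" if "w : Cr W" for w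
   using eps(2) that by (simp add: z_def)
 qed simp
 ultimately show ?thesis using fin by blast
qed

end

section \<open>Invariant forms\<close>

context heis_rep
begin

definition invariant_form :: "('w => 'w => 'q) => bool" where
 "invariant_form f <-> (\<forall>e\<in>Cr E. \<forall>x\<in>Cr W. \<forall>y\<in>Cr W. f (rho e x) (rho e y) = f x y)"

lemma sesquilinear_D:
 assumes "sesquilinear Q W eta f"
 shows "x : Cr W ==> y : Cr W ==> f x y : Cr Q"
  "x : Cr W ==> x' : Cr W ==> y : Cr W ==> f (x \<oplus>.W x') y = f x y \<oplus>.Q f x' y"
  "x : Cr W ==> y : Cr W ==> y' : Cr W ==> f x (y \<oplus>.W y') = f x y \<oplus>.Q f x y'"
  "c : Cr Q ==> x : Cr W ==> y : Cr W ==> f (c \<odot>.W x) y = c **.Q f x y"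
  "c : Cr Q ==> x : Cr W ==> y : Cr W ==> f x (c \<odot>.W y) = eta c **.Q f x y"
  "y : Cr W ==> f \<zero>.W y = \<zero>.Q" "y : Cr W ==> f y \<zero>.W = \<zero>.Q"
proof -
 note D = assms[unfolded sesquilinear_def]
 show c: "f x y : Cr Q" if "x : Cr W" "y : Cr W" for x y using D that by blast
 show "f (x \<oplus>.W x') y = f x y \<oplus>.Q f x' y" if "x : Cr W" "x' : Cr W" "y : Cr W" for x x' y using D that by blast
 show ar: "f x (y \<oplus>.W y') = f x y \<oplus>.Q f x y'" if "x : Cr W" "y : Cr W" "y' : Cr W" for x y y' using D that by blast
 show sl: "f (c \<odot>.W x) y = c **.Q f x y" if "c : Cr Q" "x : Cr W" "y : Cr W" for c x y using D that by blast
 show "f x (c \<odot>.W y) = eta c **.Q f x y" if "c : Cr Q" "x : Cr W" "y : Cr W" for c x y using D that by blast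
 show "f \<zero>.W y = \<zero>.Q" if y: "y : Cr W"
 proof -
  have "f (\<zero>.Q \<odot>.W y) y = \<zero>.Q **.Q f y y" using sl y by blast
  then show ?thesis using c[OF y y] W.smult_l_null[OF y] by simp
 qed
 show "f y \<zero>.W = \<zero>.Q" if y: "y : Cr W"
 proof -
  have "f y \<zero>.W \<oplus>.Q f y \<zero>.W = \<zero>.Q \<oplus>.Q f y \<zero>.W"
   using ar[OF y W.M.zero_closed W.M.zero_closed] c[OF y W.M.zero_closed] by simp
  then show ?thesis using Q.add.right_cancel[OF c[OF y W.M.zero_closed] c[OF y W.M.zero_closed] Q.zero_closed] by simp
 qed
qed

lemma invariant_D:
 "invariant_form f ==> e : Cr E ==> x : Cr W ==> y : Cr W ==> f (rho e x) (rho e y) = f x y"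
 by (simp add: invariant_form_def)

lemma rho_split:
 assumes v: "v : Cr V" and c: "c : prime_field K" and w: "w : Cr W"
 shows "rho (v, c) w = chi c \<odot>.W rho (v, \<zero>) w"
proof -
 have E1: "(v, \<zero>) : Cr E" "(\<zero>.V, c) : Cr E" using v c by (simp_all add: E_carrier)
 have "(v, \<zero>) **.E (\<zero>.V, c) = (v, c)" using v c by (simp add: E_mult)
 then show ?thesis using rho_mult_apply[OF E1 w] rho_central[OF c rho_D(1)[OF E1(1) w]] by simp
qed

lemma rho_finsum:
 assumes e: "e : Cr E" and I: "finite I" and b: "!!i. i : I ==> b i : Cr W"
 shows "rho e (\<Oplus>.W i\<in>I. b i) = (\<Oplus>.W i\<in>I. rho e (b i))"
proof -
 have "rho e (\<zero>.Q \<odot>.W \<zero>.W) = \<zero>.Q \<odot>.W rho e \<zero>.W" by (rule rho_D(3)[OF e]) simp_all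
 then have r0: "rho e \<zero>.W = \<zero>.W" using rho_D(1)[OF e, of "\<zero>.W"] W.smult_l_null by simp
 show ?thesis using I b
  by (induction I rule: finite_induct) (auto simp: r0 rho_D(1,2)[OF e] Pi_def W.finsum_insert)
qed

lemma dual_D:
 assumes "alf : Cr (dual_space Q W)"
 shows "x : Cr W ==> alf x : Cr Q"
  "x : Cr W ==> y : Cr W ==> alf (x \<oplus>.W y) = alf x \<oplus>.Q alf y"
  "c : Cr Q ==> x : Cr W ==> alf (c \<odot>.W x) = c **.Q alf x"
  "alf \<zero>.W = \<zero>.Q"
proof -
 show "x : Cr W ==> alf x : Cr Q"
  "x : Cr W ==> y : Cr W ==> alf (x \<oplus>.W y) = alf x \<oplus>.Q alf y"
  "c : Cr Q ==> x : Cr W ==> alf (c \<odot>.W x) = c **.Q alf x"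
  using assms by (auto simp: W.dual_iff)
 have z: "alf \<zero>.W : Cr Q" using assms by (auto simp: W.dual_iff)
 have "alf (\<zero>.Q \<odot>.W \<zero>.W) = \<zero>.Q **.Q alf \<zero>.W" using assms by (simp only: W.dual_iff Q.zero_closed W.M.zero_closed)
 then show "alf \<zero>.W = \<zero>.Q" using z W.smult_l_null by simp
qed

lemma dual_finsum:
 assumes alf: "alf : Cr (dual_space Q W)" and I: "finite I" and b: "!!i. i : I ==> b i : Cr W"
 shows "alf (\<Oplus>.W i\<in>I. b i) = (\<Oplus>.Q i\<in>I. alf (b i))"
 using I b
 by (induction I rule: finite_induct) (auto simp: dual_D[OF alf] Pi_def W.finsum_insert Q.finsum_insert)

lemma hom_finsum:
 assumes etah: "eta : Ring.ring_hom Q Q" and I: "finite I" and b: "!!i. i : I ==> b i : Cr Q"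
 shows "eta (\<Oplus>.Q i\<in>I. b i) = (\<Oplus>.Q i\<in>I. eta (b i))"
proof -
 interpret h: ring_hom_cring Q Q eta
  by (simp add: ring_hom_cring_def ring_hom_cring_axioms_def Q.is_cring etah)
 show ?thesis using b by (simp add: h.hom_finsum Pi_def o_def)
qed

text \<open>A relation \<open>\<Sum> d v \<rho>(v, 0) = 0\<close> stays valid after multiplying \<open>d v\<close> by the character
 \<open>chi (beta y v)\<close>; averaging over \<open>y\<close> isolates \<open>d 0\<close>.\<close>

lemma rho_independent:
 assumes d: "!!v. v : Cr V ==> d v : Cr Q"
  and Z: "!!w. w : Cr W ==> (\<Oplus>.W v\<in>Cr V. d v \<odot>.W rho (v, \<zero>) w) = \<zero>.W"
  and w: "w : Cr W"
 shows "d \<zero>.V \<odot>.W w = \<zero>.W"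
proof -
 have E0: "(v, \<zero>) : Cr E" if "v : Cr V" for v using that by (simp add: E_carrier)
 have rc: "rho (v, \<zero>) x : Cr W" if "v : Cr V" "x : Cr W" for v x using rho_D(1)[OF E0[OF that(1)] that(2)] .
 have bc: "beta y v : prime_field K" if "y : Cr V" "v : Cr V" for y v using that by simp
 \<comment> \<open>Applying \<open>rho (y, 0)\<close> to the twisted relation gives the original
   relation at \<open>rho (y, 0) w\<close>, and \<open>rho (y, 0)\<close> is injective.\<close>
 have tw: "(\<Oplus>.W v\<in>Cr V. (d v **.Q chi (beta y v)) \<odot>.W rho (v, \<zero>) w) = \<zero>.W" if y: "y : Cr V" for y
 proof -
  let ?t = "\<lambda>v. (d v **.Q chi (beta y v)) \<odot>.W rho (v, \<zero>) w"
  have tc: "?t v : Cr W" if "v : Cr V" for v using d[OF that] rc[OF that w] by simp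
  have "rho (y, \<zero>) (\<Oplus>.W v\<in>Cr V. ?t v) = (\<Oplus>.W v\<in>Cr V. rho (y, \<zero>) (?t v))"
   by (rule rho_finsum[OF E0[OF y] fin_V tc])
  also have "... = (\<Oplus>.W v\<in>Cr V. d v \<odot>.W rho (v, \<zero>) (rho (y, \<zero>) w))"
  proof (rule W.finsum_cong')
   fix v assume v: "v : Cr V"
   have E1: "(y, \<zero>) **.E (v, \<zero>) = (v, \<zero>) **.E (y, \<zero>) **.E (\<zero>.V, beta y v)"
    using y v by (intro E_swap) simp_all
   have c: "(\<zero>.V, beta y v) : Cr E" using y v by (simp add: E_carrier)
   have "rho (v, \<zero>) (rho (y, \<zero>) w) = rho ((y, \<zero>) **.E (v, \<zero>)) w"
    by (rule rho_mult_apply[OF E0[OF y] E0[OF v] w, symmetric])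
   also have "... = rho (\<zero>.V, beta y v) (rho ((v, \<zero>) **.E (y, \<zero>)) w)"
    unfolding E1 by (rule rho_mult_apply[OF reg.E.m_closed[OF E0[OF v] E0[OF y]] c w])
   also have "... = chi (beta y v) \<odot>.W rho (y, \<zero>) (rho (v, \<zero>) w)"
    unfolding rho_mult_apply[OF E0[OF v] E0[OF y] w] by (rule rho_central[OF bc[OF y v] rc[OF y rc[OF v w]]])
   finally have "d v \<odot>.W rho (v, \<zero>) (rho (y, \<zero>) w) = (d v **.Q chi (beta y v)) \<odot>.W rho (y, \<zero>) (rho (v, \<zero>) w)"
    using d[OF v] rc[OF y rc[OF v w]] by (simp add: W.smult_assoc1)
   then show "rho (y, \<zero>) (?t v) = d v \<odot>.W rho (v, \<zero>) (rho (y, \<zero>) w)"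
    using rho_D(3)[OF E0[OF y] _ rc[OF v w]] d[OF v] by simp
  qed (use d rc y w in auto)
  also have "... = \<zero>.W" by (rule Z[OF rc[OF y w]])
  finally have "rho (y, \<zero>) (\<Oplus>.W v\<in>Cr V. ?t v) = rho (y, \<zero>) \<zero>.W"
   using rho_finsum[OF E0[OF y] finite.emptyI] by simp
  then show ?thesis by (rule inj_onD[OF rho_D(5)[OF E0[OF y]]]) (use tc in \<open>auto intro!: W.finsum_closed\<close>)
 qed
 let ?N = "num (card (Cr V))"
 have "\<zero>.W = (\<Oplus>.W y\<in>Cr V. \<Oplus>.W v\<in>Cr V. (d v **.Q chi (beta y v)) \<odot>.W rho (v, \<zero>) w)"
  using tw by (simp cong: W.finsum_cong')
 also have "... = (\<Oplus>.W v\<in>Cr V. \<Oplus>.W y\<in>Cr V. (d v **.Q chi (beta y v)) \<odot>.W rho (v, \<zero>) w)"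
  by (rule W.finsum_swap) (use fin_V d rc w in auto)
 also have "... = (\<Oplus>.W v\<in>Cr V. if \<zero>.V = v then (d v **.Q ?N) \<odot>.W w else \<zero>.W)"
 proof (rule W.finsum_cong')
  fix v assume v: "v : Cr V"
  have "(\<Oplus>.W y\<in>Cr V. (d v **.Q chi (beta y v)) \<odot>.W rho (v, \<zero>) w)
   = (\<Oplus>.Q y\<in>Cr V. d v **.Q chi (beta y v)) \<odot>.W rho (v, \<zero>) w"
   by (rule W.smult_finsum_l[symmetric]) (use fin_V d v rc w in auto)
  also have "(\<Oplus>.Q y\<in>Cr V. d v **.Q chi (beta y v)) = d v **.Q (\<Oplus>.Q y\<in>Cr V. chi (beta y v))"
   by (rule Q.finsum_rdistr[symmetric]) (use fin_V d v in auto)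
  also have "(\<Oplus>.Q y\<in>Cr V. chi (beta y v)) = (if \<zero>.V = v then ?N else \<zero>.Q)"
  proof (cases "\<zero>.V = v")
   case True
   have "(\<Oplus>.Q y\<in>Cr V. chi (beta y v)) = (\<Oplus>.Q y\<in>Cr V. if True then \<one>.Q else \<zero>.Q)"
    by (rule Q.finsum_cong') (auto simp: True[symmetric])
   also have "... = [card {y : Cr V. True}] \<cdot>.Q \<one>.Q" by (rule Q.finsum_const_filter) (use fin_V in auto)
   finally show ?thesis using True by simp
  next
   case False
   then obtain y where y: "y : Cr V" "beta v y ~= \<zero>" using beta_nondeg[OF v] by metis
   have "beta y v ~= \<zero>"
   proof
    assume "beta y v = \<zero>"
    then show False using beta_swap[OF y(1) v] y(2) by simp
   qed
   then have "(\<Oplus>.Q y\<in>Cr V. chi (beta y v)) = \<zero>.Q"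
    using v y(1) by (intro sum_character[OF fin_V, where t = y]) (auto simp: beta_add_l)
   then show ?thesis using False by simp
  qed
  finally show "(\<Oplus>.W y\<in>Cr V. (d v **.Q chi (beta y v)) \<odot>.W rho (v, \<zero>) w)
   = (if \<zero>.V = v then (d v **.Q ?N) \<odot>.W w else \<zero>.W)"
   using d[OF v] rc[OF v w] rho_one_apply[OF w] W.smult_l_null by (auto simp: E_one)
 qed (use d w in auto)
 also have "... = (d \<zero>.V **.Q ?N) \<odot>.W w"
  using fin_V d w W.finsum_singleton[of "\<zero>.V" "Cr V" "\<lambda>v. (d v **.Q ?N) \<odot>.W w"] by simp
 finally have "?N \<odot>.W (d \<zero>.V \<odot>.W w) = \<zero>.W" using d w by (simp add: W.smult_assoc1[symmetric] Q.m_comm)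
 also have "... = ?N \<odot>.W \<zero>.W" by (rule W.smult_r_null[symmetric]) simp
 finally show ?thesis
  by (rule smult_left_cancel[OF _ num_card_nonzero(1), rotated 3]) (use d w in auto)
qed

context
 assumes fin_W: "finite (Cr W)" and irr: "irreducible_rep (form_group K V h) Q W rho"
begin

lemma W_nontrivial: "\<exists>w\<in>Cr W. w ~= \<zero>.W"
 using irr W.M.zero_closed by (auto simp: irreducible_rep_def)

lemma invariant_subspace:
 assumes N: "N <= Cr W" "\<zero>.W : N" "!!x y. x : N ==> y : N ==> x \<oplus>.W y : N"
  "!!c x. c : Cr Q ==> x : N ==> c \<odot>.W x : N" "!!e x. e : Cr E ==> x : N ==> rho e x : N"
 shows "N = {\<zero>.W} \<or> N = Cr W"
proof -
 have "submodule Q N W" by (rule submodule.intro) (use N W.module_axioms in auto)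
 then have "subspace Q N W" using W.vectorspace_axioms by (simp add: subspace_def)
 then show ?thesis using irr N(5) by (simp add: irreducible_rep_def)
qed

text \<open>Both radicals are invariant subspaces, as group elements can be moved across the form.
  Neither is everything, so both are zero.\<close>

lemma invariant_form_nondegenerate:
 assumes f: "sesquilinear Q W eta f" and etac: "!!c. c : Cr Q ==> eta c : Cr Q" and inv: "invariant_form f"
  and nz: "x0 : Cr W" "y0 : Cr W" "f x0 y0 ~= \<zero>.Q"
 shows "nondegenerate Q W f"
proof -
 note D = sesquilinear_D[OF f]
 have shl: "f (rho e x) y = f x (rho (inv\<^bsub>E\<^esub> e) y)" and shr: "f y (rho e x) = f (rho (inv\<^bsub>E\<^esub> e) y) x"
  if e: "e : Cr E" and x: "x : Cr W" and y: "y : Cr W" for e x y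
 proof -
  have c: "rho (inv\<^bsub>E\<^esub> e) y : Cr W" using rho_D(1)[OF reg.E.inv_closed[OF e] y] .
  show "f (rho e x) y = f x (rho (inv\<^bsub>E\<^esub> e) y)"
   using invariant_D[OF inv e x c] unfolding rho_inv_apply(1)[OF e y] .
  show "f y (rho e x) = f (rho (inv\<^bsub>E\<^esub> e) y) x"
   using invariant_D[OF inv e c x] unfolding rho_inv_apply(1)[OF e y] .
 qed
 have ic: "rho (inv\<^bsub>E\<^esub> e) y : Cr W" if "e : Cr E" "y : Cr W" for e y
  using rho_D(1)[OF reg.E.inv_closed[OF that(1)] that(2)] .
 define L where "L = {x : Cr W. \<forall>y\<in>Cr W. f x y = \<zero>.Q}"
 define R where "R = {y : Cr W. \<forall>x\<in>Cr W. f x y = \<zero>.Q}"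
 have "L = {\<zero>.W} \<or> L = Cr W"
  by (rule invariant_subspace) (auto simp: L_def D shl ic rho_D(1))
 moreover have "x0 \<notin> L" using nz by (auto simp: L_def)
 ultimately have L: "L = {\<zero>.W}" using nz(1) by blast
 have "R = {\<zero>.W} \<or> R = Cr W"
  by (rule invariant_subspace) (auto simp: R_def D shr ic rho_D(1) etac)
 moreover have "y0 \<notin> R" using nz by (auto simp: R_def)
 ultimately have R: "R = {\<zero>.W}" using nz(2) by blast
 show ?thesis using L R unfolding nondegenerate_def L_def R_def by blast
qed

text \<open>The forms \<open>alf x\<close> times \<open>eta (bta y)\<close> are averaged over the
  elements \<open>(v, 0)\<close>. If all averages vanished, letting \<open>bta\<close> vary for one
  suitable \<open>alf\<close> and vector would give a linear relation between the operators
  \<open>rho (v, 0)\<close> with coefficient one at \<open>v = 0\<close>, against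
  \<open>rho_independent\<close>.\<close>

lemma invariant_form_exists:
 assumes eta: "inverts_eps eta" "!!a. a : Cr Q ==> eta (eta a) = a"
 shows "\<exists>f. sesquilinear Q W eta f & invariant_form f & (\<exists>x\<in>Cr W. \<exists>y\<in>Cr W. f x y ~= \<zero>.Q)"
proof -
 have etah: "eta : Ring.ring_hom Q Q" using eta(1) by (auto simp: inverts_eps_def)
 note etac = ring_hom_closed[OF etah] and etam = ring_hom_mult[OF etah] and etaa = ring_hom_add[OF etah]
 have E0: "(v, \<zero>) : Cr E" if "v : Cr V" for v using that by (simp add: E_carrier)
 have rc: "rho (v, \<zero>) x : Cr W" if "v : Cr V" "x : Cr W" for v x using rho_D(1)[OF E0[OF that(1)] that(2)] .
 define B where "B alf bta x y = (\<Oplus>.Q v\<in>Cr V. alf (rho (v, \<zero>) x) **.Q eta (bta (rho (v, \<zero>) y)))" for alf bta x y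
 have sesq: "sesquilinear Q W eta (B alf bta)" if alf: "alf : Cr (dual_space Q W)" and bta: "bta : Cr (dual_space Q W)" for alf bta
 proof -
  note dc = dual_D[OF alf] dual_D[OF bta]
  have tc: "alf (rho (v, \<zero>) x) : Cr Q" "eta (bta (rho (v, \<zero>) x)) : Cr Q" if "v : Cr V" "x : Cr W" for v x
   using dc rc[OF that] etac by auto
  have al: "B alf bta (x \<oplus>.W x') y = B alf bta x y \<oplus>.Q B alf bta x' y" if c: "x : Cr W" "x' : Cr W" "y : Cr W" for x x' y
  proof -
   have "B alf bta (x \<oplus>.W x') y = (\<Oplus>.Q v\<in>Cr V. alf (rho (v, \<zero>) x) **.Q eta (bta (rho (v, \<zero>) y)) \<oplus>.Q alf (rho (v, \<zero>) x') **.Q eta (bta (rho (v, \<zero>) y)))"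
    unfolding B_def by (rule Q.finsum_cong') (use c tc rc in \<open>auto simp: rho_D(2)[OF E0] dual_D(2)[OF alf] Q.l_distr\<close>)
   then show ?thesis unfolding B_def using c tc by (simp add: Q.finsum_addf Pi_def)
  qed
  have ar: "B alf bta x (y \<oplus>.W y') = B alf bta x y \<oplus>.Q B alf bta x y'" if c: "x : Cr W" "y : Cr W" "y' : Cr W" for x y y'
  proof -
   have "B alf bta x (y \<oplus>.W y') = (\<Oplus>.Q v\<in>Cr V. alf (rho (v, \<zero>) x) **.Q eta (bta (rho (v, \<zero>) y)) \<oplus>.Q alf (rho (v, \<zero>) x) **.Q eta (bta (rho (v, \<zero>) y')))"
    unfolding B_def by (rule Q.finsum_cong')
     (use c tc rc in \<open>auto simp: rho_D(2)[OF E0] dual_D(1,2)[OF bta] etaa Q.r_distr\<close>)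
   then show ?thesis unfolding B_def using c tc by (simp add: Q.finsum_addf Pi_def)
  qed
  have sl: "B alf bta (k \<odot>.W x) y = k **.Q B alf bta x y" if c: "k : Cr Q" "x : Cr W" "y : Cr W" for k x y
  proof -
   have "B alf bta (k \<odot>.W x) y = (\<Oplus>.Q v\<in>Cr V. k **.Q (alf (rho (v, \<zero>) x) **.Q eta (bta (rho (v, \<zero>) y))))"
    unfolding B_def by (rule Q.finsum_cong') (use c tc rc in \<open>auto simp: rho_D(3)[OF E0] dual_D(3)[OF alf] Q.m_assoc\<close>)
   then show ?thesis unfolding B_def using c tc fin_V by (simp add: Q.finsum_rdistr Pi_def)
  qed
  have sr: "B alf bta x (k \<odot>.W y) = eta k **.Q B alf bta x y" if c: "k : Cr Q" "x : Cr W" "y : Cr W" for k x y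
  proof -
   have "B alf bta x (k \<odot>.W y) = (\<Oplus>.Q v\<in>Cr V. eta k **.Q (alf (rho (v, \<zero>) x) **.Q eta (bta (rho (v, \<zero>) y))))"
    unfolding B_def by (rule Q.finsum_cong')
     (use c tc rc etac in \<open>auto simp: rho_D(3)[OF E0] dual_D(1,3)[OF bta] etam Q.m_lcomm\<close>)
   then show ?thesis unfolding B_def using c tc fin_V etac by (simp add: Q.finsum_rdistr Pi_def)
  qed
  have cl: "B alf bta x y : Cr Q" if c: "x : Cr W" "y : Cr W" for x y
   unfolding B_def by (rule Q.finsum_closed) (use c tc in auto)
  show ?thesis unfolding sesquilinear_def by (intro conjI ballI cl al ar sl sr)
 qed
 have inv: "invariant_form (B alf bta)" if alf: "alf : Cr (dual_space Q W)" and bta: "bta : Cr (dual_space Q W)" for alf bta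
  unfolding invariant_form_def
 proof (intro ballI)
  fix e x y assume e: "e : Cr E" and x: "x : Cr W" and y: "y : Cr W"
  obtain a z where ez: "e = (a, z)" "a : Cr V" "z : prime_field K" using e by (auto simp: E_carrier)
  let ?t = "\<lambda>v. alf (rho (v, \<zero>) x) **.Q eta (bta (rho (v, \<zero>) y))"
  have tc: "alf (rho (v, \<zero>) x) : Cr Q" "bta (rho (v, \<zero>) y) : Cr Q" "eta (bta (rho (v, \<zero>) y)) : Cr Q"
   if "v : Cr V" for v
   using dual_D(1)[OF alf] dual_D(1)[OF bta] rc[OF that] etac x y by auto
  have "alf (rho (v, \<zero>) (rho e x)) **.Q eta (bta (rho (v, \<zero>) (rho e y))) = ?t (v \<oplus>.V a)" if v: "v : Cr V" for v
  proof -
   define c where "c = z \<oplus> h a v"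
   have c: "c : prime_field K" using ez v by (simp add: c_def h_closed)
   have va: "v \<oplus>.V a : Cr V" using v ez by simp
   have "e **.E (v, \<zero>) = (v \<oplus>.V a, c)" using ez v by (simp add: E_mult c_def M.a_comm)
   then have r: "rho (v, \<zero>) (rho e w) = chi c \<odot>.W rho (v \<oplus>.V a, \<zero>) w" if w: "w : Cr W" for w
    using rho_mult_apply[OF e E0[OF v] w] rho_split[OF va c w] by simp
   \<comment> \<open>Central factors cancel between the two arguments, so summing over
     \<open>V\<close> instead of \<open>E\<close> already gives invariance.\<close>
   have cc: "chi c **.Q eta (chi c) = \<one>.Q"
    unfolding inverts_eps_chi[OF eta(1) c] using c chi_add[of c "\<ominus> c"] by (simp add: F.r_neg)
   have "alf (rho (v, \<zero>) (rho e x)) **.Q eta (bta (rho (v, \<zero>) (rho e y)))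
    = (chi c **.Q alf (rho (v \<oplus>.V a, \<zero>) x)) **.Q (eta (chi c) **.Q eta (bta (rho (v \<oplus>.V a, \<zero>) y)))"
    unfolding r[OF x] r[OF y] dual_D(3)[OF alf chi_closed rc[OF va x]] dual_D(3)[OF bta chi_closed rc[OF va y]]
     etam[OF chi_closed tc(2)[OF va]] ..
   also have "... = (chi c **.Q eta (chi c)) **.Q ?t (v \<oplus>.V a)"
    using tc[OF va] etac[OF chi_closed] by (simp add: Q.m_ac)
   finally show ?thesis unfolding cc using tc[OF va] by simp
  qed
  then have "B alf bta (rho e x) (rho e y) = (\<Oplus>.Q v\<in>Cr V. ?t (v \<oplus>.V a))"
   unfolding B_def by (intro Q.finsum_cong') (use tc ez in auto)
  also have "... = (\<Oplus>.Q v\<in>(\<lambda>v. v \<oplus>.V a) ` Cr V. ?t v)"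
   by (rule Q.finsum_reindex[symmetric]) (use tc ez reg.translate_bij[OF ez(2)] in \<open>auto simp: bij_betw_def\<close>)
  also have "(\<lambda>v. v \<oplus>.V a) ` Cr V = Cr V" using reg.translate_bij[OF ez(2)] by (simp add: bij_betw_def)
  finally show "B alf bta (rho e x) (rho e y) = B alf bta x y" by (simp add: B_def)
 qed
 have "\<exists>alf\<in>Cr (dual_space Q W). \<exists>bta\<in>Cr (dual_space Q W). \<exists>x\<in>Cr W. \<exists>y\<in>Cr W. B alf bta x y ~= \<zero>.Q"
 proof (rule ccontr)
  assume "~ ?thesis"
  then have B0: "B alf bta x y = \<zero>.Q" if "alf : Cr (dual_space Q W)" "bta : Cr (dual_space Q W)" "x : Cr W" "y : Cr W" for alf bta x y
   using that by blast
  obtain w0 where w0: "w0 : Cr W" "w0 ~= \<zero>.W" using W_nontrivial by blast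
  obtain alf where alf: "alf : Cr (dual_space Q W)" "alf w0 = \<one>.Q" using W.dual_separates[OF fin_W w0] by blast
  define d where "d v = eta (alf (rho (v, \<zero>) w0))" for v
  have ac: "alf (rho (v, \<zero>) w0) : Cr Q" if "v : Cr V" for v using dual_D(1)[OF alf(1) rc[OF that w0(1)]] .
  have dc: "d v : Cr Q" if "v : Cr V" for v unfolding d_def by (rule etac[OF ac[OF that]])
  have d0: "d \<zero>.V = \<one>.Q" using rho_one_apply[OF w0(1)] alf(2) ring_hom_one[OF etah] by (simp add: d_def E_one)
  have Z: "(\<Oplus>.W v\<in>Cr V. d v \<odot>.W rho (v, \<zero>) w) = \<zero>.W" (is "?Z = _") if w: "w : Cr W" for w
  proof (rule ccontr)
   have tc: "d v \<odot>.W rho (v, \<zero>) w : Cr W" if "v : Cr V" for v using dc[OF that] rc[OF that w] by simp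
   then have Zc: "?Z : Cr W" by (intro W.finsum_closed) auto
   assume "?Z ~= \<zero>.W"
   then obtain bta where bta: "bta : Cr (dual_space Q W)" "bta ?Z = \<one>.Q" using W.dual_separates[OF fin_W Zc] by blast
   have bc: "bta (rho (v, \<zero>) w) : Cr Q" if "v : Cr V" for v using dual_D(1)[OF bta(1) rc[OF that w]] .
   have "bta ?Z = (\<Oplus>.Q v\<in>Cr V. bta (d v \<odot>.W rho (v, \<zero>) w))" by (rule dual_finsum[OF bta(1) fin_V tc])
   also have "... = (\<Oplus>.Q v\<in>Cr V. d v **.Q bta (rho (v, \<zero>) w))"
    by (rule Q.finsum_cong') (use dc bc dual_D(3)[OF bta(1) dc rc[OF _ w]] in auto)
   finally have "eta (bta ?Z) = (\<Oplus>.Q v\<in>Cr V. eta (d v **.Q bta (rho (v, \<zero>) w)))"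
    using hom_finsum[OF etah fin_V, of "\<lambda>v. d v **.Q bta (rho (v, \<zero>) w)"] dc bc by simp
   also have "... = B alf bta w0 w"
    unfolding B_def by (rule Q.finsum_cong') (use dc bc ac etac in \<open>auto simp: etam d_def eta(2)\<close>)
   also have "... = \<zero>.Q" by (rule B0[OF alf(1) bta(1) w0(1) w])
   finally show False using bta(2) ring_hom_one[OF etah] by simp
  qed
  show False using rho_independent[OF dc Z w0(1)] w0 d0 by simp
 qed
 then show ?thesis using sesq inv by blast
qed

text \<open>Adding the conjugate transpose makes the form Hermitian. If the result is zero, the form
  is skew-Hermitian and is multiplied by the skew element \<open>eps - eta eps\<close>, which is not
  zero because \<open>eps\<close> has odd order.\<close>

lemma hermitian_form_exists:
 assumes p: "odd p" and eta: "inverts_eps eta" "!!a. a : Cr Q ==> eta (eta a) = a"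
 shows "\<exists>f. sesquilinear Q W eta f & invariant_form f & nondegenerate Q W f & hermitian W eta f"
proof -
 have etah: "eta : Ring.ring_hom Q Q" and etae: "eta eps **.Q eps = \<one>.Q" using eta(1) by (auto simp: inverts_eps_def)
 note etac = ring_hom_closed[OF etah] and etam = ring_hom_mult[OF etah] and etaa = ring_hom_add[OF etah]
 interpret h: ring_hom_cring Q Q eta
  by (simp add: ring_hom_cring_def ring_hom_cring_axioms_def Q.is_cring etah)
 obtain f x0 y0 where f: "sesquilinear Q W eta f" "invariant_form f" and nz: "x0 : Cr W" "y0 : Cr W" "f x0 y0 ~= \<zero>.Q"
  using invariant_form_exists[OF eta] by blast
 note D = sesquilinear_D[OF f(1)]
 have "\<exists>g. sesquilinear Q W eta g & invariant_form g & (\<exists>x\<in>Cr W. \<exists>y\<in>Cr W. g x y ~= \<zero>.Q) & hermitian W eta g"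
 proof (cases "\<exists>x\<in>Cr W. \<exists>y\<in>Cr W. f x y \<oplus>.Q eta (f y x) ~= \<zero>.Q")
  case True
  let ?g = "\<lambda>x y. f x y \<oplus>.Q eta (f y x)"
  have "sesquilinear Q W eta ?g"
   unfolding sesquilinear_def using etac by (auto simp: D etaa etam eta(2) Q.a_ac Q.r_distr)
  moreover have "invariant_form ?g" unfolding invariant_form_def using invariant_D[OF f(2)] by simp
  moreover have "hermitian W eta ?g" unfolding hermitian_def using etac D(1) by (auto simp: etaa eta(2) Q.a_comm)
  ultimately show ?thesis using True by blast
 next
  case False
  then have sk: "eta (f y x) = \<ominus>.Q f x y" if "x : Cr W" "y : Cr W" for x y
   using that Q.minus_equality[of "eta (f y x)" "f x y"] D(1) etac Q.a_comm by metis
  define c where "c = eps \<ominus>.Q eta eps"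
  have cc: "c : Cr Q" using eps(1) etac by (simp add: c_def)
  have etacc: "eta c = \<ominus>.Q c"
   using eps(1) etac[OF eps(1)] eta(2)[OF eps(1)] by (simp add: c_def a_minus_def Q.minus_add Q.minus_minus Q.a_comm)
  have c0: "c ~= \<zero>.Q"
  proof
   assume "c = \<zero>.Q"
   then have "eps = eta eps" using Q.diff_eq_zero[OF eps(1) etac[OF eps(1)]] by (simp add: c_def)
   then have "eps [^].Q (2::nat) = \<one>.Q" using etae eps(1) by (simp add: numeral_2_eq_2)
   then have "p dvd 2" using eps_pow_inj by blast
   then show False using p F.p_ge_2 by (auto dest!: dvd_imp_le)
  qed
  let ?g = "\<lambda>x y. c **.Q f x y"
  have "sesquilinear Q W eta ?g"
   unfolding sesquilinear_def using etac cc by (auto simp: D Q.r_distr Q.m_lcomm)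
  moreover have "invariant_form ?g" unfolding invariant_form_def using invariant_D[OF f(2)] by simp
  moreover have "?g x0 y0 ~= \<zero>.Q" using Q.integral[OF _ cc D(1)[OF nz(1,2)]] c0 nz(3) by blast
  moreover have "hermitian W eta ?g"
   unfolding hermitian_def
  proof (intro ballI)
   fix x y assume xy: "x : Cr W" "y : Cr W"
   have "eta (c **.Q f x y) = \<ominus>.Q c **.Q \<ominus>.Q f y x" unfolding etam[OF cc D(1)[OF xy]] etacc sk[OF xy(2,1)] ..
   also have "... = c **.Q f y x" using cc D(1)[OF xy(2,1)] by (simp add: Q.l_minus Q.r_minus Q.minus_minus)
   finally show "c **.Q f y x = eta (c **.Q f x y)" ..
  qed
  ultimately show ?thesis using nz(1,2) by blast
 qed
 then show ?thesis using invariant_form_nondegenerate etac by blast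
qed

text \<open>If the form is symmetric, \<open>E\<close> contains no quaternion factor: let \<open>w\<close> be fixed by the \<open>a\<^sub>i\<close> and
 \<open>c\<^sup>2 + d\<^sup>2 = - 1\<close>. Then \<open>w\<close>, \<open>w i\<close>, \<open>w j\<close> are orthogonal of the same length, so that
 \<open>u = w + c (w i) + d (w j)\<close> is isotropic, and an isotropic vector fixed by the \<open>a\<^sub>i\<close> is zero.\<close>

lemma no_symmetric_form:
 assumes p2: "p = 2" and X: "extraspecial2 E (\<zero>.V, \<one>)" and fin_Q: "finite (Cr Q)"
  and f: "sesquilinear Q W id f" "invariant_form f" "nondegenerate Q W f"
  and sym: "!!x y. x : Cr W ==> y : Cr W ==> f x y = f y x"
  and H: "extraspecial2.hyperbolic E a b m"
  and ij: "i : extraspecial2.cent E a b m" "j : extraspecial2.cent E a b m"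
   "i **.E i = (\<zero>.V, \<one>)" "j **.E j = (\<zero>.V, \<one>)" "~ extraspecial2.com E i j"
  and cent: "\<forall>x\<in>extraspecial2.cent E a b m. \<exists>c\<in>{\<one>.E, (\<zero>.V, \<one>)}. \<exists>y\<in>{\<one>.E, i, j, i **.E j}. x = y **.E c"
 shows False
proof -
 let ?z = "(\<zero>.V, \<one>)"
 interpret X: extraspecial2 E ?z by (rule X)
 note D = sesquilinear_D[OF f(1)] and I = invariant_D[OF f(2)] and mul = rho_mult_apply and rc = rho_D(1)
 have iE: "i : Cr E" "j : Cr E" using ij(1,2) by (auto simp: X.cent_def)
 have "idx \<one> = 1" using F.idx(2)[of \<one>] F.idx_eq_0_iff[of \<one>] p2 by simp
 then have "chi \<one> = eps" using eps(1) by (simp add: chi_def)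
 then have chi1: "chi \<one> = \<ominus>.Q \<one>.Q" using eps_eq_minus_one[OF p2] by (rule trans)
 have rz: "rho ?z w = \<ominus>.W w" if "w : Cr W" for w
  using rho_central[of \<one> w] that by (simp add: chi1 W.smult_l_minus)
 have neg_l: "f (\<ominus>.W x) y = \<ominus>.Q f x y" and neg_r: "f y (\<ominus>.W x) = \<ominus>.Q f y x"
  if x: "x : Cr W" and y: "y : Cr W" for x y
 proof -
  have "f ((\<ominus>.Q \<one>.Q) \<odot>.W x) y = (\<ominus>.Q \<one>.Q) **.Q f x y" using x y by (intro D(4)) auto
  then show 1: "f (\<ominus>.W x) y = \<ominus>.Q f x y" using x D(1)[OF x y] by (simp add: W.smult_l_minus Q.l_minus)
  show "f y (\<ominus>.W x) = \<ominus>.Q f y x" using 1 sym[of y "\<ominus>.W x"] sym[of y x] x y by simp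
 qed
 have two: "x = \<zero>.Q" if x: "x : Cr Q" "x = \<ominus>.Q x" for x
 proof -
  have "x \<oplus>.Q x = x \<oplus>.Q \<ominus>.Q x" using arg_cong[OF x(2), of "\<lambda>y. x \<oplus>.Q y"] .
  then have "x \<oplus>.Q x = \<zero>.Q" using Q.r_neg[OF x(1)] by simp
  then have "num p **.Q x = \<zero>.Q" using x(1) p2 by (simp add: numeral_2_eq_2 Q.l_distr)
  then show ?thesis using Q.integral[of "num p" x] pQ x(1) by auto
 qed
 \<comment> \<open>Such a \<open>y\<close> acts with square minus one, so invariance and symmetry
   make the value its own negative.\<close>
 have sq: "f (rho y w) w = \<zero>.Q" if y: "y : Cr E" "y **.E y = ?z" and w: "w : Cr W" for y w
 proof -
  have yw: "rho y w : Cr W" by (rule rc[OF y(1) w])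
  have "f w (rho y w) = f (rho y w) (rho y (rho y w))" by (rule I[OF y(1) w yw, symmetric])
  also have "rho y (rho y w) = \<ominus>.W w" unfolding mul[OF y(1) y(1) w, symmetric] y(2) by (rule rz[OF w])
  also have "f (rho y w) (\<ominus>.W w) = \<ominus>.Q f (rho y w) w" by (rule neg_r[OF w yw])
  finally have "f (rho y w) w = \<ominus>.Q f (rho y w) w" unfolding sym[OF w yw] .
  then show ?thesis by (rule two[OF D(1)[OF yw w]])
 qed
 define W0 where "W0 k = {w : Cr W. \<forall>l<k. rho (a l) w = w}" for k
 have aE: "a l : Cr E" "b l : Cr E" if "l < m" for l using X.hyperbolic_D(1,2)[OF H that] .
 \<comment> \<open>The sum of \<open>w\<close> and its image under \<open>a k\<close> is fixed by
   \<open>a k\<close>. If it vanishes, \<open>a k\<close> acts on \<open>w\<close> as minus one, and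
   \<open>b k\<close> turns this into one without disturbing the earlier conditions.\<close>
 have "\<exists>w\<in>W0 k. w ~= \<zero>.W" if "k \<le> m" for k
  using that
 proof (induction k)
  case 0
  then show ?case using W_nontrivial by (simp add: W0_def)
 next
  case (Suc k)
  then have km: "k < m" by simp
  obtain w where w: "w : Cr W" "!!l. l < k ==> rho (a l) w = w" "w ~= \<zero>.W" using Suc by (auto simp: W0_def)
  let ?a = "rho (a k)"
  have aw: "?a w : Cr W" by (rule rc[OF aE(1)[OF km] w(1)])
  have aa: "?a (?a w) = w"
   unfolding mul[OF aE(1)[OF km] aE(1)[OF km] w(1), symmetric] X.hyperbolic_D(3)[OF H km] by (rule rho_one_apply[OF w(1)])
  have al: "rho (a l) (?a w) = ?a w" if l: "l < k" for l
  proof -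
   have lm: "l < m" using l km by simp
   have "a k **.E a l = a l **.E a k" using X.hyperbolic_D(7)[OF H km lm] by (simp add: X.com_def)
   then have "rho (a l) (?a w) = ?a (rho (a l) w)"
    using mul[OF aE(1)[OF km] aE(1)[OF lm] w(1)] mul[OF aE(1)[OF lm] aE(1)[OF km] w(1)] by simp
   then show ?thesis using w(2)[OF l] by simp
  qed
  show ?case
  proof (cases "w \<oplus>.W ?a w = \<zero>.W")
   case False
   have "rho (a l) (w \<oplus>.W ?a w) = w \<oplus>.W ?a w" if "l < Suc k" for l
   proof (cases "l = k")
    case True
    then show ?thesis using rho_D(2)[OF aE(1)[OF km] w(1) aw] aa w(1) aw by (simp add: W.M.a_comm)
   next
    case False
    then have l: "l < k" "l < m" using that km by auto
    then show ?thesis using rho_D(2)[OF aE(1)[OF l(2)] w(1) aw] w(2)[OF l(1)] al[OF l(1)] by simp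
   qed
   then have "w \<oplus>.W ?a w : W0 (Suc k)" using w(1) aw by (simp add: W0_def)
   then show ?thesis using False by blast
  next
   case True
   have aw': "?a w = \<ominus>.W w"
    using W.M.minus_equality[of "?a w" w] True w(1) aw by (simp add: W.M.a_comm)
   let ?b = "rho (b k)"
   have bw: "?b w : Cr W" by (rule rc[OF aE(2)[OF km] w(1)])
   have "rho (a l) (?b w) = ?b w" if "l < Suc k" for l
   proof (cases "l = k")
    case True
    have nc: "b k **.E a k = a k **.E b k **.E ?z"
     using X.not_com[OF aE(2)[OF km] aE(1)[OF km]] X.hyperbolic_D(6)[OF H km] by simp
    have "?a (?b w) = rho (a k **.E b k **.E ?z) w"
     unfolding nc[symmetric] by (rule mul[OF aE(2)[OF km] aE(1)[OF km] w(1), symmetric])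
    also have "... = rho ?z (?b (?a w))"
     unfolding mul[OF reg.E.m_closed[OF aE[OF km]] X.z(1) w(1)] mul[OF aE[OF km] w(1)] ..
    also have "... = \<ominus>.W (?b (?a w))" by (rule rz[OF rc[OF aE(2)[OF km] aw]])
    also have "?b (?a w) = \<ominus>.W (?b w)"
     unfolding aw' using rho_D(3)[OF aE(2)[OF km] _ w(1), of "\<ominus>.Q \<one>.Q"] w(1) bw by (simp add: W.smult_l_minus)
    finally show ?thesis using True bw by simp
   next
    case False
    then have l: "l < k" "l < m" using that km by auto
    have "b k **.E a l = a l **.E b k" using X.hyperbolic_D(9)[OF H km l(2)] False by (simp add: X.com_def)
    then have "rho (a l) (?b w) = ?b (rho (a l) w)"
     using mul[OF aE(2)[OF km] aE(1)[OF l(2)] w(1)] mul[OF aE(1)[OF l(2)] aE(2)[OF km] w(1)] by simp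
    then show ?thesis using w(2)[OF l(1)] by simp
   qed
   then have "?b w : W0 (Suc k)" using bw by (simp add: W0_def)
   moreover have "?b w ~= \<zero>.W"
   proof
    assume e: "?b w = \<zero>.W"
    have "w = ?b (?b w)" unfolding mul[OF aE(2)[OF km] aE(2)[OF km] w(1), symmetric] X.hyperbolic_D(4)[OF H km] by (rule rho_one_apply[OF w(1), symmetric])
    also have "... = \<zero>.W" unfolding e using rho_finsum[OF aE(2)[OF km] finite.emptyI] by simp
    finally show False using w(3) by simp
   qed
   ultimately show ?thesis by blast
  qed
 qed
 then obtain w where w: "w : W0 m" "w ~= \<zero>.W" by blast
 have gen: "rho t w = w" if w: "w : W0 m" and t: "t : generate E (a ` {..<m})" for t w
  using t
 proof (induction t)
  case one
  then show ?case using rho_one_apply w by (simp add: W0_def)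
 next
  case (incl t)
  then show ?case using w by (auto simp: W0_def)
 next
  case (inv t)
  then have t: "t : Cr E" "rho t w = w" "w : Cr W" using w aE(1) by (auto simp: W0_def)
  then show ?case using rho_inv_apply(2)[OF t(1,3)] by simp
 next
  case (eng t t')
  have "a ` {..<m} <= Cr E" using aE by auto
  then have t: "t : Cr E" "t' : Cr E" using eng reg.E.generate_in_carrier by blast+
  have "w : Cr W" using w by (simp add: W0_def)
  then show ?case using mul[OF t] eng by simp
 qed
 have ijz: "(i **.E j) **.E (i **.E j) = ?z"
  using X.square_mult[OF iE] ij(3,4,5) X.z by simp
 \<comment> \<open>The vectors orthogonal to the orbit of \<open>w\<close> form an invariant
   subspace containing \<open>w\<close>. If it is zero, so is \<open>w\<close>; if it is everything,
   nondegeneracy gives \<open>w = 0\<close>.\<close>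
 have iso0: "w = \<zero>.W" if w: "w : W0 m" and ww: "f w w = \<zero>.Q" for w
 proof -
  have wW: "w : Cr W" using w by (simp add: W0_def)
  \<comment> \<open>If \<open>e\<close> fails to commute with some \<open>a l\<close>, applying
    \<open>a l\<close> changes the sign of the value. Otherwise \<open>clear_b\<close> replaces
    \<open>e\<close> by an element of the centralizer without changing the value, which up to sign
    is then that of \<open>1\<close>, \<open>i\<close>, \<open>j\<close> or
    \<open>i j\<close>.\<close>
  have orth: "f (rho e w) w = \<zero>.Q" if e: "e : Cr E" for e
  proof (cases "\<forall>l<m. X.com e (a l)")
   case False
   then obtain l where l: "l < m" "~ X.com e (a l)" by blast
   have nc: "e **.E a l = a l **.E e **.E ?z" using X.not_com[OF e aE(1)[OF l(1)]] l(2) by simp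
   have ew: "rho e w : Cr W" by (rule rc[OF e wW])
   have alw: "rho (a l) w = w" using w l(1) by (simp add: W0_def)
   have "rho (a l) (rho e w) = rho (a l **.E e **.E ?z) w"
    unfolding nc[symmetric] by (rule mul[OF e aE(1)[OF l(1)] wW, symmetric])
   also have "... = rho ?z (rho e (rho (a l) w))"
    unfolding mul[OF reg.E.m_closed[OF aE(1)[OF l(1)] e] X.z(1) wW] mul[OF aE(1)[OF l(1)] e wW] ..
   also have "... = \<ominus>.W rho e w" unfolding alw by (rule rz[OF ew])
   finally have "f (rho e w) w = f (\<ominus>.W rho e w) w" using I[OF aE(1)[OF l(1)] ew wW] alw by simp
   also have "... = \<ominus>.Q f (rho e w) w" by (rule neg_l[OF ew wW])
   finally show ?thesis by (rule two[OF D(1)[OF ew wW]])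
  next
   case True
   then obtain t where t: "t : generate E (a ` {..<m})" "e **.E t : X.cent a b m" using X.clear_b[OF H e] by blast
   have tE: "t : Cr E" using t(1) reg.E.generate_in_carrier[of "a ` {..<m}"] aE by blast
   obtain c y where cy: "c : {\<one>.E, ?z}" "y : {\<one>.E, i, j, i **.E j}" "e **.E t = y **.E c" using cent t(2) by blast
   have cE: "c : Cr E" and yE: "y : Cr E" using cy iE X.z(1) by auto
   have yw: "rho y w : Cr W" and ew: "rho e w : Cr W" using rc yE e wW by auto
   have y0: "f (rho y w) w = \<zero>.Q"
    using cy(2) ww rho_one_apply[OF wW] sq[OF iE(1) ij(3) wW] sq[OF iE(2) ij(4) wW] sq[OF reg.E.m_closed[OF iE] ijz wW] by auto
   have "f (rho e w) w = f (rho t (rho e w)) (rho t w)" by (rule I[OF tE ew wW, symmetric])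
   also have "... = f (rho (e **.E t) w) w" unfolding mul[OF e tE wW] gen[OF w t(1)] ..
   also have "... = f (rho c (rho y w)) w" unfolding cy(3) mul[OF yE cE wW] ..
   also have "... = \<zero>.Q" using cy(1) rho_one_apply[OF yw] rz[OF yw] neg_l[OF yw wW] y0 by auto
   finally show ?thesis .
  qed
  define N where "N = {v : Cr W. \<forall>e\<in>Cr E. f (rho e w) v = \<zero>.Q}"
  have ew: "rho e w : Cr W" if "e : Cr E" for e by (rule rc[OF that wW])
  have "N = {\<zero>.W} \<or> N = Cr W"
  proof (rule invariant_subspace)
   show "rho e x : N" if e: "e : Cr E" and x: "x : N" for e x
   proof -
    have xW: "x : Cr W" using x by (simp add: N_def)
    have "f (rho e' w) (rho e x) = \<zero>.Q" if e': "e' : Cr E" for e'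
    proof -
     have c: "e' **.E inv\<^bsub>E\<^esub> e : Cr E" using e e' by simp
     have "(e' **.E inv\<^bsub>E\<^esub> e) **.E e = e'" using e e' by (simp add: reg.E.m_assoc)
     then have "rho e' w = rho e (rho (e' **.E inv\<^bsub>E\<^esub> e) w)" using mul[OF c e wW] by simp
     then have "f (rho e' w) (rho e x) = f (rho (e' **.E inv\<^bsub>E\<^esub> e) w) x" using I[OF e ew[OF c] xW] by simp
     then show ?thesis using x c by (simp add: N_def)
    qed
    then show ?thesis using rc[OF e xW] by (simp add: N_def)
   qed
  qed (use ew D in \<open>auto simp: N_def\<close>)
  moreover have wN: "w : N" using orth wW by (simp add: N_def)
  moreover have "w = \<zero>.W" if "N = Cr W"
  proof -
   have "f (rho \<one>.E w) v = \<zero>.Q" if "v : Cr W" for v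
    using that \<open>N = Cr W\<close> reg.E.one_closed unfolding N_def by blast
   then show ?thesis using f(3) wW rho_one_apply[OF wW] by (simp add: nondegenerate_def)
  qed
  ultimately show ?thesis by blast
 qed
 have wW: "w : Cr W" using w(1) by (simp add: W0_def)
 define v1 v2 where v: "v1 = rho i w" "v2 = rho j w"
 have vW: "v1 : Cr W" "v2 : Cr W" using rc iE wW by (auto simp: v)
 define bta where "bta = f w w"
 have btac: "bta : Cr Q" unfolding bta_def by (rule D(1)[OF wW wW])
 have gram: "f v1 v1 = bta" "f v2 v2 = bta" "f v1 w = \<zero>.Q" "f v2 w = \<zero>.Q" "f w v1 = \<zero>.Q" "f w v2 = \<zero>.Q"
  using I[OF iE(1) wW wW] I[OF iE(2) wW wW] sq[OF iE(1) ij(3) wW] sq[OF iE(2) ij(4) wW] sym[OF wW vW(1)] sym[OF wW vW(2)]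
  by (simp_all add: v bta_def)
 have g12: "f v1 v2 = \<zero>.Q" "f v2 v1 = \<zero>.Q"
 proof -
  have "f v1 v2 = f (rho j v1) (rho j v2)" by (rule I[OF iE(2) vW, symmetric])
  also have "rho j v2 = \<ominus>.W w" unfolding v mul[OF iE(2) iE(2) wW, symmetric] ij(4) by (rule rz[OF wW])
  also have "rho j v1 = rho (i **.E j) w" unfolding v by (rule mul[OF iE wW, symmetric])
  also have "f (rho (i **.E j) w) (\<ominus>.W w) = \<zero>.Q"
   using neg_r[OF wW rc[OF reg.E.m_closed[OF iE] wW]] sq[OF reg.E.m_closed[OF iE] ijz wW] by simp
  finally show "f v1 v2 = \<zero>.Q" .
  then show "f v2 v1 = \<zero>.Q" using sym[OF vW] by simp
 qed
 have "\<one>.Q \<oplus>.Q \<one>.Q ~= \<zero>.Q" using pQ p2 by (simp add: numeral_2_eq_2)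
 then obtain c d where cd: "c : Cr Q" "d : Cr Q" "c **.Q c \<oplus>.Q d **.Q d \<oplus>.Q \<one>.Q = \<zero>.Q"
  using field.minus_one_sum_two_squares[OF W.field_axioms fin_Q] by blast
 define u where "u = w \<oplus>.W c \<odot>.W v1 \<oplus>.W d \<odot>.W v2"
 have uW: "u : Cr W" using wW vW cd by (simp add: u_def)
 have uw: "f u w = bta" "f u v1 = c **.Q bta" "f u v2 = d **.Q bta"
  using wW vW cd btac by (simp_all add: u_def D gram g12 bta_def[symmetric])
 have "f u u = bta \<oplus>.Q c **.Q (c **.Q bta) \<oplus>.Q d **.Q (d **.Q bta)"
  using D(3)[OF uW, of "w \<oplus>.W c \<odot>.W v1" "d \<odot>.W v2"] D(3)[OF uW, of w "c \<odot>.W v1"]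
   D(5)[OF cd(1) uW vW(1)] D(5)[OF cd(2) uW vW(2)] wW vW cd uw
  by (simp add: u_def[symmetric])
 also have "... = (c **.Q c \<oplus>.Q d **.Q d \<oplus>.Q \<one>.Q) **.Q bta"
  using cd(1,2) btac by (simp add: Q.l_distr Q.m_assoc Q.a_ac)
 also have "... = \<zero>.Q" unfolding cd(3) using btac by simp
 finally have uu: "f u u = \<zero>.Q" .
 have fixv: "rho (a l) (rho y w) = rho y w" if l: "l < m" and y: "y : X.cent a b m" for l y
 proof -
  have yE: "y : Cr E" and yc: "y **.E a l = a l **.E y" using y l by (auto simp: X.cent_def X.com_def)
  have "rho (a l) (rho y w) = rho y (rho (a l) w)"
   using mul[OF yE aE(1)[OF l] wW] mul[OF aE(1)[OF l] yE wW] yc by simp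
  then show ?thesis using w(1) l by (simp add: W0_def)
 qed
 have "rho (a l) u = u" if l: "l < m" for l
 proof -
  note A = aE(1)[OF l]
  have "rho (a l) u = rho (a l) w \<oplus>.W c \<odot>.W rho (a l) v1 \<oplus>.W d \<odot>.W rho (a l) v2"
   using wW vW cd by (simp add: u_def rho_D(2,3)[OF A])
  then show ?thesis using fixv[OF l ij(1)] fixv[OF l ij(2)] w(1) l by (simp add: u_def v W0_def)
 qed
 then have "u : W0 m" using uW by (simp add: W0_def)
 then have "u = \<zero>.W" using uu by (rule iso0)
 then have "f w w = \<zero>.Q" using uw(1) D(6)[OF wW] by (simp add: bta_def)
 then show False using iso0[OF w(1)] w(2) by blast
qed

end

end

text \<open>For \<open>p = 2\<close> the prime field consists of zero and one, and the square of
  \<open>(v, c)\<close> is \<open>(0, h v v)\<close>.\<close>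

lemma (in heis) extraspecial2:
 assumes p2: "p = 2"
 shows "extraspecial2 E (\<zero>.V, \<one>)"
proof -
 interpret E: group E by (rule E_group)
 have P: "c = \<zero> \<or> c = \<one>" if "c : prime_field K" for c
  using F.idx[OF that] p2 by (cases "idx c") (auto simp: less_Suc_eq)
 have dbl: "c \<oplus> c = \<zero>" if "c : Cr K" for c using F.add_pow_p[of c 1] that p2 by (simp add: numeral_2_eq_2)
 have dblV: "x \<oplus>.V x = \<zero>.V" if "x : Cr V" for x using add_pow_p_V[OF that] that p2 by (simp add: numeral_2_eq_2)
 have zc: "(\<zero>.V, \<one>) : group_center E" by (simp add: E_center)
 show ?thesis
 proof unfold_locales
  show "finite (Cr E)" by (rule E_finite)
  show zE: "(\<zero>.V, \<one>) : Cr E" by (simp add: E_carrier)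
  show "(\<zero>.V, \<one>) ~= \<one>.E" by (simp add: E_one)
  show "(\<zero>.V, \<one>) **.E (\<zero>.V, \<one>) = \<one>.E" using dbl[of \<one>] by (simp add: E_mult E_one)
  show "x **.E (\<zero>.V, \<one>) = (\<zero>.V, \<one>) **.E x" if "x : Cr E" for x
   using zc that unfolding group_center_def by force
  show "x **.E y = y **.E x \<or> x **.E y = y **.E x **.E (\<zero>.V, \<one>)" if "x : Cr E" "y : Cr E" for x y
  proof -
   obtain v c v' c' where xy: "x = (v, c)" "y = (v', c')" "v : Cr V" "c : prime_field K" "v' : Cr V" "c' : prime_field K"
    using \<open>x : Cr E\<close> \<open>y : Cr E\<close> by (auto simp: E_carrier)
   have "x **.E y = y **.E x **.E (\<zero>.V, beta v v')" unfolding xy(1,2) by (rule E_swap[OF xy(3-6)])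
   moreover have "y **.E x **.E (\<zero>.V, \<zero>) = y **.E x" using that E.r_one[of "y **.E x"] by (simp add: E_one)
   ultimately show ?thesis using P[OF beta_closed[OF xy(3,5)]] by auto
  qed
  show "x **.E x = \<one>.E \<or> x **.E x = (\<zero>.V, \<one>)" if "x : Cr E" for x
  proof -
   obtain v c where x: "x = (v, c)" "v : Cr V" "c : prime_field K" using \<open>x : Cr E\<close> by (auto simp: E_carrier)
   have "x **.E x = (\<zero>.V, h v v)" using x dbl[of c] dblV[OF x(2)] by (simp add: E_mult)
   then show ?thesis using P[OF h_closed[OF x(2,2)]] by (auto simp: E_one)
  qed
  show "x = \<one>.E \<or> x = (\<zero>.V, \<one>)" if "x : Cr E" "!!y. y : Cr E ==> x **.E y = y **.E x" for x
  proof -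
   have "x : group_center E" using that unfolding group_center_def by blast
   then show ?thesis using P by (auto simp: E_center E_one)
  qed
 qed
qed

context heis_rep
begin

text \<open>From an invariant form that is not symmetric, subtracting the transpose gives the
  alternating form. A symmetric one cannot occur: as \<open>E\<close> is not a central power of
  dihedral groups, the quaternion alternative holds, and \<open>no_symmetric_form\<close>
  applies.\<close>

lemma alternating_form_exists:
 assumes p2: "p = 2" and fin_W: "finite (Cr W)" and irr: "irreducible_rep E Q W rho" and fin_Q: "finite (Cr Q)"
  and V0: "Cr V ~= {\<zero>.V}" and n: "order E = p ^ (2 * n + 1)"
  and nD: "~ E \<cong> central_power (dihedral_group 4) n"
  and eta: "inverts_eps eta" "!!a. a : Cr Q ==> eta a = a"
 shows "\<exists>f. sesquilinear Q W eta f & invariant_form f & nondegenerate Q W f & alternating Q W f"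
proof -
 interpret X: extraspecial2 E "(\<zero>.V, \<one>)" by (rule extraspecial2[OF p2])
 obtain f x0 y0 where f: "sesquilinear Q W eta f" "invariant_form f" and nz: "x0 : Cr W" "y0 : Cr W" "f x0 y0 ~= \<zero>.Q"
  using invariant_form_exists[OF fin_W irr eta(1)] eta(2) by auto
 note D = sesquilinear_D[OF f(1)]
 have etac: "eta c : Cr Q" if "c : Cr Q" for c using that eta(2) by simp
 show ?thesis
 proof (cases "\<exists>x\<in>Cr W. \<exists>y\<in>Cr W. f x y ~= f y x")
  case True
  then obtain x y where xy: "x : Cr W" "y : Cr W" "f x y ~= f y x" by blast
  let ?g = "\<lambda>x y. f x y \<ominus>.Q f y x"
  have 1: "sesquilinear Q W eta ?g"
   unfolding sesquilinear_def
   by (auto simp: D eta(2) a_minus_def Q.minus_add Q.a_ac Q.r_distr Q.r_minus)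
  have 2: "invariant_form ?g" unfolding invariant_form_def using invariant_D[OF f(2)] by simp
  have 3: "alternating Q W ?g" unfolding alternating_def by (auto simp: D(1) a_minus_def Q.r_neg)
  have g0: "?g x y ~= \<zero>.Q" using Q.diff_eq_zero[OF D(1) D(1)] xy by blast
  have "nondegenerate Q W ?g" by (rule invariant_form_nondegenerate[OF fin_W irr 1 etac 2 xy(1,2) g0])
  then show ?thesis using 1 2 3 by blast
 next
  case False
  have nd: "nondegenerate Q W f" by (rule invariant_form_nondegenerate[OF fin_W irr f(1) etac f(2) nz])
  have f_id: "sesquilinear Q W id f" using f(1) eta(2) by (simp add: sesquilinear_def)
  obtain v where v: "v : Cr V" "v ~= \<zero>.V" using V0 M.zero_closed by blast
  have "(v, \<zero>) : Cr E" using v by (simp add: E_carrier)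
  then have "Cr E ~= {\<one>.E, (\<zero>.V, \<one>)}" using v(2) by (auto simp: E_one)
  from X.dihedral_or_quaternion[OF this] show ?thesis
  proof
   assume "\<exists>m. order E = 2 * 4 ^ m & E \<cong> central_power (dihedral_group 4) m"
   then obtain m where m: "order E = 2 * 4 ^ m" "E \<cong> central_power (dihedral_group 4) m" by blast
   \<comment> \<open>The order of \<open>E\<close> fixes the number of dihedral factors.\<close>
   have "(4::nat) ^ m = 4 ^ n" using m(1) n p2 by (simp add: power_mult)
   then have "m = n" by simp
   then show ?thesis using m(2) nD by simp
  next
   assume "\<exists>a b m i j. X.hyperbolic a b m & i : X.cent a b m & j : X.cent a b m & i **.E i = (\<zero>.V, \<one>) &
    j **.E j = (\<zero>.V, \<one>) & ~ X.com i j &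
    (\<forall>x\<in>X.cent a b m. \<exists>c\<in>{\<one>.E, (\<zero>.V, \<one>)}. \<exists>y\<in>{\<one>.E, i, j, i **.E j}. x = y **.E c)"
   then obtain a b m i j where q: "X.hyperbolic a b m" "i : X.cent a b m" "j : X.cent a b m" "i **.E i = (\<zero>.V, \<one>)"
    "j **.E j = (\<zero>.V, \<one>)" "~ X.com i j"
    "\<forall>x\<in>X.cent a b m. \<exists>c\<in>{\<one>.E, (\<zero>.V, \<one>)}. \<exists>y\<in>{\<one>.E, i, j, i **.E j}. x = y **.E c" by blast
   have "False"
    by (rule no_symmetric_form[OF fin_W irr p2 extraspecial2[OF p2] fin_Q f_id f(2) nd _ q]) (use False in blast)
   then show ?thesis ..
  qed
 qed
qed

end

section \<open>The three kinds of forms\<close>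

context finite_field_char
begin

lemma Tr_zero: "Tr \<zero> = \<zero>"
 using Tr_smult[of \<one> \<zero>] Tr_carrier[of \<one>] by simp

lemma Tr_minus:
 assumes x: "x : Cr R" shows "Tr (\<ominus> x) = \<ominus> Tr x"
proof -
 have "Tr (\<ominus> x) \<oplus> Tr x = \<zero>" using Tr_add[of "\<ominus> x" x] x Tr_zero by (simp add: l_neg)
 then show ?thesis using minus_equality[of "Tr (\<ominus> x)" "Tr x"] x Tr_carrier by simp
qed

lemma Tr_multiples_nonzero:
 assumes a: "a : Cr R" "a ~= \<zero>" shows "\<exists>c\<in>Cr R. Tr (c ** a) ~= \<zero>"
proof -
 obtain t where t: "t : Cr R" "Tr t ~= \<zero>" using Tr_nonzero by blast
 have u: "a : Units R" using a field_Units by simp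
 have "(t ** inv a) ** a = t" using t u a by (simp add: m_assoc)
 then show ?thesis using t u by (intro bexI[of _ "t ** inv a"]) auto
qed

lemma double_eq_zero:
 assumes p: "p ~= 2" and x: "x : Cr R" "x \<oplus> x = \<zero>" shows "x = \<zero>"
proof -
 have "~ p dvd 2" using p primes_dvd_imp_eq[OF prime_p two_is_prime_nat] by blast
 then have n: "[(2::nat)] \<cdot> \<one> ~= \<zero>" using add_pow_one_eq_0_iff by blast
 have "[(2::nat)] \<cdot> \<one> ** x = \<zero>" using x by (simp add: numeral_2_eq_2 l_distr)
 then show ?thesis using integral[of "[(2::nat)] \<cdot> \<one>" x] n x by auto
qed

text \<open>The field has basis \<open>1\<close>, \<open>c\<close> over the fixed field of
  \<open>eta\<close>, so its size is a square. Elements of norm one arise as quotients of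
  \<open>eta x\<close> by \<open>x\<close>; the fibres of this map are cosets of the nonzero fixed
  elements, which leaves \<open>r + 1\<close> values.\<close>

lemma involution_norm_group:
 assumes etah: "eta : Ring.ring_hom R R" and inv: "!!a. a : Cr R ==> eta (eta a) = a"
  and c0: "c : Cr R" "eta c ~= c"
 shows "\<exists>r N. card (Cr R) = r * r & r \<ge> 2 & N <= Cr R & card N = r + 1 & \<zero> \<notin> N & \<one> : N &
  (\<forall>a\<in>N. \<forall>b\<in>N. a ** b : N) & (\<forall>a\<in>N. a ** eta a = \<one>)"
proof -
 interpret h: ring_hom_cring R R eta
  by (simp add: ring_hom_cring_def ring_hom_cring_axioms_def is_cring etah)
 define F0 where "F0 = {a : Cr R. eta a = a}"
 define r where "r = card F0"
 have F0: "a : Cr R" "eta a = a" if "a : F0" for a using that by (auto simp: F0_def)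
 have F0fin: "finite F0" using finite_R by (simp add: F0_def)
 have F01: "\<zero> : F0" "\<one> : F0" by (simp_all add: F0_def)
 have r2: "r \<ge> 2"
 proof -
  have "card {\<zero>, \<one>} \<le> r" unfolding r_def by (rule card_mono[OF F0fin]) (use F01 in auto)
  then show ?thesis by simp
 qed
 define dlt where "dlt = c \<ominus> eta c"
 have dlt: "dlt : Cr R" "dlt ~= \<zero>" using c0 diff_eq_zero[of c "eta c"] by (auto simp: dlt_def)
 let ?m = "\<lambda>(a, b). a \<oplus> b ** c"
 have inj: "inj_on ?m (F0 \<times> F0)"
 proof (rule inj_onI, clarify)
  fix a b a' b' assume F: "a : F0" "b : F0" "a' : F0" "b' : F0" and e: "a \<oplus> b ** c = a' \<oplus> b' ** c"
  note C = F0(1)[OF F(1)] F0(1)[OF F(2)] F0(1)[OF F(3)] F0(1)[OF F(4)]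
  define P P' where P: "P = b ** c" "P' = b' ** c"
  have Pc: "P : Cr R" "P' : Cr R" using C c0 by (simp_all add: P)
  have "P \<ominus> P' = (P \<oplus> a) \<ominus> (P' \<oplus> a)" using add_diff_cancel[OF Pc C(1)] ..
  also have "P \<oplus> a = a' \<oplus> P'" using e Pc C by (simp add: P[symmetric] a_comm)
  also have "(a' \<oplus> P') \<ominus> (P' \<oplus> a) = (a' \<oplus> P') \<ominus> (a \<oplus> P')" using Pc C by (simp add: a_comm)
  also have "... = a' \<ominus> a" using add_diff_cancel[OF C(3,1) Pc(2)] .
  finally have d: "P \<ominus> P' = a' \<ominus> a" .
  have l: "P \<ominus> P' = (b \<ominus> b') ** c" using C c0 by (simp add: P a_minus_def l_distr l_minus)
  have "eta (P \<ominus> P') = P \<ominus> P'" unfolding d using C F F0(2) by (simp add: a_minus_def)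
  then have "(b \<ominus> b') ** eta c = (b \<ominus> b') ** c" unfolding l using C F F0(2) c0 by (simp add: a_minus_def)
  then have "b \<ominus> b' = \<zero>" using m_lcancel[of "b \<ominus> b'" "eta c" c] c0 C by auto
  then have bb: "b = b'" using diff_eq_zero C by blast
  then have "a \<oplus> P = a' \<oplus> P" using e by (simp add: P)
  then have "a = a'" using add.right_cancel[OF Pc(1) C(1,3)] by simp
  then show "a = a' & b = b'" using bb by simp
 qed
 have surj: "?m ` (F0 \<times> F0) = Cr R"
 proof
  show "?m ` (F0 \<times> F0) <= Cr R" using F0 c0 by auto
  show "Cr R <= ?m ` (F0 \<times> F0)"
  proof
   fix x assume x: "x : Cr R"
   \<comment> \<open>The coordinate of \<open>x\<close> along \<open>c\<close>: both
     \<open>x - eta x\<close> and \<open>c - eta c\<close> change sign under \<open>eta\<close>, so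
     their quotient is fixed.\<close>
   define b where "b = (x \<ominus> eta x) ** inv dlt"
   have u: "dlt : Units R" using dlt field_Units by simp
   have bc: "b : Cr R" using x u by (simp add: b_def)
   have bdlt: "b ** dlt = x \<ominus> eta x" using x u dlt by (simp add: b_def m_assoc)
   have sw: "eta (y \<ominus> eta y) = \<ominus> (y \<ominus> eta y)" if "y : Cr R" for y
    using that inv[OF that] by (simp add: a_minus_def minus_add minus_minus a_comm)
   have "eta b ** eta dlt = eta (x \<ominus> eta x)" unfolding bdlt[symmetric] using bc dlt by simp
   then have "\<ominus> (eta b ** dlt) = \<ominus> (b ** dlt)"
    using sw[OF x] sw[OF c0(1)] bc dlt by (simp add: dlt_def[symmetric] bdlt r_minus)
   then have "eta b ** dlt = b ** dlt" using bc dlt minus_minus by (metis h.hom_closed m_closed)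
   then have b: "b : F0" using m_rcancel[OF dlt(2,1)] bc by (simp add: F0_def)
   define P S where PS: "P = b ** c" "S = b ** eta c"
   have PSc: "P : Cr R" "S : Cr R" using bc c0 by (simp_all add: PS)
   have e: "x \<ominus> eta x = P \<ominus> S" unfolding bdlt[symmetric] using bc c0 by (simp add: PS dlt_def a_minus_def r_distr r_minus)
   have "x = (x \<ominus> eta x) \<oplus> eta x" using x by (simp add: a_minus_def a_assoc l_neg)
   then have "x \<ominus> P = ((P \<oplus> \<ominus> S) \<oplus> eta x) \<oplus> \<ominus> P" unfolding e by (simp add: a_minus_def)
   also have "... = (P \<oplus> \<ominus> P) \<oplus> (eta x \<oplus> \<ominus> S)"
    using PSc x by (simp only: a_ac add.m_closed add.inv_closed h.hom_closed)
   also have "... = eta x \<ominus> S" using PSc x by (simp add: r_neg a_minus_def)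
   also have "... = eta (x \<ominus> P)" using x bc c0 b F0(2) by (simp add: PS a_minus_def)
   finally have fx: "x \<ominus> P = eta (x \<ominus> P)" .
   have "x \<ominus> P : Cr R" using x PSc by simp
   then have "x \<ominus> P : F0" unfolding F0_def using fx[symmetric] by blast
   moreover have "x = (x \<ominus> P) \<oplus> b ** c" using x PSc by (simp add: PS[symmetric] a_minus_def a_assoc l_neg)
   ultimately show "x : ?m ` (F0 \<times> F0)" using b by (intro image_eqI[of _ _ "(x \<ominus> P, b)"]) auto
  qed
 qed
 have cardR: "card (Cr R) = r * r"
  unfolding surj[symmetric] card_image[OF inj] by (simp add: r_def card_cartesian_product)
 define nu where "nu x = eta x ** inv x" for x
 let ?S = "Cr R - {\<zero>}"
 define N where "N = nu ` ?S"
 have S: "x : Cr R" "x : Units R" "inv x : Cr R" "inv x ** x = \<one>" "x ** inv x = \<one>" if "x : ?S" for x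
  using that field_Units by auto
 have nux: "nu x ** x = eta x" if "x : ?S" for x using S[OF that] by (simp add: nu_def m_assoc)
 have nuc: "nu x : Cr R" if "x : ?S" for x using S[OF that] by (simp add: nu_def)
 have eta0: "eta x ~= \<zero>" if "x : ?S" for x
 proof
  assume "eta x = \<zero>"
  then have "x = \<zero>" using inv[of x] that by auto
  then show False using that by simp
 qed
 have fib: "card {y : ?S. nu y = nu x} = r - 1" if x: "x : ?S" for x
 proof -
  have "{y : ?S. nu y = nu x} = (\<lambda>a. a ** x) ` (F0 - {\<zero>})"
  proof (intro equalityI subsetI)
   fix y assume "y : {y : ?S. nu y = nu x}"
   then have y: "y : ?S" "nu y = nu x" by auto
   define a where "a = y ** inv x"
   have ac: "a : Cr R" using S[OF x] S[OF y(1)] by (simp add: a_def)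
   have ax: "a ** x = y" using S[OF x] S[OF y(1)] by (simp add: a_def m_assoc)
   have "eta a ** eta x = eta y" unfolding ax[symmetric] using ac S[OF x] by simp
   also have "... = nu x ** (a ** x)" using nux[OF y(1)] unfolding y(2) ax ..
   also have "... = a ** eta x" unfolding nux[OF x, symmetric] using ac nuc[OF x] S[OF x] by (simp add: m_lcomm)
   finally have "eta a = a" using m_rcancel[OF eta0[OF x]] ac S(1)[OF x] by simp
   moreover have "a ~= \<zero>" using ax y(1) S(1)[OF x] by auto
   ultimately show "y : (\<lambda>a. a ** x) ` (F0 - {\<zero>})" using ac ax by (intro image_eqI[of _ _ a]) (auto simp: F0_def)
  next
   fix y assume "y : (\<lambda>a. a ** x) ` (F0 - {\<zero>})"
   then obtain a where a: "a : F0" "a ~= \<zero>" "y = a ** x" by auto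
   note ac = F0[OF a(1)]
   have y: "y : ?S" using integral[of a x] a ac x by auto
   have "nu y ** y = a ** eta x" unfolding nux[OF y] using a ac S(1)[OF x] by simp
   also have "... = nu x ** y" unfolding nux[OF x, symmetric] a(3) using ac nuc[OF x] S(1)[OF x] by (simp add: m_lcomm)
   finally have "nu y = nu x" using m_rcancel[of y "nu y" "nu x"] y nuc[OF x] nuc[OF y] by auto
   then show "y : {y : ?S. nu y = nu x}" using y by blast
  qed
  moreover have "inj_on (\<lambda>a. a ** x) (F0 - {\<zero>})"
   using m_rcancel[of x] x F0(1) by (auto simp: inj_on_def)
  ultimately show ?thesis using F0fin F01 by (simp add: card_image r_def)
 qed
 have "sum (\<lambda>_. 1::nat) ?S = (\<Sum>y\<in>nu ` ?S. sum (\<lambda>_. 1) {x : ?S. nu x = y})"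
  by (rule sum.image_gen) (use finite_R in simp)
 also have "... = (\<Sum>y\<in>N. r - 1)" unfolding N_def by (rule sum.cong) (use fib in auto)
 finally have "r * r - 1 = card N * (r - 1)" using finite_R cardR by simp
 moreover have "r * r - 1 = (r + 1) * (r - 1)" using r2 by (cases r) auto
 ultimately have "card N * (r - 1) = (r + 1) * (r - 1)" by (rule trans[OF sym])
 moreover have "r - 1 ~= 0" using r2 by simp
 ultimately have cardN: "card N = r + 1" using mult_right_cancel[of "r - 1" "card N" "r + 1"] by blast
 have "N <= Cr R" using nuc by (auto simp: N_def)
 moreover have "\<zero> \<notin> N"
 proof
  assume "\<zero> : N"
  then obtain x where x: "\<zero> = nu x" "x : ?S" unfolding N_def by (rule imageE)
  then show False using nux[OF x(2)] eta0[OF x(2)] l_null[OF S(1)[OF x(2)]] by metis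
 qed
 moreover have "\<one> : N" unfolding N_def by (rule image_eqI[of _ _ \<one>]) (simp_all add: nu_def)
 moreover have "a ** b : N" if "a : N" "b : N" for a b
 proof -
  obtain x where x: "a = nu x" "x : ?S" using \<open>a : N\<close> unfolding N_def by blast
  obtain y where y: "b = nu y" "y : ?S" using \<open>b : N\<close> unfolding N_def by blast
  have xy: "x ** y : ?S" using integral[of x y] x(2) y(2) by auto
  have "(nu x ** nu y) ** (x ** y) = (nu x ** x) ** (nu y ** y)"
   using x(2) y(2) nuc S(1) by (simp add: m_ac)
  also have "... = nu (x ** y) ** (x ** y)" unfolding nux[OF x(2)] nux[OF y(2)] nux[OF xy] using x(2) y(2) by simp
  finally have "nu x ** nu y = nu (x ** y)"
   using m_rcancel[of "x ** y" "nu x ** nu y" "nu (x ** y)"] xy nuc[OF xy] nuc[OF x(2)] nuc[OF y(2)] by auto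
  then show ?thesis unfolding N_def x(1) y(1) by (rule image_eqI[OF _ xy])
 qed
 moreover have "a ** eta a = \<one>" if "a : N" for a
 proof -
  obtain x where x: "x : ?S" "a = nu x" using \<open>a : N\<close> unfolding N_def by blast
  have ac: "a : Cr R" unfolding x(2) by (rule nuc[OF x(1)])
  have ax: "a ** x = eta x" unfolding x(2) by (rule nux[OF x(1)])
  have "eta a ** eta x = x" using arg_cong[OF ax, of eta] ac S(1)[OF x(1)] inv[OF S(1)[OF x(1)]] by simp
  then have "(a ** eta a) ** eta x = \<one> ** eta x" using ax ac S(1)[OF x(1)] by (simp add: m_assoc)
  then show ?thesis using m_rcancel[OF eta0[OF x(1)], of "a ** eta a" \<one>] ac S(1)[OF x(1)] by simp
 qed
 ultimately show ?thesis using cardR r2 cardN by blast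
qed

end

section \<open>Nondegeneracy of the trace forms\<close>

lemma heis_trace_form:
 assumes F: "finite_field_char K p" and V: "vectorspace K V" "finite (Cr V)"
  and eta: "eta : Ring.ring_hom K K" and f: "sesquilinear K V eta f" and lam: "lam : Cr K"
  and nondeg: "!!x. x : Cr V ==> (!!y. y : Cr V ==>
    trace_map p K (lam **.K f x y) = trace_map p K (lam **.K f y x)) ==> x = \<zero>.V"
 shows "heis K V p (trace_form p K lam f)"
proof -
 interpret F: finite_field_char K p by (rule F)
 interpret V: vectorspace K V by (rule V)
 note D = f[unfolded sesquilinear_def]
 have fc: "f x y : Cr K" if "x : Cr V" "y : Cr V" for x y using D that by blast
 have fal: "f (x \<oplus>.V x') y = f x y \<oplus>.K f x' y" if "x : Cr V" "x' : Cr V" "y : Cr V" for x x' y using D that by blast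
 have far: "f x (y \<oplus>.V y') = f x y \<oplus>.K f x y'" if "x : Cr V" "y : Cr V" "y' : Cr V" for x y y' using D that by blast
 have fsl: "f (a \<odot>.V x) y = a **.K f x y" if "a : Cr K" "x : Cr V" "y : Cr V" for a x y using D that by blast
 have fsr: "f x (a \<odot>.V y) = eta a **.K f x y" if "a : Cr K" "x : Cr V" "y : Cr V" for a x y using D that by blast
 have lin: "F.Tr (lam **.K (a **.K b)) = a **.K F.Tr (lam **.K b)" if "a : prime_field K" "b : Cr K" for a b
  using F.Tr_smult[of "lam **.K b" a] that lam by (simp add: F.m_lcomm)
 show ?thesis
 proof (intro heis.intro heis_axioms.intro)
  show "finite_field_char K p" by (rule F)
  show "module K V" by (rule V.module_axioms)
  show "finite (Cr V)" by (rule V)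
  fix x y assume x: "x : Cr V" and y: "y : Cr V"
  show "trace_form p K lam f x y : prime_field K"
   unfolding trace_form_def by (rule F.Tr_prime_field) (use fc[OF x y] lam in simp)
  show "trace_form p K lam f (x \<oplus>.V x') y = trace_form p K lam f x y \<oplus>.K trace_form p K lam f x' y"
   if x': "x' : Cr V" for x'
   using F.Tr_add[of "lam **.K f x y" "lam **.K f x' y"] fc[OF x y] fc[OF x' y] lam
   by (simp add: trace_form_def fal[OF x x' y] F.r_distr)
  show "trace_form p K lam f x (y \<oplus>.V y') = trace_form p K lam f x y \<oplus>.K trace_form p K lam f x y'"
   if y': "y' : Cr V" for y'
   using F.Tr_add[of "lam **.K f x y" "lam **.K f x y'"] fc[OF x y] fc[OF x y'] lam
   by (simp add: trace_form_def far[OF x y y'] F.r_distr)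
  show "trace_form p K lam f (a \<odot>.V x) y = a **.K trace_form p K lam f x y" if a: "a : prime_field K" for a
   using lin[OF a fc[OF x y]] fsl[OF _ x y] a by (simp add: trace_form_def)
  show "trace_form p K lam f x (a \<odot>.V y) = a **.K trace_form p K lam f x y" if a: "a : prime_field K" for a
   using lin[OF a fc[OF x y]] fsr[OF _ x y] a F.automorphism_prime_field[OF eta a] by (simp add: trace_form_def)
 next
  fix x assume "x : Cr V" "x ~= \<zero>.V"
  then show "\<exists>y\<in>Cr V. trace_form p K lam f x y ~= trace_form p K lam f y x"
   using nondeg[of x] unfolding trace_form_def by blast
 qed
qed

text \<open>The form is skew-symmetric, so equality of the two traces makes every trace of a
  multiple of \<open>f x y\<close> its own negative, hence zero. But a nonzero element has a
  multiple with nonzero trace.\<close>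

lemma alternating_trace_nondegenerate:
 assumes F: "finite_field_char K p" and V: "vectorspace K V"
  and eta: "!!a. a : Cr K ==> eta a = a" and f: "sesquilinear K V eta f"
  and p: "p ~= 2" and alt: "alternating K V f" and nd: "nondegenerate K V f"
  and x: "x : Cr V" and eq: "!!y. y : Cr V ==>
    trace_map p K (\<one>.K **.K f x y) = trace_map p K (\<one>.K **.K f y x)"
 shows "x = \<zero>.V"
proof (rule ccontr)
 interpret F: finite_field_char K p by (rule F)
 interpret V: vectorspace K V by (rule V)
 note D = f[unfolded sesquilinear_def]
 have fc: "f x y : Cr K" if "x : Cr V" "y : Cr V" for x y using D that by blast
 have skew: "f y x = \<ominus>.K f x y" if y: "y : Cr V" for y
 proof -
  have "f (y \<oplus>.V x) (y \<oplus>.V x) = f y (y \<oplus>.V x) \<oplus>.K f x (y \<oplus>.V x)" using D x y V.M.a_closed by blast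
  moreover have "f y (y \<oplus>.V x) = f y y \<oplus>.K f y x" "f x (y \<oplus>.V x) = f x y \<oplus>.K f x x" using D x y by blast+
  moreover have "f y y = \<zero>.K" "f x x = \<zero>.K" "f (y \<oplus>.V x) (y \<oplus>.V x) = \<zero>.K"
   using alt x y by (simp_all add: alternating_def)
  ultimately have "f y x \<oplus>.K f x y = \<zero>.K" using fc x y by simp
  then show ?thesis using F.minus_equality[of "f y x" "f x y"] fc x y by simp
 qed
 assume "x ~= \<zero>.V"
 then obtain y where y: "y : Cr V" "f x y ~= \<zero>.K" using nd x unfolding nondegenerate_def by blast
 then obtain c where c: "c : Cr K" "F.Tr (c **.K f x y) ~= \<zero>.K" using F.Tr_multiples_nonzero[of "f x y"] fc x by blast
 have cy: "c \<odot>.V y : Cr V" using c y by simp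
 have e: "f x (c \<odot>.V y) = c **.K f x y" using D c y x eta[OF c(1)] by auto
 have zc: "c **.K f x y : Cr K" using c fc x y by simp
 define t where "t = F.Tr (c **.K f x y)"
 have tc: "t : Cr K" unfolding t_def by (rule F.Tr_carrier[OF zc])
 have "t = \<ominus>.K t"
  using eq[OF cy] skew[OF cy] F.Tr_minus[OF zc] zc by (simp add: e t_def)
 then have "t \<oplus>.K t = t \<oplus>.K \<ominus>.K t" by (rule arg_cong)
 then have "t \<oplus>.K t = \<zero>.K" using F.r_neg[OF tc] by simp
 then have "t = \<zero>.K" by (rule F.double_eq_zero[OF p tc])
 then show False using c(2) by (simp add: t_def)
qed

text \<open>For \<open>a = f x y\<close> the transposed value is \<open>eta a\<close>, and the trace
  does not change under \<open>eta\<close>; so equality says that \<open>lam - eta lam\<close> times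
  \<open>a\<close> has trace zero. The possible \<open>a\<close> form all multiples of one nonzero
  element, and \<open>lam - eta lam\<close> is not zero.\<close>

lemma hermitian_trace_nondegenerate:
 assumes F: "finite_field_char K p" and V: "vectorspace K V" and etah: "eta : Ring.ring_hom K K"
  and inv: "!!a. a : Cr K ==> eta (eta a) = a" and f: "sesquilinear K V eta f"
  and her: "hermitian V eta f" and nd: "nondegenerate K V f" and lam: "lam : Cr K" "eta lam ~= lam"
  and x: "x : Cr V" and eq: "!!y. y : Cr V ==>
    trace_map p K (lam **.K f x y) = trace_map p K (lam **.K f y x)"
 shows "x = \<zero>.V"
proof (rule ccontr)
 interpret F: finite_field_char K p by (rule F)
 interpret V: vectorspace K V by (rule V)
 note D = f[unfolded sesquilinear_def] and etac = ring_hom_closed[OF etah]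
 have fc: "f x y : Cr K" if "x : Cr V" "y : Cr V" for x y using D that by blast
 assume "x ~= \<zero>.V"
 then obtain y where y: "y : Cr V" "f x y ~= \<zero>.K" using nd x unfolding nondegenerate_def by blast
 define mu where "mu = lam \<ominus>.K eta lam"
 have mu: "mu : Cr K" "mu ~= \<zero>.K" using lam etac F.diff_eq_zero[of lam "eta lam"] by (auto simp: mu_def)
 have fxy: "f x y : Cr K" by (rule fc[OF x y(1)])
 have m0: "mu **.K f x y ~= \<zero>.K" using F.integral[OF _ mu(1) fxy] mu(2) y(2) by blast
 obtain c where c: "c : Cr K" "F.Tr (c **.K (mu **.K f x y)) ~= \<zero>.K"
  using F.Tr_multiples_nonzero[OF _ m0] mu fxy by auto
 \<comment> \<open>By semilinearity in the second variable, the scalar \<open>eta c\<close> puts the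
   factor \<open>c\<close> in front of the form.\<close>
 define y' where "y' = eta c \<odot>.V y"
 have y': "y' : Cr V" using etac[OF c(1)] y by (simp add: y'_def)
 have "f x y' = eta (eta c) **.K f x y" unfolding y'_def using D etac[OF c(1)] x y by blast
 then have e: "f x y' = c **.K f x y" using inv[OF c(1)] by simp
 define a where "a = f x y'"
 have ac: "a : Cr K" unfolding a_def by (rule fc[OF x y'])
 have fy: "f y' x = eta a" unfolding a_def using her x y' unfolding hermitian_def by blast
 have "F.Tr (lam **.K a) = F.Tr (lam **.K eta a)"
  using eq[OF y'] unfolding fy a_def[symmetric] .
 also have "lam **.K eta a = eta (eta lam **.K a)"
  using ring_hom_mult[OF etah etac[OF lam(1)] ac] inv[OF lam(1)] by simp
 also have "F.Tr (eta (eta lam **.K a)) = F.Tr (eta lam **.K a)"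
  by (rule F.Tr_automorphism[OF etah]) (use etac lam ac in simp)
 finally have t: "F.Tr (lam **.K a) = F.Tr (eta lam **.K a)" .
 have la: "lam **.K a : Cr K" "eta lam **.K a : Cr K" using lam etac ac by auto
 have "mu **.K a = lam **.K a \<oplus>.K \<ominus>.K (eta lam **.K a)"
  using lam etac ac by (simp add: mu_def a_minus_def F.l_distr F.l_minus)
 then have "F.Tr (mu **.K a) = F.Tr (lam **.K a) \<oplus>.K \<ominus>.K F.Tr (eta lam **.K a)"
  using F.Tr_add[OF la(1), of "\<ominus>.K (eta lam **.K a)"] F.Tr_minus[OF la(2)] la by simp
 also have "... = \<zero>.K" unfolding t using F.r_neg[OF F.Tr_carrier[OF la(2)]] .
 finally have "F.Tr (mu **.K a) = \<zero>.K" .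
 moreover have "mu **.K a = c **.K (mu **.K f x y)" unfolding a_def e using mu c fxy by (simp add: F.m_lcomm)
 ultimately show False using c(2) by simp
qed

section \<open>The polarized form\<close>

locale pairing_data = finite_field_char K p + V: vectorspace K V + U: vectorspace K U
 for K :: "('k, 'm) ring_scheme" (structure) and p :: nat
  and V :: "('k, 'v, 'n) module_scheme" and U :: "('k, 'u, 'o) module_scheme" +
 fixes \<theta> and f
 assumes fin_V: "finite (Cr V)"
  and theta: "\<theta> : module_hom K V (direct_sum (dual_space K U) U)"
  and theta_bij: "bij_betw \<theta> (Cr V) (Cr (direct_sum (dual_space K U) U))"
  and f_eq: "!!x y. x : Cr V ==> y : Cr V ==> f x y = pairing_form (\<theta> x) (\<theta> y)"
begin

abbreviation zf where "zf == (\<lambda>u\<in>Cr U. \<zero>)"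

lemma zf: "zf : Cr (dual_space K U)" by (auto simp: U.dual_iff)

lemma f_apply: "x : Cr V ==> y : Cr V ==> f x y = fst (\<theta> y) (snd (\<theta> x))"
 by (simp add: f_eq pairing_form_def split_beta)

lemma theta_lin:
 "x : Cr V ==> \<theta> x : Cr (direct_sum (dual_space K U) U)"
 "x : Cr V ==> y : Cr V ==> \<theta> (x \<oplus>.V y) = (\<lambda>u\<in>Cr U. fst (\<theta> x) u \<oplus> fst (\<theta> y) u, snd (\<theta> x) \<oplus>.U snd (\<theta> y))"
 "c : Cr K ==> x : Cr V ==> \<theta> (c \<odot>.V x) = (\<lambda>u\<in>Cr U. c ** fst (\<theta> x) u, c \<odot>.U snd (\<theta> x))"
 using theta by (auto simp: module_hom_def U.DS_simps(2,3) U.dual_ops)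

lemma theta_surj: "alf : Cr (dual_space K U) ==> u : Cr U ==> \<exists>x\<in>Cr V. \<theta> x = (alf, u)"
proof -
 assume "alf : Cr (dual_space K U)" "u : Cr U"
 then have "(alf, u) : Cr (direct_sum (dual_space K U) U)" by (simp add: U.DS_simps)
 then have "(alf, u) : \<theta> ` Cr V" using theta_bij by (simp add: bij_betw_def)
 then show "\<exists>x\<in>Cr V. \<theta> x = (alf, u)" by force
qed

lemma theta_parts: "x : Cr V ==> fst (\<theta> x) : Cr (dual_space K U)" "x : Cr V ==> snd (\<theta> x) : Cr U"
 using theta_lin(1)[of x] by (simp_all add: U.DS_simps mem_Times_iff)

lemma theta_inj: "x : Cr V ==> y : Cr V ==> \<theta> x = \<theta> y ==> x = y"
 using theta_bij by (auto simp: bij_betw_def inj_on_def)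

lemma finite_U: "finite (Cr U)"
proof -
 have "finite (Cr (direct_sum (dual_space K U) U))" using theta_bij fin_V bij_betw_finite by blast
 then have "finite (Cr (dual_space K U) \<times> Cr U)" by (simp only: U.DS_simps)
 then have "finite (snd ` (Cr (dual_space K U) \<times> Cr U))" by (rule finite_imageI)
 moreover have "snd ` (Cr (dual_space K U) \<times> Cr U) = Cr U" using zf by force
 ultimately show ?thesis by simp
qed

lemma dual_zero: "alf : Cr (dual_space K U) ==> alf \<zero>.U = \<zero>"
proof -
 assume a: "alf : Cr (dual_space K U)"
 then have c: "alf \<zero>.U : Cr K" by (auto simp: U.dual_iff)
 have "alf (\<zero> \<odot>.U \<zero>.U) = \<zero> ** alf \<zero>.U" using a by (simp only: U.dual_iff zero_closed U.M.zero_closed)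
 then show "alf \<zero>.U = \<zero>" using c U.smult_l_null by simp
qed

text \<open>Testing against the vector with coordinates \<open>(bta, w)\<close> equates a trace
  depending only on \<open>bta\<close> with one depending only on \<open>w\<close>. Setting either
  coordinate to zero makes the other trace vanish.\<close>

lemma pairing_trace_nondegenerate:
 assumes x: "x : Cr V" and eq: "!!y. y : Cr V ==> Tr (\<one> ** f x y) = Tr (\<one> ** f y x)"
 shows "x = \<zero>.V"
proof -
 note P = theta_parts[OF x]
 have dc: "bta w : Cr K" if "bta : Cr (dual_space K U)" "w : Cr U" for bta w using that by (auto simp: U.dual_iff)
 have E: "Tr (bta (snd (\<theta> x))) = Tr (fst (\<theta> x) w)" if b: "bta : Cr (dual_space K U)" "w : Cr U" for bta w
 proof -
  obtain y where y: "y : Cr V" "\<theta> y = (bta, w)" using theta_surj[OF b] by blast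
  show ?thesis using eq[OF y(1)] f_apply[OF x y(1)] f_apply[OF y(1) x] dc[OF b(1) P(2)] dc[OF P(1) b(2)] by (simp add: y(2))
 qed
 have u0: "snd (\<theta> x) = \<zero>.U"
 proof (rule ccontr)
  assume "snd (\<theta> x) ~= \<zero>.U"
  then obtain bta where bta: "bta : Cr (dual_space K U)" "bta (snd (\<theta> x)) = \<one>" using U.dual_separates[OF finite_U P(2)] by blast
  obtain c where c: "c : Cr K" "Tr (c ** \<one>) ~= \<zero>" using Tr_multiples_nonzero[of \<one>] by auto
  have "c \<odot>\<^bsub>dual_space K U\<^esub> bta : Cr (dual_space K U)" by (rule U.dual_op_closed(2)[OF c(1) bta(1)])
  from E[OF this U.M.zero_closed] show False
   using c bta P(2) dual_zero[OF P(1)] Tr_zero by (simp add: U.dual_ops)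
 qed
 have a0: "fst (\<theta> x) w = \<zero>" if w: "w : Cr U" for w
 proof (rule ccontr)
  assume n: "fst (\<theta> x) w ~= \<zero>"
  obtain c where c: "c : Cr K" "Tr (c ** fst (\<theta> x) w) ~= \<zero>" using Tr_multiples_nonzero[OF dc[OF P(1) w] n] by blast
  have "fst (\<theta> x) (c \<odot>.U w) = c ** fst (\<theta> x) w" using P(1) c(1) w by (auto simp: U.dual_iff)
  then show False using E[OF zf, of "c \<odot>.U w"] c w P(2) Tr_zero by simp
 qed
 \<comment> \<open>Linearity computes the image of zero times \<open>x\<close>, to which injectivity
   of \<theta> can then be applied.\<close>
 have "\<theta> (\<zero> \<odot>.V x) = \<theta> x"
 proof -
  have "fst (\<theta> x) = zf"
   by (rule extensionalityI[of _ "Cr U"]) (use P(1) a0 in \<open>auto simp: U.dual_iff PiE_iff\<close>)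
  moreover have "\<theta> (\<zero> \<odot>.V x) = (zf, \<zero>.U)"
   using theta_lin(3)[OF zero_closed x] dc[OF P(1)] U.smult_l_null[OF P(2)] by (simp cong: restrict_cong)
  ultimately show ?thesis using u0 by (metis prod.collapse)
 qed
 then have "\<zero> \<odot>.V x = x" using theta_inj[OF _ x] x by simp
 then show ?thesis using V.smult_l_null[OF x] by simp
qed

text \<open>In coordinates, \<open>(alf, u)\<close> is \<open>(alf, 0)\<close> plus
  \<open>(0, u)\<close>. After taking traces the summands lie in the left and the right radical, as
  \<open>normalizing_polarized\<close> asks.\<close>

lemma pairing_decomposition:
 assumes x: "x : Cr V"
 shows "\<exists>l\<in>Cr V. \<exists>r\<in>Cr V. x = l \<oplus>.V r & (\<forall>y\<in>Cr V. f l y = \<zero>) & (\<forall>y\<in>Cr V. f y r = \<zero>)"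
proof -
 note P = theta_parts[OF x]
 obtain l where l: "l : Cr V" "\<theta> l = (fst (\<theta> x), \<zero>.U)" using theta_surj[OF P(1) U.M.zero_closed] by blast
 obtain r where r: "r : Cr V" "\<theta> r = (zf, snd (\<theta> x))" using theta_surj[OF zf P(2)] by blast
 have "(\<lambda>u\<in>Cr U. fst (\<theta> x) u \<oplus> zf u) = fst (\<theta> x)"
  by (rule extensionalityI[of _ "Cr U"]) (use P(1) in \<open>auto simp: U.dual_iff PiE_iff\<close>)
 then have "\<theta> (l \<oplus>.V r) = \<theta> x" using theta_lin(2)[OF l(1) r(1)] P(2) by (simp add: l(2) r(2))
 then have "x = l \<oplus>.V r" using theta_inj[of x "l \<oplus>.V r"] x l(1) r(1) by simp
 moreover have "f l y = \<zero>" "f y r = \<zero>" if y: "y : Cr V" for y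
  using f_apply[OF l(1) y] f_apply[OF y r(1)] dual_zero[OF theta_parts(1)[OF y]] theta_parts(2)[OF y] by (simp_all add: l(2) r(2))
 ultimately show ?thesis using l(1) r(1) by blast
qed

end

theorem mainTheorem2:
  fixes p p' :: nat
    and K :: "'k ring"
    and V :: "('k, 'v) module"
    and \<eta> :: "'k \<Rightarrow> 'k"
    and lam :: 'k
    and f fhat :: "'v \<Rightarrow> 'v \<Rightarrow> 'k"
    and E :: "('v \<times> 'k) monoid"
  assumes primes: "Factorial_Ring.prime p" "Factorial_Ring.prime p'" "p \<noteq> p'"
    and K: "field K" "finite (carrier K)" "[p] \<cdot>\<^bsub>K\<^esub> \<one>\<^bsub>K\<^esub> = \<zero>\<^bsub>K\<^esub>"
    and V: "vectorspace K V" "vectorspace.fin_dim K V" "carrier V \<noteq> {\<zero>\<^bsub>V\<^esub>}"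
    and eta: "\<eta> \<in> ring_iso K K" "\<forall>a\<in>carrier K. \<eta> (\<eta> a) = a"
    and f: "sesquilinear K V \<eta> f"
    and lam: "lam \<in> carrier K"
    and cases:
      "((\<forall>a\<in>carrier K. \<eta> a = a) \<and> p \<noteq> 2 \<and> alternating K V f \<and> nondegenerate K V f
          \<and> lam = \<one>\<^bsub>K\<^esub>)
       \<or> ((\<forall>a\<in>carrier K. \<eta> a = a)
          \<and> (\<exists>(U :: ('k, 'u) module) \<theta>.
                vectorspace K U
                \<and> \<theta> \<in> module_hom K V (direct_sum (dual_space K U) U)
                \<and> bij_betw \<theta> (carrier V) (carrier (direct_sum (dual_space K U) U))
                \<and> (\<forall>x\<in>carrier V. \<forall>y\<in>carrier V. f x y = pairing_form (\<theta> x) (\<theta> y)))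
          \<and> lam = \<one>\<^bsub>K\<^esub>)
       \<or> (\<not> (\<forall>a\<in>carrier K. \<eta> a = a) \<and> hermitian V \<eta> f \<and> nondegenerate K V f
          \<and> \<eta> lam \<noteq> lam)"
    and fhat: "fhat = trace_form p K lam f"
    and E: "E = form_group K V fhat"
  shows
    "nondegenerate K V (\<lambda>x y. fhat x y \<ominus>\<^bsub>K\<^esub> fhat y x)
     \<and> extraspecial p E
     \<and> (\<exists>n. order E = p ^ (2 * n + 1)
        \<and> (\<forall>(K' :: 'l ring) (W :: ('l, 'w) module) \<rho>'.
             field K' \<and> finite (carrier K') \<and> [p'] \<cdot>\<^bsub>K'\<^esub> \<one>\<^bsub>K'\<^esub> = \<zero>\<^bsub>K'\<^esub>
             \<and> vectorspace K' W
             \<and> \<rho>' \<in> hom E (GL K' W) \<and> inj_on \<rho>' (carrier E)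
             \<and> absolutely_irreducible_rep E K' W \<rho>'
             \<longrightarrow>
             (\<exists>\<epsilon>\<in>carrier K'.
                \<epsilon> [^]\<^bsub>K'\<^esub> p = \<one>\<^bsub>K'\<^esub> \<and> (\<forall>k. 0 < k \<and> k < p \<longrightarrow> \<epsilon> [^]\<^bsub>K'\<^esub> k \<noteq> \<one>\<^bsub>K'\<^esub>)
                \<and> \<rho>' (\<zero>\<^bsub>V\<^esub>, \<one>\<^bsub>K\<^esub>) = (\<lambda>w\<in>carrier W. \<epsilon> \<odot>\<^bsub>W\<^esub> w)
                \<and> (if E \<cong> central_power (dihedral_group 4) n \<or> (odd p \<and> odd (ord p p'))
                   then
                     extends_to_embedding (isometry_group K V fhat) E (\<lambda>g (x, z). (g x, z))
                       (isometry_group K' (direct_sum (dual_space K' W) W) pairing_form)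
                       (rep_sum (dual_space K' W) W (contragredient E K' W \<rho>') \<rho>')
                   else
                     (\<forall>\<eta>'\<in>ring_iso K' K'.
                        (\<forall>a\<in>carrier K'. \<eta>' (\<eta>' a) = a) \<and> \<eta>' \<epsilon> = inv\<^bsub>K'\<^esub> \<epsilon>
                        \<and> (p = 2 \<longrightarrow> (\<forall>a\<in>carrier K'. \<eta>' a = a))
                        \<longrightarrow>
                        (\<exists>f'. sesquilinear K' W \<eta>' f' \<and> nondegenerate K' W f'
                           \<and> (p = 2 \<longrightarrow> alternating K' W f')
                           \<and> (odd p \<longrightarrow> hermitian W \<eta>' f')
                           \<and> \<rho>' ` carrier E \<subseteq> carrier (isometry_group K' W f')
                           \<and> extends_to_embedding (isometry_group K V fhat) E
                               (\<lambda>g (x, z). (g x, z)) (isometry_group K' W f') \<rho>'))))))"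
proof -
 interpret F: finite_field_char K p
  unfolding finite_field_char_def finite_field_char_axioms_def using K primes(1) by blast
 interpret V: vectorspace K V by (rule V)
 have fin_V: "finite (Cr V)" by (rule V.finite_of_fin_dim[OF V(2) K(2)])
 have \<eta>h: "\<eta> : Ring.ring_hom K K" using eta(1) by (simp add: ring_iso_def)
 have inv\<eta>: "\<eta> (\<eta> a) = a" if "a : Cr K" for a using eta(2) that by blast
 note FF = F.finite_field_char_axioms
 have pairing: "pairing_data K p V U \<theta> f"
  if "vectorspace K U" "\<theta> : module_hom K V (direct_sum (dual_space K U) U)"
   "bij_betw \<theta> (Cr V) (Cr (direct_sum (dual_space K U) U))"
   "\<forall>x\<in>Cr V. \<forall>y\<in>Cr V. f x y = pairing_form (\<theta> x) (\<theta> y)" for U :: "('k, 'u) module" and \<theta>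
  unfolding pairing_data_def pairing_data_axioms_def using that FF V(1) fin_V by blast
 have "heis K V p (trace_form p K lam f)"
  using cases
 proof (elim disjE conjE exE)
  assume a: "\<forall>a\<in>Cr K. \<eta> a = a" "p ~= 2" "alternating K V f" "nondegenerate K V f" "lam = \<one>.K"
  show ?thesis
   by (rule heis_trace_form[OF FF V(1) fin_V \<eta>h f lam])
    (use alternating_trace_nondegenerate[OF FF V(1) _ f a(2,3,4)] a(1,5) in blast)
 next
  fix U :: "('k, 'u) module" and \<theta>
  assume a: "vectorspace K U" "\<theta> : module_hom K V (direct_sum (dual_space K U) U)"
   "bij_betw \<theta> (Cr V) (Cr (direct_sum (dual_space K U) U))"
   "\<forall>x\<in>Cr V. \<forall>y\<in>Cr V. f x y = pairing_form (\<theta> x) (\<theta> y)" "lam = \<one>.K"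
  interpret P: pairing_data K p V U \<theta> f by (rule pairing[OF a(1-4)])
  show ?thesis
   by (rule heis_trace_form[OF FF V(1) fin_V \<eta>h f lam])
    (use P.pairing_trace_nondegenerate a(5) in blast)
 next
  assume a: "hermitian V \<eta> f" "nondegenerate K V f" "\<eta> lam ~= lam"
  show ?thesis
   by (rule heis_trace_form[OF FF V(1) fin_V \<eta>h f lam])
    (use hermitian_trace_nondegenerate[OF FF V(1) \<eta>h inv\<eta> f a(1,2) lam a(3)] in blast)
 qed
 then have H: "heis K V p fhat" unfolding fhat .
 interpret H: heis K V p fhat by (rule H)
 have fhat_eq: "fhat x y = F.Tr (lam **.K f x y)" for x y by (simp add: fhat trace_form_def)
 have nd: "nondegenerate K V (\<lambda>x y. fhat x y \<ominus>.K fhat y x)"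
 proof -
  have "x = \<zero>.V" if x: "x : Cr V" and z: "\<forall>y\<in>Cr V. fhat x y = fhat y x" for x
   using H.nondeg[OF x] z by blast
  then show ?thesis
   unfolding nondegenerate_def using F.diff_eq_zero[OF H.h_carrier H.h_carrier] by (metis (no_types, lifting))
 qed
 obtain n where n: "order E = p ^ (2 * n + 1)" using H.E_order unfolding E by blast
 have main: "\<exists>\<epsilon>\<in>Cr K'.
   \<epsilon> [^].K' p = \<one>.K' & (\<forall>k. 0 < k & k < p --> \<epsilon> [^].K' k ~= \<one>.K')
   & \<rho>' (\<zero>.V, \<one>.K) = (\<lambda>w\<in>Cr W. \<epsilon> \<odot>.W w)
   & (if E \<cong> central_power (dihedral_group 4) n \<or> (odd p & odd (ord p p'))
     then
      extends_to_embedding (isometry_group K V fhat) E (\<lambda>g (x, z). (g x, z))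
       (isometry_group K' (direct_sum (dual_space K' W) W) pairing_form)
       (rep_sum (dual_space K' W) W (contragredient E K' W \<rho>') \<rho>')
     else
      (\<forall>\<eta>'\<in>ring_iso K' K'.
       (\<forall>a\<in>Cr K'. \<eta>' (\<eta>' a) = a) & \<eta>' \<epsilon> = inv\<^bsub>K'\<^esub> \<epsilon>
       & (p = 2 --> (\<forall>a\<in>Cr K'. \<eta>' a = a))
       -->
       (\<exists>f'. sesquilinear K' W \<eta>' f' & nondegenerate K' W f'
         & (p = 2 --> alternating K' W f')
         & (odd p --> hermitian W \<eta>' f')
         & \<rho>' ` Cr E <= Cr (isometry_group K' W f')
         & extends_to_embedding (isometry_group K V fhat) E
           (\<lambda>g (x, z). (g x, z)) (isometry_group K' W f') \<rho>')))"
  if K': "field K'" "finite (Cr K')" "[p'] \<cdot>.K' \<one>.K' = \<zero>.K'" and W: "vectorspace K' W"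
   and \<rho>: "\<rho>' : hom E (GL K' W)" "inj_on \<rho>' (Cr E)" "absolutely_irreducible_rep E K' W \<rho>'"
  for K' :: "'l ring" and W :: "('l, 'w) module" and \<rho>'
 proof -
  interpret F': finite_field_char K' p'
   unfolding finite_field_char_def finite_field_char_axioms_def using K' primes(2) by blast
  have "~ p' dvd p" using primes_dvd_imp_eq[OF primes(2,1)] primes(3) by blast
  then have pK': "[p] \<cdot>.K' \<one>.K' ~= \<zero>.K'" using F'.add_pow_one_eq_0_iff by blast
  obtain \<epsilon> where R: "heis_rep K V p fhat K' \<epsilon> W \<rho>'" and fin_W: "finite (Cr W)"
   and prim: "\<forall>k. 0 < k & k < p --> \<epsilon> [^].K' k ~= \<one>.K'"
   and cen: "\<rho>' (\<zero>.V, \<one>.K) = (\<lambda>w\<in>Cr W. \<epsilon> \<odot>.W w)"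
   using H.central_character[OF K'(1,2) pK' W \<rho>[unfolded E]] by blast
  interpret R: heis_rep K V p fhat K' \<epsilon> W \<rho>' by (rule R)
  have irr: "irreducible_rep (form_group K V fhat) K' W \<rho>'"
   using \<rho>(3) by (simp add: absolutely_irreducible_rep_def E)
  \<comment> \<open>The factors are fixed before any \<eta>' is given; \<open>normalizing\<close>
    speaks of all homomorphisms that invert \<epsilon>.\<close>
  have "\<exists>s. R.normalizing s"
  proof (cases "odd p")
   case True
   then show ?thesis using R.normalizing_odd K'(1) by blast
  next
   case False
   then have p2: "p = 2" using primes(1) prime_odd_nat F.p_ge_2 by (metis le_neq_implies_less)
   show ?thesis
    using cases
   proof (elim disjE conjE exE)
    assume "p ~= 2"
    then show ?thesis using p2 by simp
   next
    fix U :: "('k, 'u) module" and \<theta>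
    assume a: "vectorspace K U" "\<theta> : module_hom K V (direct_sum (dual_space K U) U)"
     "bij_betw \<theta> (Cr V) (Cr (direct_sum (dual_space K U) U))"
     "\<forall>x\<in>Cr V. \<forall>y\<in>Cr V. f x y = pairing_form (\<theta> x) (\<theta> y)" "lam = \<one>.K"
    interpret P: pairing_data K p V U \<theta> f by (rule pairing[OF a(1-4)])
    have T0: "F.Tr (lam **.K \<zero>.K) = \<zero>.K" using lam F.Tr_zero by simp
    show ?thesis
    proof (rule R.normalizing_polarized)
     fix x assume "x : Cr V"
     then obtain l r where lr: "l : Cr V" "r : Cr V" "x = l \<oplus>.V r"
      "\<forall>y\<in>Cr V. f l y = \<zero>.K" "\<forall>y\<in>Cr V. f y r = \<zero>.K" using P.pairing_decomposition by blast
     then have "l : H.rad_l" "r : H.rad_r" using T0 by (auto simp: H.rad_l_def H.rad_r_def fhat_eq)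
     then show "\<exists>l\<in>H.rad_l. \<exists>r\<in>H.rad_r. x = l \<oplus>.V r" using lr(3) by blast
    qed
   next
    assume a: "~ (\<forall>a\<in>Cr K. \<eta> a = a)"
    then obtain c where "c : Cr K" "\<eta> c ~= c" by blast
    then obtain r N where N: "card (Cr K) = r * r" "r \<ge> 2" "N <= Cr K" "card N = r + 1" "\<zero>.K \<notin> N" "\<one>.K : N"
     "\<forall>a\<in>N. \<forall>b\<in>N. a **.K b : N" "\<forall>a\<in>N. a **.K \<eta> a = \<one>.K"
     using F.involution_norm_group[OF \<eta>h inv\<eta>] by blast
    \<comment> \<open>The Hermitian form picks up the norm of \<open>c\<close>, which is
      one.\<close>
    have "fhat (c \<odot>.V x) (c \<odot>.V y) = fhat x y" if c: "c : N" and x: "x : Cr V" and y: "y : Cr V" for c x y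
    proof -
     have cK: "c : Cr K" "\<eta> c : Cr K" using c N(3) ring_hom_closed[OF \<eta>h] by auto
     note D = f[unfolded sesquilinear_def]
     have fxy: "f x y : Cr K" using D x y by blast
     have cy: "c \<odot>.V y : Cr V" using cK y by simp
     have "f (c \<odot>.V x) (c \<odot>.V y) = c **.K f x (c \<odot>.V y)" using D x cy cK by blast
     also have "f x (c \<odot>.V y) = \<eta> c **.K f x y" using D x y cK by blast
     also have "c **.K (\<eta> c **.K f x y) = (c **.K \<eta> c) **.K f x y" using F.m_assoc[OF cK fxy] ..
     also have "... = f x y" using N(8) c fxy by simp
     finally show ?thesis by (simp add: fhat_eq)
    qed
    then show ?thesis using R.normalizing_hermitian[OF p2 N(1-6)] N(7) by blast
   qed
  qed
  then obtain s where s: "R.normalizing s" by blast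
  have B: "\<exists>f'. sesquilinear K' W \<eta>' f' & nondegenerate K' W f'
     & (p = 2 --> alternating K' W f') & (odd p --> hermitian W \<eta>' f')
     & \<rho>' ` Cr E <= Cr (isometry_group K' W f')
     & extends_to_embedding (isometry_group K V fhat) E (\<lambda>g (x, z). (g x, z)) (isometry_group K' W f') \<rho>'"
   if nD: "~ E \<cong> central_power (dihedral_group 4) n" and \<eta>': "\<eta>' : ring_iso K' K'"
    "\<forall>a\<in>Cr K'. \<eta>' (\<eta>' a) = a" "\<eta>' \<epsilon> = inv\<^bsub>K'\<^esub> \<epsilon>" "p = 2 --> (\<forall>a\<in>Cr K'. \<eta>' a = a)" for \<eta>'
  proof -
   have "\<epsilon> ~= \<zero>.K'"
   proof
    assume "\<epsilon> = \<zero>.K'"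
    then show False using R.eps(2) F.p_gt_0 by (simp add: F'.nat_pow_zero)
   qed
   then have "\<epsilon> : Units K'" using F'.field_Units R.eps(1) by simp
   \<comment> \<open>As \<epsilon> is a unit, being sent to its inverse gives the product equation
     in \<open>inverts_eps\<close>.\<close>
   then have \<eta>i: "R.inverts_eps \<eta>'" using \<eta>'(1,3) by (simp add: R.inverts_eps_def ring_iso_def F'.Units_l_inv)
   have inv': "\<eta>' (\<eta>' a) = a" if "a : Cr K'" for a using \<eta>'(2) that by blast
   have "\<exists>f'. sesquilinear K' W \<eta>' f' & R.invariant_form f' & nondegenerate K' W f'
     & (p = 2 --> alternating K' W f') & (odd p --> hermitian W \<eta>' f')"
   proof (cases "odd p")
    case True
    then show ?thesis using R.hermitian_form_exists[OF fin_W irr True \<eta>i inv'] by auto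
   next
    case False
    then have p2: "p = 2" using primes(1) prime_odd_nat F.p_ge_2 by (metis le_neq_implies_less)
    have id: "\<eta>' a = a" if "a : Cr K'" for a using \<eta>'(4) p2 that by blast
    show ?thesis
     using R.alternating_form_exists[OF p2 fin_W irr K'(2) V(3) n[unfolded E] nD[unfolded E] \<eta>i id] False by auto
   qed
   then obtain f' where f': "sesquilinear K' W \<eta>' f'" "R.invariant_form f'" "nondegenerate K' W f'"
    "p = 2 --> alternating K' W f'" "odd p --> hermitian W \<eta>' f'" by blast
   note I = R.invariant_D[OF f'(2)]
   have "\<rho>' ` Cr E <= Cr (isometry_group K' W f')"
    using R.rho_GL I by (auto simp: E isometry_group_def)
   moreover have "extends_to_embedding (isometry_group K V fhat) E (\<lambda>g (x, z). (g x, z)) (isometry_group K' W f') \<rho>'"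
    unfolding E by (rule R.extends_to_isometries[OF s f'(1) \<eta>i I])
   ultimately show ?thesis using f' by blast
  qed
  have A: "extends_to_embedding (isometry_group K V fhat) E (\<lambda>g (x, z). (g x, z))
    (isometry_group K' (direct_sum (dual_space K' W) W) pairing_form)
    (rep_sum (dual_space K' W) W (contragredient E K' W \<rho>') \<rho>')"
   unfolding E by (rule R.extends_to_dual_sum[OF s])
  show ?thesis
  proof (intro bexI[of _ \<epsilon>] conjI)
   show "\<epsilon> : Cr K'" "\<epsilon> [^].K' p = \<one>.K'" by (rule R.eps)+
  qed (use prim cen A B in auto)
 qed
 show ?thesis
 proof (intro conjI exI[of _ n] allI impI)
  show "nondegenerate K V (\<lambda>x y. fhat x y \<ominus>.K fhat y x)" by (rule nd)
  show "extraspecial p E" unfolding E by (rule H.E_extraspecial[OF V(3)])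
  show "order E = p ^ (2 * n + 1)" by (rule n)
 qed (use main in blast)
qed

end
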